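(* The semigroup $T(t)=e^{t\mathsf B}$ on $\mathcal V$ is polynomially semiuniformly stable with decay rate $\sqrt t$: there is a constant $K>0$ such that $\|T(t)\mathsf B^{-1}\|\le K/\sqrt t$ for all $t>0$. If in addition $\chi_\varsigma\,\chi_\tau\neq0$, this rate is optimal: $\limsup_{t\to\infty}\sqrt t\,\|T(t)\mathsf B^{-1}\|>0$.
   Context: Fix constants $\ell,\rho_1,\rho_2,\rho_3,k,k_0,b,\varpi,l,\gamma,\varsigma,\tau>0$ with $l\ell\neq n\pi$ for every positive integer $n$. $L^2,H^1,H^1_0,H^2$ are complex Lebesgue/Sobolev spaces on $(0,\ell)$ with $L^2$ norm $\|\cdot\|$; $L^2_*=\{f\in L^2:\int_0^\ell f=0\}$, $H^1_*=H^1\cap L^2_*$ with norm $\|f_x\|$. $\mathcal V=H^1_0\times L^2\times H^1_*\times L^2_*\times H^1_*\times L^2_*\times L^2\times L^2_*\times L^2\times L^2_*$ with norm, for $v=(\varphi,\Phi,\psi,\Psi,w,W,\vartheta,p,\xi,q)$, $\|v\|_{\mathcal V}^2=k\|\varphi_x+\psi+lw\|^2+\rho_1\|\Phi\|^2+b\|\psi_x\|^2+\rho_2\|\Psi\|^2+k_0\|w_x-l\varphi\|^2+\rho_1\|W\|^2+\rho_3\|\vartheta\|^2+\varsigma\|p\|^2+\rho_3\|\xi\|^2+\tau\|q\|^2$. The operator $\mathsf B v=\big(\Phi,\ \tfrac{k}{\rho_1}(\varphi_x+\psi+lw)_x+\tfrac{lk_0}{\rho_1}(w_x-l\varphi)-\tfrac{l\gamma}{\rho_1}\xi,\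 \Psi,\ \tfrac{b}{\rho_2}\psi_{xx}-\tfrac{k}{\rho_2}(\varphi_x+\psi+lw)-\tfrac{\gamma}{\rho_2}\vartheta_x,\ W,\ \tfrac{k_0}{\rho_1}(w_x-l\varphi)_x-\tfrac{lk}{\rho_1}(\varphi_x+\psi+lw)-\tfrac{\gamma}{\rho_1}\xi_x,\ -\tfrac1{\rho_3}p_x-\tfrac{\gamma}{\rho_3}\Psi_x,\ -\tfrac{1}{\varsigma\varpi}p-\tfrac1\varsigma\vartheta_x,\ -\tfrac1{\rho_3}q_x-\tfrac{\gamma}{\rho_3}(W_x-l\Phi),\ -\tfrac{1}{\tau\varpi}q-\tfrac1\tau\xi_x\big)$ with domain $D(\mathsf B)=\{v\in\mathcal V:\varphi\in H^2;\ \Phi,\psi_x,w_x\in H^1_0;\ \Psi,W\in H^1;\ \vartheta,\xi\in H^1_0;\ p,q\in H^1\}$ (Bresse–Maxwell–Cattaneo system). It is known that $\mathsf B$ generates a $C_0$ contraction semigroup $T(t)$ on $\mathcal V$ and that $i\mathbb R\subset\varrho(\mathsf B)$. Stability numbers: $\chi_\varsigma=\big(\varsigma\rho_3-\tfrac{\rho_1}{k}\big)\big(b-\tfrac{k\rho_2}{\rho_1}\big)+\gamma^2\varsigma$, $\chi_\tau=\big(\tau\rho_3-\tfrac{\rho_1}{k}\big)(k_0-k)+\gamma^2\tau$. *)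

theory Defs
  imports "HOL-Analysis.Analysis"
begin

section \<open>Parameters of the Bresse--Maxwell--Cattaneo system\<close>

record bmc_params =
  p_ell :: real
  p_rho1 :: real
  p_rho2 :: real
  p_rho3 :: real
  p_k :: real
  p_k0 :: real
  p_b :: real
  p_varpi :: real
  p_l :: real
  p_gamma :: real
  p_varsigma :: real
  p_tau :: real

section \<open>Function spaces on (0,ell) (elements are representatives, modulo a.e. equality)\<close>

definition L2 :: "real \<Rightarrow> (real \<Rightarrow> complex) \<Rightarrow> bool" where
  "L2 ell f \<longleftrightarrow> f \<in> borel_measurable (lebesgue_on {0..ell})
      \<and> integrable (lebesgue_on {0..ell}) (\<lambda>x. (cmod (f x))^2)"

definition L2norm :: "real \<Rightarrow> (real \<Rightarrow> complex) \<Rightarrow> real" where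
  "L2norm ell f = sqrt (\<integral>x. (cmod (f x))^2 \<partial>(lebesgue_on {0..ell}))"

definition mean0 :: "real \<Rightarrow> (real \<Rightarrow> complex) \<Rightarrow> bool" where
  "mean0 ell f \<longleftrightarrow> (\<integral>x. f x \<partial>(lebesgue_on {0..ell})) = 0"

definition test_fun :: "real \<Rightarrow> (real \<Rightarrow> real) \<Rightarrow> bool" where
  "test_fun ell \<phi> \<longleftrightarrow>
     (\<forall>n x. ((deriv ^^ n) \<phi> has_real_derivative (deriv ^^ Suc n) \<phi> x) (at x))
   \<and> (\<exists>a c. 0 < a \<and> a \<le> c \<and> c < ell \<and> (\<forall>x. x \<notin> {a..c} \<longrightarrow> \<phi> x = 0))"

definition weak_deriv :: "real \<Rightarrow> (real \<Rightarrow> complex) \<Rightarrow> (real \<Rightarrow> complex) \<Rightarrow> bool" where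
  "weak_deriv ell f g \<longleftrightarrow> (\<forall>\<phi>. test_fun ell \<phi> \<longrightarrow>
     (\<integral>x. f x * complex_of_real (deriv \<phi> x) \<partial>(lebesgue_on {0..ell}))
       = - (\<integral>x. g x * complex_of_real (\<phi> x) \<partial>(lebesgue_on {0..ell})))"

definition H1 :: "real \<Rightarrow> (real \<Rightarrow> complex) \<Rightarrow> bool" where
  "H1 ell f \<longleftrightarrow> L2 ell f \<and> (\<exists>g. L2 ell g \<and> weak_deriv ell f g)"

definition dx :: "real \<Rightarrow> (real \<Rightarrow> complex) \<Rightarrow> (real \<Rightarrow> complex)" where
  "dx ell f = (SOME g. L2 ell g \<and> weak_deriv ell f g)"

definition H10 :: "real \<Rightarrow> (real \<Rightarrow> complex) \<Rightarrow> bool" where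
  "H10 ell f \<longleftrightarrow> H1 ell f \<and> (\<exists>h. continuous_on {0..ell} h \<and> h 0 = 0 \<and> h ell = 0
       \<and> (AE x in lebesgue_on {0..ell}. f x = h x))"

definition H2 :: "real \<Rightarrow> (real \<Rightarrow> complex) \<Rightarrow> bool" where
  "H2 ell f \<longleftrightarrow> H1 ell f \<and> H1 ell (dx ell f)"

record bmc_state =
  s_phi :: "real \<Rightarrow> complex"
  s_Phi :: "real \<Rightarrow> complex"
  s_psi :: "real \<Rightarrow> complex"
  s_Psi :: "real \<Rightarrow> complex"
  s_w :: "real \<Rightarrow> complex"
  s_W :: "real \<Rightarrow> complex"
  s_theta :: "real \<Rightarrow> complex"
  s_p :: "real \<Rightarrow> complex"
  s_xi :: "real \<Rightarrow> complex"
  s_q :: "real \<Rightarrow> complex"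

definition st_add :: "bmc_state \<Rightarrow> bmc_state \<Rightarrow> bmc_state" where
  "st_add u v = \<lparr> s_phi = (\<lambda>x. s_phi u x + s_phi v x), s_Phi = (\<lambda>x. s_Phi u x + s_Phi v x),
     s_psi = (\<lambda>x. s_psi u x + s_psi v x), s_Psi = (\<lambda>x. s_Psi u x + s_Psi v x),
     s_w = (\<lambda>x. s_w u x + s_w v x), s_W = (\<lambda>x. s_W u x + s_W v x),
     s_theta = (\<lambda>x. s_theta u x + s_theta v x), s_p = (\<lambda>x. s_p u x + s_p v x),
     s_xi = (\<lambda>x. s_xi u x + s_xi v x), s_q = (\<lambda>x. s_q u x + s_q v x) \<rparr>"

definition st_scale :: "complex \<Rightarrow> bmc_state \<Rightarrow> bmc_state" where
  "st_scale c v = \<lparr> s_phi = (\<lambda>x. c * s_phi v x), s_Phi = (\<lambda>x. c * s_Phi v x),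
     s_psi = (\<lambda>x. c * s_psi v x), s_Psi = (\<lambda>x. c * s_Psi v x),
     s_w = (\<lambda>x. c * s_w v x), s_W = (\<lambda>x. c * s_W v x),
     s_theta = (\<lambda>x. c * s_theta v x), s_p = (\<lambda>x. c * s_p v x),
     s_xi = (\<lambda>x. c * s_xi v x), s_q = (\<lambda>x. c * s_q v x) \<rparr>"

definition st_diff :: "bmc_state \<Rightarrow> bmc_state \<Rightarrow> bmc_state" where
  "st_diff u v = st_add u (st_scale (-1) v)"

definition Vspace :: "bmc_params \<Rightarrow> bmc_state \<Rightarrow> bool" where
  "Vspace P v \<longleftrightarrow> (let ell = p_ell P in
      H10 ell (s_phi v) \<and> L2 ell (s_Phi v)
    \<and> H1 ell (s_psi v) \<and> mean0 ell (s_psi v) \<and> L2 ell (s_Psi v) \<and> mean0 ell (s_Psi v)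
    \<and> H1 ell (s_w v) \<and> mean0 ell (s_w v) \<and> L2 ell (s_W v) \<and> mean0 ell (s_W v)
    \<and> L2 ell (s_theta v) \<and> L2 ell (s_p v) \<and> mean0 ell (s_p v)
    \<and> L2 ell (s_xi v) \<and> L2 ell (s_q v) \<and> mean0 ell (s_q v))"

definition shearS :: "bmc_params \<Rightarrow> bmc_state \<Rightarrow> (real \<Rightarrow> complex)" where
  "shearS P v = (\<lambda>x. dx (p_ell P) (s_phi v) x + s_psi v x + complex_of_real (p_l P) * s_w v x)"

definition axialN :: "bmc_params \<Rightarrow> bmc_state \<Rightarrow> (real \<Rightarrow> complex)" where
  "axialN P v = (\<lambda>x. dx (p_ell P) (s_w v) x - complex_of_real (p_l P) * s_phi v x)"

definition Vnorm :: "bmc_params \<Rightarrow> bmc_state \<Rightarrow> real" where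
  "Vnorm P v = (let n = L2norm (p_ell P) in sqrt (
        p_k P * (n (shearS P v))^2 + p_rho1 P * (n (s_Phi v))^2
      + p_b P * (n (dx (p_ell P) (s_psi v)))^2 + p_rho2 P * (n (s_Psi v))^2
      + p_k0 P * (n (axialN P v))^2 + p_rho1 P * (n (s_W v))^2
      + p_rho3 P * (n (s_theta v))^2 + p_varsigma P * (n (s_p v))^2
      + p_rho3 P * (n (s_xi v))^2 + p_tau P * (n (s_q v))^2))"

definition Bop :: "bmc_params \<Rightarrow> bmc_state \<Rightarrow> bmc_state" where
  "Bop P v = (let ell = p_ell P; D = dx ell; c = complex_of_real;
       rho1 = p_rho1 P; rho2 = p_rho2 P; rho3 = p_rho3 P; k = p_k P; k0 = p_k0 P;
       b = p_b P; vpi = p_varpi P; l = p_l P; gamma = p_gamma P;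
       vs = p_varsigma P; tau = p_tau P; S = shearS P v; N = axialN P v in
     \<lparr> s_phi = s_Phi v,
       s_Phi = (\<lambda>x. c (k/rho1) * D S x + c (l*k0/rho1) * N x - c (l*gamma/rho1) * s_xi v x),
       s_psi = s_Psi v,
       s_Psi = (\<lambda>x. c (b/rho2) * D (D (s_psi v)) x - c (k/rho2) * S x
                    - c (gamma/rho2) * D (s_theta v) x),
       s_w = s_W v,
       s_W = (\<lambda>x. c (k0/rho1) * D N x - c (l*k/rho1) * S x - c (gamma/rho1) * D (s_xi v) x),
       s_theta = (\<lambda>x. - c (1/rho3) * D (s_p v) x - c (gamma/rho3) * D (s_Psi v) x),
       s_p = (\<lambda>x. - c (1/(vs * vpi)) * s_p v x - c (1/vs) * D (s_theta v) x),
       s_xi = (\<lambda>x. - c (1/rho3) * D (s_q v) x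
                   - c (gamma/rho3) * (D (s_W v) x - c l * s_Phi v x)),
       s_q = (\<lambda>x. - c (1/(tau * vpi)) * s_q v x - c (1/tau) * D (s_xi v) x) \<rparr>)"

definition Bdom :: "bmc_params \<Rightarrow> bmc_state \<Rightarrow> bool" where
  "Bdom P v \<longleftrightarrow> (let ell = p_ell P in Vspace P v
    \<and> H2 ell (s_phi v) \<and> H10 ell (s_Phi v) \<and> H10 ell (dx ell (s_psi v)) \<and> H10 ell (dx ell (s_w v))
    \<and> H1 ell (s_Psi v) \<and> H1 ell (s_W v) \<and> H10 ell (s_theta v) \<and> H10 ell (s_xi v)
    \<and> H1 ell (s_p v) \<and> H1 ell (s_q v))"

definition Veq :: "bmc_params \<Rightarrow> bmc_state \<Rightarrow> bmc_state \<Rightarrow> bool" where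
  "Veq P u v \<longleftrightarrow> Vnorm P (st_diff u v) = 0"

definition generates_C0_semigroup ::
    "bmc_params \<Rightarrow> (real \<Rightarrow> bmc_state \<Rightarrow> bmc_state) \<Rightarrow> bool" where
  "generates_C0_semigroup P T \<longleftrightarrow>
     (\<forall>t\<ge>0. \<forall>v. Vspace P v \<longrightarrow> Vspace P (T t v))
   \<and> (\<forall>t\<ge>0. \<forall>u v a c. Vspace P u \<and> Vspace P v \<longrightarrow>
        Veq P (T t (st_add (st_scale a u) (st_scale c v))) (st_add (st_scale a (T t u)) (st_scale c (T t v))))
   \<and> (\<forall>t\<ge>0. \<exists>C. \<forall>v. Vspace P v \<longrightarrow> Vnorm P (T t v) \<le> C * Vnorm P v)
   \<and> (\<forall>v. Vspace P v \<longrightarrow> Veq P (T 0 v) v)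
   \<and> (\<forall>s\<ge>0. \<forall>t\<ge>0. \<forall>v. Vspace P v \<longrightarrow> Veq P (T (s + t) v) (T s (T t v)))
   \<and> (\<forall>v. Vspace P v \<longrightarrow> ((\<lambda>t. Vnorm P (st_diff (T t v) v)) \<longlongrightarrow> 0) (at_right 0))
   \<and> (\<forall>v. Vspace P v \<longrightarrow> (Bdom P v \<longleftrightarrow> (\<exists>y. Vspace P y \<and>
        ((\<lambda>h. Vnorm P (st_diff (st_scale (complex_of_real (1/h)) (st_diff (T h v) v)) y)) \<longlongrightarrow> 0) (at_right 0))))
   \<and> (\<forall>v. Bdom P v \<longrightarrow>
        ((\<lambda>h. Vnorm P (st_diff (st_scale (complex_of_real (1/h)) (st_diff (T h v) v)) (Bop P v))) \<longlongrightarrow> 0) (at_right 0))"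

text \<open>B^{-1} (0 is in the resolvent set of B; the inverse is determined modulo null elements).\<close>
definition Binv :: "bmc_params \<Rightarrow> bmc_state \<Rightarrow> bmc_state" where
  "Binv P f = (SOME u. Bdom P u \<and> Veq P (Bop P u) f)"

definition TBinv_norm :: "bmc_params \<Rightarrow> (real \<Rightarrow> bmc_state \<Rightarrow> bmc_state) \<Rightarrow> real \<Rightarrow> ereal" where
  "TBinv_norm P T t = (SUP f\<in>{f. Vspace P f \<and> Vnorm P f \<le> 1}. ereal (Vnorm P (T t (Binv P f))))"

definition chi_varsigma :: "bmc_params \<Rightarrow> real" where
  "chi_varsigma P = (p_varsigma P * p_rho3 P - p_rho1 P / p_k P) * (p_b P - p_k P * p_rho2 P / p_rho1 P)
      + (p_gamma P)^2 * p_varsigma P"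

definition chi_tau :: "bmc_params \<Rightarrow> real" where
  "chi_tau P = (p_tau P * p_rho3 P - p_rho1 P / p_k P) * (p_k0 P - p_k P) + (p_gamma P)^2 * p_tau P"

end

theory Submission
  imports Defs
begin

text \<open>The ten energy variables \<open>\<phi>\<^sub>x + \<psi> + l w, \<Phi>, \<psi>\<^sub>x, \<Psi>, w\<^sub>x - l \<phi>, W, \<theta>, p, \<xi>, q\<close> can be expanded
  in cosines (first, fourth, sixth, eighth, tenth) and sines (the others), and this decouples the system into
  ten-dimensional ordinary differential equations indexed by the wave number \<open>\<kappa> = n \<pi> / \<ell>\<close>.
  In each mode the energy plus a small multiple of a hierarchy of multiplier functionals is a Lyapunov
  function, and the energy decays like \<open>\<kappa>\<^sup>2 / t\<close>; moreover the inverse of the modal matrix is of size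
  \<open>1 / \<kappa>\<close>. The two powers of \<open>\<kappa>\<close> cancel for the data \<open>B\<^sup>-\<^sup>1 f\<close>, and the bound is summed over the modes by
  Parseval and Bessel. No resolvent estimate is involved.

  If \<open>\<chi>\<^sub>\<varsigma> \<chi>\<^sub>\<tau> \<noteq> 0\<close>, each high mode has an approximate eigenvector to an imaginary eigenvalue of order
  \<open>\<kappa>\<close>, with relative residual of order \<open>1 / \<kappa>\<^sup>2\<close>. A trajectory starting there keeps a fixed part of its energy
  up to a time of order \<open>\<kappa>\<^sup>2\<close>, which makes the rate optimal.

  Since the modal functions of the semigroup are a priori only right differentiable, left continuity of an orbit
  is needed; it is propagated by the semigroup law from one point of continuity.\<close>

section \<open>Smooth test functions\<close>

text \<open>Damping acts on \<open>p\<close> and \<open>q\<close> only, and the shear pair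
  \<open>S, \<Phi>\<close> is coupled to the rest by terms without the factor
  \<open>\<kappa>\<close>. Dividing the pair by \<open>\<kappa>\<close> puts all couplings on the
  same order, with coefficients bounded in \<open>1/\<kappa>\<close>; the hierarchy then closes
  uniformly in the mode, and undoing the division costs \<open>\<kappa>\<^sup>2\<close>. The
  condition on \<open>l \<ell>\<close> keeps \<open>1 - l\<^sup>2/\<kappa>\<^sup>2\<close> away from
  zero, on which the last two links of the hierarchy and the modal inverse depend; for the full
  equation \<open>B u = f\<close> it appears as \<open>sin (l \<ell>) \<noteq> 0\<close>. For the
  approximate eigenvectors the leading order alone leaves too large a residual: the heat subsystems
  are followed to first order in the damping and the frequency to second order. The stability
  numbers are, up to a factor, the determinants of these subsystems at the speed of the undamped
  shear wave. States are representatives, and \<open>dx\<close> and \<open>Binv\<close> are choices: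
  equality means equality almost everywhere or distance zero.\<close>

definition expm :: "nat \<Rightarrow> real \<Rightarrow> real" where
  "expm k y = (if y > 0 then exp (- (1 / y)) / y ^ k else 0)"

lemma expm_tendsto_0: "(expm k \<longlongrightarrow> 0) (at 0)"
proof (rule filterlim_split_at)
  show "(expm k \<longlongrightarrow> 0) (at_left 0)"
    by (rule tendsto_eventually) (auto simp: expm_def eventually_at_filter)
  have "((\<lambda>z::real. z ^ k / exp z) \<longlongrightarrow> 0) at_top"
    by (rule tendsto_power_div_exp_0)
  then have "((\<lambda>y::real. (inverse y) ^ k / exp (inverse y)) \<longlongrightarrow> 0) (at_right 0)"
    using filterlim_inverse_at_top_right by (rule filterlim_compose)
  moreover have "\<forall>\<^sub>F y::real in at_right 0. (inverse y) ^ k / exp (inverse y) = expm k y"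
    by (auto simp: expm_def eventually_at_filter exp_minus field_simps)
  ultimately show "(expm k \<longlongrightarrow> 0) (at_right 0)"
    by (rule Lim_transform_eventually)
qed

text \<open>Differentiating \<open>exp (- (1 / y)) / y ^ k\<close> only raises the power in the
  denominator, so the family over all \<open>k\<close> is closed under differentiation up to linear
  combinations. At the origin every member is flat.\<close>

lemma expm_deriv:
  "(expm k has_real_derivative (expm (k + 2) y - real k * expm (k + 1) y)) (at y)"
proof -
  consider "y > 0" | "y < 0" | "y = 0" by linarith
  then show ?thesis
  proof cases
    case 1
    have "((\<lambda>y. exp (- (1 / y)) / y ^ k) has_real_derivative
        (expm (k + 2) y - real k * expm (k + 1) y)) (at y)"
    proof (cases k)
      case 0
      then show ?thesis using 1
        by (auto intro!: derivative_eq_intros simp: expm_def field_simps power2_eq_square)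
    next
      case (Suc m)
      have "((\<lambda>y. y ^ Suc m) has_real_derivative real (Suc m) * y ^ m) (at y)"
        using DERIV_pow[of "Suc m" y] by simp
      moreover have "((\<lambda>y. exp (- (1 / y))) has_real_derivative exp (- (1 / y)) / y ^ 2) (at y)"
        using 1 by (auto intro!: derivative_eq_intros simp: field_simps power2_eq_square)
      ultimately have "((\<lambda>y. exp (- (1 / y)) / y ^ Suc m) has_real_derivative
          (exp (- (1 / y)) / y ^ 2 * y ^ Suc m - exp (- (1 / y)) * (real (Suc m) * y ^ m))
            / (y ^ Suc m * y ^ Suc m)) (at y)"
        using 1 by (intro DERIV_divide) auto
      moreover have "(exp (- (1 / y)) / y ^ 2 * y ^ Suc m - exp (- (1 / y)) * (real (Suc m) * y ^ m))
            / (y ^ Suc m * y ^ Suc m) = expm (k + 2) y - real k * expm (k + 1) y"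
        using 1 Suc by (simp add: expm_def field_simps power2_eq_square)
      ultimately show ?thesis using Suc by simp
    qed
    then show ?thesis
      by (rule has_field_derivative_transform_within_open[where S = "{0<..}"])
        (use 1 in \<open>auto simp: expm_def\<close>)
  next
    case 2
    have "((\<lambda>y. 0) has_real_derivative (expm (k + 2) y - real k * expm (k + 1) y)) (at y)"
      using 2 by (auto simp: expm_def)
    then show ?thesis
      by (rule has_field_derivative_transform_within_open[where S = "{..<0}"])
        (use 2 in \<open>auto simp: expm_def\<close>)
  next
    case 3
    \<comment> \<open>At the origin the difference quotient of \<open>expm k\<close> is itself
      \<open>expm (k + 1)\<close>, whose limit is already known.\<close>
    have "((\<lambda>h. (expm k (0 + h) - expm k 0) / h) \<longlongrightarrow> 0) (at 0)"
    proof (rule Lim_transform_eventually[OF expm_tendsto_0[of "k + 1"]])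
      show "\<forall>\<^sub>F x in at 0. expm (k + 1) x = (expm k (0 + x) - expm k 0) / x"
        by (auto simp: eventually_at_filter expm_def)
    qed
    then show ?thesis
      using 3 by (simp add: DERIV_def expm_def)
  qed
qed

text \<open>\<open>test_fun\<close> speaks of all iterates of \<open>deriv\<close>, so smoothness is
  captured by a class in which every member has a derivative in the class. The rule
  \<open>smooth_prim\<close> admits primitives: the test function of the du Bois-Reymond argument
  below is one.\<close>

inductive smooth :: "(real \<Rightarrow> real) \<Rightarrow> bool" where
  smooth_const: "smooth (\<lambda>x. c)"
| smooth_expm: "smooth (\<lambda>x. expm k (a * x + b))"
| smooth_add: "smooth f \<Longrightarrow> smooth g \<Longrightarrow> smooth (\<lambda>x. f x + g x)"
| smooth_mult: "smooth f \<Longrightarrow> smooth g \<Longrightarrow> smooth (\<lambda>x. f x * g x)"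
| smooth_exp: "smooth f \<Longrightarrow> smooth (\<lambda>x. exp (f x))"
| smooth_prim: "(\<And>x. (f has_real_derivative g x) (at x)) \<Longrightarrow> smooth g \<Longrightarrow> smooth f"

lemma smooth_has_derivative:
  "smooth f \<Longrightarrow> \<exists>g. smooth g \<and> (\<forall>x. (f has_real_derivative g x) (at x))"
proof (induction rule: smooth.induct)
  case (smooth_const c)
  show ?case by (rule exI[of _ "\<lambda>x. 0"]) (auto intro: smooth.smooth_const)
next
  case (smooth_expm k a b)
  let ?g = "\<lambda>x. a * (expm (k + 2) (a * x + b) + (- real k) * expm (k + 1) (a * x + b))"
  have "smooth ?g"
    by (intro smooth.smooth_const smooth.smooth_expm smooth.smooth_add smooth.smooth_mult)
  moreover have "((\<lambda>x. expm k (a * x + b)) has_real_derivative ?g x) (at x)" for x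
  proof -
    have "((\<lambda>x. a * x + b) has_real_derivative a) (at x)"
      by (auto intro!: derivative_eq_intros)
    from DERIV_chain2[OF expm_deriv this] show ?thesis by (simp add: algebra_simps)
  qed
  ultimately show ?case by blast
next
  case (smooth_add f g)
  then obtain f' g' where "smooth f'" "\<forall>x. (f has_real_derivative f' x) (at x)"
    "smooth g'" "\<forall>x. (g has_real_derivative g' x) (at x)" by auto
  then show ?case
    by (intro exI[of _ "\<lambda>x. f' x + g' x"]) (auto intro!: smooth.smooth_add derivative_eq_intros)
next
  case (smooth_mult f g)
  then obtain f' g' where "smooth f'" "\<forall>x. (f has_real_derivative f' x) (at x)"
    "smooth g'" "\<forall>x. (g has_real_derivative g' x) (at x)" by auto
  with smooth_mult.hyps show ?case
    by (intro exI[of _ "\<lambda>x. f' x * g x + f x * g' x"])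
      (auto intro!: smooth.smooth_add smooth.smooth_mult derivative_eq_intros)
next
  case (smooth_exp f)
  then obtain f' where "smooth f'" "\<forall>x. (f has_real_derivative f' x) (at x)" by auto
  with smooth_exp.hyps show ?case
    by (intro exI[of _ "\<lambda>x. exp (f x) * f' x"])
      (auto intro!: smooth.smooth_mult smooth.smooth_exp derivative_eq_intros)
next
  case (smooth_prim f g)
  then show ?case by blast
qed

lemma smooth_deriv:
  assumes "smooth f" shows "smooth (deriv f)" "(f has_real_derivative deriv f x) (at x)"
proof -
  obtain g where g: "smooth g" "\<And>x. (f has_real_derivative g x) (at x)"
    using smooth_has_derivative[OF assms] by blast
  then have "deriv f = g" by (auto simp: DERIV_imp_deriv)
  with g show "smooth (deriv f)" "(f has_real_derivative deriv f x) (at x)" by auto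
qed

lemma smooth_iter_deriv:
  assumes "smooth f"
  shows "((deriv ^^ n) f has_real_derivative (deriv ^^ Suc n) f x) (at x)"
proof -
  have "smooth ((deriv ^^ n) f)" by (induction n) (use assms smooth_deriv in auto)
  then show ?thesis using smooth_deriv(2) by simp
qed

lemma test_fun_smooth:
  assumes "smooth f" "0 < a" "a \<le> c" "c < ell" "\<And>x. x \<notin> {a..c} \<Longrightarrow> f x = 0"
  shows "test_fun ell f"
  unfolding test_fun_def using assms smooth_iter_deriv by blast

lemma smooth_continuous: "smooth f \<Longrightarrow> continuous_on A f"
  by (meson DERIV_continuous_on has_field_derivative_at_within smooth_deriv(2))

text \<open>Smooth functions increasing to the indicator of \<open>(a,c)\<close> as \<open>j\<close> grows.\<close>
definition bump :: "real \<Rightarrow> real \<Rightarrow> nat \<Rightarrow> real \<Rightarrow> real" where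
  "bump a c j x = 1 - exp (- real j * (expm 0 (x - a) * expm 0 (c - x)))"

lemma bump_smooth: "smooth (bump a c j)"
proof -
  have "smooth (\<lambda>x. 1 + (- 1) * exp ((- real j) * (expm 0 (1 * x + (- a)) * expm 0 ((- 1) * x + c))))"
    by (intro smooth_const smooth_add smooth_mult smooth_exp smooth_expm)
  then show ?thesis unfolding bump_def[abs_def] by (simp add: add.commute)
qed

lemma expm_nonneg: "0 \<le> expm k y" by (simp add: expm_def)

lemma bump_bounds: "0 \<le> bump a c j x" "bump a c j x \<le> 1"
  by (auto simp: bump_def expm_nonneg)

lemma bump_outside: "x \<notin> {a<..<c} \<Longrightarrow> bump a c j x = 0"
  by (auto simp: bump_def expm_def)

lemma bump_tendsto: "(\<lambda>j. bump a c j x) \<longlonglongrightarrow> indicator {a<..<c} x"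
proof (cases "x \<in> {a<..<c}")
  case True
  define y where "y = expm 0 (x - a) * expm 0 (c - x)"
  have y: "y > 0" using True by (auto simp: y_def expm_def)
  have "(\<lambda>j. exp (- y) ^ j) \<longlonglongrightarrow> 0"
    by (rule LIMSEQ_power_zero) (use y in auto)
  moreover have "exp (- real j * y) = exp (- y) ^ j" for j
    by (simp add: exp_of_nat_mult[symmetric])
  ultimately have "(\<lambda>j. 1 - exp (- real j * y)) \<longlonglongrightarrow> 1 - 0"
    by (intro tendsto_intros) simp
  then show ?thesis using True by (simp add: bump_def y_def)
next
  case False
  then show ?thesis by (simp add: bump_outside)
qed

section \<open>Sobolev functions as primitives\<close>

text \<open>Up to almost everywhere equality, functions in H1 are exactly those of the form
  \<open>c + J g\<close> with \<open>g\<close> in L2. Every fact about \<open>dx\<close> is obtained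
  from this form.\<close>

definition J :: "(real \<Rightarrow> complex) \<Rightarrow> real \<Rightarrow> complex" where
  "J f x = integral\<^sup>L (lebesgue_on {0..x}) f"

lemma integrable_continuous_ivl:
  fixes f :: "real \<Rightarrow> 'a::euclidean_space"
  assumes "continuous_on {a..b} f" shows "integrable (lebesgue_on {a..b}) f"
  by (rule absolutely_integrable_imp_integrable[OF absolutely_integrable_continuous_real[OF assms]]) simp

lemma measurable_continuous_ivl:
  fixes f :: "real \<Rightarrow> 'a::euclidean_space"
  assumes "continuous_on {a..b} f" shows "f \<in> borel_measurable (lebesgue_on {a..b})"
  by (rule borel_measurable_integrable[OF integrable_continuous_ivl[OF assms]])

lemma integral_FTC_ivl:
  fixes f :: "real \<Rightarrow> 'a::euclidean_space"
  assumes "a \<le> b" "continuous_on {a..b} f'"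
    "\<And>x. x \<in> {a..b} \<Longrightarrow> (f has_vector_derivative f' x) (at x within {a..b})"
  shows "integral\<^sup>L (lebesgue_on {a..b}) f' = f b - f a"
proof -
  have "(f' has_integral (f b - f a)) {a..b}"
    by (rule fundamental_theorem_of_calculus[OF assms(1,3)])
  moreover have "(f' has_integral integral\<^sup>L (lebesgue_on {a..b}) f') {a..b}"
    by (rule has_integral_integral_lebesgue_on[OF integrable_continuous_ivl[OF assms(2)]]) simp
  ultimately show ?thesis using has_integral_unique by blast
qed

lemma integrable_mult_bounded:
  fixes f g :: "real \<Rightarrow> complex"
  assumes "integrable M f" "g \<in> borel_measurable M" "\<And>x. x \<in> space M \<Longrightarrow> cmod (g x) \<le> B"
  shows "integrable M (\<lambda>x. f x * g x)"
proof (rule Bochner_Integration.integrable_bound[of M "\<lambda>x. B * cmod (f x)"])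
  show "integrable M (\<lambda>x. B * cmod (f x))" using assms(1) by simp
  show "(\<lambda>x. f x * g x) \<in> borel_measurable M" using assms by auto
  show "AE x in M. norm (f x * g x) \<le> norm (B * cmod (f x))"
  proof (rule AE_I2)
    fix x assume x: "x \<in> space M"
    then have "cmod (g x) * cmod (f x) \<le> B * cmod (f x)"
      using assms(3) by (intro mult_right_mono) auto
    moreover have "B \<ge> 0" using assms(3)[OF x] norm_ge_zero order_trans by blast
    ultimately show "norm (f x * g x) \<le> norm (B * cmod (f x))"
      by (simp add: norm_mult mult.commute)
  qed
qed

lemma integrable_mult_continuous:
  fixes f g :: "real \<Rightarrow> complex"
  assumes "integrable (lebesgue_on {a..b}) f" "continuous_on {a..b} g"
  shows "integrable (lebesgue_on {a..b}) (\<lambda>x. f x * g x)"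
proof -
  have "bounded (g ` {a..b})"
    using assms(2) compact_continuous_image compact_imp_bounded compact_Icc by blast
  then obtain B where "\<forall>x\<in>{a..b}. cmod (g x) \<le> B"
    unfolding bounded_iff by blast
  then show ?thesis
    using assms by (intro integrable_mult_bounded measurable_continuous_ivl) auto
qed

lemma J_continuous:
  "integrable (lebesgue_on {0..b}) f \<Longrightarrow> continuous_on {0..b} (J f)"
  unfolding J_def by (rule indefinite_integral_continuous_real)

lemma J_0 [simp]: "J f 0 = 0"
proof -
  have "{0::real} \<in> null_sets lebesgue"
    by (intro null_sets_completionI finite_imp_null_set_lborel) auto
  then show ?thesis by (simp add: J_def integral_eq_zero_null_sets)
qed

lemma integrable_sub_ivl:
  fixes f :: "real \<Rightarrow> complex"
  assumes "integrable (lebesgue_on {0..b}) f" "x \<le> b"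
  shows "integrable (lebesgue_on {0..x}) f"
  by (rule integrable_subinterval[OF assms(1)]) (use assms in auto)

lemma J_add:
  assumes "integrable (lebesgue_on {0..b}) f" "integrable (lebesgue_on {0..b}) g" "x \<le> b"
  shows "J (\<lambda>x. f x + g x) x = J f x + J g x"
  unfolding J_def
  by (intro Bochner_Integration.integral_add integrable_sub_ivl[OF assms(1,3)] integrable_sub_ivl[OF assms(2,3)])

lemma J_diff:
  assumes "integrable (lebesgue_on {0..b}) f" "integrable (lebesgue_on {0..b}) g" "x \<le> b"
  shows "J (\<lambda>x. f x - g x) x = J f x - J g x"
  unfolding J_def
  by (intro Bochner_Integration.integral_diff integrable_sub_ivl[OF assms(1,3)] integrable_sub_ivl[OF assms(2,3)])

lemma J_mult: "J (\<lambda>x. c * f x) x = c * J f x"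
  unfolding J_def by simp

text \<open>Both sides integrate \<open>h s * g r\<close> over the triangle
  \<open>r \<le> s\<close>, once along each axis.\<close>

lemma Fubini_triangle:
  fixes g h :: "real \<Rightarrow> complex"
  assumes b: "0 \<le> b" and g: "integrable (lebesgue_on {0..b}) g" and h: "integrable (lebesgue_on {0..b}) h"
  shows "(\<integral>s. h s * J g s \<partial>lebesgue_on {0..b})
    = (\<integral>r. g r * integral\<^sup>L (lebesgue_on {r..b}) h \<partial>lebesgue_on {0..b})"
proof -
  let ?M = "lebesgue_on {0..b}"
  interpret finite_measure ?M by (intro finite_measure_lebesgue_on) auto
  interpret P: pair_sigma_finite ?M ?M ..
  define F where "F s r = (if r \<le> s then h s * g r else 0)" for s r
  have [measurable]: "g \<in> borel_measurable ?M" "h \<in> borel_measurable ?M" using g h by auto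
  have [measurable]: "(\<lambda>x. x) \<in> borel_measurable ?M"
    using id_borel_measurable_lebesgue_on[of "{0..b}"] by (simp add: id_def)
  have [measurable]: "{y. snd y \<le> fst y} \<inter> space (?M \<Otimes>\<^sub>M ?M) \<in> sets (?M \<Otimes>\<^sub>M ?M)"
  proof -
    have "{w \<in> space (?M \<Otimes>\<^sub>M ?M). snd w \<le> fst w} \<in> sets (?M \<Otimes>\<^sub>M ?M)"
      by (intro borel_measurable_le measurable_compose[OF measurable_fst]
          measurable_compose[OF measurable_snd]) auto
    then show ?thesis by (simp add: Int_def conj_commute)
  qed
  have Fm: "case_prod F \<in> borel_measurable (?M \<Otimes>\<^sub>M ?M)"
  proof -
    have "(\<lambda>y. if y \<in> {y. snd y \<le> fst y} then h (fst y) * g (snd y) else 0) \<in> borel_measurable (?M \<Otimes>\<^sub>M ?M)"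
      by (rule measurable_If_set) measurable
    then show ?thesis by (simp add: F_def case_prod_beta')
  qed
  have F1: "integrable ?M (F s)" for s
  proof (rule Bochner_Integration.integrable_bound[of ?M "\<lambda>r. h s * g r"])
    show "F s \<in> borel_measurable ?M" unfolding F_def by measurable
  qed (use g in \<open>auto simp: F_def\<close>)
  have "integrable (?M \<Otimes>\<^sub>M ?M) (case_prod F)"
  proof (rule P.Fubini_integrable[OF Fm])
    show "integrable ?M (\<lambda>x. \<integral>y. norm (case_prod F (x, y)) \<partial>?M)"
    proof (rule Bochner_Integration.integrable_bound[of ?M "\<lambda>s. cmod (h s) * (\<integral>r. cmod (g r) \<partial>?M)"])
      show "integrable ?M (\<lambda>s. cmod (h s) * (\<integral>r. cmod (g r) \<partial>?M))" using h by simp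
      show "(\<lambda>x. \<integral>y. norm (case_prod F (x, y)) \<partial>?M) \<in> borel_measurable ?M"
        using Fm by measurable
      have "(\<integral>y. norm (F x y) \<partial>?M) \<le> cmod (h x) * (\<integral>r. cmod (g r) \<partial>?M)" for x
      proof -
        have "(\<integral>y. norm (F x y) \<partial>?M) \<le> (\<integral>y. cmod (h x) * cmod (g y) \<partial>?M)"
        proof (rule integral_mono)
          show "integrable ?M (\<lambda>y. norm (F x y))" by (intro integrable_norm F1)
          show "integrable ?M (\<lambda>y. cmod (h x) * cmod (g y))" using g by simp
        qed (auto simp: F_def norm_mult)
        then show ?thesis by simp
      qed
      then show "AE x in ?M. norm (\<integral>y. norm (case_prod F (x, y)) \<partial>?M)
          \<le> norm (cmod (h x) * (\<integral>r. cmod (g r) \<partial>?M))"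
        by (intro AE_I2) (simp add: order_trans[OF _ abs_ge_self])
    qed
  qed (use F1 in auto)
  note fub = P.Fubini_integral[OF this]
  have "(\<integral>s. h s * J g s \<partial>?M) = (\<integral>s. (\<integral>r. F s r \<partial>?M) \<partial>?M)"
  proof (rule Bochner_Integration.integral_cong[OF refl])
    fix s assume "s \<in> space ?M"
    then have "J g s = (\<integral>r. (if r \<in> {0..s} then g r else 0) \<partial>?M)"
      unfolding J_def by (intro integral_restrict[symmetric]) auto
    then have "h s * J g s = (\<integral>r. h s * (if r \<in> {0..s} then g r else 0) \<partial>?M)" by simp
    also have "\<dots> = (\<integral>r. F s r \<partial>?M)"
      by (intro Bochner_Integration.integral_cong) (auto simp: F_def)
    finally show "h s * J g s = (\<integral>r. F s r \<partial>?M)" .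
  qed
  also have "\<dots> = (\<integral>r. (\<integral>s. F s r \<partial>?M) \<partial>?M)" using fub by simp
  also have "\<dots> = (\<integral>r. g r * integral\<^sup>L (lebesgue_on {r..b}) h \<partial>?M)"
  proof (rule Bochner_Integration.integral_cong[OF refl])
    fix r assume r: "r \<in> space ?M"
    then have "integral\<^sup>L (lebesgue_on {r..b}) h = (\<integral>s. (if s \<in> {r..b} then h s else 0) \<partial>?M)"
      by (intro integral_restrict[symmetric]) auto
    then have "g r * integral\<^sup>L (lebesgue_on {r..b}) h = (\<integral>s. g r * (if s \<in> {r..b} then h s else 0) \<partial>?M)"
      by simp
    also have "\<dots> = (\<integral>s. F s r \<partial>?M)"
      by (intro Bochner_Integration.integral_cong) (auto simp: F_def)
    finally show "(\<integral>s. F s r \<partial>?M) = g r * integral\<^sup>L (lebesgue_on {r..b}) h" by simp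
  qed
  finally show ?thesis .
qed

text \<open>As \<open>g\<close> is merely integrable, \<open>J g\<close> need not be differentiable
  at every point and no pointwise product rule is available. Fubini on the triangle replaces it;
  only the smooth factor is differentiated.\<close>

lemma J_by_parts:
  fixes g e e' :: "real \<Rightarrow> complex"
  assumes b: "0 \<le> b" and g: "integrable (lebesgue_on {0..b}) g"
    and e: "\<And>x. (e has_vector_derivative e' x) (at x)" and e': "continuous_on {0..b} e'"
  shows "J (\<lambda>s. e' s * J g s) b = e b * J g b - J (\<lambda>s. e s * g s) b"
proof -
  have ce: "continuous_on {0..b} e"
    using e by (meson continuous_at_imp_continuous_on has_vector_derivative_continuous)
  have 1: "integrable (lebesgue_on {0..b}) (\<lambda>r. g r * e r)"
    by (rule integrable_mult_continuous[OF g ce])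
  have "J (\<lambda>s. e' s * J g s) b
      = (\<integral>r. g r * integral\<^sup>L (lebesgue_on {r..b}) e' \<partial>lebesgue_on {0..b})"
    unfolding J_def[of _ b]
    by (rule Fubini_triangle[OF b g integrable_continuous_ivl[OF e']])
  also have "\<dots> = (\<integral>r. g r * (e b - e r) \<partial>lebesgue_on {0..b})"
  proof (rule Bochner_Integration.integral_cong[OF refl])
    fix r assume r: "r \<in> space (lebesgue_on {0..b})"
    have "integral\<^sup>L (lebesgue_on {r..b}) e' = e b - e r"
    proof (rule integral_FTC_ivl)
      show "continuous_on {r..b} e'" using r by (intro continuous_on_subset[OF e']) auto
    qed (use r has_vector_derivative_at_within[OF e] in auto)
    then show "g r * integral\<^sup>L (lebesgue_on {r..b}) e' = g r * (e b - e r)" by simp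
  qed
  also have "\<dots> = (\<integral>r. e b * g r - g r * e r \<partial>lebesgue_on {0..b})"
    by (intro Bochner_Integration.integral_cong refl) (simp add: algebra_simps)
  also have "\<dots> = e b * J g b - J (\<lambda>s. e s * g s) b"
    using g 1 by (subst Bochner_Integration.integral_diff) (auto simp: J_def mult.commute)
  finally show ?thesis .
qed

section \<open>Square-integrable functions\<close>

lemma L2_measurable [measurable_dest]: "L2 ell f \<Longrightarrow> f \<in> borel_measurable (lebesgue_on {0..ell})"
  by (simp add: L2_def)

lemma L2_sq_integrable: "L2 ell f \<Longrightarrow> integrable (lebesgue_on {0..ell}) (\<lambda>x. (cmod (f x))\<^sup>2)"
  by (simp add: L2_def)

lemma L2_continuous: "continuous_on {0..ell} f \<Longrightarrow> L2 ell f"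
  unfolding L2_def
  by (intro conjI measurable_continuous_ivl integrable_continuous_ivl continuous_intros)

lemma L2_norm_mult_integrable:
  assumes "L2 ell f" "L2 ell g"
  shows "integrable (lebesgue_on {0..ell}) (\<lambda>x. cmod (f x) * cmod (g x))"
proof (rule Bochner_Integration.integrable_bound
    [of _ "\<lambda>x. (cmod (f x))\<^sup>2 + (cmod (g x))\<^sup>2"])
  show "(\<lambda>x. cmod (f x) * cmod (g x)) \<in> borel_measurable (lebesgue_on {0..ell})"
    using assms by (auto dest!: L2_measurable)
  have "a * b \<le> a\<^sup>2 + b\<^sup>2" for a b :: real
  proof -
    have "2 * (a * b) \<le> a\<^sup>2 + b\<^sup>2" using sum_squares_bound[of a b] by (simp add: mult.assoc)
    moreover have "0 \<le> a\<^sup>2 + b\<^sup>2" by simp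
    ultimately show ?thesis by linarith
  qed
  then show "AE x in lebesgue_on {0..ell}. norm (cmod (f x) * cmod (g x)) \<le>
      norm ((cmod (f x))\<^sup>2 + (cmod (g x))\<^sup>2)"
    by (intro AE_I2) (simp add: abs_mult)
qed (use assms in \<open>auto simp: L2_def\<close>)

lemma L2_mult_integrable:
  assumes "L2 ell f" "L2 ell g"
  shows "integrable (lebesgue_on {0..ell}) (\<lambda>x. f x * g x)"
  by (rule Bochner_Integration.integrable_bound[OF L2_norm_mult_integrable[OF assms]])
    (use assms in \<open>auto dest!: L2_measurable simp: norm_mult\<close>)

lemma L2_integrable:
  assumes "L2 ell f" shows "integrable (lebesgue_on {0..ell}) f"
  using L2_mult_integrable[OF assms L2_continuous[of ell "\<lambda>x. 1"]] by simp

lemma L2_add: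
  assumes "L2 ell f" "L2 ell g" shows "L2 ell (\<lambda>x. f x + g x)"
  unfolding L2_def
proof (intro conjI Bochner_Integration.integrable_bound
    [of _ "\<lambda>x. 2 * (cmod (f x))\<^sup>2 + 2 * (cmod (g x))\<^sup>2" "\<lambda>x. (cmod (f x + g x))\<^sup>2"])
  have "(cmod (a + b))\<^sup>2 \<le> 2 * (cmod a)\<^sup>2 + 2 * (cmod b)\<^sup>2" for a b
  proof -
    have "(cmod (a + b))\<^sup>2 \<le> (cmod a + cmod b)\<^sup>2" by (intro power_mono norm_triangle_ineq) auto
    also have "\<dots> \<le> 2 * (cmod a)\<^sup>2 + 2 * (cmod b)\<^sup>2"
      using sum_squares_bound[of "cmod a" "cmod b"] by (simp add: power2_sum)
    finally show ?thesis .
  qed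
  then show "AE x in lebesgue_on {0..ell}. norm ((cmod (f x + g x))\<^sup>2) \<le>
      norm (2 * (cmod (f x))\<^sup>2 + 2 * (cmod (g x))\<^sup>2)"
    by (intro AE_I2) simp
qed (use assms in \<open>auto simp: L2_def\<close>)

lemma L2_cmult: assumes "L2 ell f" shows "L2 ell (\<lambda>x. c * f x)"
  using assms unfolding L2_def by (auto simp: norm_mult power_mult_distrib)

lemma L2_diff: assumes "L2 ell f" "L2 ell g" shows "L2 ell (\<lambda>x. f x - g x)"
  using L2_add[OF assms(1) L2_cmult[OF assms(2), of "-1"]] by simp

lemma L2_uminus: assumes "L2 ell f" shows "L2 ell (\<lambda>x. - f x)"
  using L2_cmult[OF assms, of "-1"] by simp

lemma L2_divide: assumes "L2 ell f" shows "L2 ell (\<lambda>x. f x / c)"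
  using L2_cmult[OF assms, of "inverse c"] by (simp add: divide_inverse mult.commute)

lemma L2_mult_continuous:
  assumes "L2 ell f" "continuous_on {0..ell} g" shows "L2 ell (\<lambda>x. g x * f x)"
proof -
  have "integrable (lebesgue_on {0..ell}) (\<lambda>x. complex_of_real ((cmod (f x))\<^sup>2) * complex_of_real ((cmod (g x))\<^sup>2))"
    by (intro integrable_mult_continuous continuous_intros assms integrable_of_real L2_sq_integrable)
  from integrable_Re[OF this] show ?thesis
    using assms(1) measurable_continuous_ivl[OF assms(2)]
    by (auto simp: L2_def norm_mult power_mult_distrib mult.commute simp flip: of_real_mult)
qed

lemmas L2_intros = L2_add L2_diff L2_uminus L2_cmult L2_divide

lemma L2norm_nonneg [simp]: "0 \<le> L2norm ell f" by (simp add: L2norm_def)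

lemma L2norm_sq: "(L2norm ell f)\<^sup>2 = (\<integral>x. (cmod (f x))\<^sup>2 \<partial>lebesgue_on {0..ell})"
  by (simp add: L2norm_def)

lemma L2norm_cong_AE:
  assumes "L2 ell f" "L2 ell g" "AE x in lebesgue_on {0..ell}. f x = g x"
  shows "L2norm ell f = L2norm ell g"
  unfolding L2norm_def
  by (intro arg_cong[where f = sqrt] integral_cong_AE) (use assms in \<open>auto simp: L2_def\<close>)

lemma L2norm_cmult: "L2norm ell (\<lambda>x. c * f x) = cmod c * L2norm ell f"
  by (simp add: L2norm_def norm_mult power_mult_distrib real_sqrt_mult)

lemma L2norm_eq_0_iff:
  assumes "L2 ell f" shows "L2norm ell f = 0 \<longleftrightarrow> (AE x in lebesgue_on {0..ell}. f x = 0)"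
proof -
  have "L2norm ell f = 0 \<longleftrightarrow> (\<integral>x. (cmod (f x))\<^sup>2 \<partial>lebesgue_on {0..ell}) = 0"
    by (simp add: L2norm_def)
  also have "\<dots> \<longleftrightarrow> (AE x in lebesgue_on {0..ell}. (cmod (f x))\<^sup>2 = 0)"
    by (intro integral_nonneg_eq_0_iff_AE L2_sq_integrable assms) auto
  finally show ?thesis by simp
qed

text \<open>The quadratic \<open>key\<close> in \<open>t\<close> is nonnegative, so its discriminant
  is not positive. The version with absolute values inside the integral is the one that the triangle
  inequality uses.\<close>

lemma Cauchy_Schwarz_norm:
  assumes "L2 ell f" "L2 ell g"
  shows "(\<integral>x. cmod (f x) * cmod (g x) \<partial>lebesgue_on {0..ell}) \<le> L2norm ell f * L2norm ell g"
proof -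
  let ?M = "lebesgue_on {0..ell}"
  define A B I where "A = (L2norm ell f)\<^sup>2" and "B = (L2norm ell g)\<^sup>2"
    and "I = (\<integral>x. cmod (f x) * cmod (g x) \<partial>?M)"
  have int: "integrable ?M (\<lambda>x. (cmod (f x))\<^sup>2)" "integrable ?M (\<lambda>x. (cmod (g x))\<^sup>2)"
    "integrable ?M (\<lambda>x. cmod (f x) * cmod (g x))"
    using assms L2_sq_integrable L2_norm_mult_integrable by auto
  have I0: "I \<ge> 0" unfolding I_def by simp
  have key: "0 \<le> t\<^sup>2 * A - 2 * t * I + B" for t
  proof -
    have "0 \<le> (\<integral>x. (t * cmod (f x) - cmod (g x))\<^sup>2 \<partial>?M)" by simp
    also have "\<dots> = (\<integral>x. t\<^sup>2 * (cmod (f x))\<^sup>2 - 2 * t * (cmod (f x) * cmod (g x)) + (cmod (g x))\<^sup>2 \<partial>?M)"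
      by (intro Bochner_Integration.integral_cong) (auto simp: power2_eq_square algebra_simps)
    also have "\<dots> = t\<^sup>2 * A - 2 * t * I + B"
      using int by (simp add: A_def B_def I_def L2norm_sq)
    finally show ?thesis .
  qed
  have "I\<^sup>2 \<le> A * B"
  proof (cases "A = 0")
    case True
    have "I = 0"
    proof (rule ccontr)
      assume "I \<noteq> 0"
      \<comment> \<open>With \<open>A = 0\<close> the quadratic is linear in \<open>t\<close>, and
        at this point its value is -1.\<close>
      then show False using key[of "(B + 1) / (2 * I)"] True by simp
    qed
    then show ?thesis using True by simp
  next
    case False
    then have "A > 0" unfolding A_def by simp
    then show ?thesis using key[of "I / A"] by (simp add: field_simps power2_eq_square)
  qed
  then have "I\<^sup>2 \<le> (L2norm ell f * L2norm ell g)\<^sup>2" by (simp add: A_def B_def power_mult_distrib)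
  then show ?thesis unfolding I_def[symmetric] by (rule power2_le_imp_le) simp
qed

lemma L2norm_triangle:
  assumes "L2 ell f" "L2 ell g"
  shows "L2norm ell (\<lambda>x. f x + g x) \<le> L2norm ell f + L2norm ell g"
proof (rule power2_le_imp_le)
  let ?M = "lebesgue_on {0..ell}"
  have int: "integrable ?M (\<lambda>x. (cmod (f x))\<^sup>2)" "integrable ?M (\<lambda>x. (cmod (g x))\<^sup>2)"
    "integrable ?M (\<lambda>x. cmod (f x) * cmod (g x))"
    using assms L2_sq_integrable L2_norm_mult_integrable by auto
  have "(L2norm ell (\<lambda>x. f x + g x))\<^sup>2 = (\<integral>x. (cmod (f x + g x))\<^sup>2 \<partial>?M)" by (rule L2norm_sq)
  also have "\<dots> \<le> (\<integral>x. (cmod (f x))\<^sup>2 + 2 * (cmod (f x) * cmod (g x)) + (cmod (g x))\<^sup>2 \<partial>?M)"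
  proof (rule integral_mono)
    show "integrable ?M (\<lambda>x. (cmod (f x + g x))\<^sup>2)" using L2_sq_integrable[OF L2_add[OF assms]] .
    show "(cmod (f x + g x))\<^sup>2 \<le> (cmod (f x))\<^sup>2 + 2 * (cmod (f x) * cmod (g x)) + (cmod (g x))\<^sup>2" for x
      using power_mono[OF norm_triangle_ineq[of "f x" "g x"], of 2]
      by (simp add: power2_sum algebra_simps)
  qed (use int in simp)
  also have "\<dots> = (L2norm ell f)\<^sup>2 + 2 * (\<integral>x. cmod (f x) * cmod (g x) \<partial>?M) + (L2norm ell g)\<^sup>2"
    using int by (simp add: L2norm_sq)
  also have "\<dots> \<le> (L2norm ell f + L2norm ell g)\<^sup>2"
    using Cauchy_Schwarz_norm[OF assms] by (simp add: power2_sum)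
  finally show "(L2norm ell (\<lambda>x. f x + g x))\<^sup>2 \<le> (L2norm ell f + L2norm ell g)\<^sup>2" .
qed simp

section \<open>The fundamental lemma of the calculus of variations\<close>

lemma interval_integrals_zero_imp_AE:
  fixes h :: "real \<Rightarrow> complex"
  assumes h: "integrable (lebesgue_on {0..ell}) h" and J0: "\<And>x. x \<in> {0..ell} \<Longrightarrow> J h x = 0"
  shows "AE x in lebesgue_on {0..ell}. h x = 0"
proof (cases "ell \<ge> 0")
  case False
  then show ?thesis by (intro AE_I2) auto
next
  case ell: True
  \<comment> \<open>Extension by zero moves the problem to the whole line, where the open intervals
    generate the Borel sets.\<close>
  define h0 where "h0 x = (if x \<in> {0..ell} then h x else 0)" for x
  have h0: "integrable lebesgue h0"
    unfolding h0_def using h by (subst Lebesgue_Measure.integrable_restrict_UNIV) auto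
  have seti: "set_lebesgue_integral lebesgue {a<..<b} h0 = 0" for a b
  proof (cases "max a 0 < min b ell")
    case False
    have "AE x in lebesgue. indicat_real {a<..<b} x *\<^sub>R h0 x = 0"
      by (rule AE_I'[of "{0, ell}"])
        (use False in \<open>auto intro!: null_sets_completionI finite_imp_null_set_lborel
          simp: h0_def indicator_def\<close>)
    then show ?thesis
      unfolding set_lebesgue_integral_def by (rule integral_eq_zero_AE)
  next
    case True
    define a' b' where "a' = max a 0" and "b' = min b ell"
    have ab: "0 \<le> a'" "a' < b'" "b' \<le> ell" using True by (auto simp: a'_def b'_def)
    have ind: "integrable lebesgue (\<lambda>x. indicator A x *\<^sub>R h0 x)" if "A \<in> sets lebesgue" for A
      using h0 that by (intro integrable_mult_indicator) auto
    have Jx: "J h x = (\<integral>y. indicator {0..x} y *\<^sub>R h0 y \<partial>lebesgue)" if "x \<in> {0..ell}" for x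
    proof -
      have "J h x = (\<integral>y. (if y \<in> {0..x} then h y else 0) \<partial>lebesgue)"
        unfolding J_def by (rule Lebesgue_Measure.integral_restrict_UNIV[symmetric]) simp
      also have "\<dots> = (\<integral>y. indicator {0..x} y *\<^sub>R h0 y \<partial>lebesgue)"
        using that by (intro Bochner_Integration.integral_cong) (auto simp: h0_def indicator_def)
      finally show ?thesis .
    qed
    have "set_lebesgue_integral lebesgue {a<..<b} h0
        = (\<integral>y. indicator {0..b'} y *\<^sub>R h0 y - indicator {0..a'} y *\<^sub>R h0 y \<partial>lebesgue)"
      unfolding set_lebesgue_integral_def
    proof (rule integral_cong_AE)
      show "AE x in lebesgue. indicat_real {a<..<b} x *\<^sub>R h0 x =
          indicat_real {0..b'} x *\<^sub>R h0 x - indicat_real {0..a'} x *\<^sub>R h0 x"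
        by (rule AE_I'[of "{0, ell, a', b'}"])
          (use ab in \<open>auto intro!: null_sets_completionI finite_imp_null_set_lborel
            simp: h0_def indicator_def a'_def b'_def max_def min_def split: if_splits\<close>)
    qed (use h0 in \<open>auto intro!: borel_measurable_integrable ind\<close>)
    also have "\<dots> = J h b' - J h a'"
      using ab Jx ind by (subst Bochner_Integration.integral_diff) auto
    finally show ?thesis using J0 ab by simp
  qed
  have UN: "set_lebesgue_integral lebesgue UNIV h0 = 0"
  proof -
    have "set_lebesgue_integral lebesgue UNIV h0 = J h ell"
      unfolding set_lebesgue_integral_def J_def h0_def
      by (subst Lebesgue_Measure.integral_restrict_UNIV[symmetric]) auto
    then show ?thesis using J0[of ell] ell by simp
  qed
  have si: "set_integrable lebesgue A h0" if "A \<in> sets borel" for A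
    unfolding set_integrable_def using h0 that by (intro integrable_mult_indicator) auto
  have sbox: "sets borel = sigma_sets UNIV (range (\<lambda>(a, b). {a<..<b::real}))"

  proof -
    have "(\<lambda>(a, b). box a b) = (\<lambda>(a, b). {a<..<b::real})" by (auto simp: fun_eq_iff)
    then show ?thesis
      by (subst borel_eq_box) (simp del: box_real)
  qed
  \<comment> \<open>Dynkin's argument: open intervals are stable under intersection, and the Borel
    sets with vanishing integral are closed under complements, because the total integral vanishes
    by \<open>UN\<close>, and under countable disjoint unions.\<close>
  have borel0: "set_lebesgue_integral lebesgue A h0 = 0" if "A \<in> sets borel" for A
  proof -
    have st: "Int_stable (range (\<lambda>(a, b). {a<..<b::real}))"
    proof (unfold Int_stable_def, safe)
      fix a b c d :: real
      have "{a<..<b} \<inter> {c<..<d} = {max a c<..<min b d}" by auto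
      then show "{a<..<b} \<inter> {c<..<d} \<in> range (\<lambda>(a, b). {a<..<b::real})" by auto
    qed
    have gen: "range (\<lambda>(a, b). {a<..<b::real}) \<subseteq> Pow UNIV" by simp
    have sig: "A \<in> sigma_sets UNIV (range (\<lambda>(a, b). {a<..<b::real}))"
      using that by (simp add: sbox)
    show ?thesis using st gen sig
    proof (induction rule: sigma_sets_induct_disjoint)
      case (basic A)
      then show ?case using seti by auto
    next
      case empty
      then show ?case by (simp add: set_lebesgue_integral_def)
    next
      case (compl A)
      then have A: "A \<in> sets borel" by (simp add: sbox)
      have "set_lebesgue_integral lebesgue (A \<union> (UNIV - A)) h0
          = set_lebesgue_integral lebesgue A h0 + set_lebesgue_integral lebesgue (UNIV - A) h0"
        using A by (intro set_integral_Un si) auto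
      then show ?case using compl UN by simp
    next
      case (union A)
      have A: "A i \<in> sets borel" for i using union unfolding sbox by blast
      then have UA: "(\<Union>i. A i) \<in> sets borel" by blast
      have "set_lebesgue_integral lebesgue (\<Union>i. A i) h0 = (\<Sum>i. set_lebesgue_integral lebesgue (A i) h0)"
      proof (rule lebesgue_integral_countable_add)
        show "A i \<in> sets lebesgue" for i using A by simp
        show "set_integrable lebesgue (\<Union> (range A)) h0" using UA by (intro si) simp
        show "i \<noteq> j \<Longrightarrow> A i \<inter> A j = {}" for i j
          using union by (auto simp: disjoint_family_on_def)
      qed
      then show ?case using union by simp
    qed
  qed
  interpret finite_measure "lebesgue_on {0..ell}" by (rule finite_measure_lebesgue_on) simp
  show ?thesis
  proof (rule density_zero[OF h])
    fix A :: "real set" assume "A \<in> sets (lebesgue_on {0..ell})"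
    then have A: "A \<in> sets lebesgue" "A \<subseteq> {0..ell}" by (auto simp: sets_restrict_space_iff)
    \<comment> \<open>A Lebesgue set differs from a Borel set by a null set only, so the statement
      for Borel sets is enough.\<close>
    then obtain S N N' where SN: "A = S \<union> N" "N \<subseteq> N'" "N' \<in> null_sets lborel" "S \<in> sets lborel"
      using sets_completionE[of A lborel] by metis
    have "N' \<in> null_sets lebesgue" using SN null_sets_completionI by blast
    then have N': "AE x in lebesgue. x \<notin> N'" by (rule AE_not_in)
    have "set_lebesgue_integral (lebesgue_on {0..ell}) A h = set_lebesgue_integral lebesgue A h0"
    proof -
      have "set_lebesgue_integral (lebesgue_on {0..ell}) A h
          = (\<integral>x. indicator {0..ell} x *\<^sub>R (indicator A x *\<^sub>R h x) \<partial>lebesgue)"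
        unfolding set_lebesgue_integral_def by (rule integral_restrict_space) simp
      also have "\<dots> = set_lebesgue_integral lebesgue A h0"
        unfolding set_lebesgue_integral_def
        by (intro Bochner_Integration.integral_cong) (auto simp: h0_def indicator_def)
      finally show ?thesis .
    qed
    also have "\<dots> = set_lebesgue_integral lebesgue S h0"
      unfolding set_lebesgue_integral_def
    proof (rule integral_cong_AE)
      show "(\<lambda>x. indicat_real A x *\<^sub>R h0 x) \<in> borel_measurable lebesgue"
        using h0 A by (intro borel_measurable_scaleR borel_measurable_indicator borel_measurable_integrable)
      show "(\<lambda>x. indicat_real S x *\<^sub>R h0 x) \<in> borel_measurable lebesgue"
        using h0 SN by (intro borel_measurable_scaleR borel_measurable_indicator borel_measurable_integrable) auto
      show "AE x in lebesgue. indicat_real A x *\<^sub>R h0 x = indicat_real S x *\<^sub>R h0 x"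
        using N' by eventually_elim (use SN in \<open>auto simp: indicator_def\<close>)
    qed
    finally show "set_lebesgue_integral (lebesgue_on {0..ell}) A h = 0" using borel0 SN by simp
  qed
qed

lemma continuous_AE_eq:
  fixes f g :: "real \<Rightarrow> complex"
  assumes "0 < b" "continuous_on {0..b} f" "continuous_on {0..b} g"
    and "AE x in lebesgue_on {0..b}. f x = g x" and x: "x \<in> {0..b}"
  shows "f x = g x"
proof -
  have c: "continuous_on {0..b} (\<lambda>x. cmod (f x - g x))"
    by (intro continuous_intros assms)
  have "(\<integral>x. cmod (f x - g x) \<partial>lebesgue_on {0..b}) = 0"
    by (rule integral_eq_zero_AE) (use assms(4) in auto)
  then have "\<forall>x\<in>{0..b}. cmod (f x - g x) = 0"
    using integralL_eq_0_iff[OF c] assms(1) by simp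
  then show ?thesis using x by auto
qed

text \<open>Dominated convergence replaces the bumps by indicators of open intervals, so
  \<open>J h\<close> is constant in the interior. By continuity it is constant on the closed
  interval, and there it equals \<open>J h 0 = 0\<close>.\<close>

lemma bump_integrals_zero_imp_AE:
  fixes h :: "real \<Rightarrow> complex"
  assumes ell: "0 < ell" and h: "integrable (lebesgue_on {0..ell}) h"
    and 0: "\<And>a c j. 0 < a \<Longrightarrow> a \<le> c \<Longrightarrow> c < ell \<Longrightarrow>
      (\<integral>x. h x * complex_of_real (bump a c j x) \<partial>lebesgue_on {0..ell}) = 0"
  shows "AE x in lebesgue_on {0..ell}. h x = 0"
proof (rule interval_integrals_zero_imp_AE[OF h])
  let ?M = "lebesgue_on {0..ell}"
  have hm: "h \<in> borel_measurable ?M" using h by auto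
  have bm: "(\<lambda>x. complex_of_real (bump a c j x)) \<in> borel_measurable ?M" for a c j
    by (intro measurable_continuous_ivl continuous_intros smooth_continuous bump_smooth)
  have eq: "J h a = J h c" if ac: "0 < a" "a \<le> c" "c < ell" for a c
  proof -
    have "(\<lambda>j. \<integral>x. h x * complex_of_real (bump a c j x) \<partial>?M)
        \<longlonglongrightarrow> (\<integral>x. (if x \<in> {a<..<c} then h x else 0) \<partial>?M)"
    proof (rule integral_dominated_convergence[where w = "\<lambda>x. cmod (h x)"])
      show "(\<lambda>x. (if x \<in> {a<..<c} then h x else 0)) \<in> borel_measurable ?M"
        by (intro measurable_If_set hm) (use ac in \<open>auto simp: sets_restrict_space_iff\<close>)
      show "AE x in ?M. (\<lambda>j. h x * complex_of_real (bump a c j x))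
          \<longlonglongrightarrow> (if x \<in> {a<..<c} then h x else 0)"
      proof (rule AE_I2)
        fix x
        have "(\<lambda>j. h x * complex_of_real (bump a c j x)) \<longlonglongrightarrow> h x * complex_of_real (indicator {a<..<c} x)"
          by (intro tendsto_intros bump_tendsto)
        then show "(\<lambda>j. h x * complex_of_real (bump a c j x)) \<longlonglongrightarrow> (if x \<in> {a<..<c} then h x else 0)"
          by (cases "x \<in> {a<..<c}") auto
      qed
      show "AE x in ?M. cmod (h x * complex_of_real (bump a c j x)) \<le> cmod (h x)" for j
        by (intro AE_I2) (simp add: norm_mult bump_bounds mult_left_le)
    qed (use h hm bm in auto)
    then have "(\<integral>x. (if x \<in> {a<..<c} then h x else 0) \<partial>?M) = 0"
      using 0[OF ac] by (simp add: LIMSEQ_const_iff)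
    moreover have "(\<integral>x. (if x \<in> {a<..<c} then h x else 0) \<partial>?M)
        = (\<integral>x. (if x \<in> {0..c} then h x else 0) - (if x \<in> {0..a} then h x else 0) \<partial>?M)"
    proof (rule integral_cong_AE)
      show "AE x in ?M. (if x \<in> {a<..<c} then h x else 0) =
          (if x \<in> {0..c} then h x else 0) - (if x \<in> {0..a} then h x else 0)"
        by (rule AE_I'[of "{c} \<inter> {0..ell}"])
          (use ac in \<open>auto simp: null_sets_restrict_space indicator_def
            intro!: null_sets_completionI finite_imp_null_set_lborel\<close>)
      show "(\<lambda>x. (if x \<in> {a<..<c} then h x else 0)) \<in> borel_measurable ?M"
        by (intro measurable_If_set hm) (use ac in \<open>auto simp: sets_restrict_space_iff\<close>)
      show "(\<lambda>x. (if x \<in> {0..c} then h x else 0) - (if x \<in> {0..a} then h x else 0)) \<in> borel_measurable ?M"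
        by (intro borel_measurable_diff measurable_If_set hm)
          (auto simp: sets_restrict_space_iff)
    qed
    moreover have "(\<integral>x. (if x \<in> {0..c} then h x else 0) - (if x \<in> {0..a} then h x else 0) \<partial>?M)
        = J h c - J h a"
    proof -
      have i: "integrable ?M (\<lambda>x. if x \<in> {0..d} then h x else 0)" for d
      proof (rule Bochner_Integration.integrable_bound[OF h])
        show "(\<lambda>x. if x \<in> {0..d} then h x else 0) \<in> borel_measurable ?M"
          by (intro measurable_If_set hm) (auto simp: sets_restrict_space_iff)
      qed auto
      have "J h d = (\<integral>x. (if x \<in> {0..d} then h x else 0) \<partial>?M)" if "d \<le> ell" for d
        unfolding J_def using that by (intro integral_restrict[symmetric]) auto
      then show ?thesis using ac i by (subst Bochner_Integration.integral_diff) auto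
    qed
    ultimately show ?thesis by simp
  qed
  have half: "J h x = J h (ell / 2)" if "x \<in> {0<..<ell}" for x
    using that eq[of x "ell / 2"] eq[of "ell / 2" x] by (cases "x \<le> ell / 2") auto
  have cl: "closure {0<..<ell} = {0..ell}" using ell by simp
  have all: "J h x = J h (ell / 2)" if "x \<in> {0..ell}" for x
    using continuous_constant_on_closure[of "{0<..<ell}" "J h" "J h (ell / 2)" x]
      J_continuous[OF h] half that unfolding cl by blast
  have "J h (ell / 2) = 0" using all[of 0] ell by simp
  then show "J h x = 0" if "x \<in> {0..ell}" for x using all that by simp
qed

lemma smooth_primitive:
  assumes "smooth g"
  obtains Q where "smooth Q" "Q 0 = 0" "\<And>x. (Q has_real_derivative g x) (at x)"
proof -
  have "\<exists>F. \<forall>x. (- \<infinity> :: ereal) < x \<longrightarrow> x < (\<infinity> :: ereal) \<longrightarrow> (F has_vector_derivative g x) (at x)"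
    by (rule einterval_antiderivative)
      (use smooth_deriv(2)[OF assms] in \<open>auto intro: DERIV_isCont\<close>)
  then obtain F where "\<And>x. (F has_real_derivative g x) (at x)"
    by (auto simp: has_real_derivative_iff_has_vector_derivative)
  then have F: "((\<lambda>x. F x - F 0) has_real_derivative g x) (at x)" for x
    by (auto intro!: derivative_eq_intros)
  show ?thesis
    by (rule that[OF smooth_prim[OF F assms] _ F]) simp
qed

text \<open>The du Bois-Reymond lemma: every bump is, up to a multiple of one fixed bump
  \<open>\<omega>\<close>, the derivative of a test function, so \<open>h - m\<close> integrates to
  zero against every bump.\<close>

lemma weak_deriv_zero_imp_const:
  fixes h :: "real \<Rightarrow> complex"
  assumes ell: "0 < ell" and h: "integrable (lebesgue_on {0..ell}) h"
    and 0: "\<And>\<phi>. test_fun ell \<phi> \<Longrightarrow>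
      (\<integral>x. h x * complex_of_real (deriv \<phi> x) \<partial>lebesgue_on {0..ell}) = 0"
  shows "\<exists>m. AE x in lebesgue_on {0..ell}. h x = m"
proof -
  let ?M = "lebesgue_on {0..ell}"
  define \<omega> where "\<omega> = bump (ell/3) (2*ell/3) 1"
  have bi: "integrable ?M (bump a c j)" for a c j
    by (intro integrable_continuous_ivl smooth_continuous bump_smooth)
  define I0 where "I0 = (\<integral>x. \<omega> x \<partial>?M)"
  have "I0 \<noteq> 0"
  proof
    assume "I0 = 0"
    then have "\<forall>x\<in>{0..ell}. \<omega> x = 0"
      unfolding I0_def \<omega>_def using ell
      by (subst (asm) integralL_eq_0_iff) (auto intro!: smooth_continuous bump_smooth bump_bounds)
    then have "\<omega> (ell/2) = 0" using ell by simp
    moreover have "\<omega> (ell/2) > 0" using ell by (simp add: \<omega>_def bump_def expm_def)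
    ultimately show False by simp
  qed
  have hi: "integrable ?M (\<lambda>x. h x * complex_of_real (bump a c j x))" for a c j
    by (intro integrable_mult_continuous h continuous_intros smooth_continuous bump_smooth)
  \<comment> \<open>The only candidate for the constant is the mean of \<open>h\<close> with respect
    to the weight \<open>\<omega>\<close>.\<close>
  define m where "m = (\<integral>x. h x * complex_of_real (\<omega> x) \<partial>?M) / complex_of_real I0"
  have "AE x in ?M. h x - m = 0"
  proof (rule bump_integrals_zero_imp_AE[OF ell])
    show "integrable ?M (\<lambda>x. h x - m)" using h by simp
    fix a c :: real and j assume ac: "0 < a" "a \<le> c" "c < ell"
    define I1 where "I1 = (\<integral>x. bump a c j x \<partial>?M)"
    \<comment> \<open>The multiple of \<open>\<omega>\<close> is chosen such that \<open>g\<close>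
      has integral zero; its primitive then vanishes near both end points and is a test
      function.\<close>
    define g where "g x = bump a c j x + (- (I1 / I0)) * \<omega> x" for x
    have g: "smooth g" unfolding g_def[abs_def] \<omega>_def
      by (intro smooth_add smooth_mult smooth_const bump_smooth)
    obtain Q where Q: "smooth Q" "Q 0 = 0" "\<And>x. (Q has_real_derivative g x) (at x)"
      using smooth_primitive[OF g] by blast
    have "(\<integral>x. g x \<partial>?M) = Q ell - Q 0"
      by (rule integral_FTC_ivl)
        (use ell Q smooth_continuous[OF g] in
          \<open>auto simp flip: has_real_derivative_iff_has_vector_derivative intro: has_field_derivative_at_within\<close>)
    moreover have "(\<integral>x. g x \<partial>?M) = 0"
      unfolding g_def using bi \<open>I0 \<noteq> 0\<close> by (simp add: I1_def I0_def \<omega>_def)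
    ultimately have Qell: "Q ell = 0" using Q by simp
    have g0: "g x = 0" if "x \<le> min a (ell/3) \<or> x \<ge> max c (2*ell/3)" for x
      unfolding g_def \<omega>_def using that by (subst (1 2) bump_outside) auto
    have "\<exists>d. \<forall>x\<in>{..min a (ell/3)}. Q x = d"
    proof (rule has_field_derivative_zero_constant)
      fix x assume "x \<in> {..min a (ell/3)}"
      then show "(Q has_field_derivative 0) (at x within {..min a (ell/3)})"
        using has_field_derivative_at_within[OF Q(3)[of x]] g0[of x] by simp
    qed simp
    then obtain d where d: "\<forall>x\<in>{..min a (ell/3)}. Q x = d" by blast
    moreover have "0 \<in> {..min a (ell/3)}" using ac ell by simp
    ultimately have "d = 0" using Q(2) by metis
    with d have Q1: "Q x = 0" if "x \<le> min a (ell/3)" for x using that by simp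
    have "\<exists>d. \<forall>x\<in>{max c (2*ell/3)..}. Q x = d"
    proof (rule has_field_derivative_zero_constant)
      fix x assume "x \<in> {max c (2*ell/3)..}"
      then show "(Q has_field_derivative 0) (at x within {max c (2*ell/3)..})"
        using has_field_derivative_at_within[OF Q(3)[of x]] g0[of x] by simp
    qed simp
    then obtain d' where d': "\<forall>x\<in>{max c (2*ell/3)..}. Q x = d'" by blast
    moreover have "ell \<in> {max c (2*ell/3)..}" using ac ell by simp
    ultimately have "d' = 0" using Qell by metis
    with d' have Q2: "Q x = 0" if "x \<ge> max c (2*ell/3)" for x using that by simp
    have test: "test_fun ell Q"
    proof (rule test_fun_smooth[OF Q(1), of "min a (ell/3)" "max c (2*ell/3)"])
      fix x assume "x \<notin> {min a (ell/3)..max c (2*ell/3)}"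
      then have "x \<le> min a (ell/3) \<or> x \<ge> max c (2*ell/3)" by (meson atLeastAtMost_iff le_cases)
      then show "Q x = 0" using Q1 Q2 by blast
    qed (use ac ell in auto)
    have "deriv Q = g" using Q(3) by (auto simp: DERIV_imp_deriv)
    then have "0 = (\<integral>x. h x * complex_of_real (g x) \<partial>?M)" using 0[OF test] by simp
    also have "\<dots> = (\<integral>x. h x * complex_of_real (bump a c j x)
        - complex_of_real (I1 / I0) * (h x * complex_of_real (\<omega> x)) \<partial>?M)"
      by (intro Bochner_Integration.integral_cong) (auto simp: g_def algebra_simps)
    also have "\<dots> = (\<integral>x. h x * complex_of_real (bump a c j x) \<partial>?M) - complex_of_real I1 * m"
      using hi by (subst Bochner_Integration.integral_diff) (auto simp: m_def \<omega>_def)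
    finally have A: "(\<integral>x. h x * complex_of_real (bump a c j x) \<partial>?M) = complex_of_real I1 * m" by simp
    have "(\<integral>x. (h x - m) * complex_of_real (bump a c j x) \<partial>?M)
        = (\<integral>x. h x * complex_of_real (bump a c j x) - m * complex_of_real (bump a c j x) \<partial>?M)"
      by (intro Bochner_Integration.integral_cong) (auto simp: algebra_simps)
    also have "\<dots> = complex_of_real I1 * m - m * complex_of_real I1"
      using hi bi A by (subst Bochner_Integration.integral_diff) (auto simp: I1_def)
    finally show "(\<integral>x. (h x - m) * complex_of_real (bump a c j x) \<partial>?M) = 0" by simp
  qed
  then show ?thesis by (intro exI[of _ m]) simp
qed

section \<open>Weak derivatives and integration by parts\<close>

lemma test_fun_props:
  assumes "test_fun ell \<phi>"
  shows "(\<phi> has_real_derivative deriv \<phi> x) (at x)" "continuous_on A (deriv \<phi>)" "\<phi> 0 = 0" "\<phi> ell = 0"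
proof -
  have *: "((deriv ^^ n) \<phi> has_real_derivative (deriv ^^ Suc n) \<phi> x) (at x)" for n x
    using assms by (auto simp: test_fun_def)
  show "(\<phi> has_real_derivative deriv \<phi> x) (at x)" using *[of 0 x] by simp
  have "isCont (deriv \<phi>) x" for x using *[of 1 x] by (auto intro: DERIV_isCont)
  then show "continuous_on A (deriv \<phi>)" by (simp add: continuous_at_imp_continuous_on)
  show "\<phi> 0 = 0" "\<phi> ell = 0" using assms by (auto simp: test_fun_def)
qed

lemma weak_deriv_J:
  assumes ell: "0 < ell" and g: "integrable (lebesgue_on {0..ell}) g" and t: "test_fun ell \<phi>"
  shows "(\<integral>x. J g x * complex_of_real (deriv \<phi> x) \<partial>lebesgue_on {0..ell})
    = - (\<integral>x. g x * complex_of_real (\<phi> x) \<partial>lebesgue_on {0..ell})"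
proof -
  have "J (\<lambda>s. complex_of_real (deriv \<phi> s) * J g s) ell
      = complex_of_real (\<phi> ell) * J g ell - J (\<lambda>s. complex_of_real (\<phi> s) * g s) ell"
  proof (rule J_by_parts)
    show "((\<lambda>x. complex_of_real (\<phi> x)) has_vector_derivative complex_of_real (deriv \<phi> x)) (at x)" for x
      using test_fun_props(1)[OF t]
      by (intro has_vector_derivative_of_real) (simp add: has_real_derivative_iff_has_vector_derivative)
  qed (use ell g test_fun_props(2)[OF t] in \<open>auto intro!: continuous_intros\<close>)
  then show ?thesis by (simp add: J_def[of _ ell] test_fun_props(4)[OF t] mult.commute)
qed

lemma test_fun_integral_deriv:
  assumes ell: "0 < ell" and t: "test_fun ell \<phi>"
  shows "(\<integral>x. complex_of_real (deriv \<phi> x) \<partial>lebesgue_on {0..ell}) = 0"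
proof -
  have "(\<integral>x. deriv \<phi> x \<partial>lebesgue_on {0..ell}) = \<phi> ell - \<phi> 0"
    by (rule integral_FTC_ivl)
      (use ell test_fun_props[OF t] in
          \<open>auto simp flip: has_real_derivative_iff_has_vector_derivative intro: has_field_derivative_at_within\<close>)
  then show ?thesis using test_fun_props[OF t] by simp
qed

lemma integrable_mult_test:
  assumes "integrable (lebesgue_on {0..ell}) f" "test_fun ell \<phi>"
  shows "integrable (lebesgue_on {0..ell}) (\<lambda>x. f x * complex_of_real (deriv \<phi> x))"
  by (rule integrable_mult_continuous[OF assms(1)])
    (intro continuous_on_of_real test_fun_props(2)[OF assms(2)])

text \<open>From left to right, \<open>f - J g\<close> has weak derivative zero and is therefore
  constant. From right to left, \<open>J g\<close> is integrated by parts and the constant drops out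
  because a test function vanishes at both ends.\<close>

lemma weak_deriv_iff:
  assumes ell: "0 < ell" and f: "L2 ell f" and g: "L2 ell g"
  shows "weak_deriv ell f g \<longleftrightarrow> (\<exists>c. AE x in lebesgue_on {0..ell}. f x = c + J g x)"
proof
  let ?M = "lebesgue_on {0..ell}"
  have gi: "integrable ?M g" and fi: "integrable ?M f" using f g L2_integrable by auto
  have Jc: "continuous_on {0..ell} (J g)" using J_continuous[OF gi] .
  have Ji: "integrable ?M (J g)" using integrable_continuous_ivl[OF Jc] .
  {
    assume w: "weak_deriv ell f g"
    have "\<exists>m. AE x in ?M. f x - J g x = m"
    proof (rule weak_deriv_zero_imp_const[OF ell])
      show "integrable ?M (\<lambda>x. f x - J g x)" using fi Ji by simp
      fix \<phi> assume t: "test_fun ell \<phi>"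
      have "(\<integral>x. (f x - J g x) * complex_of_real (deriv \<phi> x) \<partial>?M)
          = (\<integral>x. f x * complex_of_real (deriv \<phi> x) - J g x * complex_of_real (deriv \<phi> x) \<partial>?M)"
        by (intro Bochner_Integration.integral_cong) (auto simp: algebra_simps)
      also have "\<dots> = 0"
        using w t weak_deriv_J[OF ell gi t] integrable_mult_test[OF fi t] integrable_mult_test[OF Ji t]
        by (subst Bochner_Integration.integral_diff) (auto simp: weak_deriv_def)
      finally show "(\<integral>x. (f x - J g x) * complex_of_real (deriv \<phi> x) \<partial>?M) = 0" .
    qed
    then obtain m where "AE x in ?M. f x - J g x = m" by blast
    then show "\<exists>c. AE x in ?M. f x = c + J g x"
      by (intro exI[of _ m]) (auto simp: algebra_simps)
  next
    assume "\<exists>c. AE x in ?M. f x = c + J g x"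
    then obtain c where c: "AE x in ?M. f x = c + J g x" by blast
    show "weak_deriv ell f g"
      unfolding weak_deriv_def
    proof (intro allI impI)
      fix \<phi> assume t: "test_fun ell \<phi>"
      have i1: "integrable ?M (\<lambda>x. c * complex_of_real (deriv \<phi> x))"
        by (intro integrable_mult_test t) simp
      have i2: "integrable ?M (\<lambda>x. J g x * complex_of_real (deriv \<phi> x))"
        by (intro integrable_mult_test t Ji)
      have "(\<integral>x. f x * complex_of_real (deriv \<phi> x) \<partial>?M)
         = (\<integral>x. c * complex_of_real (deriv \<phi> x) + J g x * complex_of_real (deriv \<phi> x) \<partial>?M)"
      proof (rule integral_cong_AE)
        show "AE x in ?M. f x * complex_of_real (deriv \<phi> x)
            = c * complex_of_real (deriv \<phi> x) + J g x * complex_of_real (deriv \<phi> x)"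
          using c by eventually_elim (simp add: algebra_simps)
      qed (use integrable_mult_test[OF fi t] i1 i2 in auto)
      also have "\<dots> = - (\<integral>x. g x * complex_of_real (\<phi> x) \<partial>?M)"
        using i1 i2 weak_deriv_J[OF ell gi t] test_fun_integral_deriv[OF ell t]
        by (subst Bochner_Integration.integral_add) auto
      finally show "(\<integral>x. f x * complex_of_real (deriv \<phi> x) \<partial>?M)
        = - (\<integral>x. g x * complex_of_real (\<phi> x) \<partial>?M)" .
    qed
  }
qed

lemma dx_props: assumes "H1 ell f" shows "L2 ell (dx ell f)" "weak_deriv ell f (dx ell f)"
proof -
  have "\<exists>g. L2 ell g \<and> weak_deriv ell f g" using assms by (simp add: H1_def)
  then have "L2 ell (dx ell f) \<and> weak_deriv ell f (dx ell f)" unfolding dx_def by (rule someI_ex)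
  then show "L2 ell (dx ell f)" "weak_deriv ell f (dx ell f)" by auto
qed

lemma H1_L2: "H1 ell f \<Longrightarrow> L2 ell f" by (simp add: H1_def)
lemma H10_H1: "H10 ell f \<Longrightarrow> H1 ell f" by (simp add: H10_def)
lemmas L2_dx = dx_props(1)

lemma J_continuous_L2: "L2 ell g \<Longrightarrow> continuous_on {0..ell} (J g)"
  by (intro J_continuous L2_integrable)

lemma L2_J: "L2 ell g \<Longrightarrow> L2 ell (J g)"
  by (rule L2_continuous[OF J_continuous_L2])

lemma H1_AC:
  assumes "0 < ell" "H1 ell f"
  shows "\<exists>c. AE x in lebesgue_on {0..ell}. f x = c + J (dx ell f) x"
  using weak_deriv_iff[OF assms(1) H1_L2[OF assms(2)] dx_props(1)[OF assms(2)]] dx_props(2)[OF assms(2)]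
  by blast

text \<open>\<open>dx\<close> picks some weak derivative, so it can only be identified up to a null
  set. The two representations of \<open>f\<close> are continuous and agree almost everywhere, hence
  everywhere; thus the difference of the two derivatives has vanishing integrals over all initial
  intervals.\<close>

lemma H1I_AE:
  assumes ell: "0 < ell" and f: "L2 ell f" and g: "L2 ell g"
    and fg: "AE x in lebesgue_on {0..ell}. f x = c + J g x"
  shows "H1 ell f" "AE x in lebesgue_on {0..ell}. dx ell f x = g x"
proof -
  let ?M = "lebesgue_on {0..ell}"
  show H: "H1 ell f" using weak_deriv_iff[OF ell f g] fg f g by (auto simp: H1_def)
  obtain d where d: "AE x in ?M. f x = d + J (dx ell f) x" using H1_AC[OF ell H] by blast
  note L = dx_props(1)[OF H]
  have Lgi: "integrable ?M g" "integrable ?M (dx ell f)" using g L L2_integrable by auto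
  have eq: "c + J g x = d + J (dx ell f) x" if "x \<in> {0..ell}" for x
  proof (rule continuous_AE_eq[OF ell _ _ _ that])
    show "AE x in ?M. c + J g x = d + J (dx ell f) x" using fg d by eventually_elim simp
  qed (auto intro!: continuous_intros J_continuous_L2 g L)
  have "c = d" using eq[of 0] ell by simp
  then have "J (\<lambda>x. dx ell f x - g x) x = 0" if "x \<in> {0..ell}" for x
    using eq[OF that] that by (subst J_diff[OF Lgi(2,1)]) auto
  then have "AE x in ?M. dx ell f x - g x = 0"
    using Lgi by (intro interval_integrals_zero_imp_AE) auto
  then show "AE x in ?M. dx ell f x = g x" by simp
qed

lemma H1_add:
  assumes ell: "0 < ell" and f: "H1 ell f" and g: "H1 ell g"
  shows "H1 ell (\<lambda>x. f x + g x)"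
    "AE x in lebesgue_on {0..ell}. dx ell (\<lambda>x. f x + g x) x = dx ell f x + dx ell g x"
proof -
  let ?M = "lebesgue_on {0..ell}"
  obtain c d where c: "AE x in ?M. f x = c + J (dx ell f) x"
    and d: "AE x in ?M. g x = d + J (dx ell g) x"
    using H1_AC[OF ell f] H1_AC[OF ell g] by blast
  have L: "L2 ell (\<lambda>x. f x + g x)" "L2 ell (\<lambda>x. dx ell f x + dx ell g x)"
    using f g by (auto intro!: L2_add dest: H1_L2 L2_dx)
  have J: "AE x in ?M. J (\<lambda>x. dx ell f x + dx ell g x) x = J (dx ell f) x + J (dx ell g) x"
    by (intro AE_I2 J_add[of ell] L2_integrable L2_dx f g) auto
  have "AE x in ?M. f x + g x = (c + d) + J (\<lambda>x. dx ell f x + dx ell g x) x"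
    using c d J by eventually_elim simp
  from H1I_AE[OF ell L this] show "H1 ell (\<lambda>x. f x + g x)"
    "AE x in ?M. dx ell (\<lambda>x. f x + g x) x = dx ell f x + dx ell g x" by auto
qed

lemma H1_cmult:
  assumes ell: "0 < ell" and f: "H1 ell f"
  shows "H1 ell (\<lambda>x. a * f x)"
    "AE x in lebesgue_on {0..ell}. dx ell (\<lambda>x. a * f x) x = a * dx ell f x"
proof -
  let ?M = "lebesgue_on {0..ell}"
  obtain c where c: "AE x in ?M. f x = c + J (dx ell f) x"
    using H1_AC[OF ell f] by blast
  have L: "L2 ell (\<lambda>x. a * f x)" "L2 ell (\<lambda>x. a * dx ell f x)"
    using f by (auto intro!: L2_cmult dest: H1_L2 L2_dx)
  have "AE x in ?M. a * f x = a * c + J (\<lambda>x. a * dx ell f x) x"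
    using c by eventually_elim (simp add: J_mult algebra_simps)
  from H1I_AE[OF ell L this] show "H1 ell (\<lambda>x. a * f x)"
    "AE x in ?M. dx ell (\<lambda>x. a * f x) x = a * dx ell f x" by auto
qed

lemma H1_cong:
  assumes ell: "0 < ell" and f: "H1 ell f" and L: "L2 ell f'"
    and ff: "AE x in lebesgue_on {0..ell}. f x = f' x"
  shows "H1 ell f'" "AE x in lebesgue_on {0..ell}. dx ell f' x = dx ell f x"
proof -
  let ?M = "lebesgue_on {0..ell}"
  obtain c where c: "AE x in ?M. f x = c + J (dx ell f) x"
    using H1_AC[OF ell f] by blast
  have "AE x in ?M. f' x = c + J (dx ell f) x"
    using c ff by eventually_elim simp
  from H1I_AE[OF ell L L2_dx[OF f] this] show "H1 ell f'" "AE x in ?M. dx ell f' x = dx ell f x"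
    by auto
qed

text \<open>The continuous representative that vanishes at the ends must coincide with
  \<open>c + J (dx ell f)\<close>. Its values at the two end points give \<open>c = 0\<close> and
  the second claim.\<close>

lemma H10D:
  assumes ell: "0 < ell" and f: "H10 ell f"
  shows "AE x in lebesgue_on {0..ell}. f x = J (dx ell f) x" "J (dx ell f) ell = 0"
proof -
  let ?M = "lebesgue_on {0..ell}"
  have H: "H1 ell f" using f by (rule H10_H1)
  obtain c where c: "AE x in ?M. f x = c + J (dx ell f) x"
    using H1_AC[OF ell H] by blast
  obtain h where h: "continuous_on {0..ell} h" "h 0 = 0" "h ell = 0" "AE x in ?M. f x = h x"
    using f by (auto simp: H10_def)
  have eq: "h x = c + J (dx ell f) x" if "x \<in> {0..ell}" for x
  proof (rule continuous_AE_eq[OF ell h(1) _ _ that])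
    show "AE x in ?M. h x = c + J (dx ell f) x" using c h(4) by eventually_elim simp
  qed (auto intro!: continuous_intros J_continuous_L2 L2_dx H)
  have "c = 0" using eq[of 0] h ell by simp
  then show "AE x in ?M. f x = J (dx ell f) x" "J (dx ell f) ell = 0"
    using c eq[of ell] h ell by auto
qed

lemma H10I:
  assumes ell: "0 < ell" and f: "L2 ell f" and g: "L2 ell g"
    and fg: "AE x in lebesgue_on {0..ell}. f x = J g x" and b: "J g ell = 0"
  shows "H10 ell f"
  unfolding H10_def
proof (intro conjI exI[of _ "J g"])
  have "AE x in lebesgue_on {0..ell}. f x = 0 + J g x" using fg by simp
  then show "H1 ell f" by (rule H1I_AE(1)[OF ell f g])
qed (use J_continuous_L2[OF g] b fg in auto)

lemma H10_add:
  assumes ell: "0 < ell" and f: "H10 ell f" and g: "H10 ell g"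
  shows "H10 ell (\<lambda>x. f x + g x)"
proof -
  obtain h where h: "continuous_on {0..ell} h" "h 0 = 0" "h ell = 0" "AE x in lebesgue_on {0..ell}. f x = h x"
    using f by (auto simp: H10_def)
  obtain k where k: "continuous_on {0..ell} k" "k 0 = 0" "k ell = 0" "AE x in lebesgue_on {0..ell}. g x = k x"
    using g by (auto simp: H10_def)
  have "AE x in lebesgue_on {0..ell}. f x + g x = h x + k x"
    using h(4) k(4) by eventually_elim simp
  then show ?thesis unfolding H10_def
    using H1_add(1)[OF ell H10_H1[OF f] H10_H1[OF g]] h k
    by (intro conjI exI[of _ "\<lambda>x. h x + k x"]) (auto intro!: continuous_intros)
qed

lemma H10_cmult:
  assumes ell: "0 < ell" and f: "H10 ell f"
  shows "H10 ell (\<lambda>x. a * f x)"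
proof -
  obtain h where h: "continuous_on {0..ell} h" "h 0 = 0" "h ell = 0" "AE x in lebesgue_on {0..ell}. f x = h x"
    using f by (auto simp: H10_def)
  have "AE x in lebesgue_on {0..ell}. a * f x = a * h x"
    using h(4) by eventually_elim simp
  then show ?thesis unfolding H10_def
    using H1_cmult(1)[OF ell H10_H1[OF f]] h
    by (intro conjI exI[of _ "\<lambda>x. a * h x"]) (auto intro!: continuous_intros)
qed

lemma H10_diff:
  assumes ell: "0 < ell" and f: "H10 ell f" and g: "H10 ell g"
  shows "H10 ell (\<lambda>x. f x - g x)"
  using H10_add[OF ell f H10_cmult[OF ell g, of "-1"]] by simp

lemma H10_integral_dx:
  assumes "0 < ell" "H10 ell f" shows "(\<integral>x. dx ell f x \<partial>lebesgue_on {0..ell}) = 0"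
  using H10D(2)[OF assms] by (simp add: J_def)

text \<open>With \<open>f = c + J (dx ell f)\<close> the boundary term is
  \<open>e ell * (c + J (dx ell f) ell) - e 0 * c\<close>. It vanishes because of \<open>e\<close>
  in the first alternative and because of \<open>f\<close> in the second.\<close>

lemma H1_by_parts:
  fixes e e' :: "real \<Rightarrow> complex"
  assumes ell: "0 < ell" and f: "H1 ell f"
    and e: "\<And>x. (e has_vector_derivative e' x) (at x)" and e': "continuous_on {0..ell} e'"
    and b: "(e 0 = 0 \<and> e ell = 0) \<or> H10 ell f"
  shows "(\<integral>x. dx ell f x * e x \<partial>lebesgue_on {0..ell}) = - (\<integral>x. f x * e' x \<partial>lebesgue_on {0..ell})"
proof -
  let ?M = "lebesgue_on {0..ell}"
  obtain c where c: "AE x in ?M. f x = c + J (dx ell f) x" and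
    b': "(e 0 = 0 \<and> e ell = 0) \<or> (c = 0 \<and> J (dx ell f) ell = 0)"
  proof (cases "H10 ell f")
    case True
    show ?thesis using that[of 0] H10D[OF ell True] by simp
  next
    case False
    then show ?thesis using H1_AC[OF ell f] b that by metis
  qed
  have L: "L2 ell (dx ell f)" using f by (rule L2_dx)
  have ei: "integrable ?M e'" by (rule integrable_continuous_ivl[OF e'])
  have i: "integrable ?M (\<lambda>x. c * e' x)" "integrable ?M (\<lambda>x. J (dx ell f) x * e' x)"
    using ei integrable_mult_continuous[OF integrable_continuous_ivl[OF J_continuous_L2[OF L]] e'] by auto
  have "(\<integral>x. f x * e' x \<partial>?M) = (\<integral>x. c * e' x + J (dx ell f) x * e' x \<partial>?M)"
  proof (rule integral_cong_AE)
    show "AE x in ?M. f x * e' x = c * e' x + J (dx ell f) x * e' x"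
      using c by eventually_elim (simp add: algebra_simps)
    show "(\<lambda>x. f x * e' x) \<in> borel_measurable ?M"
      using L2_measurable[OF H1_L2[OF f]] ei by auto
    show "(\<lambda>x. c * e' x + J (dx ell f) x * e' x) \<in> borel_measurable ?M"
      using i by auto
  qed
  also have "\<dots> = c * (e ell - e 0) + J (\<lambda>s. e' s * J (dx ell f) s) ell"
  proof -
    have "(\<integral>x. e' x \<partial>?M) = e ell - e 0"
      by (rule integral_FTC_ivl) (use ell has_vector_derivative_at_within[OF e] e' in auto)
    then show ?thesis using i by (subst Bochner_Integration.integral_add) (auto simp: J_def mult.commute)
  qed
  also have "J (\<lambda>s. e' s * J (dx ell f) s) ell = e ell * J (dx ell f) ell - J (\<lambda>s. e s * dx ell f s) ell"
    by (rule J_by_parts[OF _ L2_integrable[OF L] e e']) (use ell in simp)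
  also have "c * (e ell - e 0) + (e ell * J (dx ell f) ell - J (\<lambda>s. e s * dx ell f s) ell)
      = - (\<integral>x. dx ell f x * e x \<partial>?M)"
    using b' by (auto simp: J_def[of _ ell] mult.commute)
  finally show ?thesis by simp
qed

section \<open>Fourier series\<close>

text \<open>All systems below have squared norm \<open>ell / 2\<close>, the constant function being
  rescaled accordingly; the factor \<open>2 / ell\<close> turns the inner product into the
  coefficient of the expansion.\<close>

definition fcoef :: "real \<Rightarrow> (real \<Rightarrow> real) \<Rightarrow> (real \<Rightarrow> complex) \<Rightarrow> complex" where
  "fcoef ell e f = complex_of_real (2 / ell) * (\<integral>x. f x * complex_of_real (e x) \<partial>lebesgue_on {0..ell})"

lemma L2norm_diff_cmult_sq:
  assumes g: "L2 ell g" and e: "continuous_on {0..ell} e"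
  shows "(L2norm ell (\<lambda>x. g x - a * complex_of_real (e x)))\<^sup>2
    = (L2norm ell g)\<^sup>2 - 2 * Re (cnj a * (\<integral>x. g x * complex_of_real (e x) \<partial>lebesgue_on {0..ell}))
      + (cmod a)\<^sup>2 * (\<integral>x. e x * e x \<partial>lebesgue_on {0..ell})"
proof -
  let ?M = "lebesgue_on {0..ell}"
  have i1: "integrable ?M (\<lambda>x. (cmod (g x))\<^sup>2)" by (rule L2_sq_integrable[OF g])
  have i2: "integrable ?M (\<lambda>x. g x * complex_of_real (e x))"
    by (intro integrable_mult_continuous L2_integrable g continuous_on_of_real e)
  have i3: "integrable ?M (\<lambda>x. e x * e x)"
    by (intro integrable_continuous_ivl continuous_intros e)
  have "(cmod (g x - a * complex_of_real (e x)))\<^sup>2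
      = (cmod (g x))\<^sup>2 - 2 * Re (cnj a * (g x * complex_of_real (e x))) + (cmod a)\<^sup>2 * (e x * e x)" for x
    unfolding cmod_power2 by (simp add: power2_eq_square algebra_simps)
  then have "(L2norm ell (\<lambda>x. g x - a * complex_of_real (e x)))\<^sup>2
      = (\<integral>x. (cmod (g x))\<^sup>2 - 2 * Re (cnj a * (g x * complex_of_real (e x))) + (cmod a)\<^sup>2 * (e x * e x) \<partial>?M)"
    by (simp add: L2norm_sq)
  also have "\<dots> = (\<integral>x. (cmod (g x))\<^sup>2 - 2 * Re (cnj a * (g x * complex_of_real (e x))) \<partial>?M)
      + (\<integral>x. (cmod a)\<^sup>2 * (e x * e x) \<partial>?M)"
    by (intro Bochner_Integration.integral_add Bochner_Integration.integrable_diff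
        integrable_mult_right integrable_Re i1 i2 i3)
  also have "(\<integral>x. (cmod (g x))\<^sup>2 - 2 * Re (cnj a * (g x * complex_of_real (e x))) \<partial>?M)
      = (\<integral>x. (cmod (g x))\<^sup>2 \<partial>?M) - (\<integral>x. 2 * Re (cnj a * (g x * complex_of_real (e x))) \<partial>?M)"
    by (intro Bochner_Integration.integral_diff integrable_mult_right integrable_Re i1 i2)
  also have "(\<integral>x. 2 * Re (cnj a * (g x * complex_of_real (e x))) \<partial>?M)
      = 2 * Re (cnj a * (\<integral>x. g x * complex_of_real (e x) \<partial>?M))"
    using i2 integral_Re[of ?M "\<lambda>x. cnj a * (g x * complex_of_real (e x))"]
    by (simp only: integral_mult_right_zero integrable_mult_right)
  finally show ?thesis by (simp add: L2norm_sq)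
qed

locale orthogonal_system =
  fixes ell :: real and e :: "nat \<Rightarrow> real \<Rightarrow> real"
  assumes ell_pos: "0 < ell" and cont: "\<And>n. continuous_on {0..ell} (e n)"
    and orth: "\<And>n m. (\<integral>x. e n x * e m x \<partial>lebesgue_on {0..ell}) = (if n = m then ell / 2 else 0)"
begin

lemma partial_sum_L2:
  assumes "L2 ell f" shows "L2 ell (\<lambda>x. f x - (\<Sum>n<N. a n * complex_of_real (e n x)))"
  by (intro L2_diff assms L2_continuous continuous_on_sum continuous_on_mult continuous_on_const
      continuous_on_of_real cont)

lemma partial_sum_coef:
  assumes f: "L2 ell f" and "N \<le> m"
  shows "(\<integral>x. (f x - (\<Sum>n<N. a n * complex_of_real (e n x))) * complex_of_real (e m x) \<partial>lebesgue_on {0..ell})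
    = complex_of_real (ell / 2) * fcoef ell (e m) f"
proof -
  let ?M = "lebesgue_on {0..ell}"
  have i1: "integrable ?M (\<lambda>x. f x * complex_of_real (e m x))"
    by (intro integrable_mult_continuous L2_integrable f continuous_on_of_real cont)
  have i2: "integrable ?M (\<lambda>x. a n * complex_of_real (e n x * e m x))" for n
    by (intro integrable_continuous_ivl continuous_on_mult continuous_on_const continuous_on_of_real cont)
  have "(\<integral>x. (f x - (\<Sum>n<N. a n * complex_of_real (e n x))) * complex_of_real (e m x) \<partial>?M)
     = (\<integral>x. f x * complex_of_real (e m x) - (\<Sum>n<N. a n * complex_of_real (e n x * e m x)) \<partial>?M)"
    by (intro Bochner_Integration.integral_cong) (auto simp: algebra_simps sum_distrib_left)
  also have "\<dots> = (\<integral>x. f x * complex_of_real (e m x) \<partial>?M) - (\<Sum>n<N. \<integral>x. a n * complex_of_real (e n x * e m x) \<partial>?M)"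
    using i1 i2 by (subst Bochner_Integration.integral_diff) (auto simp: Bochner_Integration.integral_sum)
  also have "(\<Sum>n<N. \<integral>x. a n * complex_of_real (e n x * e m x) \<partial>?M) = 0"
    using assms(2) by (intro sum.neutral) (auto simp only: integral_mult_right_zero integral_complex_of_real orth, auto)
  finally show ?thesis using ell_pos by (simp add: fcoef_def)
qed

text \<open>One identity serves two purposes. For \<open>a\<close> equal to the Fourier coefficients
  the last sum vanishes, which yields Bessel's inequality; for arbitrary \<open>a\<close> it shows
  that the Fourier coefficients give the best approximation.\<close>

lemma partial_sum_norm:
  assumes f: "L2 ell f"
  shows "(L2norm ell (\<lambda>x. f x - (\<Sum>n<N. a n * complex_of_real (e n x))))\<^sup>2
    = (L2norm ell f)\<^sup>2 - ell / 2 * (\<Sum>n<N. (cmod (fcoef ell (e n) f))\<^sup>2)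
      + ell / 2 * (\<Sum>n<N. (cmod (fcoef ell (e n) f - a n))\<^sup>2)"
proof (induction N)
  case (Suc N)
  define c where "c = fcoef ell (e N) f"
  have "(\<lambda>x. f x - (\<Sum>n<Suc N. a n * complex_of_real (e n x)))
     = (\<lambda>x. (f x - (\<Sum>n<N. a n * complex_of_real (e n x))) - a N * complex_of_real (e N x))"
    by (auto simp: algebra_simps)
  then have "(L2norm ell (\<lambda>x. f x - (\<Sum>n<Suc N. a n * complex_of_real (e n x))))\<^sup>2
     = (L2norm ell (\<lambda>x. f x - (\<Sum>n<N. a n * complex_of_real (e n x))))\<^sup>2
       - 2 * Re (cnj (a N) * (complex_of_real (ell / 2) * c)) + (cmod (a N))\<^sup>2 * (ell / 2)"
    using L2norm_diff_cmult_sq[OF partial_sum_L2[OF f, where N = N and a = a] cont[of N], of "a N"]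
      partial_sum_coef[OF f order_refl, where N = N and a = a] orth[of N N] by (simp add: c_def)
  moreover have "2 * Re (cnj (a N) * (complex_of_real (ell / 2) * c)) - (cmod (a N))\<^sup>2 * (ell / 2)
     = ell / 2 * ((cmod c)\<^sup>2 - (cmod (c - a N))\<^sup>2)"
    unfolding cmod_power2 by (simp add: power2_eq_square algebra_simps)
  ultimately have "(L2norm ell (\<lambda>x. f x - (\<Sum>n<Suc N. a n * complex_of_real (e n x))))\<^sup>2
     = (L2norm ell (\<lambda>x. f x - (\<Sum>n<N. a n * complex_of_real (e n x))))\<^sup>2
       + ell / 2 * (cmod (c - a N))\<^sup>2 - ell / 2 * (cmod c)\<^sup>2"
    unfolding right_diff_distrib by linarith
  then show ?case using Suc by (simp add: c_def algebra_simps)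
qed simp

lemma Bessel:
  assumes f: "L2 ell f"
  shows "ell / 2 * (\<Sum>n<N. (cmod (fcoef ell (e n) f))\<^sup>2) \<le> (L2norm ell f)\<^sup>2"
  using partial_sum_norm[OF f, where N = N and a = "\<lambda>n. fcoef ell (e n) f"]
    zero_le_power2[of "L2norm ell (\<lambda>x. f x - (\<Sum>n<N. fcoef ell (e n) f * complex_of_real (e n x)))"]
  by simp

text \<open>Approximability is asked only for the function at hand and with arbitrary coefficients,
  because the Fourier coefficients can only improve an approximation. Bessel's inequality bounds the
  sums from the other side.\<close>

lemma Parseval:
  assumes f: "L2 ell f"
    and dense: "\<And>\<delta>. \<delta> > 0 \<Longrightarrow> \<exists>N a. L2norm ell (\<lambda>x. f x - (\<Sum>n<N. a n * complex_of_real (e n x))) \<le> \<delta>"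
  shows "(\<lambda>n. ell / 2 * (cmod (fcoef ell (e n) f))\<^sup>2) sums (L2norm ell f)\<^sup>2"
  unfolding sums_def
proof (rule LIMSEQ_I)
  fix r :: real assume r: "r > 0"
  then have "sqrt (r / 2) > 0" by simp
  from dense[OF this] obtain N a where
    Na: "L2norm ell (\<lambda>x. f x - (\<Sum>n<N. a n * complex_of_real (e n x))) \<le> sqrt (r / 2)" by blast
  have "(L2norm ell (\<lambda>x. f x - (\<Sum>n<N. a n * complex_of_real (e n x))))\<^sup>2 \<le> (sqrt (r / 2))\<^sup>2"
    by (rule power_mono[OF Na]) simp
  also have "\<dots> = r / 2" using r by simp
  finally have "(L2norm ell f)\<^sup>2 - ell / 2 * (\<Sum>n<N. (cmod (fcoef ell (e n) f))\<^sup>2)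
      + ell / 2 * (\<Sum>n<N. (cmod (fcoef ell (e n) f - a n))\<^sup>2) \<le> r / 2"
    using partial_sum_norm[OF f] by metis
  moreover have "0 \<le> ell / 2 * (\<Sum>n<N. (cmod (fcoef ell (e n) f - a n))\<^sup>2)"
    using ell_pos by (intro mult_nonneg_nonneg sum_nonneg) auto
  ultimately have 1: "(L2norm ell f)\<^sup>2 - ell / 2 * (\<Sum>n<N. (cmod (fcoef ell (e n) f))\<^sup>2) \<le> r / 2" by linarith
  have "norm ((\<Sum>n<m. ell / 2 * (cmod (fcoef ell (e n) f))\<^sup>2) - (L2norm ell f)\<^sup>2) < r" if "m \<ge> N" for m
  proof -
    have "(\<Sum>n<N. (cmod (fcoef ell (e n) f))\<^sup>2) \<le> (\<Sum>n<m. (cmod (fcoef ell (e n) f))\<^sup>2)"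
      using that by (intro sum_mono2) auto
    then have "ell / 2 * (\<Sum>n<N. (cmod (fcoef ell (e n) f))\<^sup>2) \<le> ell / 2 * (\<Sum>n<m. (cmod (fcoef ell (e n) f))\<^sup>2)"
      using ell_pos by (intro mult_left_mono) auto
    moreover have "(\<Sum>n<m. ell / 2 * (cmod (fcoef ell (e n) f))\<^sup>2) = ell / 2 * (\<Sum>n<m. (cmod (fcoef ell (e n) f))\<^sup>2)"
      by (simp only: sum_distrib_left)
    ultimately show ?thesis using Bessel[OF f, of m] 1 r unfolding real_norm_def by linarith
  qed
  then show "\<exists>no. \<forall>n\<ge>no. norm ((\<Sum>n<n. ell / 2 * (cmod (fcoef ell (e n) f))\<^sup>2) - (L2norm ell f)\<^sup>2) < r"
    by blast
qed

end

lemma fcoef_cong_AE: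
  assumes "L2 ell f" "L2 ell g" "AE x in lebesgue_on {0..ell}. f x = g x" "continuous_on {0..ell} e"
  shows "fcoef ell e f = fcoef ell e g"
proof -
  have "(\<integral>x. f x * complex_of_real (e x) \<partial>lebesgue_on {0..ell})
      = (\<integral>x. g x * complex_of_real (e x) \<partial>lebesgue_on {0..ell})"
  proof (rule integral_cong_AE)
    show "AE x in lebesgue_on {0..ell}. f x * complex_of_real (e x) = g x * complex_of_real (e x)"
      using assms(3) by eventually_elim simp
  qed (intro borel_measurable_integrable integrable_mult_continuous L2_integrable assms
      continuous_on_of_real)+
  then show ?thesis by (simp add: fcoef_def)
qed

lemma fcoef_add:
  assumes "L2 ell f" "L2 ell g" "continuous_on {0..ell} e"
  shows "fcoef ell e (\<lambda>x. f x + g x) = fcoef ell e f + fcoef ell e g"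
proof -
  have "(\<integral>x. (f x + g x) * complex_of_real (e x) \<partial>lebesgue_on {0..ell})
      = (\<integral>x. f x * complex_of_real (e x) + g x * complex_of_real (e x) \<partial>lebesgue_on {0..ell})"
    by (simp add: algebra_simps)
  also have "\<dots> = (\<integral>x. f x * complex_of_real (e x) \<partial>lebesgue_on {0..ell}) + (\<integral>x. g x * complex_of_real (e x) \<partial>lebesgue_on {0..ell})"
    by (intro Bochner_Integration.integral_add integrable_mult_continuous L2_integrable assms
      continuous_on_of_real)
  finally show ?thesis by (simp add: fcoef_def algebra_simps)
qed

lemma fcoef_cmult: "fcoef ell e (\<lambda>x. a * f x) = a * fcoef ell e f"
  by (simp add: fcoef_def mult.assoc mult.left_commute)

lemma fcoef_diff:
  assumes "L2 ell f" "L2 ell g" "continuous_on {0..ell} e"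
  shows "fcoef ell e (\<lambda>x. f x - g x) = fcoef ell e f - fcoef ell e g"
  using fcoef_add[OF assms(1) L2_cmult[OF assms(2), of "-1"] assms(3)] fcoef_cmult[of ell e "-1" g] by simp

section \<open>Wave numbers and the sine and cosine systems\<close>

definition kap :: "real \<Rightarrow> nat \<Rightarrow> real" where "kap ell n = real (Suc n) * (pi / ell)"
text \<open>The index shift in \<open>kap\<close> leaves out the constant function, which is absent
  from expansions of functions with zero mean. \<open>cosf0\<close> restores it where completeness
  is needed.\<close>

definition cosf :: "real \<Rightarrow> nat \<Rightarrow> real \<Rightarrow> real" where "cosf ell n x = cos (kap ell n * x)"
definition sinf :: "real \<Rightarrow> nat \<Rightarrow> real \<Rightarrow> real" where "sinf ell n x = sin (kap ell n * x)"

lemma cosf_alt: "cosf ell n x = cos (real (Suc n) * (pi / ell * x))"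
  by (simp only: cosf_def kap_def mult.assoc)
lemma sinf_alt: "sinf ell n x = sin (real (Suc n) * (pi / ell * x))"
  by (simp only: sinf_def kap_def mult.assoc)

lemma cosf_continuous [continuous_intros]: "continuous_on A (cosf ell n)"
  unfolding cosf_def[abs_def] by (intro continuous_intros)
lemma sinf_continuous [continuous_intros]: "continuous_on A (sinf ell n)"
  unfolding sinf_def[abs_def] by (intro continuous_intros)

lemma kap_pos: "0 < ell \<Longrightarrow> 0 < kap ell n" by (simp add: kap_def)

lemma sin_pi_int: "sin (of_int m * pi) = 0"
  by (simp add: sin_zero_iff_int2)

lemma integral_cos_int:
  assumes ell: "0 < ell"
  shows "(\<integral>x. cos (of_int m * (pi / ell * x)) \<partial>lebesgue_on {0..ell}) = (if m = 0 then ell else 0)"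
proof (cases "m = 0")
  case True
  have "(\<integral>x. (1::real) \<partial>lebesgue_on {0..ell}) = ell - 0"
    by (rule integral_FTC_ivl)
      (use ell in \<open>auto simp flip: has_real_derivative_iff_has_vector_derivative intro!: derivative_eq_intros\<close>)
  then show ?thesis using True by simp
next
  case False
  define k where "k = of_int m * (pi / ell)"
  have k: "k \<noteq> 0" using False ell by (simp add: k_def)
  have "(\<integral>x. cos (k * x) \<partial>lebesgue_on {0..ell}) = sin (k * ell) / k - sin (k * 0) / k"
  proof (rule integral_FTC_ivl)
    show "continuous_on {0..ell} (\<lambda>x. cos (k * x))" by (intro continuous_intros)
    show "((\<lambda>x. sin (k * x) / k) has_vector_derivative cos (k * x)) (at x within {0..ell})" for x
      unfolding has_real_derivative_iff_has_vector_derivative[symmetric]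
      using k by (auto intro!: derivative_eq_intros)
  qed (use ell in simp)
  moreover have "sin (k * ell) = 0" using ell sin_pi_int[of m] by (simp add: k_def)
  ultimately show ?thesis using False by (simp add: k_def mult.assoc)
qed

lemma cos_cos_int:
  assumes ell: "0 < ell"
  shows "(\<integral>x. cos (real n * (pi / ell * x)) * cos (real m * (pi / ell * x)) \<partial>lebesgue_on {0..ell})
    = (if n = m then if n = 0 then ell else ell / 2 else 0)"
proof -
  let ?M = "lebesgue_on {0..ell}"
  have "cos (real n * (pi / ell * x)) * cos (real m * (pi / ell * x))
      = (1/2) * cos (of_int (int n - int m) * (pi / ell * x)) + (1/2) * cos (of_int (int n + int m) * (pi / ell * x))" for x
  proof -
    define t where "t = pi / ell * x"
    show ?thesis unfolding t_def[symmetric] by (simp add: algebra_simps cos_diff cos_add)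
  qed
  then have "(\<integral>x. cos (real n * (pi / ell * x)) * cos (real m * (pi / ell * x)) \<partial>?M)
    = (\<integral>x. (1/2) * cos (of_int (int n - int m) * (pi / ell * x)) + (1/2) * cos (of_int (int n + int m) * (pi / ell * x)) \<partial>?M)"
    by simp
  also have "\<dots> = (\<integral>x. (1/2) * cos (of_int (int n - int m) * (pi / ell * x)) \<partial>?M)
      + (\<integral>x. (1/2) * cos (of_int (int n + int m) * (pi / ell * x)) \<partial>?M)"
    by (intro Bochner_Integration.integral_add integrable_continuous_ivl continuous_intros)
  also have "\<dots> = (1/2) * (if int n - int m = 0 then ell else 0) + (1/2) * (if int n + int m = 0 then ell else 0)"
    by (simp only: integral_mult_right_zero integral_cos_int[OF ell])
  finally show ?thesis by auto
qed

lemma sin_sin_int: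
  assumes ell: "0 < ell"
  shows "(\<integral>x. sin (real n * (pi / ell * x)) * sin (real m * (pi / ell * x)) \<partial>lebesgue_on {0..ell})
    = (if n = m \<and> n \<noteq> 0 then ell / 2 else 0)"
proof -
  let ?M = "lebesgue_on {0..ell}"
  have "sin (real n * (pi / ell * x)) * sin (real m * (pi / ell * x))
      = (1/2) * cos (of_int (int n - int m) * (pi / ell * x)) - (1/2) * cos (of_int (int n + int m) * (pi / ell * x))" for x
  proof -
    define t where "t = pi / ell * x"
    show ?thesis unfolding t_def[symmetric] by (simp add: algebra_simps cos_diff cos_add)
  qed
  then have "(\<integral>x. sin (real n * (pi / ell * x)) * sin (real m * (pi / ell * x)) \<partial>?M)
    = (\<integral>x. (1/2) * cos (of_int (int n - int m) * (pi / ell * x)) - (1/2) * cos (of_int (int n + int m) * (pi / ell * x)) \<partial>?M)"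
    by simp
  also have "\<dots> = (\<integral>x. (1/2) * cos (of_int (int n - int m) * (pi / ell * x)) \<partial>?M)
      - (\<integral>x. (1/2) * cos (of_int (int n + int m) * (pi / ell * x)) \<partial>?M)"
    by (intro Bochner_Integration.integral_diff integrable_continuous_ivl continuous_intros)
  also have "\<dots> = (1/2) * (if int n - int m = 0 then ell else 0) - (1/2) * (if int n + int m = 0 then ell else 0)"
    by (simp only: integral_mult_right_zero integral_cos_int[OF ell])
  finally show ?thesis by auto
qed

text \<open>The constant function is scaled to norm \<open>sqrt (ell/2)\<close> so that the full cosine system is an
  \<open>orthogonal_system\<close>.\<close>
definition cosf0 :: "real \<Rightarrow> nat \<Rightarrow> real \<Rightarrow> real" where
  "cosf0 ell n x = (if n = 0 then 1 / sqrt 2 else cosf ell (n - 1) x)"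

lemma cosf0_alt: "cosf0 ell n x = (if n = 0 then 1 / sqrt 2 else 1) * cos (real n * (pi / ell * x))"
  by (cases n) (simp_all only: cosf0_def cosf_alt, simp_all)

lemma orthogonal_cosf0: "0 < ell \<Longrightarrow> orthogonal_system ell (cosf0 ell)"
proof
  fix n m assume ell: "0 < ell"
  show "continuous_on {0..ell} (cosf0 ell n)"
    unfolding cosf0_alt[abs_def] by (intro continuous_intros)
  let ?c = "\<lambda>n::nat. (if n = 0 then 1 / sqrt 2 else 1) :: real"
  have "(\<integral>x. cosf0 ell n x * cosf0 ell m x \<partial>lebesgue_on {0..ell})
    = (\<integral>x. (?c n * ?c m) * (cos (real n * (pi / ell * x)) * cos (real m * (pi / ell * x))) \<partial>lebesgue_on {0..ell})"
    unfolding cosf0_alt by (intro Bochner_Integration.integral_cong) (auto simp: algebra_simps)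
  also have "\<dots> = (?c n * ?c m) * (if n = m then if n = 0 then ell else ell / 2 else 0)"
    by (simp only: integral_mult_right_zero cos_cos_int[OF ell])
  also have "\<dots> = (if n = m then ell / 2 else 0)" by auto
  finally show "(\<integral>x. cosf0 ell n x * cosf0 ell m x \<partial>lebesgue_on {0..ell}) = (if n = m then ell / 2 else 0)" .
qed

lemma orthogonal_cosf: "0 < ell \<Longrightarrow> orthogonal_system ell (cosf ell)"
proof
  fix n m assume ell: "0 < ell"
  show "(\<integral>x. cosf ell n x * cosf ell m x \<partial>lebesgue_on {0..ell}) = (if n = m then ell / 2 else 0)"
    unfolding cosf_alt cos_cos_int[OF ell] by simp
qed (auto intro!: continuous_intros)

lemma orthogonal_sinf: "0 < ell \<Longrightarrow> orthogonal_system ell (sinf ell)"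
proof
  fix n m assume ell: "0 < ell"
  show "(\<integral>x. sinf ell n x * sinf ell m x \<partial>lebesgue_on {0..ell}) = (if n = m then ell / 2 else 0)"
    unfolding sinf_alt sin_sin_int[OF ell] by simp
qed (auto intro!: continuous_intros)

section \<open>Density of trigonometric polynomials\<close>

inductive cospoly :: "real \<Rightarrow> (real \<Rightarrow> real) \<Rightarrow> bool" for ell where
  cospoly_cos: "cospoly ell (\<lambda>x. c * cos (real n * (pi / ell * x)))"
| cospoly_add: "cospoly ell f \<Longrightarrow> cospoly ell g \<Longrightarrow> cospoly ell (\<lambda>x. f x + g x)"

lemma cospoly_cong: "cospoly ell f \<Longrightarrow> (\<And>x. g x = f x) \<Longrightarrow> cospoly ell g"
  by (subgoal_tac "g = f") auto

lemma cospoly_mult_cos: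
  assumes "cospoly ell f" shows "cospoly ell (\<lambda>x. f x * (c * cos (real n * (pi / ell * x))))"
  using assms
proof (induction rule: cospoly.induct)
  case (cospoly_cos d m)
  define j where "j = nat \<bar>int m - int n\<bar>"
  have "d * cos (real m * (pi / ell * x)) * (c * cos (real n * (pi / ell * x)))
      = (d * c / 2) * cos (real j * (pi / ell * x)) + (d * c / 2) * cos (real (m + n) * (pi / ell * x))" for x
  proof -
    define t where "t = pi / ell * x"
    have "real j = real m - real n \<or> real j = - (real m - real n)"
      unfolding j_def by linarith
    then have "cos (real j * t) = cos ((real m - real n) * t)"
      by (metis cos_minus minus_mult_left)
    then show ?thesis unfolding t_def[symmetric]
      by (simp add: algebra_simps cos_diff cos_add)
  qed
  then show ?case
    by (intro cospoly_cong[OF cospoly.cospoly_add[OF cospoly.cospoly_cos cospoly.cospoly_cos]])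
next
  case (cospoly_add f g)
  then show ?case using cospoly.cospoly_add by (simp add: distrib_right)
qed

text \<open>The product-to-sum formula makes the span of the cosines an algebra, as the
  Stone-Weierstrass theorem requires. The span of the sines is not closed under products, so sines
  are treated through cosines below.\<close>

lemma cospoly_mult:
  assumes "cospoly ell f" "cospoly ell g" shows "cospoly ell (\<lambda>x. f x * g x)"
  using assms(2)
proof (induction rule: cospoly.induct)
  case (cospoly_cos c n)
  then show ?case using cospoly_mult_cos[OF assms(1)] by simp
next
  case (cospoly_add g h)
  then show ?case using cospoly.cospoly_add by (simp add: distrib_left)
qed

lemma cospoly_continuous: "cospoly ell f \<Longrightarrow> continuous_on A f"
proof (induction rule: cospoly.induct)
  case (cospoly_cos c n)
  have "continuous_on A (\<lambda>x. c * cos (real n * ((pi / ell) * x)))" by (intro continuous_intros)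
  then show ?case by simp
qed (intro continuous_intros)

text \<open>The single function \<open>cos (pi / ell * x)\<close> is injective on the interval and
  already separates its points.\<close>

lemma cospoly_dense:
  fixes f :: "real \<Rightarrow> real"
  assumes ell: "0 < ell" and f: "continuous_on {0..ell} f" and e: "0 < e"
  shows "\<exists>g. cospoly ell g \<and> (\<forall>x\<in>{0..ell}. \<bar>f x - g x\<bar> < e)"
proof -
  interpret function_ring_on "Collect (cospoly ell)" "{0..ell}"
  proof
    fix x y :: real assume xy: "x \<in> {0..ell}" "y \<in> {0..ell}" "x \<noteq> y"
    have "cos (pi / ell * x) \<noteq> cos (pi / ell * y)"
    proof
      assume "cos (pi / ell * x) = cos (pi / ell * y)"
      then have "pi / ell * x = pi / ell * y"
        by (rule cos_inj_pi[rotated -1]) (use xy ell in \<open>auto simp: field_simps\<close>)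
      then show False using xy ell by simp
    qed
    then show "\<exists>f\<in>Collect (cospoly ell). f x \<noteq> f y"
      using cospoly_cos[of ell 1 1] by (intro bexI[of _ "\<lambda>x. 1 * cos (real 1 * (pi / ell * x))"]) auto
  next
    fix c :: real
    show "(\<lambda>_. c) \<in> Collect (cospoly ell)" using cospoly_cos[of ell c 0] by simp
  qed (auto intro: cospoly_add cospoly_mult cospoly_continuous)
  show ?thesis using Stone_Weierstrass_basic[OF f e] by auto
qed

definition in_span :: "(nat \<Rightarrow> real \<Rightarrow> real) \<Rightarrow> (real \<Rightarrow> complex) \<Rightarrow> bool" where
  "in_span e f \<longleftrightarrow> (\<exists>N a. \<forall>x. f x = (\<Sum>n<N. a n * complex_of_real (e n x)))"

lemma in_span_base: "in_span e (\<lambda>x. c * complex_of_real (e n x))"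
  unfolding in_span_def
  by (rule exI[of _ "Suc n"], rule exI[of _ "\<lambda>k. if k = n then c else 0"])
    (auto simp: if_distrib[of "\<lambda>z. z * _"] cong: if_cong)

lemma in_span_add:
  assumes "in_span e f" "in_span e g" shows "in_span e (\<lambda>x. f x + g x)"
proof -
  obtain N a where f: "\<And>x. f x = (\<Sum>n<N. a n * complex_of_real (e n x))" using assms(1) by (auto simp: in_span_def)
  obtain K b where g: "\<And>x. g x = (\<Sum>n<K. b n * complex_of_real (e n x))" using assms(2) by (auto simp: in_span_def)
  have pad: "(\<Sum>n<N. a n * z n) = (\<Sum>n<N + K. (if n < N then a n else 0) * z n)" for N K a and z :: "nat \<Rightarrow> complex"
    by (rule sum.mono_neutral_cong_left) auto
  show ?thesis unfolding in_span_def
    by (rule exI[of _ "N + K"], rule exI[of _ "\<lambda>n. (if n < N then a n else 0) + (if n < K then b n else 0)"])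
      (simp add: f g pad[where N = N and K = K and a = a] pad[where N = K and K = N and a = b] distrib_right sum.distrib add.commute[of K N])
qed

lemma cospoly_in_span: "cospoly ell g \<Longrightarrow> in_span (cosf0 ell) (\<lambda>x. c * complex_of_real (g x))"
proof (induction rule: cospoly.induct)
  case (cospoly_cos d n)
  have eq: "(\<lambda>x. c * complex_of_real (d * cos (real n * (pi / ell * x))))
      = (\<lambda>x. (c * complex_of_real d * (if n = 0 then complex_of_real (sqrt 2) else 1)) * complex_of_real (cosf0 ell n x))"
    by (auto simp: cosf0_alt fun_eq_iff simp flip: of_real_mult)
  show ?case unfolding eq by (rule in_span_base)
next
  case (cospoly_add f g)
  then show ?case using in_span_add by (simp add: distrib_left)
qed

text \<open>Multiplication by the first sine sends cosine polynomials to sine polynomials, by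
  \<open>2 sin t cos (n t) = sin ((n + 1) t) - sin ((n - 1) t)\<close>.\<close>

lemma sin_cospoly_in_span: "cospoly ell g \<Longrightarrow> in_span (sinf ell) (\<lambda>x. c * complex_of_real (sin (pi / ell * x) * g x))"
proof (induction rule: cospoly.induct)
  case (cospoly_cos d n)
  have 1: "sin (pi / ell * x) * (d * cos (real n * (pi / ell * x)))
     = d / 2 * (sin (real (Suc n) * (pi / ell * x)) - sin ((real n - 1) * (pi / ell * x)))" for x
  proof -
    define t where "t = pi / ell * x"
    show ?thesis unfolding t_def[symmetric] by (simp add: algebra_simps sin_add sin_diff)
  qed
  \<comment> \<open>The lower frequency leaves the index range of \<open>sinf\<close> twice: for
    \<open>n = 0\<close> oddness gives the negative of the first sine, and for \<open>n = 1\<close>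
    the term is zero.\<close>
  have S: "in_span (sinf ell) (\<lambda>x. a * complex_of_real (sin ((real n - 1) * (pi / ell * x))))" for a
  proof -
    consider "n = 0" | "n = 1" | m where "n = Suc (Suc m)" by (metis One_nat_def not0_implies_Suc)
    then show ?thesis
    proof cases
      case 1
      then have eq: "(\<lambda>x. a * complex_of_real (sin ((real n - 1) * (pi / ell * x)))) = (\<lambda>x. (- a) * complex_of_real (sinf ell 0 x))"
        by (simp add: sinf_def kap_def)
      show ?thesis unfolding eq by (rule in_span_base)
    next
      case 2
      then show ?thesis using in_span_base[of "sinf ell" 0 0] by simp
    next
      case (3 m)
      then have "real n - 1 = real (Suc m)" by simp
      then have eq: "(\<lambda>x. a * complex_of_real (sin ((real n - 1) * (pi / ell * x)))) = (\<lambda>x. a * complex_of_real (sinf ell m x))"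
        by (simp only: sinf_alt)
      show ?thesis unfolding eq by (rule in_span_base)
    qed
  qed
  have eq: "(\<lambda>x. c * complex_of_real (sin (pi / ell * x) * (d * cos (real n * (pi / ell * x)))))
      = (\<lambda>x. (c * complex_of_real (d / 2)) * complex_of_real (sinf ell n x)
        + (- (c * complex_of_real (d / 2))) * complex_of_real (sin ((real n - 1) * (pi / ell * x))))"
  proof -
    have "c * complex_of_real (d' * (A - B))
        = (c * complex_of_real d') * complex_of_real A + (- (c * complex_of_real d')) * complex_of_real B" for A B d'
      by (simp add: algebra_simps)
    then show ?thesis by (simp only: 1 sinf_alt)
  qed
  show ?case unfolding eq by (rule in_span_add[OF in_span_base S])
next
  case (cospoly_add f g)
  then show ?case using in_span_add by (simp add: distrib_left)
qed

lemma L2norm_le_bound: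
  assumes ell: "0 < ell" and g: "continuous_on {0..ell} g" and B: "\<And>x. x \<in> {0..ell} \<Longrightarrow> cmod (g x) \<le> B"
  shows "L2norm ell g \<le> B * sqrt ell"
proof -
  have "cmod (g 0) \<le> B" using B[of 0] ell by simp
  then have B0: "0 \<le> B" using norm_ge_zero[of "g 0"] by linarith
  have "(L2norm ell g)\<^sup>2 \<le> (\<integral>x. B\<^sup>2 * cos (of_int 0 * (pi / ell * x)) \<partial>lebesgue_on {0..ell})"
    unfolding L2norm_sq
  proof (rule integral_mono)
    show "integrable (lebesgue_on {0..ell}) (\<lambda>x. (cmod (g x))\<^sup>2)"
      by (intro L2_sq_integrable L2_continuous g)
  qed (use B in \<open>auto intro!: power_mono\<close>)
  also have "\<dots> = B\<^sup>2 * ell" by (simp only: integral_mult_right_zero integral_cos_int[OF ell]) simp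
  also have "\<dots> = (B * sqrt ell)\<^sup>2" using ell by (simp add: power_mult_distrib)
  finally show ?thesis using B0 ell by (rule_tac power2_le_imp_le) auto
qed

lemma cospoly_dense_complex:
  assumes ell: "0 < ell" and f: "continuous_on {0..ell} f" and e: "0 < e"
  shows "\<exists>g h. cospoly ell g \<and> cospoly ell h \<and>
    (\<forall>x\<in>{0..ell}. cmod (f x - (complex_of_real (g x) + \<i> * complex_of_real (h x))) \<le> e)"
proof -
  have c: "continuous_on {0..ell} (\<lambda>x. Re (f x))" "continuous_on {0..ell} (\<lambda>x. Im (f x))"
    using f by (auto intro!: continuous_intros)
  obtain g where g: "cospoly ell g" "\<forall>x\<in>{0..ell}. \<bar>Re (f x) - g x\<bar> < e / 2"
    using cospoly_dense[OF ell c(1) half_gt_zero[OF e]] by blast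
  obtain h where h: "cospoly ell h" "\<forall>x\<in>{0..ell}. \<bar>Im (f x) - h x\<bar> < e / 2"
    using cospoly_dense[OF ell c(2) half_gt_zero[OF e]] by blast
  have "cmod (f x - (complex_of_real (g x) + \<i> * complex_of_real (h x))) \<le> e" if "x \<in> {0..ell}" for x
  proof -
    have "cmod (f x - (complex_of_real (g x) + \<i> * complex_of_real (h x)))
        \<le> \<bar>Re (f x) - g x\<bar> + \<bar>Im (f x) - h x\<bar>"
      using cmod_le[of "f x - (complex_of_real (g x) + \<i> * complex_of_real (h x))"] by simp
    also have "\<dots> \<le> e / 2 + e / 2" using g h that by (intro add_mono) (auto intro: less_imp_le)
    finally show ?thesis by simp
  qed
  with g h show ?thesis by blast
qed

lemma cos_dense:
  assumes ell: "0 < ell" and f: "continuous_on {0..ell} f" and e: "0 < \<delta>"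
  shows "\<exists>N a. L2norm ell (\<lambda>x. f x - (\<Sum>n<N. a n * complex_of_real (cosf0 ell n x))) \<le> \<delta>"
proof -
  have "0 < \<delta> / sqrt ell" using ell e by simp
  from cospoly_dense_complex[OF ell f this] obtain g h where gh: "cospoly ell g" "cospoly ell h"
    and b: "\<And>x. x \<in> {0..ell} \<Longrightarrow> cmod (f x - (complex_of_real (g x) + \<i> * complex_of_real (h x))) \<le> \<delta> / sqrt ell"
    by blast
  have "in_span (cosf0 ell) (\<lambda>x. 1 * complex_of_real (g x) + \<i> * complex_of_real (h x))"
    by (intro in_span_add cospoly_in_span gh)
  then obtain N a where Na: "\<And>x. complex_of_real (g x) + \<i> * complex_of_real (h x) = (\<Sum>n<N. a n * complex_of_real (cosf0 ell n x))"
    by (auto simp: in_span_def)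
  have "L2norm ell (\<lambda>x. f x - (complex_of_real (g x) + \<i> * complex_of_real (h x))) \<le> \<delta> / sqrt ell * sqrt ell"
    by (rule L2norm_le_bound[OF ell _ b])
      (auto intro!: continuous_intros f cospoly_continuous gh)
  then show ?thesis using ell unfolding Na by auto
qed

lemma sin_pos_ivl: "0 < ell \<Longrightarrow> x \<in> {0<..<ell} \<Longrightarrow> 0 < sin (pi / ell * x)"
  by (rule sin_gt_zero) (auto simp: field_simps)

text \<open>All sines vanish at the ends, so a function with other end values has no uniform
  approximation by them. It is replaced by the first sine times \<open>G j\<close>, where
  \<open>G j\<close> divides \<open>f\<close> by the sine cut off from below at
  \<open>1 / (j + 1)\<close>. The error tends to zero in L2 by dominated convergence, and the
  continuous factor \<open>G j\<close> is approximated uniformly by cosine polynomials.\<close>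

lemma sin_dense:
  assumes ell: "0 < ell" and f: "continuous_on {0..ell} f" and e: "0 < \<delta>"
  shows "\<exists>N a. L2norm ell (\<lambda>x. f x - (\<Sum>n<N. a n * complex_of_real (sinf ell n x))) \<le> \<delta>"
proof -
  let ?M = "lebesgue_on {0..ell}"
  let ?s = "\<lambda>x. sin (pi / ell * x)"
  have s0: "0 \<le> ?s x" if "x \<in> {0..ell}" for x
    using that ell by (intro sin_ge_zero) (auto simp: field_simps)
  define m where "m j x = max (?s x) (1 / real (Suc j))" for j x
  have m_pos: "0 < m j x" for j x unfolding m_def by (simp add: less_max_iff_disj)
  have mc: "continuous_on A (m j)" for A j
    unfolding m_def[abs_def] by (intro continuous_intros)
  define G where "G j x = f x / complex_of_real (m j x)" for j x
  have Gc: "continuous_on {0..ell} (G j)" for j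
    unfolding G_def[abs_def] using m_pos[of j]
    by (intro continuous_intros f mc) (simp add: less_imp_neq[symmetric])
  define F where "F j x = complex_of_real (?s x) * G j x" for j x
  have Fc: "continuous_on {0..ell} (F j)" for j
    unfolding F_def[abs_def] by (intro continuous_intros Gc)
  have Ff: "cmod (f x - F j x) \<le> cmod (f x)" if "x \<in> {0..ell}" for x j
  proof -
    have "f x - F j x = f x * complex_of_real (1 - ?s x / m j x)"
      by (simp add: F_def G_def algebra_simps)
    moreover have "0 \<le> ?s x / m j x" "?s x / m j x \<le> 1"
      using m_pos[of j x] s0[OF that] by (auto simp: m_def)
    ultimately show ?thesis by (simp add: norm_mult mult_left_le del: of_real_diff of_real_divide)
  qed
  have "(\<lambda>j. \<integral>x. (cmod (f x - F j x))\<^sup>2 \<partial>?M) \<longlonglongrightarrow> (\<integral>x. 0 \<partial>?M)"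
  proof (rule integral_dominated_convergence[where w = "\<lambda>x. (cmod (f x))\<^sup>2"])
    show "integrable ?M (\<lambda>x. (cmod (f x))\<^sup>2)" by (intro L2_sq_integrable L2_continuous f)
    show "(\<lambda>x. (cmod (f x - F j x))\<^sup>2) \<in> borel_measurable ?M" for j
      by (intro measurable_continuous_ivl continuous_intros f Fc)
    show "AE x in ?M. norm ((cmod (f x - F j x))\<^sup>2) \<le> (cmod (f x))\<^sup>2" for j
      using Ff by (intro AE_I2) (auto intro!: power_mono)
    have conv: "(\<lambda>j. (cmod (f x - F j x))\<^sup>2) \<longlonglongrightarrow> 0" if x: "x \<in> {0<..<ell}" for x
    proof (rule tendsto_eventually)
      obtain J :: nat where J: "inverse (real (Suc J)) < ?s x" using reals_Archimedean[OF sin_pos_ivl[OF ell x]] by blast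
      have "(cmod (f x - F j x))\<^sup>2 = 0" if "j \<ge> J" for j
      proof -
        have "1 / real (Suc j) \<le> 1 / real (Suc J)" using that by (intro divide_left_mono) auto
        then have "m j x = ?s x" using J unfolding m_def by (simp add: inverse_eq_divide)
        then show ?thesis using sin_pos_ivl[OF ell x] by (simp add: F_def G_def)
      qed
      then show "\<forall>\<^sub>F j in sequentially. (cmod (f x - F j x))\<^sup>2 = 0"
        by (auto simp: eventually_sequentially)
    qed
    have "{x \<in> space ?M. \<not> (\<lambda>j. (cmod (f x - F j x))\<^sup>2) \<longlonglongrightarrow> 0} \<subseteq> {0, ell} \<inter> {0..ell}"
    proof (intro subsetI)
      fix x assume x: "x \<in> {x \<in> space ?M. \<not> (\<lambda>j. (cmod (f x - F j x))\<^sup>2) \<longlonglongrightarrow> 0}"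
      with conv have "x \<notin> {0<..<ell}" by blast
      with x show "x \<in> {0, ell} \<inter> {0..ell}" by auto
    qed
    moreover have "{0, ell} \<inter> {0..ell} \<in> null_sets ?M"
      by (auto simp: null_sets_restrict_space intro!: null_sets_completionI finite_imp_null_set_lborel)
    ultimately show "AE x in ?M. (\<lambda>j. (cmod (f x - F j x))\<^sup>2) \<longlonglongrightarrow> 0"
      by (rule AE_I'[rotated])
  qed simp
  then have "(\<lambda>j. (L2norm ell (\<lambda>x. f x - F j x))\<^sup>2) \<longlonglongrightarrow> 0" by (simp add: L2norm_sq)
  then have "\<forall>\<^sub>F j in sequentially. (L2norm ell (\<lambda>x. f x - F j x))\<^sup>2 < (\<delta> / 2)\<^sup>2"
    by (rule order_tendstoD(2)) (use e in simp)
  then obtain j where "(L2norm ell (\<lambda>x. f x - F j x))\<^sup>2 < (\<delta> / 2)\<^sup>2"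
    by (auto simp: eventually_sequentially)
  then have j: "L2norm ell (\<lambda>x. f x - F j x) \<le> \<delta> / 2"
    using power2_less_imp_less[of "L2norm ell (\<lambda>x. f x - F j x)" "\<delta> / 2"] e by simp
  have "0 < \<delta> / (2 * sqrt ell)" using ell e by simp
  from cospoly_dense_complex[OF ell Gc[of j] this] obtain g h where gh: "cospoly ell g" "cospoly ell h"
    and b: "\<And>x. x \<in> {0..ell} \<Longrightarrow> cmod (G j x - (complex_of_real (g x) + \<i> * complex_of_real (h x))) \<le> \<delta> / (2 * sqrt ell)"
    by blast
  define Q where "Q x = 1 * complex_of_real (?s x * g x) + \<i> * complex_of_real (?s x * h x)" for x
  have Qc: "continuous_on {0..ell} Q"
    unfolding Q_def[abs_def]
    by (intro continuous_intros cospoly_continuous[OF gh(1)] cospoly_continuous[OF gh(2)])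
  have "in_span (sinf ell) Q"
    unfolding Q_def[abs_def] by (intro in_span_add sin_cospoly_in_span gh)
  then obtain N a where Na: "\<And>x. Q x = (\<Sum>n<N. a n * complex_of_real (sinf ell n x))"
    by (auto simp: in_span_def)
  have "L2norm ell (\<lambda>x. F j x - Q x) \<le> \<delta> / (2 * sqrt ell) * sqrt ell"
  proof (rule L2norm_le_bound[OF ell])
    show "continuous_on {0..ell} (\<lambda>x. F j x - Q x)" by (intro continuous_intros Fc Qc)
    fix x assume x: "x \<in> {0..ell}"
    have "F j x - Q x = complex_of_real (?s x) * (G j x - (complex_of_real (g x) + \<i> * complex_of_real (h x)))"
      by (simp add: F_def Q_def algebra_simps)
    then have "cmod (F j x - Q x) = \<bar>?s x\<bar> * cmod (G j x - (complex_of_real (g x) + \<i> * complex_of_real (h x)))"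
      by (simp only: norm_mult norm_of_real)
    also have "\<dots> \<le> 1 * cmod (G j x - (complex_of_real (g x) + \<i> * complex_of_real (h x)))"
      by (intro mult_right_mono) auto
    finally show "cmod (F j x - Q x) \<le> \<delta> / (2 * sqrt ell)" using b[OF x] by simp
  qed
  then have 2: "L2norm ell (\<lambda>x. F j x - Q x) \<le> \<delta> / 2" using ell by simp
  have "L2norm ell (\<lambda>x. (f x - F j x) + (F j x - Q x)) \<le> L2norm ell (\<lambda>x. f x - F j x) + L2norm ell (\<lambda>x. F j x - Q x)"
    by (intro L2norm_triangle L2_diff L2_continuous f Fc Qc)
  then have "L2norm ell (\<lambda>x. f x - Q x) \<le> \<delta>" using j 2 by simp
  then show ?thesis unfolding Na by blast
qed

text \<open>The density results concern continuous functions, whence the continuous representative.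
  This is enough because Parseval's identity is applied to states in the domain of \<open>B\<close>,
  whose energy variables lie in H1.\<close>

lemma Parseval_sin:
  assumes ell: "0 < ell" and f: "L2 ell f" and h: "continuous_on {0..ell} h"
    and fh: "AE x in lebesgue_on {0..ell}. f x = h x"
  shows "(\<lambda>n. ell / 2 * (cmod (fcoef ell (sinf ell n) f))\<^sup>2) sums (L2norm ell f)\<^sup>2"
proof -
  interpret orthogonal_system ell "sinf ell" by (rule orthogonal_sinf[OF ell])
  have "(\<lambda>n. ell / 2 * (cmod (fcoef ell (sinf ell n) h))\<^sup>2) sums (L2norm ell h)\<^sup>2"
    by (rule Parseval[OF L2_continuous[OF h] sin_dense[OF ell h]])
  then show ?thesis
    using fcoef_cong_AE[OF f L2_continuous[OF h] fh sinf_continuous] L2norm_cong_AE[OF f L2_continuous[OF h] fh]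
    by simp
qed

lemma Parseval_cos:
  assumes ell: "0 < ell" and f: "L2 ell f" and h: "continuous_on {0..ell} h"
    and fh: "AE x in lebesgue_on {0..ell}. f x = h x" and m: "mean0 ell f"
  shows "(\<lambda>n. ell / 2 * (cmod (fcoef ell (cosf ell n) f))\<^sup>2) sums (L2norm ell f)\<^sup>2"
proof -
  interpret orthogonal_system ell "cosf0 ell" by (rule orthogonal_cosf0[OF ell])
  have "(\<lambda>n. ell / 2 * (cmod (fcoef ell (cosf0 ell n) h))\<^sup>2) sums (L2norm ell h)\<^sup>2"
    by (rule Parseval[OF L2_continuous[OF h] cos_dense[OF ell h]])
  then have *: "(\<lambda>n. ell / 2 * (cmod (fcoef ell (cosf0 ell n) f))\<^sup>2) sums (L2norm ell f)\<^sup>2"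
    using fcoef_cong_AE[OF f L2_continuous[OF h] fh cont] L2norm_cong_AE[OF f L2_continuous[OF h] fh]
    by simp
  \<comment> \<open>Zero mean removes the coefficient of the constant, so the series can start with
    the first proper cosine.\<close>
  have "fcoef ell (cosf0 ell 0) f = 0"
    using m by (simp add: fcoef_def cosf0_def[abs_def] mean0_def)
  moreover have "cosf0 ell (Suc n) = cosf ell n" for n by (simp add: cosf0_def[abs_def])
  ultimately show ?thesis using * sums_Suc_iff[of "\<lambda>n. ell / 2 * (cmod (fcoef ell (cosf0 ell n) f))\<^sup>2"] by simp
qed

section \<open>Coefficients of derivatives\<close>

lemma cosf_deriv: "((\<lambda>x. complex_of_real (cosf ell n x)) has_vector_derivative
    complex_of_real (- kap ell n * sinf ell n x)) (at x)"
  by (intro has_vector_derivative_of_real)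
    (auto simp: cosf_def[abs_def] sinf_def simp flip: has_real_derivative_iff_has_vector_derivative
      intro!: derivative_eq_intros)

lemma sinf_deriv: "((\<lambda>x. complex_of_real (sinf ell n x)) has_vector_derivative
    complex_of_real (kap ell n * cosf ell n x)) (at x)"
  by (intro has_vector_derivative_of_real)
    (auto simp: sinf_def[abs_def] cosf_def simp flip: has_real_derivative_iff_has_vector_derivative
      intro!: derivative_eq_intros)

lemma sinf_boundary: assumes "0 < ell" shows "sinf ell n 0 = 0" "sinf ell n ell = 0"
  using assms sin_pi_int[of "int (Suc n)"] by (auto simp: sinf_def kap_def)

lemma fcoef_sin_dx:
  assumes ell: "0 < ell" and f: "H1 ell f"
  shows "fcoef ell (sinf ell n) (dx ell f) = - complex_of_real (kap ell n) * fcoef ell (cosf ell n) f"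
proof -
  have "(\<integral>x. dx ell f x * complex_of_real (sinf ell n x) \<partial>lebesgue_on {0..ell})
     = - (\<integral>x. f x * complex_of_real (kap ell n * cosf ell n x) \<partial>lebesgue_on {0..ell})"
    by (rule H1_by_parts[OF ell f sinf_deriv])
      (auto intro!: continuous_intros simp: sinf_boundary[OF ell])
  also have "\<dots> = - (\<integral>x. complex_of_real (kap ell n) * (f x * complex_of_real (cosf ell n x)) \<partial>lebesgue_on {0..ell})"
    by (simp add: mult.left_commute)
  finally show ?thesis by (simp add: fcoef_def)
qed

text \<open>Cosines do not vanish at the end points, so here the boundary condition has to come from
  \<open>f\<close>. For sine coefficients of a derivative the basis function supplies it.\<close>

lemma fcoef_cos_dx:
  assumes ell: "0 < ell" and f: "H10 ell f"
  shows "fcoef ell (cosf ell n) (dx ell f) = complex_of_real (kap ell n) * fcoef ell (sinf ell n) f"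
proof -
  have "(\<integral>x. dx ell f x * complex_of_real (cosf ell n x) \<partial>lebesgue_on {0..ell})
     = - (\<integral>x. f x * complex_of_real (- kap ell n * sinf ell n x) \<partial>lebesgue_on {0..ell})"
    by (rule H1_by_parts[OF ell H10_H1[OF f] cosf_deriv])
      (use f in \<open>auto intro!: continuous_intros\<close>)
  also have "\<dots> = (\<integral>x. complex_of_real (kap ell n) * (f x * complex_of_real (sinf ell n x)) \<partial>lebesgue_on {0..ell})"
    by (simp add: mult.left_commute)
  finally show ?thesis by (simp add: fcoef_def)
qed

section \<open>Decay of a single mode\<close>

lemma abs_mult_le: "\<bar>x\<bar> \<le> a \<Longrightarrow> \<bar>y\<bar> \<le> b \<Longrightarrow> \<bar>x * y\<bar> \<le> a * b" for x y a b :: real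
  by (simp add: abs_mult mult_mono)

lemma arith: "Z \<le> - (C + 2) * \<rho> + a + (g + (\<rho> + Q) / 2) \<Longrightarrow> a + g \<le> U \<Longrightarrow> W \<le> - Q + C * (P + \<rho>)
    \<Longrightarrow> Z + W \<le> - (1/2) * (\<rho> + Q) + C * P + U - \<rho>" for Z C \<rho> a g Q U W P :: real
  by (simp add: algebra_simps add_divide_distrib)

lemma arith2: "X \<le> - (1/2) * (\<rho> + Q) + CP + U - \<rho> \<Longrightarrow> 0 \<le> \<rho> \<Longrightarrow> 2 * X \<le> - (\<rho> + Q) + 2 * (CP + U)"
  for X \<rho> Q CP U :: real
  by (simp add: algebra_simps add_divide_distrib)

text \<open>Each \<open>D i\<close> controls \<open>r i\<close> up to products having a factor of lower level; a suitable positive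
  combination therefore controls all levels by level 0.\<close>
lemma triangular_combination:
  fixes m K :: real and n :: nat
  assumes m: "0 < m" and K: "0 \<le> K" and i: "i \<le> Suc n"
  shows "\<exists>c C. (\<forall>j. 0 \<le> c j) \<and> 0 \<le> C \<and> (\<forall>r D.
      (\<forall>j. 0 \<le> r j) \<and> (\<forall>j\<in>{i..n}. D j \<le> - m * (r j)\<^sup>2 + K * (\<Sum>k<j. r k) * (\<Sum>k\<le>n. r k))
      \<longrightarrow> (\<Sum>j=i..n. c j * D j) \<le> - (\<Sum>j=i..n. (r j)\<^sup>2) + C * (\<Sum>j<i. (r j)\<^sup>2))"
  using i
\<comment> \<open>Downward induction: the levels above \<open>i\<close> are already combined at the
  price of all levels up to \<open>i\<close>. Level \<open>i\<close> is now added with a weight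
  large enough to pay for its own share of that price.\<close>
proof (induction rule: inc_induct)
  case base
  show ?case by (rule exI[of _ "\<lambda>_. 0"], rule exI[of _ 0]) simp
next
  case (step i)
  from step.IH obtain c C where c: "\<And>j. 0 \<le> c j" and C: "0 \<le> C"
    and IH: "\<And>r D. \<forall>j. (0::real) \<le> r j \<Longrightarrow>
        \<forall>j\<in>{Suc i..n}. D j \<le> - m * (r j)\<^sup>2 + K * (\<Sum>k<j. r k) * (\<Sum>k\<le>n. r k) \<Longrightarrow>
      (\<Sum>j=Suc i..n. c j * D j) \<le> - (\<Sum>j=Suc i..n. (r j)\<^sup>2) + C * (\<Sum>j<Suc i. (r j)\<^sup>2)"
    by blast
  have i: "i \<le> n" using step.hyps by simp
  define N where "N = real (Suc n)"
  have N: "0 < N" by (simp add: N_def)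
  \<comment> \<open>This weight turns \<open>- m\<close> into \<open>- (C + 2)\<close>: the part
    \<open>C\<close> pays the debt of the higher levels at level \<open>i\<close>, and 2 is left for
    absorbing mixed products.\<close>
  define c0 where "c0 = (C + 2) / m"
  have c0: "0 < c0" using C m by (simp add: c0_def)
  \<comment> \<open>Young's inequality uses up to half of the good squares; the overall factor 2
    restores the coefficient -1.\<close>
  define c' where "c' j = 2 * (if j = i then c0 else c j)" for j
  define C' where "C' = 2 * (C + N * (c0 * K + (c0 * K)\<^sup>2 * N / 2))"
  have C': "0 \<le> C'" using C K c0 N by (simp add: C'_def)
  show ?case
  proof (rule exI[of _ c'], rule exI[of _ C'], intro conjI allI impI)
    show "0 \<le> c' j" for j using c c0 by (simp add: c'_def)
    show "0 \<le> C'" by (rule C')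
    fix r D
    assume *: "(\<forall>j. 0 \<le> r j) \<and> (\<forall>j\<in>{i..n}. D j \<le> - m * (r j)\<^sup>2 + K * (\<Sum>k<j. r k) * (\<Sum>k\<le>n. r k))"
    then have r: "\<And>j. 0 \<le> r j" by blast
    define S where "S = (\<Sum>k<i. r k)"
    define T where "T = (\<Sum>k=i..n. r k)"
    define Q where "Q = (\<Sum>k=Suc i..n. (r k)\<^sup>2)"
    define P where "P = (\<Sum>k<i. (r k)\<^sup>2)"
    have S0: "0 \<le> S" "0 \<le> T" "0 \<le> Q" "0 \<le> P" unfolding S_def T_def Q_def P_def using r by (auto intro!: sum_nonneg)
    have tot: "(\<Sum>k\<le>n. r k) = S + T"
    proof -
      have "{..n} = {..<i} \<union> {i..n}" using i by auto
      moreover have "{..<i} \<inter> {i..n} = {}" by auto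
      ultimately show ?thesis unfolding S_def T_def by (simp add: sum.union_disjoint)
    qed
    have T2: "T\<^sup>2 \<le> N * ((r i)\<^sup>2 + Q)"
    proof -
      have "T\<^sup>2 \<le> (\<Sum>k=i..n. 1\<^sup>2) * (\<Sum>k=i..n. (r k)\<^sup>2)"
        using Cauchy_Schwarz_ineq_sum[of "\<lambda>_. 1" r "{i..n}"] by (simp add: T_def)
      also have "\<dots> = real (Suc n - i) * ((r i)\<^sup>2 + Q)"
        using i by (simp add: Q_def sum.atLeast_Suc_atMost)
      also have "\<dots> \<le> N * ((r i)\<^sup>2 + Q)" using S0 by (intro mult_right_mono) (auto simp: N_def)
      finally show ?thesis .
    qed
    have S2: "S\<^sup>2 \<le> N * P"
    proof -
      have "S\<^sup>2 \<le> (\<Sum>k<i. 1\<^sup>2) * (\<Sum>k<i. (r k)\<^sup>2)"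
        using Cauchy_Schwarz_ineq_sum[of "\<lambda>_. 1" r "{..<i}"] by (simp add: S_def)
      also have "\<dots> = real i * P" by (simp add: P_def)
      also have "\<dots> \<le> N * P" using S0 i by (intro mult_right_mono) (auto simp: N_def)
      finally show ?thesis .
    qed
    have old: "(\<Sum>j=Suc i..n. c j * D j) \<le> - Q + C * (P + (r i)\<^sup>2)"
      using IH[of r D] * by (simp add: Q_def P_def)
    have Di: "D i \<le> - m * (r i)\<^sup>2 + K * S * (S + T)"
      using * i tot by (auto simp: S_def)
    have "c0 * D i \<le> c0 * (- m * (r i)\<^sup>2 + K * S * (S + T))"
      using Di c0 by (intro mult_left_mono) auto
    also have "\<dots> = - (C + 2) * (r i)\<^sup>2 + (c0 * K) * S\<^sup>2 + (c0 * K * S) * T"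
      using m by (simp add: c0_def field_simps power2_eq_square)
    \<comment> \<open>Young's inequality, weighted such that by \<open>T2\<close> the share of
      \<open>T\<close> costs at most half of the squares of the levels from \<open>i\<close>
      on.\<close>
    also have "(c0 * K * S) * T \<le> (c0 * K)\<^sup>2 * N / 2 * S\<^sup>2 + T\<^sup>2 / (2 * N)"
    proof -
      have "0 \<le> (c0 * K * S * N - T)\<^sup>2" by simp
      then have "2 * N * ((c0 * K * S) * T) \<le> (c0 * K)\<^sup>2 * N\<^sup>2 * S\<^sup>2 + T\<^sup>2"
        by (simp add: power2_eq_square algebra_simps)
      then have "(c0 * K * S) * T \<le> ((c0 * K)\<^sup>2 * N\<^sup>2 * S\<^sup>2 + T\<^sup>2) / (2 * N)"
        using N by (simp add: pos_le_divide_eq mult.commute)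
      also have "\<dots> = (c0 * K)\<^sup>2 * N / 2 * S\<^sup>2 + T\<^sup>2 / (2 * N)"
        using N by (simp add: field_simps power2_eq_square)
      finally show ?thesis .
    qed
    also have "T\<^sup>2 / (2 * N) \<le> ((r i)\<^sup>2 + Q) / 2"
      using T2 N by (simp add: field_simps)
    finally have c0D: "c0 * D i \<le> - (C + 2) * (r i)\<^sup>2 + (c0 * K) * S\<^sup>2 + ((c0 * K)\<^sup>2 * N / 2 * S\<^sup>2 + ((r i)\<^sup>2 + Q) / 2)"
      by simp
    define h where "h = c0 * K + (c0 * K)\<^sup>2 * N / 2"
    have "h * S\<^sup>2 \<le> h * (N * P)"
      using S2 K c0 N by (intro mult_left_mono) (auto simp: h_def)
    moreover have "h * S\<^sup>2 = (c0 * K) * S\<^sup>2 + (c0 * K)\<^sup>2 * N / 2 * S\<^sup>2"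
      by (simp add: h_def distrib_right)
    ultimately have U: "(c0 * K) * S\<^sup>2 + (c0 * K)\<^sup>2 * N / 2 * S\<^sup>2 \<le> h * (N * P)" by simp
    have new: "c0 * D i + (\<Sum>j=Suc i..n. c j * D j)
        \<le> - (1/2) * ((r i)\<^sup>2 + Q) + C * P + h * (N * P) - (r i)\<^sup>2"
      using arith[OF c0D U old] .
    have "(\<Sum>j=i..n. c' j * D j) = c' i * D i + (\<Sum>j=Suc i..n. c' j * D j)"
      using i by (simp add: sum.atLeast_Suc_atMost)
    also have "(\<Sum>j=Suc i..n. c' j * D j) = 2 * (\<Sum>j=Suc i..n. c j * D j)"
      unfolding sum_distrib_left by (intro sum.cong) (auto simp: c'_def)
    finally have "(\<Sum>j=i..n. c' j * D j) = 2 * (c0 * D i + (\<Sum>j=Suc i..n. c j * D j))"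
      by (simp add: c'_def)
    also have "\<dots> \<le> - ((r i)\<^sup>2 + Q) + C' * P"
    proof -
      have "C' * P = 2 * (C * P + h * (N * P))" unfolding C'_def h_def by (simp add: algebra_simps)
      then show ?thesis using arith2[OF new zero_le_power2[of "r i"]] by (simp only:)
    qed
    also have "(r i)\<^sup>2 + Q = (\<Sum>j=i..n. (r j)\<^sup>2)"
      using i by (simp add: Q_def sum.atLeast_Suc_atMost)
    finally show "(\<Sum>j=i..n. c' j * D j) \<le> - (\<Sum>j=i..n. (r j)\<^sup>2) + C' * (\<Sum>j<i. (r j)\<^sup>2)"
      by (simp add: P_def)
  qed
qed

text \<open>Allow a slack of slope \<open>e\<close> and take the supremum of the times up to which
  \<open>g s \<le> g 0 + e * s\<close> holds. Continuity keeps the inequality at the supremum, and a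
  right derivative below \<open>e\<close> carries it beyond, so the supremum is
  \<open>T\<close>.\<close>

lemma right_derivative_nonpos_imp_le:
  fixes g :: "real \<Rightarrow> real"
  assumes cont: "continuous_on {0..T} g"
    and der: "\<And>t. 0 \<le> t \<Longrightarrow> t < T \<Longrightarrow> (g has_real_derivative D t) (at t within {t..})"
    and D: "\<And>t. 0 \<le> t \<Longrightarrow> t < T \<Longrightarrow> D t \<le> 0" and T: "0 \<le> T"
  shows "g T \<le> g 0"
proof (rule field_le_epsilon)
  fix e' :: real assume "0 < e'"
  \<comment> \<open>The shift by one keeps the slope defined for \<open>T = 0\<close>, while still
    \<open>e * T \<le> e'\<close>.\<close>
  define e where "e = e' / (T + 1)"
  have e: "0 < e" using \<open>0 < e'\<close> T by (simp add: e_def)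
  define A where "A = {t \<in> {0..T}. g t \<le> g 0 + e * t}"
  define G where "G = {t \<in> {0..T}. \<forall>s\<in>{0..t}. g s \<le> g 0 + e * s}"
  have G0: "0 \<in> G" using T by (simp add: G_def)
  define t where "t = Sup G"
  have bdd: "bdd_above G" by (rule bdd_aboveI[of _ T]) (simp add: G_def)
  have t0: "0 \<le> t" unfolding t_def by (rule cSup_upper[OF G0 bdd])
  have tT: "t \<le> T" unfolding t_def by (rule cSup_least) (use G0 in \<open>auto simp: G_def\<close>)
  have less: "g s \<le> g 0 + e * s" if st: "0 \<le> s" "s < t" for s
  proof -
    have "\<exists>u\<in>G. s < u" using st(2) less_cSup_iff[OF _ bdd, of s] G0 unfolding t_def by blast
    then show ?thesis using st by (auto simp: G_def)
  qed
  have tle: "g t \<le> g 0 + e * t"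
  proof (cases "t = 0")
    case False
    have cl: "closed A"
    proof -
      have "continuous_on {0..T} (\<lambda>t. g t - (g 0 + e * t))" by (intro continuous_intros cont)
      then have "closed {t \<in> {0..T}. (\<lambda>t. g t - (g 0 + e * t)) t \<le> 0}"
        by (rule continuous_on_closed_Collect_le[OF _ continuous_on_const closed_atLeastAtMost])
      then show ?thesis by (simp add: A_def)
    qed
    have "t \<in> closure {0..<t}" using t0 False by simp
    moreover have "{0..<t} \<subseteq> A" using less tT by (auto simp: A_def)
    ultimately have "t \<in> A" using closure_minimal[OF _ cl] by blast
    then show ?thesis by (simp add: A_def)
  qed simp
  have "t = T"
  proof (rule ccontr)
    assume "t \<noteq> T"
    then have tlt: "t < T" using tT by simp
    from der[OF t0 tlt] have "((\<lambda>y. (g y - g t) / (y - t)) \<longlongrightarrow> D t) (at t within {t..})"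
      by (simp add: has_field_derivative_iff)
    then have "\<forall>\<^sub>F y in at t within {t..}. (g y - g t) / (y - t) < e"
      by (rule order_tendstoD(2)) (use D[OF t0 tlt] e in simp)
    then obtain d where d: "0 < d" "\<And>y. y \<in> {t..} \<Longrightarrow> y \<noteq> t \<Longrightarrow> dist y t < d \<Longrightarrow> (g y - g t) / (y - t) < e"
      unfolding eventually_at by blast
    define u where "u = min (t + d / 2) T"
    have u: "t < u" "u \<le> T" "u \<le> t + d / 2" using d tlt by (auto simp: u_def)
    have "g s \<le> g 0 + e * s" if s: "s \<in> {0..u}" for s
    proof (cases "s \<le> t")
      case True
      then show ?thesis using less[of s] tle s by (cases "s = t") auto
    next
      case False
      then have "(g s - g t) / (s - t) < e" using s u d by (intro d(2)) (auto simp: dist_real_def)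
      then have "g s - g t < e * (s - t)" using False by (simp add: pos_divide_less_eq)
      then show ?thesis using tle by (simp add: algebra_simps)
    qed
    then have "u \<in> G" using u t0 by (auto simp: G_def)
    then have "u \<le> t" unfolding t_def by (rule cSup_upper[OF _ bdd])
    then show False using u by simp
  qed
  then have "g T \<le> g 0 + e * T" using tle by simp
  also have "e * T \<le> e'" using \<open>0 < e'\<close> T by (simp add: e_def field_simps)
  finally show "g T \<le> g 0 + e'" by simp
qed

lemma sq_le: "\<bar>x\<bar> \<le> g \<Longrightarrow> x\<^sup>2 \<le> g\<^sup>2" for x g :: real
  by (metis abs_ge_zero power2_abs power_mono)

lemma prod_le: "\<bar>x\<bar> \<le> a \<Longrightarrow> \<bar>z\<bar> \<le> c * R \<Longrightarrow> x * z \<le> c * (a * R)" for x z a c R :: real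
  using abs_mult_le[of x a z "c * R"] by (simp add: algebra_simps)

lemma prod_ge: "\<bar>x\<bar> \<le> a \<Longrightarrow> \<bar>z\<bar> \<le> c * R \<Longrightarrow> - (x * z) \<le> c * (a * R)" for x z a c R :: real
  using abs_mult_le[of x a z "c * R"] by (simp add: algebra_simps)

section \<open>Multipliers in the scaled variables\<close>

locale bmc_coeffs =
  fixes rho1 rho2 rho3 k k0 b varpi l gamma vs tau :: real
  assumes pos: "0 < rho1" "0 < rho2" "0 < rho3" "0 < k" "0 < k0" "0 < b" "0 < varpi" "0 < l"
    "0 < gamma" "0 < vs" "0 < tau"
begin

text \<open>With \<open>e = 1/\<kappa>\<close>, \<open>f = \<Phi>/\<kappa>\<close>, \<open>s = S/\<kappa>\<close> and \<open>V = W + l \<Phi>/\<kappa>\<close>, the functions \<open>Dp, \<dots>, DY\<close> are the time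
  derivatives of the modal variables divided by \<open>\<kappa>\<close>. The variables \<open>X\<close> and \<open>Y\<close> (see \<open>cX\<close>, \<open>cY\<close>) are chosen such
  that \<open>\<Psi>' = \<kappa> X/\<rho>\<^sub>2\<close> and \<open>V' = \<kappa> Y/\<rho>\<^sub>1\<close>.\<close>
definition al :: "real \<Rightarrow> real" where "al e = 1 - l\<^sup>2 * e\<^sup>2"
definition be :: "real \<Rightarrow> real" where "be e = 1 + l\<^sup>2 * e\<^sup>2"

definition Dp :: "real \<Rightarrow> real \<Rightarrow> real \<Rightarrow> real" where "Dp e p th = (- e * p / varpi - th) / vs"
definition Dq :: "real \<Rightarrow> real \<Rightarrow> real \<Rightarrow> real" where "Dq e q xi = (- e * q / varpi - xi) / tau"
definition Dth :: "real \<Rightarrow> real \<Rightarrow> real" where "Dth p Ps = (p + gamma * Ps) / rho3"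
definition Dxi :: "real \<Rightarrow> real \<Rightarrow> real" where "Dxi q V = (q + gamma * V) / rho3"
definition Ds :: "real \<Rightarrow> real \<Rightarrow> real \<Rightarrow> real \<Rightarrow> real" where
  "Ds e f Ps V = al e * f + e\<^sup>2 * (Ps + l * V)"
definition Df :: "real \<Rightarrow> real \<Rightarrow> real \<Rightarrow> real" where
  "Df e s Y = (- (al e / be e) * k * s + e\<^sup>2 * l * Y / be e) / rho1"
definition DX :: "real \<Rightarrow> real \<Rightarrow> real \<Rightarrow> real \<Rightarrow> real \<Rightarrow> real" where
  "DX e f Ps V p = - b * Ps - k * Ds e f Ps V - gamma * Dth p Ps"
definition DY :: "real \<Rightarrow> real \<Rightarrow> real \<Rightarrow> real \<Rightarrow> real \<Rightarrow> real" where
  "DY e f Ps V q = - be e * k0 * V - 2 * l * k * Ds e f Ps V - gamma * be e * Dxi q V"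

text \<open>Derivatives of the multipliers collected in \<open>FB\<close>. They pass the dissipation of \<open>p, q\<close> on to \<open>\<theta>, \<xi>\<close>, then to
  \<open>\<Psi>, V\<close>, then to \<open>X, Y\<close>, then to \<open>f\<close> and finally to \<open>s\<close>.\<close>
definition dB1 where "dB1 e p th Ps q xi V =
  vs * (Dp e p th * th + p * Dth p Ps) + tau * (Dq e q xi * xi + q * Dxi q V)"
definition dB2 where "dB2 p th Ps X q xi V Y =
  - rho3 * (Dth p Ps * Ps + th * (X / rho2) + (Dxi q V * V + xi * (Y / rho1)))"
definition dB3 where "dB3 e p Ps X f q V Y =
  - (rho2 * (X / rho2 * X + Ps * DX e f Ps V p) + rho1 * (Y / rho1 * Y + V * DY e f Ps V q))"
definition dB4 where "dB4 e p Ps X f s V Y = al e * (DX e f Ps V p * f + X * Df e s Y)"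
definition dB5 where "dB5 e Ps f s V Y = al e * rho1 * (Ds e f Ps V * f + s * Df e s Y)"

lemma be_ge_1: "1 \<le> be e" by (simp add: be_def)

text \<open>Each \<open>dB\<close> contains the negative square of its own level, and every other
  product has a factor of lower level. The constants are uniform since \<open>e = 1/\<kappa>\<close>
  stays in a bounded interval. The bound \<open>del\<close> on \<open>al e\<close> is needed at the
  last two levels, where the square carries the coefficients \<open>k * (al e)\<^sup>2\<close> and
  \<open>k * (al e)\<^sup>2 / be e\<close>.\<close>

lemma chain_estimates:
  assumes e1: "0 < e1" and del: "0 < del"
  shows "\<exists>m K. 0 < m \<and> 0 \<le> K \<and> (\<forall>e p th Ps X f s q xi V Y.
    0 < e \<and> e \<le> e1 \<and> del \<le> \<bar>al e\<bar> \<longrightarrow>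
    (let r0 = \<bar>p\<bar> + \<bar>q\<bar>; r1 = \<bar>th\<bar> + \<bar>xi\<bar>; r2 = \<bar>Ps\<bar> + \<bar>V\<bar>; r3 = \<bar>X\<bar> + \<bar>Y\<bar>; r4 = \<bar>f\<bar>; r5 = \<bar>s\<bar>;
         R = r0 + r1 + r2 + r3 + r4 + r5 in
      dB1 e p th Ps q xi V \<le> - m * r1\<^sup>2 + K * r0 * R
    \<and> dB2 p th Ps X q xi V Y \<le> - m * r2\<^sup>2 + K * (r0 + r1) * R
    \<and> dB3 e p Ps X f q V Y \<le> - m * r3\<^sup>2 + K * (r0 + r1 + r2) * R
    \<and> dB4 e p Ps X f s V Y \<le> - m * r4\<^sup>2 + K * (r0 + r1 + r2 + r3) * R
    \<and> dB5 e Ps f s V Y \<le> - m * r5\<^sup>2 + K * (r0 + r1 + r2 + r3 + r4) * R))"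
proof -
  define A where "A = 1 + l\<^sup>2 * e1\<^sup>2"
  have A1: "1 \<le> A" by (simp add: A_def)
  define Ks where "Ks = A + e1\<^sup>2 * (1 + l)"
  define Kt where "Kt = (1 + gamma) / rho3"
  define KX where "KX = b + k * Ks + gamma * Kt"
  define KY where "KY = A * k0 + 2 * l * k * Ks + gamma * A * Kt"
  define Kf where "Kf = (A * k + e1\<^sup>2 * l) / rho1"
  define K1 where "K1 = e1 / varpi + (vs + tau) * Kt"
  define K2 where "K2 = 1 + rho3 / rho2 + rho3 / rho1"
  define K3 where "K3 = rho2 * KX + rho1 * KY"
  define K4 where "K4 = A * b + A * k * e1\<^sup>2 * (1 + l) + A * gamma * Kt + A * Kf"
  define K5 where "K5 = A * rho1 * Ks + A * e1\<^sup>2 * l"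
  define K where "K = K1 + K2 + K3 + K4 + K5"
  \<comment> \<open>The entries belong to the levels: \<open>1/2\<close> to levels 1 and 3,
    \<open>gamma / 2\<close> to level 2, where the halves come from squaring a sum of two absolute
    values; the last two entries belong to \<open>f\<close> and \<open>s\<close>.\<close>
  define m where "m = min (min (1/2) (gamma / 2)) (min (k * del\<^sup>2) (k * del\<^sup>2 / A))"
  have Kpos: "0 \<le> Ks" "0 \<le> KX" "0 \<le> KY" "0 \<le> Kf"
    unfolding Ks_def Kt_def KX_def KY_def Kf_def using A1 pos e1 by (auto intro!: add_nonneg_nonneg)
  have Ks: "0 \<le> K1" "0 \<le> K2" "0 \<le> K3" "0 \<le> K4" "0 \<le> K5"
    unfolding K1_def K2_def K3_def K4_def K5_def Kt_def using Kpos A1 pos e1 by (auto intro!: add_nonneg_nonneg)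
  have m: "0 < m" using pos del A1 by (auto simp: m_def)
  have K0: "0 \<le> K" using Ks by (simp add: K_def)
  show ?thesis
  proof (rule exI[of _ m], rule exI[of _ K], intro conjI allI impI m K0)
    fix e p th Ps X f s q xi V Y :: real
    assume adm: "0 < e \<and> e \<le> e1 \<and> del \<le> \<bar>al e\<bar>"
    define r0 r1 r2 r3 r4 r5 where r: "r0 = \<bar>p\<bar> + \<bar>q\<bar>" "r1 = \<bar>th\<bar> + \<bar>xi\<bar>" "r2 = \<bar>Ps\<bar> + \<bar>V\<bar>" "r3 = \<bar>X\<bar> + \<bar>Y\<bar>" "r4 = \<bar>f\<bar>" "r5 = \<bar>s\<bar>"
    define R where "R = r0 + r1 + r2 + r3 + r4 + r5"
    have rn: "0 \<le> r0" "0 \<le> r1" "0 \<le> r2" "0 \<le> r3" "0 \<le> r4" "0 \<le> r5" by (auto simp: r)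
    have R0: "0 \<le> R" using rn by (simp add: R_def)
    have vR: "\<bar>p\<bar> \<le> R" "\<bar>q\<bar> \<le> R" "\<bar>th\<bar> \<le> R" "\<bar>xi\<bar> \<le> R" "\<bar>Ps\<bar> \<le> R" "\<bar>V\<bar> \<le> R" "\<bar>X\<bar> \<le> R" "\<bar>Y\<bar> \<le> R" "\<bar>f\<bar> \<le> R" "\<bar>s\<bar> \<le> R"
      by (auto simp: R_def r)
    have e2: "e\<^sup>2 \<le> e1\<^sup>2" "0 \<le> e\<^sup>2" using adm e1 by (auto intro!: power_mono)
    have le2: "l\<^sup>2 * e\<^sup>2 \<le> l\<^sup>2 * e1\<^sup>2" "0 \<le> l\<^sup>2 * e\<^sup>2" using e2 by (auto intro!: mult_left_mono)
    have alA: "\<bar>al e\<bar> \<le> A" using le2 unfolding al_def A_def by linarith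
    have beA: "\<bar>be e\<bar> \<le> A" "be e \<le> A" "1 \<le> be e" using le2 unfolding be_def A_def by linarith+
    have ab: "\<bar>al e / be e\<bar> \<le> A"
    proof -
      have "\<bar>al e\<bar> / \<bar>be e\<bar> \<le> \<bar>al e\<bar> / 1" using beA by (intro divide_left_mono) auto
      then show ?thesis using alA by (simp add: abs_divide)
    qed
    have ib: "\<bar>1 / be e\<bar> \<le> 1" using beA by simp
    have bTh: "\<bar>Dth p Ps\<bar> \<le> Kt * (r0 + r2)" "\<bar>Dxi q V\<bar> \<le> Kt * (r0 + r2)"
    proof -
      have g: "\<bar>x + gamma * y\<bar> \<le> (1 + gamma) * (r0 + r2)" if "\<bar>x\<bar> \<le> r0" "\<bar>y\<bar> \<le> r2" for x y
      proof -
        have "\<bar>x + gamma * y\<bar> \<le> r0 + gamma * r2"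
          using that abs_mult_le[of gamma gamma y r2] pos by linarith
        also have "\<dots> \<le> (1 + gamma) * (r0 + r2)" using rn pos by (simp add: algebra_simps)
        finally show ?thesis .
      qed
      have "\<bar>x + gamma * y\<bar> / rho3 \<le> Kt * (r0 + r2)" if "\<bar>x\<bar> \<le> r0" "\<bar>y\<bar> \<le> r2" for x y
        using divide_right_mono[OF g[OF that], of rho3] pos by (simp add: Kt_def)
      then show "\<bar>Dth p Ps\<bar> \<le> Kt * (r0 + r2)" "\<bar>Dxi q V\<bar> \<le> Kt * (r0 + r2)"
        using pos by (auto simp: Dth_def Dxi_def abs_divide r)
    qed
    have Kt0: "0 \<le> Kt" using pos by (simp add: Kt_def)
    have r02R: "Kt * (r0 + r2) \<le> Kt * R" using Kt0 rn by (intro mult_left_mono) (auto simp: R_def)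
    have bThR: "\<bar>Dth p Ps\<bar> \<le> Kt * R" "\<bar>Dxi q V\<bar> \<le> Kt * R" using bTh r02R by linarith+
    have bPV2: "\<bar>Ps + l * V\<bar> \<le> (1 + l) * r2"
    proof -
      have "\<bar>Ps + l * V\<bar> \<le> \<bar>Ps\<bar> + l * \<bar>V\<bar>" using pos abs_triangle_ineq[of Ps "l * V"] by (simp add: abs_mult)
      also have "\<dots> \<le> (1 + l) * r2" using pos by (simp add: r algebra_simps)
      finally show ?thesis .
    qed
    have r2R: "(1 + l) * r2 \<le> (1 + l) * R" using rn pos by (intro mult_left_mono) (auto simp: R_def)
    have e2R: "\<bar>e\<^sup>2\<bar> \<le> e1\<^sup>2" using e2 by simp
    have cm: "\<bar>c * x\<bar> \<le> c * B" if "\<bar>x\<bar> \<le> B" "0 < c" for c x B :: real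
      using abs_mult_le[of c c x B] that by simp
    have bDs: "\<bar>Ds e f Ps V\<bar> \<le> Ks * R"
    proof -
      have "\<bar>al e * f\<bar> \<le> A * R" by (rule abs_mult_le[OF alA vR(9)])
      moreover have "\<bar>e\<^sup>2 * (Ps + l * V)\<bar> \<le> e1\<^sup>2 * ((1 + l) * R)"
        by (rule abs_mult_le[OF e2R order_trans[OF bPV2 r2R]])
      ultimately show ?thesis unfolding Ds_def Ks_def by (simp add: algebra_simps)
    qed
    have bDX: "\<bar>DX e f Ps V p\<bar> \<le> KX * R"
    proof -
      have "\<bar>b * Ps\<bar> \<le> b * R" "\<bar>k * Ds e f Ps V\<bar> \<le> k * (Ks * R)" "\<bar>gamma * Dth p Ps\<bar> \<le> gamma * (Kt * R)"
        by (rule cm[OF vR(5) pos(6)], rule cm[OF bDs pos(4)], rule cm[OF bThR(1) pos(9)])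
      then show ?thesis unfolding DX_def KX_def by (simp add: algebra_simps)
    qed
    have bDY: "\<bar>DY e f Ps V q\<bar> \<le> KY * R"
    proof -
      have "\<bar>be e * (k0 * V)\<bar> \<le> A * (k0 * R)" "\<bar>(2 * l * k) * Ds e f Ps V\<bar> \<le> (2 * l * k) * (Ks * R)"
        "\<bar>(gamma * be e) * Dxi q V\<bar> \<le> (gamma * A) * (Kt * R)"
      proof -
        show "\<bar>be e * (k0 * V)\<bar> \<le> A * (k0 * R)" by (rule abs_mult_le[OF beA(1) cm[OF vR(6) pos(5)]])
        show "\<bar>(2 * l * k) * Ds e f Ps V\<bar> \<le> (2 * l * k) * (Ks * R)" by (rule cm[OF bDs]) (use pos in simp)
        have "\<bar>gamma * be e\<bar> \<le> gamma * A" by (rule cm[OF beA(1) pos(9)])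
        then show "\<bar>(gamma * be e) * Dxi q V\<bar> \<le> (gamma * A) * (Kt * R)" by (rule abs_mult_le[OF _ bThR(2)])
      qed
      then show ?thesis unfolding DY_def KY_def by (simp add: algebra_simps)
    qed
    have bYb: "\<bar>Y / be e\<bar> \<le> R"
      using abs_mult_le[OF vR(8) ib] by simp
    have bDf: "\<bar>Df e s Y\<bar> \<le> Kf * R"
    proof -
      have "\<bar>(al e / be e) * (k * s)\<bar> \<le> A * (k * R)" "\<bar>e\<^sup>2 * (l * (Y / be e))\<bar> \<le> e1\<^sup>2 * (l * R)"
        by (rule abs_mult_le[OF ab cm[OF vR(10) pos(4)]], rule abs_mult_le[OF e2R cm[OF bYb pos(8)]])
      then have "\<bar>- ((al e / be e) * (k * s)) + e\<^sup>2 * (l * (Y / be e))\<bar> \<le> (A * k + e1\<^sup>2 * l) * R"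
      proof -
        have "(A * k + e1\<^sup>2 * l) * R = A * (k * R) + e1\<^sup>2 * (l * R)" by (simp add: algebra_simps)
        moreover assume "\<bar>(al e / be e) * (k * s)\<bar> \<le> A * (k * R)" "\<bar>e\<^sup>2 * (l * (Y / be e))\<bar> \<le> e1\<^sup>2 * (l * R)"
        ultimately show ?thesis by linarith
      qed
      moreover have "Df e s Y = (- ((al e / be e) * (k * s)) + e\<^sup>2 * (l * (Y / be e))) / rho1"
        by (simp add: Df_def mult.assoc)
      ultimately show ?thesis unfolding Kf_def using pos by (simp add: abs_divide divide_right_mono)
    qed
    have mm: "m \<le> 1 / 2" "m \<le> gamma / 2" "m \<le> k * del\<^sup>2" "m \<le> k * del\<^sup>2 / A"
      unfolding m_def
      by (rule min.coboundedI1[OF min.cobounded1], rule min.coboundedI1[OF min.cobounded2],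
          rule min.coboundedI2[OF min.cobounded1], rule min.coboundedI2[OF min.cobounded2])
    have KK: "K1 \<le> K" "K2 \<le> K" "K3 \<le> K" "K4 \<le> K" "K5 \<le> K" using Ks by (auto simp: K_def)
    have fin: "D \<le> - m * x\<^sup>2 + K * y * R" if "D \<le> - m' * x\<^sup>2 + K' * (y * R)" "m \<le> m'" "K' \<le> K" "0 \<le> y" for D m' x K' y
    proof -
      have "m * x\<^sup>2 \<le> m' * x\<^sup>2" "K' * (y * R) \<le> K * (y * R)"
        using that R0 by (auto intro!: mult_right_mono)
      then show ?thesis using that(1) by (simp add: mult.assoc)
    qed
    have sq: "- (x\<^sup>2 + y\<^sup>2) \<le> - (1/2) * (\<bar>x\<bar> + \<bar>y\<bar>)\<^sup>2" for x y :: real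
    proof -
      have "0 \<le> (\<bar>x\<bar> - \<bar>y\<bar>)\<^sup>2" by simp
      then have "2 * (\<bar>x\<bar> * \<bar>y\<bar>) \<le> x\<^sup>2 + y\<^sup>2" by (simp add: power2_diff)
      moreover have "(\<bar>x\<bar> + \<bar>y\<bar>)\<^sup>2 = x\<^sup>2 + y\<^sup>2 + 2 * (\<bar>x\<bar> * \<bar>y\<bar>)" by (simp add: power2_sum)
      ultimately show ?thesis by linarith
    qed
    have I1: "dB1 e p th Ps q xi V \<le> - m * r1\<^sup>2 + K * r0 * R"
    proof (rule fin[OF _ mm(1) KK(1) rn(1)])
      define z1 z2 where "z1 = vs * Dth p Ps - e / varpi * th" and "z2 = tau * Dxi q V - e / varpi * xi"
      have eq: "dB1 e p th Ps q xi V = - (th\<^sup>2 + xi\<^sup>2) + p * z1 + q * z2"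
        unfolding dB1_def Dp_def Dq_def z1_def z2_def using pos by (simp add: field_simps power2_eq_square)
      have ev: "\<bar>e / varpi\<bar> \<le> e1 / varpi" using adm pos by (simp add: divide_right_mono)
      have "\<bar>e / varpi * th\<bar> \<le> e1 / varpi * R" "\<bar>e / varpi * xi\<bar> \<le> e1 / varpi * R"
        by (rule abs_mult_le[OF ev vR(3)], rule abs_mult_le[OF ev vR(4)])
      moreover have "\<bar>vs * Dth p Ps\<bar> \<le> vs * (Kt * R)" "\<bar>tau * Dxi q V\<bar> \<le> tau * (Kt * R)"
        by (rule cm[OF bThR(1) pos(10)], rule cm[OF bThR(2) pos(11)])
      moreover have "0 \<le> vs * (Kt * R)" "0 \<le> tau * (Kt * R)" using pos Kt0 R0 by auto
      moreover have "K1 * R = e1 / varpi * R + vs * (Kt * R) + tau * (Kt * R)"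
        unfolding K1_def by (simp add: algebra_simps)
      ultimately have "\<bar>z1\<bar> \<le> K1 * R" "\<bar>z2\<bar> \<le> K1 * R" unfolding z1_def z2_def by linarith+
      then have "p * z1 \<le> K1 * (\<bar>p\<bar> * R)" "q * z2 \<le> K1 * (\<bar>q\<bar> * R)"
        using prod_le[OF order_refl] by blast+
      moreover have "K1 * (r0 * R) = K1 * (\<bar>p\<bar> * R) + K1 * (\<bar>q\<bar> * R)" by (simp add: r algebra_simps)
      ultimately show "dB1 e p th Ps q xi V \<le> - (1/2) * r1\<^sup>2 + K1 * (r0 * R)"
        unfolding eq using sq[of th xi, folded r] by linarith
    qed
    have I2: "dB2 p th Ps X q xi V Y \<le> - m * r2\<^sup>2 + K * (r0 + r1) * R"
    proof (rule fin[OF _ mm(2) KK(2)])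
      have eq: "dB2 p th Ps X q xi V Y = gamma * (- (Ps\<^sup>2 + V\<^sup>2)) + - (p * Ps) + - (q * V)
          + - (th * (rho3 / rho2 * X)) + - (xi * (rho3 / rho1 * Y))"
        unfolding dB2_def Dth_def Dxi_def using pos by (simp add: field_simps power2_eq_square)
      have "- (p * Ps) \<le> 1 * (\<bar>p\<bar> * R)" "- (q * V) \<le> 1 * (\<bar>q\<bar> * R)"
        using prod_ge[of p "\<bar>p\<bar>" Ps 1 R] prod_ge[of q "\<bar>q\<bar>" V 1 R] vR(5,6) by (simp_all only: order_refl mult_1)
      moreover have "- (th * (rho3 / rho2 * X)) \<le> rho3 / rho2 * (\<bar>th\<bar> * R)" "- (xi * (rho3 / rho1 * Y)) \<le> rho3 / rho1 * (\<bar>xi\<bar> * R)"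
        by (rule prod_ge[OF order_refl cm[OF vR(7) divide_pos_pos[OF pos(3,2)]]],
            rule prod_ge[OF order_refl cm[OF vR(8) divide_pos_pos[OF pos(3,1)]]])
      moreover have "gamma * (- (Ps\<^sup>2 + V\<^sup>2)) \<le> gamma * (- (1/2) * r2\<^sup>2)"
        by (rule mult_left_mono[OF sq[of Ps V, folded r] less_imp_le[OF pos(9)]])
      ultimately have *: "- (p * Ps) \<le> 1 * (\<bar>p\<bar> * R)" "- (q * V) \<le> 1 * (\<bar>q\<bar> * R)"
        "- (th * (rho3 / rho2 * X)) \<le> rho3 / rho2 * (\<bar>th\<bar> * R)" "- (xi * (rho3 / rho1 * Y)) \<le> rho3 / rho1 * (\<bar>xi\<bar> * R)"
        "gamma * (- (Ps\<^sup>2 + V\<^sup>2)) \<le> gamma * (- (1/2) * r2\<^sup>2)" by blast+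
      have "dB2 p th Ps X q xi V Y \<le> - (gamma / 2) * r2\<^sup>2 + 1 * (r0 * R) + rho3 / rho2 * (\<bar>th\<bar> * R) + rho3 / rho1 * (\<bar>xi\<bar> * R)"
      proof -
        have "1 * (r0 * R) = 1 * (\<bar>p\<bar> * R) + 1 * (\<bar>q\<bar> * R)" by (simp add: r algebra_simps)
        moreover have "gamma * (- (1/2) * r2\<^sup>2) = - (gamma / 2) * r2\<^sup>2" by simp
        ultimately show ?thesis unfolding eq using * by linarith
      qed
      also have "rho3 / rho2 * (\<bar>th\<bar> * R) \<le> rho3 / rho2 * (r1 * R)" using pos R0 by (intro mult_left_mono mult_right_mono) (auto simp: r)
      also have "rho3 / rho1 * (\<bar>xi\<bar> * R) \<le> rho3 / rho1 * (r1 * R)" using pos R0 by (intro mult_left_mono mult_right_mono) (auto simp: r)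
      finally have "dB2 p th Ps X q xi V Y \<le> - (gamma / 2) * r2\<^sup>2 + 1 * (r0 * R) + rho3 / rho2 * (r1 * R) + rho3 / rho1 * (r1 * R)" by simp
      moreover have "K2 * ((r0 + r1) * R) = 1 * (r0 * R) + rho3 / rho2 * (r1 * R) + rho3 / rho1 * (r1 * R)
          + (r1 * R + rho3 / rho2 * (r0 * R) + rho3 / rho1 * (r0 * R))"
        unfolding K2_def by (simp add: algebra_simps)
      moreover have "0 \<le> r1 * R + rho3 / rho2 * (r0 * R) + rho3 / rho1 * (r0 * R)"
        using pos rn R0 by (intro add_nonneg_nonneg mult_nonneg_nonneg) auto
      ultimately show "dB2 p th Ps X q xi V Y \<le> - (gamma / 2) * r2\<^sup>2 + K2 * ((r0 + r1) * R)" by linarith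
    qed (use rn in simp)
    have I3: "dB3 e p Ps X f q V Y \<le> - m * r3\<^sup>2 + K * (r0 + r1 + r2) * R"
    proof (rule fin[OF _ mm(1) KK(3)])
      have eq: "dB3 e p Ps X f q V Y = - (X\<^sup>2 + Y\<^sup>2) + - (Ps * (rho2 * DX e f Ps V p)) + - (V * (rho1 * DY e f Ps V q))"
        unfolding dB3_def using pos by (simp add: field_simps power2_eq_square)
      have "\<bar>rho2 * DX e f Ps V p\<bar> \<le> (rho2 * KX) * R" "\<bar>rho1 * DY e f Ps V q\<bar> \<le> (rho1 * KY) * R"
        unfolding mult.assoc by (rule cm[OF bDX pos(2)], rule cm[OF bDY pos(1)])
      then have "- (Ps * (rho2 * DX e f Ps V p)) \<le> (rho2 * KX) * (\<bar>Ps\<bar> * R)" "- (V * (rho1 * DY e f Ps V q)) \<le> (rho1 * KY) * (\<bar>V\<bar> * R)"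
        using prod_ge[OF order_refl] by blast+
      moreover have "(rho2 * KX) * (\<bar>Ps\<bar> * R) \<le> (rho2 * KX) * ((r0 + r1 + r2) * R)" "(rho1 * KY) * (\<bar>V\<bar> * R) \<le> (rho1 * KY) * ((r0 + r1 + r2) * R)"
      proof -
        have "\<bar>Ps\<bar> * R \<le> (r0 + r1 + r2) * R" "\<bar>V\<bar> * R \<le> (r0 + r1 + r2) * R"
          by (rule mult_right_mono[OF _ R0]; simp add: r)+
        then show "(rho2 * KX) * (\<bar>Ps\<bar> * R) \<le> (rho2 * KX) * ((r0 + r1 + r2) * R)" "(rho1 * KY) * (\<bar>V\<bar> * R) \<le> (rho1 * KY) * ((r0 + r1 + r2) * R)"
          using pos Kpos by (auto intro!: mult_left_mono mult_nonneg_nonneg)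
      qed
      ultimately have "dB3 e p Ps X f q V Y \<le> - (X\<^sup>2 + Y\<^sup>2) + K3 * ((r0 + r1 + r2) * R)"
        unfolding eq K3_def distrib_right[of "rho2 * KX" "rho1 * KY"] by linarith
      then show "dB3 e p Ps X f q V Y \<le> - (1/2) * r3\<^sup>2 + K3 * ((r0 + r1 + r2) * R)"
        using sq[of X Y, folded r] by linarith
    qed (use rn in simp)
    have alf: "\<bar>al e * f\<bar> \<le> A * R" "\<bar>al e * s\<bar> \<le> A * R" by (intro abs_mult_le alA vR)+
    have al2: "del\<^sup>2 \<le> (al e)\<^sup>2" using adm del power_mono[of del "\<bar>al e\<bar>" 2] by simp
    have I4: "dB4 e p Ps X f s V Y \<le> - m * r4\<^sup>2 + K * (r0 + r1 + r2 + r3) * R"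
    proof (rule fin[OF _ mm(3) KK(4)])
      define y where "y = r0 + r1 + r2 + r3"
      \<comment> \<open>The negative square stems from the part \<open>al e * f\<close> of
        \<open>Ds\<close> inside \<open>DX\<close>. The variable \<open>s\<close>, of higher level,
        occurs only in \<open>Df\<close>, where it is multiplied by \<open>X\<close>.\<close>
      have eq: "dB4 e p Ps X f s V Y = - (k * ((al e)\<^sup>2 * f\<^sup>2)) + - (Ps * (b * (al e * f)))
          + - ((Ps + l * V) * (k * (e\<^sup>2 * (al e * f)))) + - (Dth p Ps * (gamma * (al e * f))) + X * (al e * Df e s Y)"
        unfolding dB4_def DX_def Ds_def by (simp add: algebra_simps power2_eq_square)
      have "\<bar>Ps\<bar> \<le> y" by (simp add: y_def r)
      moreover have "\<bar>b * (al e * f)\<bar> \<le> (A * b) * R"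
        using cm[OF alf(1) pos(6)] by (simp add: mult.assoc mult.left_commute)
      ultimately have t1: "- (Ps * (b * (al e * f))) \<le> (A * b) * (y * R)" by (rule prod_ge)
      have "\<bar>Ps + l * V\<bar> \<le> (1 + l) * y"
      proof -
        have "(1 + l) * r2 \<le> (1 + l) * y" using pos rn by (intro mult_left_mono) (auto simp: y_def)
        then show ?thesis using bPV2 by linarith
      qed
      moreover have "\<bar>k * (e\<^sup>2 * (al e * f))\<bar> \<le> (A * k * e1\<^sup>2) * R"
        using cm[OF abs_mult_le[OF e2R alf(1)] pos(4)] by (simp add: mult.assoc mult.left_commute)
      ultimately have "- ((Ps + l * V) * (k * (e\<^sup>2 * (al e * f)))) \<le> (A * k * e1\<^sup>2) * ((1 + l) * y * R)" by (rule prod_ge)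
      then have t2: "- ((Ps + l * V) * (k * (e\<^sup>2 * (al e * f)))) \<le> (A * k * e1\<^sup>2 * (1 + l)) * (y * R)" by (simp add: algebra_simps)
      have "\<bar>Dth p Ps\<bar> \<le> Kt * y"
      proof -
        have "Kt * (r0 + r2) \<le> Kt * y" using Kt0 rn by (intro mult_left_mono) (auto simp: y_def)
        then show ?thesis using bTh by linarith
      qed
      moreover have "\<bar>gamma * (al e * f)\<bar> \<le> (A * gamma) * R"
        using cm[OF alf(1) pos(9)] by (simp add: mult.assoc mult.left_commute)
      ultimately have "- (Dth p Ps * (gamma * (al e * f))) \<le> (A * gamma) * (Kt * y * R)" by (rule prod_ge)
      then have t3: "- (Dth p Ps * (gamma * (al e * f))) \<le> (A * gamma * Kt) * (y * R)" by (simp add: algebra_simps)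
      have "\<bar>X\<bar> \<le> y" by (simp add: y_def r)
      moreover have "\<bar>al e * Df e s Y\<bar> \<le> (A * Kf) * R"
        using abs_mult_le[OF alA bDf] by (simp add: mult.assoc)
      ultimately have t4: "X * (al e * Df e s Y) \<le> (A * Kf) * (y * R)" by (rule prod_le)
      have "(k * del\<^sup>2) * r4\<^sup>2 \<le> k * ((al e)\<^sup>2 * f\<^sup>2)"
        unfolding mult.assoc r power2_abs using pos al2 by (intro mult_left_mono mult_right_mono) auto
      then have t0': "- (k * ((al e)\<^sup>2 * f\<^sup>2)) \<le> - (k * del\<^sup>2) * r4\<^sup>2" by simp
      have "K4 * (y * R) = (A * b) * (y * R) + (A * k * e1\<^sup>2 * (1 + l)) * (y * R) + (A * gamma * Kt) * (y * R) + (A * Kf) * (y * R)"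
        unfolding K4_def by (simp add: algebra_simps)
      then show "dB4 e p Ps X f s V Y \<le> - (k * del\<^sup>2) * r4\<^sup>2 + K4 * ((r0 + r1 + r2 + r3) * R)"
        unfolding eq y_def[symmetric] using add_mono[OF add_mono[OF add_mono[OF add_mono[OF t0' t1] t2] t3] t4]
        by (simp only: add.assoc)
    qed (use rn in simp)
    have I5: "dB5 e Ps f s V Y \<le> - m * r5\<^sup>2 + K * (r0 + r1 + r2 + r3 + r4) * R"
    proof (rule fin[OF _ mm(4) KK(5)])
      define y where "y = r0 + r1 + r2 + r3 + r4"
      \<comment> \<open>The negative square stems from \<open>s * Df\<close>; the product with
        \<open>Ds\<close> carries the factor \<open>f\<close>, which is of lower level.\<close>
      have eq: "dB5 e Ps f s V Y = - ((al e)\<^sup>2 / be e * (k * s\<^sup>2)) + Y * (e\<^sup>2 * (l * ((al e * s) * (1 / be e))))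
          + f * (al e * (rho1 * Ds e f Ps V))"
        unfolding dB5_def Df_def using pos by (simp add: field_simps power2_eq_square)
      have "\<bar>Y\<bar> \<le> y" by (simp add: y_def r)
      moreover have "\<bar>e\<^sup>2 * (l * ((al e * s) * (1 / be e)))\<bar> \<le> (A * e1\<^sup>2 * l) * R"
        using abs_mult_le[OF e2R cm[OF abs_mult_le[OF alf(2) ib] pos(8)]]
        by (simp add: mult.assoc mult.left_commute)
      ultimately have t1: "Y * (e\<^sup>2 * (l * ((al e * s) * (1 / be e)))) \<le> (A * e1\<^sup>2 * l) * (y * R)" by (rule prod_le)
      have "\<bar>f\<bar> \<le> y" by (simp add: y_def r)
      moreover have "\<bar>al e * (rho1 * Ds e f Ps V)\<bar> \<le> (A * rho1 * Ks) * R"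
        using abs_mult_le[OF alA cm[OF bDs pos(1)]] by (simp add: mult.assoc)
      ultimately have t2: "f * (al e * (rho1 * Ds e f Ps V)) \<le> (A * rho1 * Ks) * (y * R)" by (rule prod_le)
      have "del\<^sup>2 / A \<le> (al e)\<^sup>2 / be e"
        using al2 beA A1 by (intro frac_le) auto
      then have "del\<^sup>2 / A * (k * s\<^sup>2) \<le> (al e)\<^sup>2 / be e * (k * s\<^sup>2)"
        using pos by (intro mult_right_mono) auto
      then have t0: "(k * del\<^sup>2 / A) * r5\<^sup>2 \<le> (al e)\<^sup>2 / be e * (k * s\<^sup>2)"
        by (simp add: r algebra_simps)
      have "K5 * (y * R) = (A * rho1 * Ks) * (y * R) + (A * e1\<^sup>2 * l) * (y * R)"
        unfolding K5_def by (simp add: algebra_simps)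
      then show "dB5 e Ps f s V Y \<le> - (k * del\<^sup>2 / A) * r5\<^sup>2 + K5 * ((r0 + r1 + r2 + r3 + r4) * R)"
        unfolding eq y_def[symmetric] using t0 t1 t2 by linarith
    qed (use rn in simp)
    show "let r0 = \<bar>p\<bar> + \<bar>q\<bar>; r1 = \<bar>th\<bar> + \<bar>xi\<bar>; r2 = \<bar>Ps\<bar> + \<bar>V\<bar>; r3 = \<bar>X\<bar> + \<bar>Y\<bar>; r4 = \<bar>f\<bar>; r5 = \<bar>s\<bar>;
         R = r0 + r1 + r2 + r3 + r4 + r5 in
      dB1 e p th Ps q xi V \<le> - m * r1\<^sup>2 + K * r0 * R
    \<and> dB2 p th Ps X q xi V Y \<le> - m * r2\<^sup>2 + K * (r0 + r1) * R
    \<and> dB3 e p Ps X f q V Y \<le> - m * r3\<^sup>2 + K * (r0 + r1 + r2) * R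
    \<and> dB4 e p Ps X f s V Y \<le> - m * r4\<^sup>2 + K * (r0 + r1 + r2 + r3) * R
    \<and> dB5 e Ps f s V Y \<le> - m * r5\<^sup>2 + K * (r0 + r1 + r2 + r3 + r4) * R"
      unfolding Let_def using I1 I2 I3 I4 I5 unfolding R_def r by blast
  qed
qed

end

lemma mult_le_sq: "\<bar>x\<bar> * \<bar>y\<bar> \<le> R2" if "x\<^sup>2 + y\<^sup>2 \<le> R2" for x y R2 :: real
proof -
  have "0 \<le> (\<bar>x\<bar> - \<bar>y\<bar>)\<^sup>2" by simp
  then have "2 * (\<bar>x\<bar> * \<bar>y\<bar>) \<le> x\<^sup>2 + y\<^sup>2" by (simp add: power2_diff)
  moreover have "0 \<le> \<bar>x\<bar> * \<bar>y\<bar>" by simp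
  ultimately show ?thesis using that by linarith
qed

context bmc_coeffs
begin

definition R2 :: "real \<Rightarrow> real \<Rightarrow> real \<Rightarrow> real \<Rightarrow> real \<Rightarrow> real \<Rightarrow> real \<Rightarrow> real \<Rightarrow> real \<Rightarrow> real \<Rightarrow> real" where
  "R2 p th Ps X f s q xi V Y = p\<^sup>2 + q\<^sup>2 + th\<^sup>2 + xi\<^sup>2 + Ps\<^sup>2 + V\<^sup>2 + X\<^sup>2 + Y\<^sup>2 + f\<^sup>2 + s\<^sup>2"

text \<open>Level 0 consists of \<open>p\<close> and \<open>q\<close>, precisely the variables that
  the energy dissipates, so the remainder on the right can later be absorbed by a multiple of the
  energy. The weights do not depend on the mode.\<close>

lemma lyapunov_static:
  assumes e1: "0 < e1" and del: "0 < del"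
  obtains c1 c2 c3 c4 c5 C where "0 \<le> c1" "0 \<le> c2" "0 \<le> c3" "0 \<le> c4" "0 \<le> c5" "0 \<le> C"
    "\<And>e p th Ps X f s q xi V Y. 0 < e \<Longrightarrow> e \<le> e1 \<Longrightarrow> del \<le> \<bar>al e\<bar> \<Longrightarrow>
      c1 * dB1 e p th Ps q xi V + c2 * dB2 p th Ps X q xi V Y + c3 * dB3 e p Ps X f q V Y
      + c4 * dB4 e p Ps X f s V Y + c5 * dB5 e Ps f s V Y
      \<le> - R2 p th Ps X f s q xi V Y + C * (p\<^sup>2 + q\<^sup>2)"
proof -
  obtain m K where m: "0 < m" and K: "0 \<le> K" and est: "\<And>e p th Ps X f s q xi V Y.
    0 < e \<and> e \<le> e1 \<and> del \<le> \<bar>al e\<bar> \<Longrightarrow>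
    (let r0 = \<bar>p\<bar> + \<bar>q\<bar>; r1 = \<bar>th\<bar> + \<bar>xi\<bar>; r2 = \<bar>Ps\<bar> + \<bar>V\<bar>; r3 = \<bar>X\<bar> + \<bar>Y\<bar>; r4 = \<bar>f\<bar>; r5 = \<bar>s\<bar>;
         R = r0 + r1 + r2 + r3 + r4 + r5 in
      dB1 e p th Ps q xi V \<le> - m * r1\<^sup>2 + K * r0 * R
    \<and> dB2 p th Ps X q xi V Y \<le> - m * r2\<^sup>2 + K * (r0 + r1) * R
    \<and> dB3 e p Ps X f q V Y \<le> - m * r3\<^sup>2 + K * (r0 + r1 + r2) * R
    \<and> dB4 e p Ps X f s V Y \<le> - m * r4\<^sup>2 + K * (r0 + r1 + r2 + r3) * R
    \<and> dB5 e Ps f s V Y \<le> - m * r5\<^sup>2 + K * (r0 + r1 + r2 + r3 + r4) * R)"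
    using chain_estimates[OF e1 del] by blast
  obtain c C where c: "\<And>j. 0 \<le> c j" and C: "0 \<le> C" and comb: "\<And>r D.
      (\<forall>j. (0::real) \<le> r j) \<and> (\<forall>j\<in>{1..5::nat}. D j \<le> - m * (r j)\<^sup>2 + K * (\<Sum>k<j. r k) * (\<Sum>k\<le>5. r k))
      \<Longrightarrow> (\<Sum>j=1..5. c j * D j) \<le> - (\<Sum>j=1..5. (r j)\<^sup>2) + C * (\<Sum>j<1. (r j)\<^sup>2)"
    using triangular_combination[OF m K, of 1 5] by auto
  have "c 1 * dB1 e p th Ps q xi V + c 2 * dB2 p th Ps X q xi V Y + c 3 * dB3 e p Ps X f q V Y
      + c 4 * dB4 e p Ps X f s V Y + c 5 * dB5 e Ps f s V Y
      \<le> - R2 p th Ps X f s q xi V Y + (2 * C + 1) * (p\<^sup>2 + q\<^sup>2)"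
    if adm: "0 < e" "e \<le> e1" "del \<le> \<bar>al e\<bar>" for e p th Ps X f s q xi V Y
  proof -
    define r where "r j = (if j = 0 then \<bar>p\<bar> + \<bar>q\<bar> else if j = 1 then \<bar>th\<bar> + \<bar>xi\<bar> else if j = 2 then \<bar>Ps\<bar> + \<bar>V\<bar>
      else if j = 3 then \<bar>X\<bar> + \<bar>Y\<bar> else if j = 4 then \<bar>f\<bar> else if j = 5 then \<bar>s\<bar> else 0)" for j :: nat
    define D where "D j = (if j = 1 then dB1 e p th Ps q xi V else if j = 2 then dB2 p th Ps X q xi V Y
      else if j = 3 then dB3 e p Ps X f q V Y else if j = 4 then dB4 e p Ps X f s V Y else dB5 e Ps f s V Y)" for j :: nat
    have rv: "r 0 = \<bar>p\<bar> + \<bar>q\<bar>" "r 1 = \<bar>th\<bar> + \<bar>xi\<bar>" "r 2 = \<bar>Ps\<bar> + \<bar>V\<bar>" "r 3 = \<bar>X\<bar> + \<bar>Y\<bar>" "r 4 = \<bar>f\<bar>" "r 5 = \<bar>s\<bar>"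
      by (simp_all add: r_def)
    have Dv: "D 1 = dB1 e p th Ps q xi V" "D 2 = dB2 p th Ps X q xi V Y" "D 3 = dB3 e p Ps X f q V Y"
      "D 4 = dB4 e p Ps X f s V Y" "D 5 = dB5 e Ps f s V Y" by (simp_all add: D_def)
    have sums: "(\<Sum>k<1. g k) = g 0" "(\<Sum>k<2. g k) = g 0 + g 1" "(\<Sum>k<3. g k) = g 0 + g 1 + g 2"
      "(\<Sum>k<4. g k) = g 0 + g 1 + g 2 + g 3" "(\<Sum>k<5. g k) = g 0 + g 1 + g 2 + g 3 + g 4"
      "(\<Sum>k\<le>5. g k) = g 0 + g 1 + g 2 + g 3 + g 4 + g 5"
      "(\<Sum>k=1..5. g k) = g 1 + g 2 + g 3 + g 4 + g 5" for g :: "nat \<Rightarrow> real"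
      by (simp_all add: eval_nat_numeral sum.atLeast_Suc_atMost)
    have "\<forall>j\<in>{1..5}. D j \<le> - m * (r j)\<^sup>2 + K * (\<Sum>k<j. r k) * (\<Sum>k\<le>5. r k)"
    proof
      fix j :: nat assume "j \<in> {1..5}"
      then consider "j = 1" | "j = 2" | "j = 3" | "j = 4" | "j = 5" by fastforce
      then show "D j \<le> - m * (r j)\<^sup>2 + K * (\<Sum>k<j. r k) * (\<Sum>k\<le>5. r k)"
        using est[of e p q th xi Ps V X Y f s] adm unfolding Let_def
        by cases (simp_all only: sums rv Dv simp_thms)
    qed
    moreover have "\<forall>j. 0 \<le> r j" by (simp add: r_def)
    ultimately have "(\<Sum>j=1..5. c j * D j) \<le> - (\<Sum>j=1..5. (r j)\<^sup>2) + C * (\<Sum>j<1. (r j)\<^sup>2)"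
      by (intro comb) blast
    then have 1: "c 1 * dB1 e p th Ps q xi V + c 2 * dB2 p th Ps X q xi V Y + c 3 * dB3 e p Ps X f q V Y
      + c 4 * dB4 e p Ps X f s V Y + c 5 * dB5 e Ps f s V Y
      \<le> - ((\<bar>th\<bar> + \<bar>xi\<bar>)\<^sup>2 + (\<bar>Ps\<bar> + \<bar>V\<bar>)\<^sup>2 + (\<bar>X\<bar> + \<bar>Y\<bar>)\<^sup>2 + \<bar>f\<bar>\<^sup>2 + \<bar>s\<bar>\<^sup>2) + C * (\<bar>p\<bar> + \<bar>q\<bar>)\<^sup>2"
      by (simp only: sums rv Dv)
    have lo: "x\<^sup>2 + y\<^sup>2 \<le> (\<bar>x\<bar> + \<bar>y\<bar>)\<^sup>2" for x y :: real by (simp add: power2_sum)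
    have "(\<bar>p\<bar> + \<bar>q\<bar>)\<^sup>2 \<le> 2 * (p\<^sup>2 + q\<^sup>2)"
      using sum_squares_bound[of "\<bar>p\<bar>" "\<bar>q\<bar>"] by (simp add: power2_sum)
    then have "C * (\<bar>p\<bar> + \<bar>q\<bar>)\<^sup>2 \<le> C * (2 * (p\<^sup>2 + q\<^sup>2))" using C by (rule mult_left_mono)
    then show ?thesis using 1 lo[of th xi] lo[of Ps V] lo[of X Y] by (simp add: R2_def algebra_simps)
  qed
  then show ?thesis using that[of "c 1" "c 2" "c 3" "c 4" "c 5" "2 * C + 1"] c C by simp
qed

section \<open>Comparison of the energy with the scaled variables\<close>

definition En :: "real \<Rightarrow> real \<Rightarrow> real \<Rightarrow> real \<Rightarrow> real \<Rightarrow> real \<Rightarrow> real \<Rightarrow> real \<Rightarrow> real \<Rightarrow> real \<Rightarrow> real" where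
  "En S Ph y Ps N W th p xi q = k * S\<^sup>2 + rho1 * Ph\<^sup>2 + b * y\<^sup>2 + rho2 * Ps\<^sup>2 + k0 * N\<^sup>2 + rho1 * W\<^sup>2
    + rho3 * th\<^sup>2 + vs * p\<^sup>2 + rho3 * xi\<^sup>2 + tau * q\<^sup>2"

lemma En_nonneg: "0 \<le> En S Ph y Ps N W th p xi q"
  unfolding En_def by (intro add_nonneg_nonneg mult_nonneg_nonneg zero_le_power2 pos[THEN less_imp_le])

definition mu :: real where
  "mu = Min {k, rho1, b, rho2, k0, rho3, vs, tau}"

lemma mu_pos: "0 < mu"
proof -
  have "mu \<in> {k, rho1, b, rho2, k0, rho3, vs, tau}" unfolding mu_def by (rule Min_in) auto
  then show ?thesis unfolding insert_iff empty_iff by (elim disjE) (simp_all add: pos)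
qed

lemma mu_le: "mu \<le> k" "mu \<le> rho1" "mu \<le> b" "mu \<le> rho2" "mu \<le> k0" "mu \<le> rho3" "mu \<le> vs" "mu \<le> tau"
  unfolding mu_def by (rule Min_le, blast, blast)+

definition Smax :: real where
  "Smax = k + rho1 + b + rho2 + k0 + rho1 + rho3 + vs + rho3 + tau"

lemma Smax_pos: "0 < Smax" unfolding Smax_def by (intro add_pos_pos pos)

lemma En_bounds_components:
  assumes "En S Ph y Ps N W th p xi q \<le> mu * g\<^sup>2" "0 \<le> g"
  shows "\<bar>S\<bar> \<le> g" "\<bar>Ph\<bar> \<le> g" "\<bar>y\<bar> \<le> g" "\<bar>Ps\<bar> \<le> g" "\<bar>N\<bar> \<le> g" "\<bar>W\<bar> \<le> g" "\<bar>th\<bar> \<le> g" "\<bar>p\<bar> \<le> g" "\<bar>xi\<bar> \<le> g" "\<bar>q\<bar> \<le> g"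
proof -
  have *: "\<bar>x\<bar> \<le> g" if "mu \<le> a" "a * x\<^sup>2 \<le> En S Ph y Ps N W th p xi q" for a x
  proof -
    have "mu * x\<^sup>2 \<le> a * x\<^sup>2" using that by (intro mult_right_mono) auto
    then have "mu * x\<^sup>2 \<le> mu * g\<^sup>2" using that assms by linarith
    then have "x\<^sup>2 \<le> g\<^sup>2" using mu_pos by simp
    then show ?thesis using assms(2) by (simp add: abs_le_square_iff[symmetric])
  qed
  have nn: "0 \<le> k * S\<^sup>2" "0 \<le> rho1 * Ph\<^sup>2" "0 \<le> b * y\<^sup>2" "0 \<le> rho2 * Ps\<^sup>2" "0 \<le> k0 * N\<^sup>2" "0 \<le> rho1 * W\<^sup>2"
    "0 \<le> rho3 * th\<^sup>2" "0 \<le> vs * p\<^sup>2" "0 \<le> rho3 * xi\<^sup>2" "0 \<le> tau * q\<^sup>2"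
    by (intro mult_nonneg_nonneg zero_le_power2 pos[THEN less_imp_le])+
  show "\<bar>S\<bar> \<le> g" by (rule *[OF mu_le(1)], unfold En_def, use nn in linarith)
  show "\<bar>Ph\<bar> \<le> g" by (rule *[OF mu_le(2)], unfold En_def, use nn in linarith)
  show "\<bar>y\<bar> \<le> g" by (rule *[OF mu_le(3)], unfold En_def, use nn in linarith)
  show "\<bar>Ps\<bar> \<le> g" by (rule *[OF mu_le(4)], unfold En_def, use nn in linarith)
  show "\<bar>N\<bar> \<le> g" by (rule *[OF mu_le(5)], unfold En_def, use nn in linarith)
  show "\<bar>W\<bar> \<le> g" by (rule *[OF mu_le(2)], unfold En_def, use nn in linarith)
  show "\<bar>th\<bar> \<le> g" by (rule *[OF mu_le(6)], unfold En_def, use nn in linarith)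
  show "\<bar>p\<bar> \<le> g" by (rule *[OF mu_le(7)], unfold En_def, use nn in linarith)
  show "\<bar>xi\<bar> \<le> g" by (rule *[OF mu_le(6)], unfold En_def, use nn in linarith)
  show "\<bar>q\<bar> \<le> g" by (rule *[OF mu_le(8)], unfold En_def, use nn in linarith)
qed

lemma components_bound_En:
  assumes "\<bar>S\<bar> \<le> g" "\<bar>Ph\<bar> \<le> g" "\<bar>y\<bar> \<le> g" "\<bar>Ps\<bar> \<le> g" "\<bar>N\<bar> \<le> g" "\<bar>W\<bar> \<le> g" "\<bar>th\<bar> \<le> g" "\<bar>p\<bar> \<le> g" "\<bar>xi\<bar> \<le> g" "\<bar>q\<bar> \<le> g"
  shows "En S Ph y Ps N W th p xi q \<le> Smax * g\<^sup>2"
proof -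
  have *: "a * x\<^sup>2 \<le> a * g\<^sup>2" if "\<bar>x\<bar> \<le> g" "0 < a" for a x
    using sq_le[OF that(1)] that(2) by (intro mult_left_mono) auto
  have "Smax * g\<^sup>2 = k * g\<^sup>2 + rho1 * g\<^sup>2 + b * g\<^sup>2 + rho2 * g\<^sup>2 + k0 * g\<^sup>2 + rho1 * g\<^sup>2
    + rho3 * g\<^sup>2 + vs * g\<^sup>2 + rho3 * g\<^sup>2 + tau * g\<^sup>2" unfolding Smax_def by (simp add: algebra_simps)
  then show ?thesis unfolding En_def
    using *[OF assms(1) pos(4)] *[OF assms(2) pos(1)] *[OF assms(3) pos(6)] *[OF assms(4) pos(2)] *[OF assms(5) pos(5)]
     *[OF assms(6) pos(1)] *[OF assms(7) pos(3)] *[OF assms(8) pos(10)] *[OF assms(9) pos(3)] *[OF assms(10) pos(11)]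
    by linarith
qed

lemma En_sqrt:
  fixes S Ph y Ps N W th p xi q :: real
  defines "g \<equiv> sqrt (En S Ph y Ps N W th p xi q / mu)"
  shows "En S Ph y Ps N W th p xi q \<le> mu * g\<^sup>2" "0 \<le> g" "g\<^sup>2 = En S Ph y Ps N W th p xi q / mu"
proof -
  have "0 \<le> En S Ph y Ps N W th p xi q / mu" using En_nonneg mu_pos by simp
  then show sq: "g\<^sup>2 = En S Ph y Ps N W th p xi q / mu" and "0 \<le> g"
    unfolding g_def by simp_all
  show "En S Ph y Ps N W th p xi q \<le> mu * g\<^sup>2" unfolding sq using mu_pos by simp
qed

definition cV where "cV kp Ph W = W + l * (Ph / kp)"
definition cX where "cX kp S y th = b * y - k * (S / kp) - gamma * th"
definition cY where "cY kp S N xi = be (1 / kp) * (k0 * N - gamma * xi) - 2 * l * k * (S / kp)"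

definition R2c where "R2c kp S Ph y Ps N W th p xi q =
  R2 p th Ps (cX kp S y th) (Ph / kp) (S / kp) q xi (cV kp Ph W) (cY kp S N xi)"

text \<open>For \<open>kp \<ge> k1\<close> the scaled variables are combinations of the energy
  variables with bounded coefficients, so no power of \<open>kp\<close> is lost in this
  direction.\<close>

lemma scaled_bounded_by_energy:
  assumes k1: "0 < k1"
  obtains M where "0 < M" "\<And>kp S Ph y Ps N W th p xi q. k1 \<le> kp \<Longrightarrow>
    R2c kp S Ph y Ps N W th p xi q \<le> M * En S Ph y Ps N W th p xi q"
proof -
  define A where "A = 1 + l\<^sup>2 * (1 / k1)\<^sup>2"
  define G where "G = 1 + 1 / k1 + l / k1 + (b + k / k1 + gamma) + (A * (k0 + gamma) + 2 * l * k / k1)"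
  have G0: "0 < G"
  proof -
    have "0 < A" unfolding A_def by (simp add: add_pos_nonneg)
    then have "0 < A * (k0 + gamma)" "0 < 2 * l * k / k1" "0 < l / k1" "0 < k / k1" "0 < 1 / k1"
      using pos k1 by auto
    then show ?thesis unfolding G_def using pos by linarith
  qed
  have "R2c kp S Ph y Ps N W th p xi q \<le> (10 * G\<^sup>2 / mu) * En S Ph y Ps N W th p xi q"
    if kp: "k1 \<le> kp" for kp S Ph y Ps N W th p xi q
  proof -
    define g where "g = sqrt (En S Ph y Ps N W th p xi q / mu)"
    note g = En_sqrt[of S Ph y Ps N W th p xi q, folded g_def]
    note co = En_bounds_components[OF g(1,2)]
    have kp0: "0 < kp" using kp k1 by simp
    have ik: "1 / kp \<le> 1 / k1" using kp k1 by (intro divide_left_mono) auto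
    have cm: "\<bar>c * x\<bar> \<le> c * B" if "\<bar>x\<bar> \<le> B" "0 < c" for c x B :: real
      using abs_mult_le[of c c x B] that by simp
    have div: "\<bar>x / kp\<bar> \<le> (1 / k1) * g" if "\<bar>x\<bar> \<le> g" for x
      using abs_mult_le[OF _ that, of "1 / kp" "1 / k1"] ik kp0 by simp
    have beA: "\<bar>be (1 / kp)\<bar> \<le> A"
    proof -
      have "(1 / kp)\<^sup>2 \<le> (1 / k1)\<^sup>2" using ik kp0 by (intro power_mono) auto
      then have "l\<^sup>2 * (1 / kp)\<^sup>2 \<le> l\<^sup>2 * (1 / k1)\<^sup>2" by (intro mult_left_mono) auto
      moreover have "0 \<le> l\<^sup>2 * (1 / kp)\<^sup>2" by simp
      ultimately show ?thesis unfolding be_def A_def by linarith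
    qed
    have A0: "0 < A" unfolding A_def by (simp add: add_pos_nonneg)
    have g0: "0 \<le> 1 / k1 * g" "0 \<le> l / k1 * g" "0 \<le> (b + k / k1 + gamma) * g"
      "0 \<le> (A * (k0 + gamma) + 2 * l * k / k1) * g" "0 \<le> g"
      using g(2) pos k1 A0 by (auto intro!: mult_nonneg_nonneg add_nonneg_nonneg)
    have Gg: "G * g = g + 1 / k1 * g + l / k1 * g + (b + k / k1 + gamma) * g + (A * (k0 + gamma) + 2 * l * k / k1) * g"
      unfolding G_def by (simp add: distrib_right)
    have ls: "\<bar>l * (Ph / kp)\<bar> \<le> l / k1 * g" using cm[OF div[OF co(2)] pos(8)] by simp
    have bV: "\<bar>cV kp Ph W\<bar> \<le> G * g" unfolding cV_def using ls co(6) g0 Gg by linarith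
    have bX: "\<bar>cX kp S y th\<bar> \<le> G * g"
    proof -
      have "\<bar>b * y\<bar> \<le> b * g" "\<bar>k * (S / kp)\<bar> \<le> k * (1 / k1 * g)" "\<bar>gamma * th\<bar> \<le> gamma * g"
        by (rule cm[OF co(3) pos(6)], rule cm[OF div[OF co(1)] pos(4)], rule cm[OF co(7) pos(9)])
      moreover have "(b + k / k1 + gamma) * g = b * g + k * (1 / k1 * g) + gamma * g" by (simp add: algebra_simps)
      ultimately show ?thesis unfolding cX_def using g0 Gg by linarith
    qed
    have bY: "\<bar>cY kp S N xi\<bar> \<le> G * g"
    proof -
      have "\<bar>k0 * N\<bar> \<le> k0 * g" "\<bar>gamma * xi\<bar> \<le> gamma * g"
        by (rule cm[OF co(5) pos(5)], rule cm[OF co(9) pos(9)])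
      then have "\<bar>k0 * N - gamma * xi\<bar> \<le> (k0 + gamma) * g" unfolding distrib_right by linarith
      then have "\<bar>be (1 / kp) * (k0 * N - gamma * xi)\<bar> \<le> A * ((k0 + gamma) * g)"
        by (rule abs_mult_le[OF beA])
      moreover have "\<bar>2 * l * k * (S / kp)\<bar> \<le> (2 * l * k) * (1 / k1 * g)"
        by (rule cm[OF div[OF co(1)]]) (use pos in simp)
      moreover have "(A * (k0 + gamma) + 2 * l * k / k1) * g = A * ((k0 + gamma) * g) + (2 * l * k) * (1 / k1 * g)"
        by (simp add: algebra_simps)
      ultimately show ?thesis unfolding cY_def using g0 Gg by linarith
    qed
    have b1: "\<bar>x\<bar> \<le> G * g" if "\<bar>x\<bar> \<le> g" for x using that g0 Gg by linarith
    have b2: "\<bar>x / kp\<bar> \<le> G * g" if "\<bar>x\<bar> \<le> g" for x using div[OF that] g0 Gg by linarith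
    have "R2c kp S Ph y Ps N W th p xi q \<le> 10 * (G * g)\<^sup>2"
      unfolding R2c_def R2_def
      using sq_le[OF b1[OF co(8)]] sq_le[OF b1[OF co(10)]] sq_le[OF b1[OF co(7)]] sq_le[OF b1[OF co(9)]] sq_le[OF b1[OF co(4)]]
        sq_le[OF bV] sq_le[OF bX] sq_le[OF bY] sq_le[OF b2[OF co(2)]] sq_le[OF b2[OF co(1)]] by linarith
    also have "\<dots> = (10 * G\<^sup>2 / mu) * En S Ph y Ps N W th p xi q"
      unfolding power_mult_distrib g(3) by simp
    finally show ?thesis .
  qed
  moreover have "0 < 10 * G\<^sup>2 / mu" using G0 mu_pos by simp
  ultimately show ?thesis using that by blast
qed

text \<open>This is where the decay rate originates: \<open>S\<close> and \<open>Ph\<close> enter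
  \<open>R2c\<close> only after division by \<open>kp\<close>, so recovering them costs
  \<open>kp\<^sup>2\<close>. The other variables are recovered with bounded constants.\<close>

lemma energy_bounded_by_scaled:
  assumes k1: "0 < k1"
  obtains M where "0 < M" "\<And>kp S Ph y Ps N W th p xi q. k1 \<le> kp \<Longrightarrow>
    En S Ph y Ps N W th p xi q \<le> M * kp\<^sup>2 * R2c kp S Ph y Ps N W th p xi q"
proof -
  \<comment> \<open>The summands bound, in this order, the unscaled variables, \<open>y\<close>
    recovered from \<open>X\<close>, \<open>N\<close> recovered from \<open>Y\<close>, and
    \<open>W\<close> recovered from \<open>V\<close>.\<close>
  define H0 where "H0 = 1 + (1 + k + gamma) / b + (1 + 2 * l * k + gamma) / k0 + (1 + l)"
  define H where "H = 1 + H0 / k1"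
  have H00: "1 \<le> H0" unfolding H0_def using pos by simp
  then have H: "1 \<le> H" unfolding H_def using k1 by simp
  have "En S Ph y Ps N W th p xi q \<le> (Smax * H\<^sup>2) * kp\<^sup>2 * R2c kp S Ph y Ps N W th p xi q"
    if kp: "k1 \<le> kp" for kp S Ph y Ps N W th p xi q
  proof -
    define V X Y where "V = cV kp Ph W" and "X = cX kp S y th" and "Y = cY kp S N xi"
    define r where "r = sqrt (R2c kp S Ph y Ps N W th p xi q)"
    have kp0: "0 < kp" using kp k1 by simp
    have R0: "0 \<le> R2c kp S Ph y Ps N W th p xi q" unfolding R2c_def R2_def by simp
    have r2: "r\<^sup>2 = R2c kp S Ph y Ps N W th p xi q" and r0: "0 \<le> r" unfolding r_def using R0 by simp_all
    have *: "\<bar>x\<bar> \<le> r" if "x\<^sup>2 \<le> R2c kp S Ph y Ps N W th p xi q" for x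
      using that r0 unfolding r2[symmetric] by (simp add: abs_le_square_iff[symmetric])
    have co: "\<bar>p\<bar> \<le> r" "\<bar>q\<bar> \<le> r" "\<bar>th\<bar> \<le> r" "\<bar>xi\<bar> \<le> r" "\<bar>Ps\<bar> \<le> r" "\<bar>V\<bar> \<le> r" "\<bar>X\<bar> \<le> r" "\<bar>Y\<bar> \<le> r"
      "\<bar>Ph / kp\<bar> \<le> r" "\<bar>S / kp\<bar> \<le> r"
      by (rule *, simp add: R2c_def R2_def V_def X_def Y_def)+
    have cm: "\<bar>c * x\<bar> \<le> c * B" if "\<bar>x\<bar> \<le> B" "0 < c" for c x B :: real
      using abs_mult_le[of c c x B] that by simp
    have h: "x \<le> H * (kp * r)" if "x \<le> c * r" "c \<le> H0" for x c
    proof -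
      have "c * r \<le> H0 * r" using that r0 by (intro mult_right_mono) auto
      also have "H0 * r = H0 / k1 * (k1 * r)" using k1 by simp
      also have "\<dots> \<le> H * (kp * r)" using H00 k1 kp r0
        by (intro mult_mono mult_right_mono) (auto simp: H_def)
      finally show ?thesis using that by simp
    qed
    have hk: "\<bar>x\<bar> \<le> H * (kp * r)" if "\<bar>x / kp\<bar> \<le> r" for x
    proof -
      have "\<bar>x\<bar> \<le> kp * r" using that kp0 by (simp add: abs_divide divide_le_eq mult.commute)
      also have "\<dots> = 1 * (kp * r)" by simp
      also have "\<dots> \<le> H * (kp * r)" using H kp0 r0 by (intro mult_right_mono) auto
      finally show ?thesis .
    qed
    have nn: "0 \<le> (1 + k + gamma) / b" "0 \<le> (1 + 2 * l * k + gamma) / k0" "0 < l" using pos by auto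
    have id: "\<bar>x\<bar> \<le> H * (kp * r)" if "\<bar>x\<bar> \<le> r" for x by (rule h[of _ 1]) (use that H00 in auto)
    have by': "\<bar>y\<bar> \<le> H * (kp * r)"
    proof (rule h)
      have "\<bar>k * (S / kp)\<bar> \<le> k * r" "\<bar>gamma * th\<bar> \<le> gamma * r" by (rule cm[OF co(10) pos(4)], rule cm[OF co(3) pos(9)])
      then have "\<bar>X + k * (S / kp) + gamma * th\<bar> \<le> (1 + k + gamma) * r" using co(7) unfolding distrib_right mult_1 by linarith
      moreover have "y = (X + k * (S / kp) + gamma * th) / b" using pos by (simp add: X_def cX_def)
      ultimately show "\<bar>y\<bar> \<le> (1 + k + gamma) / b * r" using pos by (simp add: abs_divide divide_right_mono)
      show "(1 + k + gamma) / b \<le> H0" unfolding H0_def using nn by linarith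
    qed
    have bN: "\<bar>N\<bar> \<le> H * (kp * r)"
    proof (rule h)
      define T where "T = Y + 2 * l * k * (S / kp)"
      have "\<bar>2 * l * k * (S / kp)\<bar> \<le> (2 * l * k) * r" by (rule cm[OF co(10)]) (use pos in simp)
      then have T: "\<bar>T\<bar> \<le> (1 + 2 * l * k) * r" unfolding T_def using co(8) unfolding distrib_right mult_1 by linarith
      have b1: "1 \<le> be (1 / kp)" by (rule be_ge_1)
      have "\<bar>1 / be (1 / kp)\<bar> \<le> 1" using b1 by simp
      from abs_mult_le[OF T this] have "\<bar>T / be (1 / kp)\<bar> \<le> (1 + 2 * l * k) * r" by simp
      moreover have "\<bar>gamma * xi\<bar> \<le> gamma * r" by (rule cm[OF co(4) pos(9)])
      ultimately have "\<bar>T / be (1 / kp) + gamma * xi\<bar> \<le> (1 + 2 * l * k + gamma) * r" unfolding distrib_right mult_1 by linarith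
      moreover have "N = (T / be (1 / kp) + gamma * xi) / k0" using pos b1 by (simp add: T_def Y_def cY_def)
      ultimately show "\<bar>N\<bar> \<le> (1 + 2 * l * k + gamma) / k0 * r" using pos by (simp add: abs_divide divide_right_mono)
      show "(1 + 2 * l * k + gamma) / k0 \<le> H0" unfolding H0_def using nn by linarith
    qed
    have bW: "\<bar>W\<bar> \<le> H * (kp * r)"
    proof (rule h)
      have "\<bar>l * (Ph / kp)\<bar> \<le> l * r" by (rule cm[OF co(9) pos(8)])
      moreover have "W = V - l * (Ph / kp)" by (simp add: V_def cV_def)
      ultimately show "\<bar>W\<bar> \<le> (1 + l) * r" using co(6) unfolding distrib_right mult_1 by linarith
      show "1 + l \<le> H0" unfolding H0_def using nn by linarith
    qed
    have "En S Ph y Ps N W th p xi q \<le> Smax * (H * (kp * r))\<^sup>2"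
      by (rule components_bound_En[OF hk[OF co(10)] hk[OF co(9)] by' id[OF co(5)] bN bW id[OF co(3)] id[OF co(1)] id[OF co(4)] id[OF co(2)]])
    also have "\<dots> = (Smax * H\<^sup>2) * kp\<^sup>2 * R2c kp S Ph y Ps N W th p xi q"
      unfolding power_mult_distrib r2 by simp
    finally show ?thesis .
  qed
  moreover have "0 < Smax * H\<^sup>2" using H Smax_pos by simp
  ultimately show ?thesis using that by blast
qed

section \<open>The modal equations and their Lyapunov function\<close>

definition FB where "FB c1 c2 c3 c4 c5 e p th Ps X f s q xi V Y =
    c1 * (vs * (p * th) + tau * (q * xi)) + c2 * (- rho3 * (th * Ps + xi * V))
    + c3 * (- (rho2 * (Ps * X) + rho1 * (V * Y))) + c4 * (al e * (X * f)) + c5 * (al e * rho1 * (s * f))"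

lemma FB_bounded:
  assumes e1: "0 < e1" and c: "0 \<le> c1" "0 \<le> c2" "0 \<le> c3" "0 \<le> c4" "0 \<le> c5"
  obtains M where "0 \<le> M" "\<And>e p th Ps X f s q xi V Y. 0 < e \<Longrightarrow> e \<le> e1 \<Longrightarrow>
    \<bar>FB c1 c2 c3 c4 c5 e p th Ps X f s q xi V Y\<bar> \<le> M * R2 p th Ps X f s q xi V Y"
proof -
  define A where "A = 1 + l\<^sup>2 * e1\<^sup>2"
  define M where "M = c1 * (vs + tau) + c2 * (2 * rho3) + c3 * (rho1 + rho2) + c4 * A + c5 * (A * rho1)"
  have A0: "0 \<le> A" unfolding A_def by simp
  have "0 \<le> M" unfolding M_def using c pos A0 by (intro add_nonneg_nonneg mult_nonneg_nonneg) auto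
  moreover have "\<bar>FB c1 c2 c3 c4 c5 e p th Ps X f s q xi V Y\<bar> \<le> M * R2 p th Ps X f s q xi V Y"
    if e: "0 < e" "e \<le> e1" for e p th Ps X f s q xi V Y
  proof -
    define R where "R = R2 p th Ps X f s q xi V Y"
    have "e\<^sup>2 \<le> e1\<^sup>2" using e by (intro power_mono) auto
    then have "l\<^sup>2 * e\<^sup>2 \<le> l\<^sup>2 * e1\<^sup>2" by (intro mult_left_mono) auto
    moreover have "0 \<le> l\<^sup>2 * e\<^sup>2" by simp
    ultimately have alA: "\<bar>al e\<bar> \<le> A" unfolding al_def A_def by linarith
    have pr: "\<bar>x * y\<bar> \<le> R" if "x\<^sup>2 + y\<^sup>2 \<le> R" for x y using mult_le_sq[OF that] by (simp add: abs_mult)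
    have P: "\<bar>p * th\<bar> \<le> R" "\<bar>q * xi\<bar> \<le> R" "\<bar>th * Ps\<bar> \<le> R" "\<bar>xi * V\<bar> \<le> R" "\<bar>Ps * X\<bar> \<le> R" "\<bar>V * Y\<bar> \<le> R" "\<bar>X * f\<bar> \<le> R" "\<bar>s * f\<bar> \<le> R"
      by (rule pr, simp add: R_def R2_def)+
    have cm: "\<bar>c * x\<bar> \<le> c * B" if "\<bar>x\<bar> \<le> B" "0 \<le> c" for c x B :: real
      using abs_mult_le[of c c x B] that by simp
    note p0 = pos[THEN less_imp_le]
    have t1: "\<bar>c1 * (vs * (p * th) + tau * (q * xi))\<bar> \<le> c1 * ((vs + tau) * R)"
    proof (rule cm[OF _ c(1)])
      show "\<bar>vs * (p * th) + tau * (q * xi)\<bar> \<le> (vs + tau) * R"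
        using cm[OF P(1) p0(10)] cm[OF P(2) p0(11)] unfolding distrib_right by linarith
    qed
    have t2: "\<bar>c2 * (- rho3 * (th * Ps + xi * V))\<bar> \<le> c2 * ((2 * rho3) * R)"
    proof (rule cm[OF _ c(2)])
      have "- rho3 * (th * Ps + xi * V) = - (rho3 * (th * Ps) + rho3 * (xi * V))" by (simp add: algebra_simps)
      then show "\<bar>- rho3 * (th * Ps + xi * V)\<bar> \<le> (2 * rho3) * R"
        using cm[OF P(3) p0(3)] cm[OF P(4) p0(3)] by linarith
    qed
    have t3: "\<bar>c3 * (- (rho2 * (Ps * X) + rho1 * (V * Y)))\<bar> \<le> c3 * ((rho1 + rho2) * R)"
    proof (rule cm[OF _ c(3)])
      show "\<bar>- (rho2 * (Ps * X) + rho1 * (V * Y))\<bar> \<le> (rho1 + rho2) * R"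
        using cm[OF P(5) p0(2)] cm[OF P(6) p0(1)] unfolding distrib_right by linarith
    qed
    have t4: "\<bar>c4 * (al e * (X * f))\<bar> \<le> c4 * (A * R)" by (rule cm[OF abs_mult_le[OF alA P(7)] c(4)])
    have "\<bar>al e * (rho1 * (s * f))\<bar> \<le> A * (rho1 * R)" by (rule abs_mult_le[OF alA cm[OF P(8) p0(1)]])
    then have t5: "\<bar>c5 * (al e * rho1 * (s * f))\<bar> \<le> c5 * (A * (rho1 * R))" unfolding mult.assoc by (rule cm[OF _ c(5)])
    have "M * R = c1 * ((vs + tau) * R) + c2 * ((2 * rho3) * R) + c3 * ((rho1 + rho2) * R) + c4 * (A * R) + c5 * (A * (rho1 * R))"
      unfolding M_def by (simp add: algebra_simps)
    then show ?thesis unfolding R_def[symmetric] FB_def using t1 t2 t3 t4 t5 by linarith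
  qed
  ultimately show ?thesis using that by blast
qed

text \<open>The forcing terms serve the comparison with approximate eigenvectors; decay uses the
  system without them. Derivatives are one-sided, as the difference quotients of the semigroup
  provide them, and continuity is therefore demanded separately.\<close>

definition odef where
  "odef kp S Ph y Ps N W th p xi q gS gPh gy gPs gN gW gth gp gxi gq \<longleftrightarrow>
    (\<forall>u \<in> {S, Ph, y, Ps, N, W, th, p, xi, q}. continuous_on {0::real..} u) \<and> (\<forall>t\<ge>0.
      (S has_real_derivative kp * Ph t + Ps t + l * W t + gS t) (at t within {t..})
    \<and> (Ph has_real_derivative (- k * kp * S t + l * k0 * N t - l * gamma * xi t) / rho1 + gPh t) (at t within {t..})
    \<and> (y has_real_derivative - kp * Ps t + gy t) (at t within {t..})
    \<and> (Ps has_real_derivative (b * kp * y t - k * S t - gamma * kp * th t) / rho2 + gPs t) (at t within {t..})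
    \<and> (N has_real_derivative - kp * W t - l * Ph t + gN t) (at t within {t..})
    \<and> (W has_real_derivative (k0 * kp * N t - l * k * S t - gamma * kp * xi t) / rho1 + gW t) (at t within {t..})
    \<and> (th has_real_derivative (kp * p t + gamma * kp * Ps t) / rho3 + gth t) (at t within {t..})
    \<and> (p has_real_derivative (- p t / varpi - kp * th t) / vs + gp t) (at t within {t..})
    \<and> (xi has_real_derivative (kp * q t + gamma * kp * W t + gamma * l * Ph t) / rho3 + gxi t) (at t within {t..})
    \<and> (q has_real_derivative (- q t / varpi - kp * xi t) / tau + gq t) (at t within {t..}))"

abbreviation "ode kp S Ph y Ps N W th p xi q \<equiv> odef kp S Ph y Ps N W th p xi q
  (\<lambda>_. 0) (\<lambda>_. 0) (\<lambda>_. 0) (\<lambda>_. 0) (\<lambda>_. 0) (\<lambda>_. 0) (\<lambda>_. 0) (\<lambda>_. 0) (\<lambda>_. 0) (\<lambda>_. 0)"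

text \<open>The undamped part is skew for the energy inner product: with the weights of
  \<open>En\<close> all coupling terms cancel in pairs. What remains is the damping of
  \<open>p\<close> and \<open>q\<close> and the work done by the forcing.\<close>

lemma En_deriv:
  assumes o: "odef kp S Ph y Ps N W th p xi q gS gPh gy gPs gN gW gth gp gxi gq" and t: "0 \<le> t"
  shows "((\<lambda>t. En (S t) (Ph t) (y t) (Ps t) (N t) (W t) (th t) (p t) (xi t) (q t)) has_real_derivative
    - (2 / varpi) * ((p t)\<^sup>2 + (q t)\<^sup>2)
    + 2 * (k * S t * gS t + rho1 * Ph t * gPh t + b * y t * gy t + rho2 * Ps t * gPs t + k0 * N t * gN t
       + rho1 * W t * gW t + rho3 * th t * gth t + vs * p t * gp t + rho3 * xi t * gxi t + tau * q t * gq t))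
    (at t within {t..})"
proof -
  have sq: "((\<lambda>t. a * (u t)\<^sup>2) has_real_derivative 2 * (u t * (a * d))) (at t within {t..})"
    if "(u has_real_derivative d) (at t within {t..})" for u a d
    by (auto intro!: derivative_eq_intros that)
  note D = o[unfolded odef_def, THEN conjunct2, rule_format, OF t]
  have "((\<lambda>t. En (S t) (Ph t) (y t) (Ps t) (N t) (W t) (th t) (p t) (xi t) (q t)) has_real_derivative
     2 * (S t * (k * (kp * Ph t + Ps t + l * W t + gS t)))
   + 2 * (Ph t * (rho1 * ((- k * kp * S t + l * k0 * N t - l * gamma * xi t) / rho1 + gPh t)))
   + 2 * (y t * (b * (- kp * Ps t + gy t)))
   + 2 * (Ps t * (rho2 * ((b * kp * y t - k * S t - gamma * kp * th t) / rho2 + gPs t)))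
   + 2 * (N t * (k0 * (- kp * W t - l * Ph t + gN t)))
   + 2 * (W t * (rho1 * ((k0 * kp * N t - l * k * S t - gamma * kp * xi t) / rho1 + gW t)))
   + 2 * (th t * (rho3 * ((kp * p t + gamma * kp * Ps t) / rho3 + gth t)))
   + 2 * (p t * (vs * ((- p t / varpi - kp * th t) / vs + gp t)))
   + 2 * (xi t * (rho3 * ((kp * q t + gamma * kp * W t + gamma * l * Ph t) / rho3 + gxi t)))
   + 2 * (q t * (tau * ((- q t / varpi - kp * xi t) / tau + gq t)))) (at t within {t..})"
    unfolding En_def by (intro DERIV_add sq D[THEN conjunct1] D[THEN conjunct2, THEN conjunct1]
      D[THEN conjunct2, THEN conjunct2, THEN conjunct1] D[THEN conjunct2, THEN conjunct2, THEN conjunct2, THEN conjunct1]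
      D[THEN conjunct2, THEN conjunct2, THEN conjunct2, THEN conjunct2, THEN conjunct1]
      D[THEN conjunct2, THEN conjunct2, THEN conjunct2, THEN conjunct2, THEN conjunct2, THEN conjunct1]
      D[THEN conjunct2, THEN conjunct2, THEN conjunct2, THEN conjunct2, THEN conjunct2, THEN conjunct2, THEN conjunct1]
      D[THEN conjunct2, THEN conjunct2, THEN conjunct2, THEN conjunct2, THEN conjunct2, THEN conjunct2, THEN conjunct2, THEN conjunct1]
      D[THEN conjunct2, THEN conjunct2, THEN conjunct2, THEN conjunct2, THEN conjunct2, THEN conjunct2, THEN conjunct2, THEN conjunct2, THEN conjunct1]
      D[THEN conjunct2, THEN conjunct2, THEN conjunct2, THEN conjunct2, THEN conjunct2, THEN conjunct2, THEN conjunct2, THEN conjunct2, THEN conjunct2])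
  moreover have ca: "a * (x / a + g) = x + a * g" if "0 < a" for a x g :: real
    using that by (simp add: distrib_left)
  have "2 * (S t * (k * (kp * Ph t + Ps t + l * W t + gS t)))
   + 2 * (Ph t * (rho1 * ((- k * kp * S t + l * k0 * N t - l * gamma * xi t) / rho1 + gPh t)))
   + 2 * (y t * (b * (- kp * Ps t + gy t)))
   + 2 * (Ps t * (rho2 * ((b * kp * y t - k * S t - gamma * kp * th t) / rho2 + gPs t)))
   + 2 * (N t * (k0 * (- kp * W t - l * Ph t + gN t)))
   + 2 * (W t * (rho1 * ((k0 * kp * N t - l * k * S t - gamma * kp * xi t) / rho1 + gW t)))
   + 2 * (th t * (rho3 * ((kp * p t + gamma * kp * Ps t) / rho3 + gth t)))
   + 2 * (p t * (vs * ((- p t / varpi - kp * th t) / vs + gp t)))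
   + 2 * (xi t * (rho3 * ((kp * q t + gamma * kp * W t + gamma * l * Ph t) / rho3 + gxi t)))
   + 2 * (q t * (tau * ((- q t / varpi - kp * xi t) / tau + gq t)))
   = - (2 / varpi) * ((p t)\<^sup>2 + (q t)\<^sup>2)
    + 2 * (k * S t * gS t + rho1 * Ph t * gPh t + b * y t * gy t + rho2 * Ps t * gPs t + k0 * N t * gN t
       + rho1 * W t * gW t + rho3 * th t * gth t + vs * p t * gp t + rho3 * xi t * gxi t + tau * q t * gq t)"
    unfolding ca[OF pos(1)] ca[OF pos(2)] ca[OF pos(3)] ca[OF pos(10)] ca[OF pos(11)]
    by (simp add: algebra_simps power2_eq_square)
  ultimately show ?thesis by (simp only:)
qed

lemma En_continuous:
  assumes o: "odef kp S Ph y Ps N W th p xi q gS gPh gy gPs gN gW gth gp gxi gq"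
  shows "continuous_on {0..} (\<lambda>t. En (S t) (Ph t) (y t) (Ps t) (N t) (W t) (th t) (p t) (xi t) (q t))"
proof -
  have c: "continuous_on {0..} u" if "u \<in> {S, Ph, y, Ps, N, W, th, p, xi, q}" for u
    using o that unfolding odef_def by blast
  show ?thesis unfolding En_def by (intro continuous_intros c) simp_all
qed

text \<open>Young's inequality with weight \<open>1 / T\<close> bounds the derivative by
  \<open>E / T + T * G\<close>. Over a time span \<open>T\<close> the exponential factor is then the
  absolute constant \<open>exp 1\<close>, and the forcing contributes
  \<open>T\<^sup>2 * G\<close>.\<close>

lemma forced_growth:
  assumes o: "odef kp S Ph y Ps N W th p xi q gS gPh gy gPs gN gW gth gp gxi gq" and T: "0 < T"
    and E0: "En (S 0) (Ph 0) (y 0) (Ps 0) (N 0) (W 0) (th 0) (p 0) (xi 0) (q 0) = 0"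
    and G: "\<And>t. 0 \<le> t \<Longrightarrow> En (gS t) (gPh t) (gy t) (gPs t) (gN t) (gW t) (gth t) (gp t) (gxi t) (gq t) \<le> G"
  shows "En (S T) (Ph T) (y T) (Ps T) (N T) (W T) (th T) (p T) (xi T) (q T) \<le> exp 1 * T\<^sup>2 * G"
proof -
  define E where "E t = En (S t) (Ph t) (y t) (Ps t) (N t) (W t) (th t) (p t) (xi t) (q t)" for t
  define E' where "E' t = - (2 / varpi) * ((p t)\<^sup>2 + (q t)\<^sup>2)
    + 2 * (k * S t * gS t + rho1 * Ph t * gPh t + b * y t * gy t + rho2 * Ps t * gPs t + k0 * N t * gN t
       + rho1 * W t * gW t + rho3 * th t * gth t + vs * p t * gp t + rho3 * xi t * gxi t + tau * q t * gq t)" for t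
  have dE: "(E has_real_derivative E' t) (at t within {t..})" if "0 \<le> t" for t
    using En_deriv[OF o that] unfolding E_def[abs_def] E'_def .
  have young: "2 * (a * u * g) \<le> (1 / T) * (a * u\<^sup>2) + T * (a * g\<^sup>2)" if "0 < a" for a u g
  proof -
    have "0 \<le> (u / T - g)\<^sup>2 * (T * a)" using T that by simp
    also have "(u / T - g)\<^sup>2 * (T * a) = (1 / T) * (a * u\<^sup>2) - 2 * (a * u * g) + T * (a * g\<^sup>2)"
      using T by (simp add: power2_eq_square field_simps)
    finally show ?thesis by linarith
  qed
  have E'le: "E' t \<le> E t / T + T * G" if "0 \<le> t" for t
  proof -
    have "E' t \<le> 2 * (k * S t * gS t) + 2 * (rho1 * Ph t * gPh t) + 2 * (b * y t * gy t) + 2 * (rho2 * Ps t * gPs t) + 2 * (k0 * N t * gN t)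
       + 2 * (rho1 * W t * gW t) + 2 * (rho3 * th t * gth t) + 2 * (vs * p t * gp t) + 2 * (rho3 * xi t * gxi t) + 2 * (tau * q t * gq t)"
      using pos unfolding E'_def by (simp add: algebra_simps)
    also have "\<dots> \<le> (1 / T) * E t + T * En (gS t) (gPh t) (gy t) (gPs t) (gN t) (gW t) (gth t) (gp t) (gxi t) (gq t)"
      unfolding E_def En_def distrib_left
      using young[OF pos(4), of "S t" "gS t"] young[OF pos(1), of "Ph t" "gPh t"] young[OF pos(6), of "y t" "gy t"]
        young[OF pos(2), of "Ps t" "gPs t"] young[OF pos(5), of "N t" "gN t"] young[OF pos(1), of "W t" "gW t"]
        young[OF pos(3), of "th t" "gth t"] young[OF pos(10), of "p t" "gp t"] young[OF pos(3), of "xi t" "gxi t"]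
        young[OF pos(11), of "q t" "gq t"] by linarith
    also have "\<dots> \<le> (1 / T) * E t + T * G" using G[OF that] T by (intro add_left_mono mult_left_mono) auto
    finally show ?thesis by simp
  qed
  have G0: "0 \<le> G" by (rule order_trans[OF En_nonneg G[OF order_refl]])
  define h where "h t = E t * exp (- t / T) - t * (T * G)" for t
  have "h T \<le> h 0"
  proof (rule right_derivative_nonpos_imp_le)
    have "continuous_on {0..} E" unfolding E_def[abs_def] by (rule En_continuous[OF o])
    then have "continuous_on {0..T} E" by (rule continuous_on_subset) auto
    then show "continuous_on {0..T} h" unfolding h_def[abs_def] using T by (intro continuous_intros) auto
    fix t assume t: "0 \<le> t" "t < T"
    show "(h has_real_derivative ((E' t - E t / T) * exp (- t / T) - T * G)) (at t within {t..})"
      unfolding h_def[abs_def] using T by (auto intro!: derivative_eq_intros dE[OF t(1)] simp: field_simps)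
    have "(E' t - E t / T) * exp (- t / T) \<le> (T * G) * exp (- t / T)"
      using E'le[OF t(1)] by (intro mult_right_mono) auto
    also have "\<dots> \<le> (T * G) * 1" using T G0 t by (intro mult_left_mono) auto
    finally show "(E' t - E t / T) * exp (- t / T) - T * G \<le> 0" by simp
  qed (use T in simp)
  then have "E T * exp (- 1) \<le> T\<^sup>2 * G" using T E0 by (simp add: h_def E_def power2_eq_square)
  then have "exp 1 * (E T * exp (- 1)) \<le> exp 1 * (T\<^sup>2 * G)" by (intro mult_left_mono) auto
  moreover have "exp 1 * (E T * exp (- 1)) = E T" by (simp add: exp_minus field_simps)
  ultimately show ?thesis by (simp only: E_def mult.assoc)
qed

text \<open>In the scaled variables each equation is \<open>kp\<close> times an expression in the
  scaled variables again, so the static derivatives above are the true ones up to this common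
  factor.\<close>

lemma FB_deriv:
  assumes o: "ode kp S Ph y Ps N W th p xi q" and t: "0 \<le> t" and kp: "0 < kp"
  defines "e \<equiv> 1 / kp" and "V \<equiv> \<lambda>t. cV kp (Ph t) (W t)" and "X \<equiv> \<lambda>t. cX kp (S t) (y t) (th t)"
    and "Y \<equiv> \<lambda>t. cY kp (S t) (N t) (xi t)" and "s \<equiv> \<lambda>t. S t / kp" and "f \<equiv> \<lambda>t. Ph t / kp"
  shows "((\<lambda>t. FB c1 c2 c3 c4 c5 e (p t) (th t) (Ps t) (X t) (f t) (s t) (q t) (xi t) (V t) (Y t))
    has_real_derivative kp * (c1 * dB1 e (p t) (th t) (Ps t) (q t) (xi t) (V t)
      + c2 * dB2 (p t) (th t) (Ps t) (X t) (q t) (xi t) (V t) (Y t)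
      + c3 * dB3 e (p t) (Ps t) (X t) (f t) (q t) (V t) (Y t)
      + c4 * dB4 e (p t) (Ps t) (X t) (f t) (s t) (V t) (Y t)
      + c5 * dB5 e (Ps t) (f t) (s t) (V t) (Y t))) (at t within {t..})"
proof -
  have D: "(S has_real_derivative kp * Ph t + Ps t + l * W t) (at t within {t..})"
    "(Ph has_real_derivative (- k * kp * S t + l * k0 * N t - l * gamma * xi t) / rho1) (at t within {t..})"
    "(y has_real_derivative - kp * Ps t) (at t within {t..})"
    "(Ps has_real_derivative (b * kp * y t - k * S t - gamma * kp * th t) / rho2) (at t within {t..})"
    "(N has_real_derivative - kp * W t - l * Ph t) (at t within {t..})"
    "(W has_real_derivative (k0 * kp * N t - l * k * S t - gamma * kp * xi t) / rho1) (at t within {t..})"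
    "(th has_real_derivative (kp * p t + gamma * kp * Ps t) / rho3) (at t within {t..})"
    "(p has_real_derivative (- p t / varpi - kp * th t) / vs) (at t within {t..})"
    "(xi has_real_derivative (kp * q t + gamma * kp * W t + gamma * l * Ph t) / rho3) (at t within {t..})"
    "(q has_real_derivative (- q t / varpi - kp * xi t) / tau) (at t within {t..})"
    using o t unfolding odef_def by simp_all
  have be0: "0 < be e" using be_ge_1[of e] by linarith
  have e: "e * kp = 1" "kp * e = 1" using kp by (simp_all add: e_def)
  have dp: "(p has_real_derivative kp * Dp e (p t) (th t)) (at t within {t..})"
    using D(8) kp pos by (rule_tac DERIV_cong) (auto simp: Dp_def e_def field_simps)
  have dq: "(q has_real_derivative kp * Dq e (q t) (xi t)) (at t within {t..})"
    using D(10) kp pos by (rule_tac DERIV_cong) (auto simp: Dq_def e_def field_simps)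
  have dth: "(th has_real_derivative kp * Dth (p t) (Ps t)) (at t within {t..})"
    using D(7) kp pos by (rule_tac DERIV_cong) (auto simp: Dth_def field_simps)
  have dxi: "(xi has_real_derivative kp * Dxi (q t) (V t)) (at t within {t..})"
    using D(9) kp pos by (rule_tac DERIV_cong) (auto simp: Dxi_def V_def cV_def field_simps)
  have dPs: "(Ps has_real_derivative kp * (X t / rho2)) (at t within {t..})"
    using D(4) kp pos by (rule_tac DERIV_cong) (auto simp: X_def cX_def field_simps)
  have ds: "(s has_real_derivative kp * Ds e (f t) (Ps t) (V t)) (at t within {t..})"
    unfolding s_def
  proof (rule DERIV_cong[OF DERIV_cdivide[OF D(1)]])
    show "(kp * Ph t + Ps t + l * W t) / kp = kp * Ds e (f t) (Ps t) (V t)"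
      using kp by (simp add: Ds_def al_def e_def f_def V_def cV_def field_simps power2_eq_square)
  qed
  \<comment> \<open>The combination entering the equation of \<open>Ph\<close> is expressed by
    \<open>Y\<close> and \<open>s\<close>. Substituting it turns the coefficient of \<open>s\<close>
    into \<open>al e / be e\<close>, because
    \<open>al e = be e - 2 * (l\<^sup>2 * e\<^sup>2)\<close>.\<close>
  have kN: "k0 * N t - gamma * xi t = (Y t + 2 * l * k * s t) / be e"
    using be0 by (simp add: Y_def cY_def s_def e_def field_simps)
  have df: "(f has_real_derivative kp * Df e (s t) (Y t)) (at t within {t..})"
    unfolding f_def
  proof (rule DERIV_cong[OF DERIV_cdivide[OF D(2)]])
    have ab: "al e = be e - 2 * (l\<^sup>2 * e\<^sup>2)" by (simp add: al_def be_def)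
    have "kp * Df e (s t) (Y t) = (kp * (- (al e / be e) * k * s t + e\<^sup>2 * l * Y t / be e)) / rho1"
      by (simp add: Df_def)
    also have "kp * (- (al e / be e) * k * s t + e\<^sup>2 * l * Y t / be e)
        = kp * (- k * s t + e\<^sup>2 * l * ((Y t + 2 * l * k * s t) / be e))"
      unfolding ab using be0 by (simp add: field_simps power2_eq_square)
    also have "\<dots> = (- k * kp * S t + l * (k0 * N t - gamma * xi t)) / kp"
      unfolding kN[symmetric] using kp by (simp add: s_def e_def field_simps power2_eq_square)
    finally show "(- k * kp * S t + l * k0 * N t - l * gamma * xi t) / rho1 / kp = kp * Df e (s t) (Y t)"
      by (simp add: algebra_simps)
  qed
  have dV: "(V has_real_derivative kp * (Y t / rho1)) (at t within {t..})"
    unfolding V_def cV_def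
  proof (rule DERIV_cong[OF DERIV_add[OF D(6) DERIV_cmult[OF DERIV_cdivide[OF D(2)]]]])
    have Yt: "kp * Y t = kp * (k0 * N t - gamma * xi t) + l\<^sup>2 * (k0 * N t - gamma * xi t) / kp - 2 * l * k * S t"
      using kp by (simp add: Y_def cY_def be_def field_simps power2_eq_square)
    have "kp * (Y t / rho1) = (kp * (k0 * N t - gamma * xi t) + l\<^sup>2 * (k0 * N t - gamma * xi t) / kp - 2 * l * k * S t) / rho1"
      unfolding Yt[symmetric] by simp
    also have "\<dots> = ((k0 * kp * N t - l * k * S t - gamma * kp * xi t)
        + l * ((- k * kp * S t + l * k0 * N t - l * gamma * xi t) / kp)) / rho1"
      using kp by (intro arg_cong[where f = "\<lambda>x. x / rho1"]) (simp add: field_simps power2_eq_square)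
    finally show "(k0 * kp * N t - l * k * S t - gamma * kp * xi t) / rho1
      + l * ((- k * kp * S t + l * k0 * N t - l * gamma * xi t) / rho1 / kp) = kp * (Y t / rho1)"
      by (simp add: add_divide_distrib mult.commute)
  qed
  have dX: "(X has_real_derivative kp * DX e (f t) (Ps t) (V t) (p t)) (at t within {t..})"
    unfolding X_def cX_def s_def[symmetric]
  proof (rule DERIV_cong[OF DERIV_diff[OF DERIV_diff[OF DERIV_cmult[OF D(3)] DERIV_cmult[OF ds[unfolded s_def]]] DERIV_cmult[OF dth]]])
    show "b * (- kp * Ps t) - k * (kp * Ds e (f t) (Ps t) (V t)) - gamma * (kp * Dth (p t) (Ps t)) = kp * DX e (f t) (Ps t) (V t) (p t)"
      by (simp add: DX_def algebra_simps)
  qed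
  have dY: "(Y has_real_derivative kp * DY e (f t) (Ps t) (V t) (q t)) (at t within {t..})"
    unfolding Y_def cY_def
  proof (rule DERIV_cong[OF DERIV_diff[OF DERIV_cmult[OF DERIV_diff[OF DERIV_cmult[OF D(5)] DERIV_cmult[OF dxi]]] DERIV_cmult[OF ds[unfolded s_def]]]])
    have eq: "- kp * W t - l * Ph t = kp * (- V t)" using kp by (simp add: V_def cV_def field_simps)
    show "be (1 / kp) * (k0 * (- kp * W t - l * Ph t) - gamma * (kp * Dxi (q t) (V t)))
      - 2 * l * k * (kp * Ds e (f t) (Ps t) (V t)) = kp * DY e (f t) (Ps t) (V t) (q t)"
      unfolding eq by (simp add: DY_def e_def algebra_simps)
  qed
  show ?thesis
    unfolding FB_def
    by (rule DERIV_cong, (rule DERIV_add DERIV_cmult DERIV_minus DERIV_mult dp dq dth dxi dPs ds df dV dX dY)+)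
      (simp add: dB1_def dB2_def dB3_def dB4_def dB5_def algebra_simps)
qed

text \<open>The sum of \<open>A * E\<close> and \<open>B / kp\<close> decreases at least at the rate
  \<open>R\<close>, which dominates \<open>E / (M1 * kp\<^sup>2)\<close>. This leaves room for the
  additional term \<open>\<kappa> * (t * E)\<close>; boundedness of the resulting functional gives
  decay like \<open>1 / t\<close>.\<close>

lemma mode_decay:
  assumes k1: "0 < k1" and del: "0 < del"
  obtains C where "0 < C" "\<And>kp S Ph y Ps N W th p xi q t. k1 \<le> kp \<Longrightarrow> del \<le> \<bar>1 - l\<^sup>2 * (1 / kp)\<^sup>2\<bar> \<Longrightarrow>
    ode kp S Ph y Ps N W th p xi q \<Longrightarrow> 0 < t \<Longrightarrow>
    En (S t) (Ph t) (y t) (Ps t) (N t) (W t) (th t) (p t) (xi t) (q t)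
      \<le> C * kp\<^sup>2 / t * En (S 0) (Ph 0) (y 0) (Ps 0) (N 0) (W 0) (th 0) (p 0) (xi 0) (q 0)"
proof -
  have e1: "0 < 1 / k1" using k1 by simp
  obtain c1 c2 c3 c4 c5 C where c: "0 \<le> c1" "0 \<le> c2" "0 \<le> c3" "0 \<le> c4" "0 \<le> c5" "0 \<le> C"
    and lyap: "\<And>e p th Ps X f s q xi V Y. 0 < e \<Longrightarrow> e \<le> 1 / k1 \<Longrightarrow> del \<le> \<bar>al e\<bar> \<Longrightarrow>
      c1 * dB1 e p th Ps q xi V + c2 * dB2 p th Ps X q xi V Y + c3 * dB3 e p Ps X f q V Y
      + c4 * dB4 e p Ps X f s V Y + c5 * dB5 e Ps f s V Y
      \<le> - R2 p th Ps X f s q xi V Y + C * (p\<^sup>2 + q\<^sup>2)"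
    using lyapunov_static[OF e1 del] by blast
  obtain M1 where M1: "0 < M1" "\<And>kp S Ph y Ps N W th p xi q. k1 \<le> kp \<Longrightarrow>
    En S Ph y Ps N W th p xi q \<le> M1 * kp\<^sup>2 * R2c kp S Ph y Ps N W th p xi q"
    using energy_bounded_by_scaled[OF k1] by blast
  obtain M2 where M2: "0 < M2" "\<And>kp S Ph y Ps N W th p xi q. k1 \<le> kp \<Longrightarrow>
    R2c kp S Ph y Ps N W th p xi q \<le> M2 * En S Ph y Ps N W th p xi q"
    using scaled_bounded_by_energy[OF k1] by blast
  obtain M3 where M3: "0 \<le> M3" "\<And>e p th Ps X f s q xi V Y. 0 < e \<Longrightarrow> e \<le> 1 / k1 \<Longrightarrow>
    \<bar>FB c1 c2 c3 c4 c5 e p th Ps X f s q xi V Y\<bar> \<le> M3 * R2 p th Ps X f s q xi V Y"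
    using FB_bounded[OF e1 c(1-5)] by blast
  define F where "F = M3 * M2 / k1"
  \<comment> \<open>The first summand makes the dissipation of \<open>A * E\<close> cover the
    remainder \<open>C * (p\<^sup>2 + q\<^sup>2)\<close>; the second makes \<open>A * E\<close>
    dominate the multipliers divided by \<open>kp\<close>.\<close>
  define A where "A = C * varpi / 2 + F"
  have F0: "0 \<le> F" using M3 M2 k1 by (simp add: F_def)
  have A0: "0 \<le> A" using F0 c pos by (simp add: A_def)
  have "En (S t) (Ph t) (y t) (Ps t) (N t) (W t) (th t) (p t) (xi t) (q t)
      \<le> (M1 * (A + F + 1)) * kp\<^sup>2 / t * En (S 0) (Ph 0) (y 0) (Ps 0) (N 0) (W 0) (th 0) (p 0) (xi 0) (q 0)"
    if kp: "k1 \<le> kp" and adm: "del \<le> \<bar>1 - l\<^sup>2 * (1 / kp)\<^sup>2\<bar>"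
      and o: "ode kp S Ph y Ps N W th p xi q" and t: "0 < t" for kp S Ph y Ps N W th p xi q t
  proof -
    have kp0: "0 < kp" using kp k1 by simp
    have e: "0 < 1 / kp" "1 / kp \<le> 1 / k1" using kp k1 kp0 by (auto intro: divide_left_mono)
    define E where "E t = En (S t) (Ph t) (y t) (Ps t) (N t) (W t) (th t) (p t) (xi t) (q t)" for t
    define R where "R t = R2c kp (S t) (Ph t) (y t) (Ps t) (N t) (W t) (th t) (p t) (xi t) (q t)" for t
    define B where "B t = FB c1 c2 c3 c4 c5 (1 / kp) (p t) (th t) (Ps t) (cX kp (S t) (y t) (th t)) (Ph t / kp) (S t / kp)
      (q t) (xi t) (cV kp (Ph t) (W t)) (cY kp (S t) (N t) (xi t))" for t
    define B' where "B' t = c1 * dB1 (1 / kp) (p t) (th t) (Ps t) (q t) (xi t) (cV kp (Ph t) (W t))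
      + c2 * dB2 (p t) (th t) (Ps t) (cX kp (S t) (y t) (th t)) (q t) (xi t) (cV kp (Ph t) (W t)) (cY kp (S t) (N t) (xi t))
      + c3 * dB3 (1 / kp) (p t) (Ps t) (cX kp (S t) (y t) (th t)) (Ph t / kp) (q t) (cV kp (Ph t) (W t)) (cY kp (S t) (N t) (xi t))
      + c4 * dB4 (1 / kp) (p t) (Ps t) (cX kp (S t) (y t) (th t)) (Ph t / kp) (S t / kp) (cV kp (Ph t) (W t)) (cY kp (S t) (N t) (xi t))
      + c5 * dB5 (1 / kp) (Ps t) (Ph t / kp) (S t / kp) (cV kp (Ph t) (W t)) (cY kp (S t) (N t) (xi t))" for t
    define d where "d t = (p t)\<^sup>2 + (q t)\<^sup>2" for t
    have d0: "0 \<le> d t" for t by (simp add: d_def)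
    have E0: "0 \<le> E t" for t unfolding E_def by (rule En_nonneg)
    have dE: "(E has_real_derivative - (2 / varpi) * d t) (at t within {t..})" if "0 \<le> t" for t
      using En_deriv[OF o that] unfolding E_def[abs_def] d_def by simp
    have dB: "(B has_real_derivative kp * B' t) (at t within {t..})" if "0 \<le> t" for t
      using FB_deriv[OF o that kp0] unfolding B_def[abs_def] B'_def .
    have B'le: "B' t \<le> - R t + C * d t" for t
      unfolding B'_def R_def R2c_def d_def by (rule lyap[OF e]) (use adm in \<open>simp add: al_def\<close>)
    have ER: "E t \<le> M1 * kp\<^sup>2 * R t" for t unfolding E_def R_def by (rule M1(2)[OF kp])
    have BE: "\<bar>B t / kp\<bar> \<le> F * E t" for t
    proof -
      have "\<bar>B t\<bar> \<le> M3 * R t" unfolding B_def R_def R2c_def by (rule M3(2)[OF e])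
      also have "\<dots> \<le> M3 * (M2 * E t)" unfolding R_def E_def by (rule mult_left_mono[OF M2(2)[OF kp] M3(1)])
      finally have "\<bar>B t\<bar> \<le> M3 * (M2 * E t)" .
      moreover have "\<bar>1 / kp\<bar> \<le> 1 / k1" using e by simp
      ultimately have "\<bar>B t * (1 / kp)\<bar> \<le> M3 * (M2 * E t) * (1 / k1)" by (rule abs_mult_le)
      then show ?thesis by (simp add: F_def)
    qed
    \<comment> \<open>Here \<open>\<kappa>\<close> is not the wave number but the largest factor for
      which \<open>ER\<close> gives \<open>\<kappa> * E \<le> R\<close>.\<close>
    define \<kappa> where "\<kappa> = 1 / (M1 * kp\<^sup>2)"
    have \<kappa>0: "0 < \<kappa>" using M1 kp0 by (simp add: \<kappa>_def)
    define h where "h t = A * E t + (1 / kp) * B t + \<kappa> * (t * E t)" for t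
    have "h t \<le> h 0"
    proof (rule right_derivative_nonpos_imp_le)
      have cont: "continuous_on {0..t} u" if "u \<in> {S, Ph, y, Ps, N, W, th, p, xi, q}" for u
      proof -
        have "continuous_on {0..} u" using o that unfolding odef_def by blast
        then show ?thesis by (rule continuous_on_subset) auto
      qed
      have "continuous_on {0..t} E" using En_continuous[OF o] unfolding E_def[abs_def]
        by (rule continuous_on_subset) auto
      moreover have "continuous_on {0..t} B"
        unfolding B_def[abs_def] FB_def cX_def cV_def cY_def using kp0
        by (intro continuous_intros cont) auto
      ultimately show "continuous_on {0..t} h" unfolding h_def[abs_def] by (intro continuous_intros)
      fix r assume r: "0 \<le> r" "r < t"
      show "(h has_real_derivative A * (- (2 / varpi) * d r) + (1 / kp) * (kp * B' r)
          + \<kappa> * (E r + r * (- (2 / varpi) * d r))) (at r within {r..})"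
        unfolding h_def[abs_def]
        by (auto intro!: derivative_eq_intros dE[OF r(1)] dB[OF r(1)] simp: algebra_simps)
      have "A * (2 / varpi) \<ge> C" using pos F0 by (simp add: A_def field_simps)
      then have "C * d r \<le> A * (2 / varpi) * d r" using d0 by (intro mult_right_mono)
      moreover have "\<kappa> * E r \<le> R r"
        using ER[of r] M1 kp0 by (simp add: \<kappa>_def pos_divide_le_eq mult.commute)
      moreover have "0 \<le> \<kappa> * (r * ((2 / varpi) * d r))" using \<kappa>0 r pos d0 by (intro mult_nonneg_nonneg) auto
      moreover have "(1 / kp) * (kp * B' r) = B' r" using kp0 by simp
      ultimately show "A * (- (2 / varpi) * d r) + (1 / kp) * (kp * B' r) + \<kappa> * (E r + r * (- (2 / varpi) * d r)) \<le> 0"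
        using B'le[of r] by (simp add: algebra_simps)
    qed (use t in simp)
    moreover have "h 0 \<le> (A + F + 1) * E 0"
    proof -
      have "h 0 = A * E 0 + B 0 / kp" by (simp add: h_def)
      moreover have "(A + F + 1) * E 0 = A * E 0 + F * E 0 + E 0" by (simp add: algebra_simps)
      ultimately show ?thesis using BE[of 0] E0[of 0] by linarith
    qed
    moreover have "\<kappa> * (t * E t) \<le> h t"
    proof -
      have "F * E t \<le> A * E t" using c pos E0 by (intro mult_right_mono) (auto simp: A_def)
      moreover have "h t = A * E t + B t / kp + \<kappa> * (t * E t)" by (simp add: h_def)
      ultimately show ?thesis using BE[of t] by linarith
    qed
    ultimately have "\<kappa> * (t * E t) \<le> (A + F + 1) * E 0" by linarith
    then have "E t \<le> (A + F + 1) * E 0 * (M1 * kp\<^sup>2) / t"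
      using M1 kp0 t by (simp add: \<kappa>_def field_simps)
    then show ?thesis unfolding E_def by (simp add: field_simps)
  qed
  moreover have "0 < M1 * (A + F + 1)" using M1 A0 F0 by simp
  ultimately show ?thesis using that by blast
qed

end

section \<open>Complex coefficient vectors and their trajectories\<close>

lemma sum_lessThan_10: "(\<Sum>i<10. f i) = f 0 + f 1 + f 2 + f 3 + f 4 + f 5 + f 6 + f 7 + f 8 + f (9::nat)"
  for f :: "nat \<Rightarrow> 'a::comm_monoid_add"
  by (simp add: eval_nat_numeral add.assoc)

lemma less_10_cases:
  fixes i :: nat
  assumes "i < 10"
  obtains "i = 0" | "i = 1" | "i = 2" | "i = 3" | "i = 4" | "i = 5" | "i = 6" | "i = 7" | "i = 8" | "i = 9"
  using assms by (auto simp: eval_nat_numeral less_Suc_eq)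

context bmc_coeffs
begin

definition wt :: "nat \<Rightarrow> real" where
  "wt i = [k, rho1, b, rho2, k0, rho1, rho3, vs, rho3, tau] ! i"

lemma wt_simps: "wt 0 = k" "wt 1 = rho1" "wt 2 = b" "wt 3 = rho2" "wt 4 = k0" "wt 5 = rho1" "wt 6 = rho3"
  "wt 7 = vs" "wt 8 = rho3" "wt 9 = tau"
  by (simp_all add: wt_def)

lemma wt_pos: "i < 10 \<Longrightarrow> 0 < wt i"
  by (erule less_10_cases) (simp_all only: wt_simps pos)

definition EC :: "(nat \<Rightarrow> complex) \<Rightarrow> real" where
  "EC u = (\<Sum>i<10. wt i * (cmod (u i))\<^sup>2)"

text \<open>The action of \<open>B\<close> on the coefficients, at wave number \<open>kp\<close>, of the energy variables
  \<open>\<phi>\<^sub>x + \<psi> + l w, \<Phi>, \<psi>\<^sub>x, \<Psi>, w\<^sub>x - l \<phi>, W, \<theta>, p, \<xi>, q\<close>, in this order.\<close>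
definition opA :: "real \<Rightarrow> (nat \<Rightarrow> complex) \<Rightarrow> nat \<Rightarrow> complex" where
  "opA kp u i = (let c = complex_of_real in
    [c kp * u 1 + u 3 + c l * u 5,
     (c (- k * kp) * u 0 + c (l * k0) * u 4 - c (l * gamma) * u 8) / c rho1,
     - c kp * u 3,
     (c (b * kp) * u 2 - c k * u 0 - c (gamma * kp) * u 6) / c rho2,
     - c kp * u 5 - c l * u 1,
     (c (k0 * kp) * u 4 - c (l * k) * u 0 - c (gamma * kp) * u 8) / c rho1,
     (c kp * u 7 + c (gamma * kp) * u 3) / c rho3,
     (- u 7 / c varpi - c kp * u 6) / c vs,
     (c kp * u 9 + c (gamma * kp) * u 5 + c (gamma * l) * u 1) / c rho3,
     (- u 9 / c varpi - c kp * u 8) / c tau] ! i)"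

lemma opA_simps:
  "opA kp u 0 = complex_of_real kp * u 1 + u 3 + complex_of_real l * u 5"
  "opA kp u 1 = (complex_of_real (- k * kp) * u 0 + complex_of_real (l * k0) * u 4 - complex_of_real (l * gamma) * u 8) / complex_of_real rho1"
  "opA kp u 2 = - complex_of_real kp * u 3"
  "opA kp u 3 = (complex_of_real (b * kp) * u 2 - complex_of_real k * u 0 - complex_of_real (gamma * kp) * u 6) / complex_of_real rho2"
  "opA kp u 4 = - complex_of_real kp * u 5 - complex_of_real l * u 1"
  "opA kp u 5 = (complex_of_real (k0 * kp) * u 4 - complex_of_real (l * k) * u 0 - complex_of_real (gamma * kp) * u 8) / complex_of_real rho1"
  "opA kp u 6 = (complex_of_real kp * u 7 + complex_of_real (gamma * kp) * u 3) / complex_of_real rho3"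
  "opA kp u 7 = (- u 7 / complex_of_real varpi - complex_of_real kp * u 6) / complex_of_real vs"
  "opA kp u 8 = (complex_of_real kp * u 9 + complex_of_real (gamma * kp) * u 5 + complex_of_real (gamma * l) * u 1) / complex_of_real rho3"
  "opA kp u 9 = (- u 9 / complex_of_real varpi - complex_of_real kp * u 8) / complex_of_real tau"
  by (simp_all add: opA_def Let_def)

abbreviation "EnF f u \<equiv> En (f (u 0)) (f (u 1)) (f (u 2)) (f (u 3)) (f (u 4)) (f (u 5)) (f (u 6)) (f (u 7)) (f (u 8)) (f (u (9::nat)))"

lemma EC_En: "EC u = EnF Re u + EnF Im u"
  unfolding EC_def sum_lessThan_10 wt_simps En_def cmod_power2 by (simp add: algebra_simps)

lemma EC_nonneg: "0 \<le> EC u" unfolding EC_En using En_nonneg by (intro add_nonneg_nonneg)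

lemma EC_scale: "EC (\<lambda>i. z * u i) = (cmod z)\<^sup>2 * EC u"
  unfolding EC_def sum_distrib_left by (intro sum.cong) (auto simp: norm_mult power_mult_distrib)

lemma EC_cong: "(\<And>i. i < 10 \<Longrightarrow> u i = v i) \<Longrightarrow> EC u = EC v"
  unfolding EC_def by (intro sum.cong) auto

lemma EC_le_2: "EC u \<le> 2 * EC v + 2 * EC (\<lambda>i. u i - v i)"
proof -
  have *: "(cmod a)\<^sup>2 \<le> 2 * (cmod b)\<^sup>2 + 2 * (cmod (a - b))\<^sup>2" for a b
  proof -
    have "cmod a \<le> cmod b + cmod (a - b)" using norm_triangle_ineq[of b "a - b"] by simp
    then have "(cmod a)\<^sup>2 \<le> (cmod b + cmod (a - b))\<^sup>2" by (intro power_mono) auto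
    also have "\<dots> \<le> 2 * (cmod b)\<^sup>2 + 2 * (cmod (a - b))\<^sup>2"
      using sum_squares_bound[of "cmod b" "cmod (a - b)"] by (simp add: power2_sum)
    finally show ?thesis .
  qed
  have "EC u \<le> (\<Sum>i<10. wt i * (2 * (cmod (v i))\<^sup>2 + 2 * (cmod (u i - v i))\<^sup>2))"
    unfolding EC_def by (intro sum_mono mult_left_mono *) (simp add: wt_pos less_imp_le)
  also have "\<dots> = 2 * EC v + 2 * EC (\<lambda>i. u i - v i)"
    unfolding EC_def by (simp add: distrib_left sum.distrib sum_distrib_left mult.left_commute)
  finally show ?thesis .
qed

text \<open>A right derivative gives continuity from the right only, so two-sided continuity is a
  separate clause. Entries from index 10 on are irrelevant.\<close>

definition traj :: "real \<Rightarrow> (real \<Rightarrow> nat \<Rightarrow> complex) \<Rightarrow> bool" where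
  "traj kp u \<longleftrightarrow> (\<forall>i<10. continuous_on {0..} (\<lambda>t. u t i) \<and>
     (\<forall>t\<ge>0. ((\<lambda>t. u t i) has_vector_derivative opA kp (u t) i) (at t within {t..})))"

definition trajf :: "real \<Rightarrow> (real \<Rightarrow> nat \<Rightarrow> complex) \<Rightarrow> (real \<Rightarrow> nat \<Rightarrow> complex) \<Rightarrow> bool" where
  "trajf kp u g \<longleftrightarrow> (\<forall>i<10. continuous_on {0..} (\<lambda>t. u t i) \<and>
     (\<forall>t\<ge>0. ((\<lambda>t. u t i) has_vector_derivative opA kp (u t) i + g t i) (at t within {t..})))"

abbreviation "odeF f kp u g \<equiv> odef kp (\<lambda>t. f (u t 0)) (\<lambda>t. f (u t 1)) (\<lambda>t. f (u t 2)) (\<lambda>t. f (u t 3)) (\<lambda>t. f (u t 4))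
    (\<lambda>t. f (u t 5)) (\<lambda>t. f (u t 6)) (\<lambda>t. f (u t 7)) (\<lambda>t. f (u t 8)) (\<lambda>t. f (u t (9::nat)))
    (\<lambda>t. f (g t 0)) (\<lambda>t. f (g t 1)) (\<lambda>t. f (g t 2)) (\<lambda>t. f (g t 3)) (\<lambda>t. f (g t 4))
    (\<lambda>t. f (g t 5)) (\<lambda>t. f (g t 6)) (\<lambda>t. f (g t 7)) (\<lambda>t. f (g t 8)) (\<lambda>t. f (g t (9::nat)))"

text \<open>The coefficients of \<open>opA\<close> are real, so real and imaginary parts solve the
  real system independently.\<close>

lemma trajf_odef:
  assumes t: "trajf kp u g"
  shows "odeF Re kp u g" "odeF Im kp u g"
proof -
  have c: "continuous_on {0..} (\<lambda>t. Re (u t i))" "continuous_on {0..} (\<lambda>t. Im (u t i))" if "i < 10" for i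
    using t that unfolding trajf_def by (auto intro!: continuous_intros)
  have dR: "((\<lambda>t. Re (u t i)) has_real_derivative Re (opA kp (u t) i + g t i)) (at t within {t..})"
    and dI: "((\<lambda>t. Im (u t i)) has_real_derivative Im (opA kp (u t) i + g t i)) (at t within {t..})"
    if "i < 10" "0 \<le> t" for i t
  proof -
    have "((\<lambda>t. u t i) has_vector_derivative opA kp (u t) i + g t i) (at t within {t..})"
      using t that by (simp add: trajf_def)
    from bounded_linear.has_vector_derivative[OF bounded_linear_Re this]
      bounded_linear.has_vector_derivative[OF bounded_linear_Im this]
    show "((\<lambda>t. Re (u t i)) has_real_derivative Re (opA kp (u t) i + g t i)) (at t within {t..})"
      "((\<lambda>t. Im (u t i)) has_real_derivative Im (opA kp (u t) i + g t i)) (at t within {t..})"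
      by (simp_all only: has_real_derivative_iff_has_vector_derivative)
  qed
  show "odeF Re kp u g"
    unfolding odef_def
  proof (intro conjI allI impI)
    show "\<forall>v\<in>{\<lambda>t. Re (u t 0), \<lambda>t. Re (u t 1), \<lambda>t. Re (u t 2), \<lambda>t. Re (u t 3), \<lambda>t. Re (u t 4), \<lambda>t. Re (u t 5),
       \<lambda>t. Re (u t 6), \<lambda>t. Re (u t 7), \<lambda>t. Re (u t 8), \<lambda>t. Re (u t 9)}. continuous_on {0..} v"
      using c(1) by simp
    fix t :: real assume t0: "0 \<le> t"
    note d = dR[OF _ t0]
    show "((\<lambda>t. Re (u t 0)) has_real_derivative kp * Re (u t 1) + Re (u t 3) + l * Re (u t 5) + Re (g t 0)) (at t within {t..})"
      using d[of 0] by (simp add: opA_simps del: One_nat_def)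
    show "((\<lambda>t. Re (u t 1)) has_real_derivative (- k * kp * Re (u t 0) + l * k0 * Re (u t 4) - l * gamma * Re (u t 8)) / rho1 + Re (g t 1)) (at t within {t..})"
      using d[of 1] by (simp add: opA_simps del: One_nat_def)
    show "((\<lambda>t. Re (u t 2)) has_real_derivative - kp * Re (u t 3) + Re (g t 2)) (at t within {t..})"
      using d[of 2] by (simp add: opA_simps del: One_nat_def)
    show "((\<lambda>t. Re (u t 3)) has_real_derivative (b * kp * Re (u t 2) - k * Re (u t 0) - gamma * kp * Re (u t 6)) / rho2 + Re (g t 3)) (at t within {t..})"
      using d[of 3] by (simp add: opA_simps del: One_nat_def)
    show "((\<lambda>t. Re (u t 4)) has_real_derivative - kp * Re (u t 5) - l * Re (u t 1) + Re (g t 4)) (at t within {t..})"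
      using d[of 4] by (simp add: opA_simps del: One_nat_def)
    show "((\<lambda>t. Re (u t 5)) has_real_derivative (k0 * kp * Re (u t 4) - l * k * Re (u t 0) - gamma * kp * Re (u t 8)) / rho1 + Re (g t 5)) (at t within {t..})"
      using d[of 5] by (simp add: opA_simps del: One_nat_def)
    show "((\<lambda>t. Re (u t 6)) has_real_derivative (kp * Re (u t 7) + gamma * kp * Re (u t 3)) / rho3 + Re (g t 6)) (at t within {t..})"
      using d[of 6] by (simp add: opA_simps del: One_nat_def)
    show "((\<lambda>t. Re (u t 7)) has_real_derivative (- Re (u t 7) / varpi - kp * Re (u t 6)) / vs + Re (g t 7)) (at t within {t..})"
      using d[of 7] by (simp add: opA_simps del: One_nat_def)
    show "((\<lambda>t. Re (u t 8)) has_real_derivative (kp * Re (u t 9) + gamma * kp * Re (u t 5) + gamma * l * Re (u t 1)) / rho3 + Re (g t 8)) (at t within {t..})"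
      using d[of 8] by (simp add: opA_simps del: One_nat_def)
    show "((\<lambda>t. Re (u t 9)) has_real_derivative (- Re (u t 9) / varpi - kp * Re (u t 8)) / tau + Re (g t 9)) (at t within {t..})"
      using d[of 9] by (simp add: opA_simps del: One_nat_def)
  qed
  show "odeF Im kp u g"
    unfolding odef_def
  proof (intro conjI allI impI)
    show "\<forall>v\<in>{\<lambda>t. Im (u t 0), \<lambda>t. Im (u t 1), \<lambda>t. Im (u t 2), \<lambda>t. Im (u t 3), \<lambda>t. Im (u t 4), \<lambda>t. Im (u t 5),
       \<lambda>t. Im (u t 6), \<lambda>t. Im (u t 7), \<lambda>t. Im (u t 8), \<lambda>t. Im (u t 9)}. continuous_on {0..} v"
      using c(2) by simp
    fix t :: real assume t0: "0 \<le> t"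
    note d = dI[OF _ t0]
    show "((\<lambda>t. Im (u t 0)) has_real_derivative kp * Im (u t 1) + Im (u t 3) + l * Im (u t 5) + Im (g t 0)) (at t within {t..})"
      using d[of 0] by (simp add: opA_simps del: One_nat_def)
    show "((\<lambda>t. Im (u t 1)) has_real_derivative (- k * kp * Im (u t 0) + l * k0 * Im (u t 4) - l * gamma * Im (u t 8)) / rho1 + Im (g t 1)) (at t within {t..})"
      using d[of 1] by (simp add: opA_simps del: One_nat_def)
    show "((\<lambda>t. Im (u t 2)) has_real_derivative - kp * Im (u t 3) + Im (g t 2)) (at t within {t..})"
      using d[of 2] by (simp add: opA_simps del: One_nat_def)
    show "((\<lambda>t. Im (u t 3)) has_real_derivative (b * kp * Im (u t 2) - k * Im (u t 0) - gamma * kp * Im (u t 6)) / rho2 + Im (g t 3)) (at t within {t..})"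
      using d[of 3] by (simp add: opA_simps del: One_nat_def)
    show "((\<lambda>t. Im (u t 4)) has_real_derivative - kp * Im (u t 5) - l * Im (u t 1) + Im (g t 4)) (at t within {t..})"
      using d[of 4] by (simp add: opA_simps del: One_nat_def)
    show "((\<lambda>t. Im (u t 5)) has_real_derivative (k0 * kp * Im (u t 4) - l * k * Im (u t 0) - gamma * kp * Im (u t 8)) / rho1 + Im (g t 5)) (at t within {t..})"
      using d[of 5] by (simp add: opA_simps del: One_nat_def)
    show "((\<lambda>t. Im (u t 6)) has_real_derivative (kp * Im (u t 7) + gamma * kp * Im (u t 3)) / rho3 + Im (g t 6)) (at t within {t..})"
      using d[of 6] by (simp add: opA_simps del: One_nat_def)
    show "((\<lambda>t. Im (u t 7)) has_real_derivative (- Im (u t 7) / varpi - kp * Im (u t 6)) / vs + Im (g t 7)) (at t within {t..})"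
      using d[of 7] by (simp add: opA_simps del: One_nat_def)
    show "((\<lambda>t. Im (u t 8)) has_real_derivative (kp * Im (u t 9) + gamma * kp * Im (u t 5) + gamma * l * Im (u t 1)) / rho3 + Im (g t 8)) (at t within {t..})"
      using d[of 8] by (simp add: opA_simps del: One_nat_def)
    show "((\<lambda>t. Im (u t 9)) has_real_derivative (- Im (u t 9) / varpi - kp * Im (u t 8)) / tau + Im (g t 9)) (at t within {t..})"
      using d[of 9] by (simp add: opA_simps del: One_nat_def)
  qed
qed

lemma traj_decay:
  assumes k1: "0 < k1" and del: "0 < del"
  obtains C where "0 < C" "\<And>kp u t. k1 \<le> kp \<Longrightarrow> del \<le> \<bar>1 - l\<^sup>2 * (1 / kp)\<^sup>2\<bar> \<Longrightarrow>
    traj kp u \<Longrightarrow> 0 < t \<Longrightarrow> EC (u t) \<le> C * kp\<^sup>2 / t * EC (u 0)"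
proof -
  obtain C where C: "0 < C" "\<And>kp S Ph y Ps N W th p xi q t. k1 \<le> kp \<Longrightarrow> del \<le> \<bar>1 - l\<^sup>2 * (1 / kp)\<^sup>2\<bar> \<Longrightarrow>
    ode kp S Ph y Ps N W th p xi q \<Longrightarrow> 0 < t \<Longrightarrow>
    En (S t) (Ph t) (y t) (Ps t) (N t) (W t) (th t) (p t) (xi t) (q t)
      \<le> C * kp\<^sup>2 / t * En (S 0) (Ph 0) (y 0) (Ps 0) (N 0) (W 0) (th 0) (p 0) (xi 0) (q 0)"
    using mode_decay[OF k1 del] by blast
  have "EC (u t) \<le> C * kp\<^sup>2 / t * EC (u 0)"
    if kp: "k1 \<le> kp" "del \<le> \<bar>1 - l\<^sup>2 * (1 / kp)\<^sup>2\<bar>" and tr: "traj kp u" and t: "0 < t" for kp u t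
  proof -
    have "trajf kp u (\<lambda>_ _. 0)" using tr by (simp add: traj_def trajf_def)
    from trajf_odef[OF this] have "odeF Re kp u (\<lambda>_ _. 0)" "odeF Im kp u (\<lambda>_ _. 0)" by blast+
    then have o: "ode kp (\<lambda>t. Re (u t 0)) (\<lambda>t. Re (u t 1)) (\<lambda>t. Re (u t 2)) (\<lambda>t. Re (u t 3)) (\<lambda>t. Re (u t 4))
        (\<lambda>t. Re (u t 5)) (\<lambda>t. Re (u t 6)) (\<lambda>t. Re (u t 7)) (\<lambda>t. Re (u t 8)) (\<lambda>t. Re (u t 9))"
      "ode kp (\<lambda>t. Im (u t 0)) (\<lambda>t. Im (u t 1)) (\<lambda>t. Im (u t 2)) (\<lambda>t. Im (u t 3)) (\<lambda>t. Im (u t 4))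
        (\<lambda>t. Im (u t 5)) (\<lambda>t. Im (u t 6)) (\<lambda>t. Im (u t 7)) (\<lambda>t. Im (u t 8)) (\<lambda>t. Im (u t 9))"
      by simp_all
    show ?thesis unfolding EC_En distrib_left
      using C(2)[OF kp o(1) t] C(2)[OF kp o(2) t] by linarith
  qed
  then show ?thesis using that C(1) by blast
qed

lemma opA_linear: "i < 10 \<Longrightarrow> opA kp (\<lambda>i. u i - z * v i) i = opA kp u i - z * opA kp v i"
  by (erule less_10_cases) (simp_all only: opA_simps, simp_all add: field_simps diff_divide_distrib add_divide_distrib)

text \<open>The difference to the pure oscillation starts at zero and solves the modal system with
  the rotating residual as forcing, whose energy is constant in time. Real and imaginary part are
  each bounded with the full energy of the residual, which accounts for the factor 2.\<close>

lemma quasimode_tracking: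
  fixes lam :: real
  assumes tr: "traj kp u" and T: "0 < T"
  shows "EC (\<lambda>i. u T i - exp (\<i> * complex_of_real (lam * T)) * u 0 i)
    \<le> 2 * exp 1 * T\<^sup>2 * EC (\<lambda>i. opA kp (u 0) i - \<i> * complex_of_real lam * u 0 i)"
proof -
  define x where "x t = exp (\<i> * complex_of_real (lam * t))" for t :: real
  define g where "g t i = x t * (opA kp (u 0) i - \<i> * complex_of_real lam * u 0 i)" for t i
  define w where "w t i = u t i - x t * u 0 i" for t i
  have x1: "cmod (x t) = 1" for t unfolding x_def by (simp add: norm_exp_eq_Re)
  have dx: "(x has_vector_derivative (\<i> * complex_of_real lam) * x t) (at t within A)" for t A
  proof -
    have "((\<lambda>t. exp (t *\<^sub>R (\<i> * complex_of_real lam))) has_vector_derivative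
      (\<i> * complex_of_real lam) * exp (t *\<^sub>R (\<i> * complex_of_real lam))) (at t within A)"
      by (rule has_vector_derivative_at_within[OF exp_scaleR_has_vector_derivative_left])
    moreover have "(\<lambda>t. exp (t *\<^sub>R (\<i> * complex_of_real lam))) = x"
      by (auto simp: x_def scaleR_conv_of_real mult.commute mult.left_commute)
    ultimately show ?thesis by metis
  qed
  have "trajf kp w g"
    unfolding trajf_def
  proof (intro allI impI conjI)
    fix i :: nat assume i: "i < 10"
    have "continuous_on {0..} x" unfolding x_def[abs_def] by (intro continuous_intros)
    then show "continuous_on {0..} (\<lambda>t. w t i)"
      unfolding w_def using tr i by (intro continuous_intros) (auto simp: traj_def)
    fix t :: real assume t: "0 \<le> t"
    have "((\<lambda>t. u t i) has_vector_derivative opA kp (u t) i) (at t within {t..})"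
      using tr i t by (simp add: traj_def)
    then have "((\<lambda>t. w t i) has_vector_derivative opA kp (u t) i - (\<i> * complex_of_real lam) * x t * u 0 i) (at t within {t..})"
      unfolding w_def by (intro has_vector_derivative_diff has_vector_derivative_mult_left dx)
    moreover have "opA kp (w t) i = opA kp (u t) i - x t * opA kp (u 0) i"
      unfolding w_def[abs_def] by (rule opA_linear[OF i])
    ultimately show "((\<lambda>t. w t i) has_vector_derivative opA kp (w t) i + g t i) (at t within {t..})"
      by (simp add: g_def algebra_simps)
  qed
  note o = trajf_odef[OF this]
  have w0: "w 0 i = 0" for i by (simp add: w_def x_def)
  define G where "G = EC (\<lambda>i. opA kp (u 0) i - \<i> * complex_of_real lam * u 0 i)"
  have "EC (g t) = G" for t unfolding g_def G_def using EC_scale x1 by simp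
  then have G: "EnF Re (g t) \<le> G" "EnF Im (g t) \<le> G" for t
    unfolding EC_En using En_nonneg
    by (metis add.commute le_add_same_cancel2)+
  have z: "En 0 0 0 0 0 0 0 0 0 0 = 0" by (simp add: En_def)
  have "EnF Re (w T) \<le> exp 1 * T\<^sup>2 * G" "EnF Im (w T) \<le> exp 1 * T\<^sup>2 * G"
    by (rule forced_growth[OF o(1) T _ G(1)], simp add: w0 z, rule forced_growth[OF o(2) T _ G(2)], simp add: w0 z)
  then have "EC (w T) \<le> 2 * exp 1 * T\<^sup>2 * G" unfolding EC_En by linarith
  then show ?thesis unfolding w_def x_def G_def .
qed

text \<open>Back substitution, each unknown being bounded at order \<open>1 / kp\<close>:
  \<open>Ps\<close> is immediate, then \<open>Ph\<close>, \<open>W\<close>, \<open>p\<close>,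
  \<open>q\<close>, \<open>th\<close>, \<open>xi\<close>, \<open>S\<close>, \<open>N\<close> and
  \<open>y\<close> follow. The pairs \<open>Ph, W\<close> and \<open>S, N\<close> are coupled, each
  with the factor \<open>1 - l\<^sup>2 * (1 / kp)\<^sup>2\<close>, bounded from below by
  \<open>del\<close>.\<close>

lemma inverse_bound_real:
  assumes k1: "0 < k1" and del: "0 < del"
  obtains C where "0 < C" "\<And>kp S Ph y Ps N W th p xi q. k1 \<le> kp \<Longrightarrow> del \<le> \<bar>1 - l\<^sup>2 * (1 / kp)\<^sup>2\<bar> \<Longrightarrow>
    kp\<^sup>2 * En S Ph y Ps N W th p xi q \<le> C * En
      (kp * Ph + Ps + l * W) ((- k * kp * S + l * k0 * N - l * gamma * xi) / rho1) (- kp * Ps)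
      ((b * kp * y - k * S - gamma * kp * th) / rho2) (- kp * W - l * Ph)
      ((k0 * kp * N - l * k * S - gamma * kp * xi) / rho1) ((kp * p + gamma * kp * Ps) / rho3)
      ((- p / varpi - kp * th) / vs) ((kp * q + gamma * kp * W + gamma * l * Ph) / rho3)
      ((- q / varpi - kp * xi) / tau)"
proof -
  define c1 where "c1 = (1 + 1 / k1 + l / k1) / del"
  define c2 where "c2 = 1 + l * c1 / k1"
  define c3 where "c3 = rho3 + gamma"
  define c4 where "c4 = vs + c3 / (k1 * varpi)"
  define c5 where "c5 = tau + c3 / (k1 * varpi)"
  define c6 where "c6 = rho1 + l * gamma * c5 / k1"
  define c7 where "c7 = rho1 + gamma * c5"
  define c8 where "c8 = (c6 + l * c7 / k1) / (k * del)"
  define c9 where "c9 = (c7 + l * k * c8 / k1) / k0"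
  define c10 where "c10 = (rho2 + k * c8 / k1 + gamma * c4) / b"
  define Cm where "Cm = 1 + c1 + c2 + c3 + c4 + c5 + c8 + c9 + c10"
  have cp: "0 < c1" unfolding c1_def using k1 del pos by (intro divide_pos_pos add_pos_pos) auto
  have cp2: "0 < c2" unfolding c2_def using cp k1 pos by (intro add_pos_pos divide_pos_pos mult_pos_pos) auto
  have cp3: "0 < c3" unfolding c3_def using pos by simp
  have cp4: "0 < c4" unfolding c4_def using cp3 k1 pos by (intro add_pos_pos divide_pos_pos mult_pos_pos) auto
  have cp5: "0 < c5" unfolding c5_def using cp3 k1 pos by (intro add_pos_pos divide_pos_pos mult_pos_pos) auto
  have cp6: "0 < c6" unfolding c6_def using cp5 k1 pos by (intro add_pos_pos divide_pos_pos mult_pos_pos) auto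
  have cp7: "0 < c7" unfolding c7_def using cp5 k1 pos by (intro add_pos_pos divide_pos_pos mult_pos_pos) auto
  have cp8: "0 < c8" unfolding c8_def using cp6 cp7 k1 del pos by (intro add_pos_pos divide_pos_pos mult_pos_pos) auto
  have cp9: "0 < c9" unfolding c9_def using cp7 cp8 k1 pos by (intro add_pos_pos divide_pos_pos mult_pos_pos) auto
  have cp10: "0 < c10" unfolding c10_def using cp4 cp8 k1 pos by (intro add_pos_pos divide_pos_pos mult_pos_pos) auto
  note cps = cp cp2 cp3 cp4 cp5 cp6 cp7 cp8 cp9 cp10
  have Cm: "1 \<le> Cm" "c1 \<le> Cm" "c2 \<le> Cm" "c3 \<le> Cm" "c4 \<le> Cm" "c5 \<le> Cm" "c8 \<le> Cm" "c9 \<le> Cm" "c10 \<le> Cm"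
    unfolding Cm_def using cps by linarith+
  have "kp\<^sup>2 * En S Ph y Ps N W th p xi q \<le> (Smax * Cm\<^sup>2 / mu) * En
      (kp * Ph + Ps + l * W) ((- k * kp * S + l * k0 * N - l * gamma * xi) / rho1) (- kp * Ps)
      ((b * kp * y - k * S - gamma * kp * th) / rho2) (- kp * W - l * Ph)
      ((k0 * kp * N - l * k * S - gamma * kp * xi) / rho1) ((kp * p + gamma * kp * Ps) / rho3)
      ((- p / varpi - kp * th) / vs) ((kp * q + gamma * kp * W + gamma * l * Ph) / rho3)
      ((- q / varpi - kp * xi) / tau)" (is "_ \<le> _ * ?E")
    if kp: "k1 \<le> kp" and adm: "del \<le> \<bar>1 - l\<^sup>2 * (1 / kp)\<^sup>2\<bar>" for kp S Ph y Ps N W th p xi q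
  proof -
    have kp0: "0 < kp" using kp k1 by simp
    define g where "g = sqrt (?E / mu)"
    note g = En_sqrt[of "kp * Ph + Ps + l * W" "(- k * kp * S + l * k0 * N - l * gamma * xi) / rho1" "- kp * Ps"
      "(b * kp * y - k * S - gamma * kp * th) / rho2" "- kp * W - l * Ph"
      "(k0 * kp * N - l * k * S - gamma * kp * xi) / rho1" "(kp * p + gamma * kp * Ps) / rho3"
      "(- p / varpi - kp * th) / vs" "(kp * q + gamma * kp * W + gamma * l * Ph) / rho3"
      "(- q / varpi - kp * xi) / tau", folded g_def]
    note co = En_bounds_components[OF g(1,2)]
    have cm: "\<bar>c * x\<bar> \<le> c * B" if "\<bar>x\<bar> \<le> B" "0 < c" for c x B :: real
      using abs_mult_le[of c c x B] that by simp
    have dv: "\<bar>x\<bar> \<le> a * g" if "\<bar>x / a\<bar> \<le> g" "0 < a" for x a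
      using that by (simp add: abs_divide pos_divide_le_eq mult.commute)
    have lo: "\<bar>x\<bar> \<le> c / k1 * g" if "\<bar>kp * x\<bar> \<le> c * g" for x c
    proof -
      have "k1 * \<bar>x\<bar> \<le> kp * \<bar>x\<bar>" using kp by (intro mult_right_mono) auto
      also have "\<dots> \<le> c * g" using that kp0 by (simp add: abs_mult)
      finally show ?thesis using k1 by (simp add: pos_le_divide_eq mult.commute)
    qed
    have hPs: "\<bar>kp * Ps\<bar> \<le> 1 * g" using co(3) by simp
    note lPs = lo[OF hPs]
    have hPh: "\<bar>kp * Ph\<bar> \<le> c1 * g"
    proof -
      define gN where "gN = - kp * W - l * Ph"
      \<comment> \<open>\<open>W\<close> is eliminated by adding \<open>l / kp\<close> times the
        fifth component.\<close>
      have eq: "kp * Ph * (1 - l\<^sup>2 * (1 / kp)\<^sup>2) = (kp * Ph + Ps + l * W) - Ps + l * (gN / kp)"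
        using kp0 by (simp add: gN_def field_simps power2_eq_square)
      have "\<bar>gN / kp\<bar> \<le> 1 / k1 * g" by (rule lo) (use co(5) kp0 in \<open>simp add: gN_def\<close>)
      then have "\<bar>l * (gN / kp)\<bar> \<le> l * (1 / k1 * g)" by (rule cm[OF _ pos(8)])
      then have "\<bar>kp * Ph * (1 - l\<^sup>2 * (1 / kp)\<^sup>2)\<bar> \<le> g + 1 / k1 * g + l * (1 / k1 * g)"
        unfolding eq using co(1) lPs by linarith
      moreover have "\<bar>kp * Ph\<bar> * del \<le> \<bar>kp * Ph * (1 - l\<^sup>2 * (1 / kp)\<^sup>2)\<bar>"
        unfolding abs_mult[of "kp * Ph"] using adm by (intro mult_left_mono) auto
      moreover have "g + 1 / k1 * g + l * (1 / k1 * g) = (c1 * g) * del"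
        using del k1 by (simp add: c1_def field_simps)
      ultimately have "\<bar>kp * Ph\<bar> * del \<le> (c1 * g) * del" by linarith
      then show ?thesis using del by simp
    qed
    note lPh = lo[OF hPh]
    have hW: "\<bar>kp * W\<bar> \<le> c2 * g"
    proof -
      have "\<bar>l * Ph\<bar> \<le> l * (c1 / k1 * g)" by (rule cm[OF lPh pos(8)])
      moreover have "c2 * g = g + l * (c1 / k1 * g)" by (simp add: c2_def algebra_simps)
      ultimately show ?thesis using co(5) by linarith
    qed
    have hp: "\<bar>kp * p\<bar> \<le> c3 * g"
    proof -
      have "\<bar>kp * p + gamma * kp * Ps\<bar> \<le> rho3 * g" by (rule dv[OF co(7) pos(3)])
      moreover have "\<bar>gamma * kp * Ps\<bar> \<le> gamma * (1 * g)" using cm[OF hPs pos(9)] by (simp add: mult.assoc)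
      moreover have "c3 * g = rho3 * g + gamma * (1 * g)" by (simp add: c3_def algebra_simps)
      ultimately show ?thesis by linarith
    qed
    have hq: "\<bar>kp * q\<bar> \<le> c3 * g"
    proof -
      have "\<bar>kp * q + gamma * kp * W + gamma * l * Ph\<bar> \<le> rho3 * g" by (rule dv[OF co(9) pos(3)])
      moreover have "\<bar>gamma * (- kp * W - l * Ph)\<bar> \<le> gamma * g" by (rule cm[OF co(5) pos(9)])
      moreover have "gamma * (- kp * W - l * Ph) = - (gamma * kp * W) - gamma * l * Ph" by (simp add: algebra_simps)
      moreover have "c3 * g = rho3 * g + gamma * g" by (simp add: c3_def algebra_simps)
      ultimately show ?thesis by linarith
    qed
    have pv: "\<bar>x / varpi\<bar> \<le> c3 / (k1 * varpi) * g" if "\<bar>kp * x\<bar> \<le> c3 * g" for x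
      using divide_right_mono[OF lo[OF that], of varpi] pos by (simp add: abs_divide)
    have hth: "\<bar>kp * th\<bar> \<le> c4 * g"
    proof -
      have "\<bar>- p / varpi - kp * th\<bar> \<le> vs * g" by (rule dv[OF co(8) pos(10)])
      moreover have "c4 * g = vs * g + c3 / (k1 * varpi) * g" by (simp add: c4_def algebra_simps)
      moreover have "- p / varpi = - (p / varpi)" by simp
      ultimately show ?thesis using pv[OF hp] by linarith
    qed
    have hxi: "\<bar>kp * xi\<bar> \<le> c5 * g"
    proof -
      have "\<bar>- q / varpi - kp * xi\<bar> \<le> tau * g" by (rule dv[OF co(10) pos(11)])
      moreover have "c5 * g = tau * g + c3 / (k1 * varpi) * g" by (simp add: c5_def algebra_simps)
      moreover have "- q / varpi = - (q / varpi)" by simp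
      ultimately show ?thesis using pv[OF hq] by linarith
    qed
    have a1: "\<bar>- k * kp * S + l * k0 * N\<bar> \<le> c6 * g"
    proof -
      have "\<bar>- k * kp * S + l * k0 * N - l * gamma * xi\<bar> \<le> rho1 * g" by (rule dv[OF co(2) pos(1)])
      moreover have "\<bar>l * gamma * xi\<bar> \<le> (l * gamma) * (c5 / k1 * g)" by (rule cm[OF lo[OF hxi]]) (use pos in simp)
      moreover have "c6 * g = rho1 * g + (l * gamma) * (c5 / k1 * g)" by (simp add: c6_def algebra_simps)
      ultimately show ?thesis by linarith
    qed
    have a2: "\<bar>k0 * kp * N - l * k * S\<bar> \<le> c7 * g"
    proof -
      have "\<bar>k0 * kp * N - l * k * S - gamma * kp * xi\<bar> \<le> rho1 * g" by (rule dv[OF co(6) pos(1)])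
      moreover have "\<bar>gamma * kp * xi\<bar> \<le> gamma * (c5 * g)" using cm[OF hxi pos(9)] by (simp add: mult.assoc)
      moreover have "c7 * g = rho1 * g + gamma * (c5 * g)" by (simp add: c7_def algebra_simps)
      ultimately show ?thesis by linarith
    qed
    have hS: "\<bar>kp * S\<bar> \<le> c8 * g"
    proof -
      define m where "m = k0 * kp * N - l * k * S"
      \<comment> \<open>\<open>N\<close> is eliminated by subtracting \<open>l / kp\<close> times
        the combination bounded in \<open>a2\<close>.\<close>
      have eq: "- (k * (kp * S * (1 - l\<^sup>2 * (1 / kp)\<^sup>2))) = (- k * kp * S + l * k0 * N) - l * (m / kp)"
        using kp0 by (simp add: m_def field_simps power2_eq_square)
      have "\<bar>m / kp\<bar> \<le> c7 / k1 * g" by (rule lo) (use a2 kp0 in \<open>simp add: m_def\<close>)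
      then have "\<bar>l * (m / kp)\<bar> \<le> l * (c7 / k1 * g)" by (rule cm[OF _ pos(8)])
      then have "\<bar>k * (kp * S * (1 - l\<^sup>2 * (1 / kp)\<^sup>2))\<bar> \<le> c6 * g + l * (c7 / k1 * g)"
        using eq a1 by linarith
      moreover have "k * (\<bar>kp * S\<bar> * del) \<le> \<bar>k * (kp * S * (1 - l\<^sup>2 * (1 / kp)\<^sup>2))\<bar>"
        unfolding abs_mult[of k] abs_mult[of "kp * S"] using adm pos by (auto intro!: mult_left_mono)
      moreover have "c6 * g + l * (c7 / k1 * g) = k * ((c8 * g) * del)"
        using del pos k1 by (simp add: c8_def field_simps)
      ultimately have "k * (\<bar>kp * S\<bar> * del) \<le> k * ((c8 * g) * del)" by linarith
      then show ?thesis using del pos by simp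
    qed
    have hN: "\<bar>kp * N\<bar> \<le> c9 * g"
    proof -
      have "\<bar>l * k * S\<bar> \<le> (l * k) * (c8 / k1 * g)" by (rule cm[OF lo[OF hS]]) (use pos in simp)
      moreover have "k0 * (c9 * g) = c7 * g + (l * k) * (c8 / k1 * g)" using pos k1 by (simp add: c9_def field_simps)
      ultimately have "\<bar>k0 * kp * N\<bar> \<le> k0 * (c9 * g)" using a2 by linarith
      then show ?thesis using pos by (simp add: abs_mult mult.assoc)
    qed
    have hy: "\<bar>kp * y\<bar> \<le> c10 * g"
    proof -
      have "\<bar>b * kp * y - k * S - gamma * kp * th\<bar> \<le> rho2 * g" by (rule dv[OF co(4) pos(2)])
      moreover have "\<bar>k * S\<bar> \<le> k * (c8 / k1 * g)" by (rule cm[OF lo[OF hS] pos(4)])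
      moreover have "\<bar>gamma * kp * th\<bar> \<le> gamma * (c4 * g)" using cm[OF hth pos(9)] by (simp add: mult.assoc)
      moreover have "b * (c10 * g) = rho2 * g + k * (c8 / k1 * g) + gamma * (c4 * g)" using pos k1 by (simp add: c10_def field_simps)
      ultimately have "\<bar>b * kp * y\<bar> \<le> b * (c10 * g)" by linarith
      then show ?thesis using pos by (simp add: abs_mult mult.assoc)
    qed
    have up: "\<bar>x\<bar> \<le> Cm * g" if "\<bar>x\<bar> \<le> c * g" "c \<le> Cm" for x c
      using mult_right_mono[OF that(2) g(2)] that(1) by linarith
    have "En (kp * S) (kp * Ph) (kp * y) (kp * Ps) (kp * N) (kp * W) (kp * th) (kp * p) (kp * xi) (kp * q) \<le> Smax * (Cm * g)\<^sup>2"
      by (rule components_bound_En[OF up[OF hS Cm(7)] up[OF hPh Cm(2)] up[OF hy Cm(9)] up[OF hPs Cm(1)] up[OF hN Cm(8)]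
          up[OF hW Cm(3)] up[OF hth Cm(5)] up[OF hp Cm(4)] up[OF hxi Cm(6)] up[OF hq Cm(4)]])
    also have "\<dots> = (Smax * Cm\<^sup>2 / mu) * ?E" unfolding power_mult_distrib g(3) by simp
    also have "En (kp * S) (kp * Ph) (kp * y) (kp * Ps) (kp * N) (kp * W) (kp * th) (kp * p) (kp * xi) (kp * q)
        = kp\<^sup>2 * En S Ph y Ps N W th p xi q"
      by (simp add: En_def power_mult_distrib algebra_simps)
    finally show ?thesis .
  qed
  moreover have "0 < Smax * Cm\<^sup>2 / mu" using Smax_pos mu_pos Cm by simp
  ultimately show ?thesis using that by blast
qed

lemma inverse_bound:
  assumes k1: "0 < k1" and del: "0 < del"
  obtains C where "0 < C" "\<And>kp u. k1 \<le> kp \<Longrightarrow> del \<le> \<bar>1 - l\<^sup>2 * (1 / kp)\<^sup>2\<bar> \<Longrightarrow>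
    kp\<^sup>2 * EC u \<le> C * EC (opA kp u)"
proof -
  obtain C where C: "0 < C" "\<And>kp S Ph y Ps N W th p xi q. k1 \<le> kp \<Longrightarrow> del \<le> \<bar>1 - l\<^sup>2 * (1 / kp)\<^sup>2\<bar> \<Longrightarrow>
    kp\<^sup>2 * En S Ph y Ps N W th p xi q \<le> C * En
      (kp * Ph + Ps + l * W) ((- k * kp * S + l * k0 * N - l * gamma * xi) / rho1) (- kp * Ps)
      ((b * kp * y - k * S - gamma * kp * th) / rho2) (- kp * W - l * Ph)
      ((k0 * kp * N - l * k * S - gamma * kp * xi) / rho1) ((kp * p + gamma * kp * Ps) / rho3)
      ((- p / varpi - kp * th) / vs) ((kp * q + gamma * kp * W + gamma * l * Ph) / rho3)
      ((- q / varpi - kp * xi) / tau)"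
    using inverse_bound_real[OF k1 del] by blast
  have "kp\<^sup>2 * EC u \<le> C * EC (opA kp u)" if kp: "k1 \<le> kp" "del \<le> \<bar>1 - l\<^sup>2 * (1 / kp)\<^sup>2\<bar>" for kp u
  proof -
    have "EnF Re (opA kp u) = En
      (kp * Re (u 1) + Re (u 3) + l * Re (u 5)) ((- k * kp * Re (u 0) + l * k0 * Re (u 4) - l * gamma * Re (u 8)) / rho1) (- kp * Re (u 3))
      ((b * kp * Re (u 2) - k * Re (u 0) - gamma * kp * Re (u 6)) / rho2) (- kp * Re (u 5) - l * Re (u 1))
      ((k0 * kp * Re (u 4) - l * k * Re (u 0) - gamma * kp * Re (u 8)) / rho1) ((kp * Re (u 7) + gamma * kp * Re (u 3)) / rho3)
      ((- Re (u 7) / varpi - kp * Re (u 6)) / vs) ((kp * Re (u 9) + gamma * kp * Re (u 5) + gamma * l * Re (u 1)) / rho3)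
      ((- Re (u 9) / varpi - kp * Re (u 8)) / tau)"
      "EnF Im (opA kp u) = En
      (kp * Im (u 1) + Im (u 3) + l * Im (u 5)) ((- k * kp * Im (u 0) + l * k0 * Im (u 4) - l * gamma * Im (u 8)) / rho1) (- kp * Im (u 3))
      ((b * kp * Im (u 2) - k * Im (u 0) - gamma * kp * Im (u 6)) / rho2) (- kp * Im (u 5) - l * Im (u 1))
      ((k0 * kp * Im (u 4) - l * k * Im (u 0) - gamma * kp * Im (u 8)) / rho1) ((kp * Im (u 7) + gamma * kp * Im (u 3)) / rho3)
      ((- Im (u 7) / varpi - kp * Im (u 6)) / vs) ((kp * Im (u 9) + gamma * kp * Im (u 5) + gamma * l * Im (u 1)) / rho3)
      ((- Im (u 9) / varpi - kp * Im (u 8)) / tau)"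
      by (simp_all add: opA_simps del: One_nat_def)
    then have "kp\<^sup>2 * EnF Re u \<le> C * EnF Re (opA kp u)" "kp\<^sup>2 * EnF Im u \<le> C * EnF Im (opA kp u)"
      using C(2)[OF kp] by metis+
    then show ?thesis unfolding EC_En distrib_left by linarith
  qed
  then show ?thesis using that C(1) by blast
qed

end

section \<open>Slowly decaying modes\<close>

text \<open>Leading and first-order response of one of the two hyperbolic heat subsystems to a forcing of
  amplitude \<open>kk\<close> at frequency \<open>mu\<close>; the nonresonance condition is the nonvanishing of the stability number.\<close>
lemma resonance_free_response:
  fixes mu rr bb kk sg r3 g vp :: real
  assumes mu: "0 < mu" and sg: "0 < sg"
    and nr: "(bb - mu\<^sup>2 * rr) * (mu\<^sup>2 * r3 * sg - 1) + g\<^sup>2 * mu\<^sup>2 * sg \<noteq> 0"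
  obtains A y0 t0 p0 r y1 t1 p1 where
    "A + mu * y0 = 0" "bb * y0 - kk - g * t0 + mu * rr * A = 0" "p0 + g * A - mu * r3 * t0 = 0" "t0 = mu * sg * p0"
    "r = mu * y1" "bb * y1 - g * t1 - mu * rr * r = 0" "p1 + g * r + mu * r3 * t1 = 0" "p0 / vp + t1 + mu * sg * p1 = 0"
proof -
  define ch where "ch = (bb - mu\<^sup>2 * rr) * (mu\<^sup>2 * r3 * sg - 1) + g\<^sup>2 * mu\<^sup>2 * sg"
  have ch: "ch \<noteq> 0" using nr by (simp add: ch_def)
  define m where "m = mu\<^sup>2 * r3 * sg - 1"
  define n where "n = mu\<^sup>2 * rr - bb"
  have chmn: "ch = g\<^sup>2 * mu\<^sup>2 * sg - m * n" by (simp add: ch_def m_def n_def algebra_simps)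
  \<comment> \<open>Cramer's rule at leading order, with determinant \<open>ch\<close>. The
    first-order system has the same determinant up to sign conventions and is driven by the damping
    term \<open>p0 / vp\<close>, where \<open>p0 = g * a\<close>.\<close>
  define a where "a = - kk * mu / ch"
  define t1 where "t1 = - n * (g * a / vp) / ch"
  define r where "r = g * mu * (g * a / vp) / ch"
  show ?thesis
  proof (rule that[of "m * a" "- m * a / mu" "g * mu * sg * a" "g * a" r "r / mu" t1 "- g * r - mu * r3 * t1"])
    show "m * a + mu * (- m * a / mu) = 0" using mu by simp
    have "bb * (- m * a / mu) - kk - g * (g * mu * sg * a) + mu * rr * (m * a) = - (a * ch) / mu - kk"
      using mu by (simp add: chmn n_def field_simps power2_eq_square)
    also have "\<dots> = 0" using mu ch by (simp add: a_def)
    finally show "bb * (- m * a / mu) - kk - g * (g * mu * sg * a) + mu * rr * (m * a) = 0" .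
    show "g * a + g * (m * a) - mu * r3 * (g * mu * sg * a) = 0" by (simp add: m_def algebra_simps power2_eq_square)
    show "g * mu * sg * a = mu * sg * (g * a)" by simp
    show "r = mu * (r / mu)" using mu by simp
    have "bb * (r / mu) - g * t1 - mu * rr * r = - (n * r / mu) - g * t1"
      using mu by (simp add: n_def field_simps power2_eq_square)
    also have "\<dots> = 0" using mu by (simp add: r_def t1_def)
    finally show "bb * (r / mu) - g * t1 - mu * rr * r = 0" .
    show "- g * r - mu * r3 * t1 + g * r + mu * r3 * t1 = 0" by simp
    have "g * a / vp + t1 + mu * sg * (- g * r - mu * r3 * t1) = g * a / vp - (m * t1 + g * mu * sg * r)"
      by (simp add: m_def algebra_simps power2_eq_square)
    also have "m * t1 + g * mu * sg * r = (g * a / vp) * (g\<^sup>2 * mu\<^sup>2 * sg - m * n) / ch"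
      by (simp add: t1_def r_def algebra_simps power2_eq_square add_divide_distrib diff_divide_distrib)
    also have "\<dots> = g * a / vp" using ch by (simp add: chmn[symmetric])
    finally show "g * a / vp + t1 + mu * sg * (- g * r - mu * r3 * t1) = 0" by simp
  qed
qed

text \<open>Boundedness for large wave numbers with a fixed threshold. The closure rules then settle
  any expression built from a few bounded functions.\<close>

definition bounded_above :: "real \<Rightarrow> (real \<Rightarrow> real) \<Rightarrow> bool" where
  "bounded_above K f \<longleftrightarrow> (\<exists>B\<ge>0. \<forall>x\<ge>K. \<bar>f x\<bar> \<le> B)"

lemma bounded_above_const: "bounded_above K (\<lambda>x. c)"
  unfolding bounded_above_def by (rule exI[of _ "\<bar>c\<bar>"]) simp

lemma bounded_above_add:
  assumes "bounded_above K f" "bounded_above K g" shows "bounded_above K (\<lambda>x. f x + g x)"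
proof -
  obtain A where A: "A \<ge> 0" "\<And>x. x \<ge> K \<Longrightarrow> \<bar>f x\<bar> \<le> A" using assms by (auto simp: bounded_above_def)
  obtain B where B: "B \<ge> 0" "\<And>x. x \<ge> K \<Longrightarrow> \<bar>g x\<bar> \<le> B" using assms by (auto simp: bounded_above_def)
  show ?thesis unfolding bounded_above_def
    by (rule exI[of _ "A + B"]) (use A B in \<open>auto intro: order_trans[OF abs_triangle_ineq] add_mono\<close>)
qed

lemma bounded_above_mult:
  assumes "bounded_above K f" "bounded_above K g" shows "bounded_above K (\<lambda>x. f x * g x)"
proof -
  obtain A where A: "A \<ge> 0" "\<And>x. x \<ge> K \<Longrightarrow> \<bar>f x\<bar> \<le> A" using assms by (auto simp: bounded_above_def)
  obtain B where B: "B \<ge> 0" "\<And>x. x \<ge> K \<Longrightarrow> \<bar>g x\<bar> \<le> B" using assms by (auto simp: bounded_above_def)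
  show ?thesis unfolding bounded_above_def
    by (rule exI[of _ "A * B"]) (use A B in \<open>auto intro: abs_mult_le\<close>)
qed

lemmas bounded_above_intros = bounded_above_const bounded_above_add bounded_above_mult

context bmc_coeffs
begin

text \<open>A shear wave of amplitude \<open>kp\<close> drives the two heat subsystems, whose
  response stays of order one exactly because the stability numbers do not vanish. All components of
  the residual are made of order \<open>1 / kp\<close>; relative to the energy, which is at least
  \<open>k * kp\<^sup>2\<close>, the squared residual is of order \<open>1 / kp ^ 4\<close>.\<close>

lemma quasimode_exists:
  assumes chs: "(vs * rho3 - rho1 / k) * (b - k * rho2 / rho1) + gamma\<^sup>2 * vs \<noteq> 0"
    and cht: "(tau * rho3 - rho1 / k) * (k0 - k) + gamma\<^sup>2 * tau \<noteq> 0"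
  obtains C K0 where "0 < C" "0 < K0" "\<And>kp. K0 \<le> kp \<Longrightarrow> \<exists>lam u. 0 < EC u \<and>
      EC (\<lambda>i. opA kp u i - \<i> * complex_of_real lam * u i) \<le> C / kp ^ 4 * EC u \<and>
      EC (opA kp u) \<le> C * kp\<^sup>2 * EC u"
proof -
  \<comment> \<open>The speed of the undamped shear waves, which the heat conduction does not damp to leading order.\<close>
  define mu0 where "mu0 = sqrt (k / rho1)"
  have mu0: "0 < mu0" using pos by (simp add: mu0_def)
  have mu02: "mu0\<^sup>2 = k / rho1" using pos by (simp add: mu0_def)
  have "(b - mu0\<^sup>2 * rho2) * (mu0\<^sup>2 * rho3 * vs - 1) + gamma\<^sup>2 * mu0\<^sup>2 * vs
      = k / rho1 * ((vs * rho3 - rho1 / k) * (b - k * rho2 / rho1) + gamma\<^sup>2 * vs)"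
    unfolding mu02 using pos by (simp add: field_simps power2_eq_square)
  then have nr1: "(b - mu0\<^sup>2 * rho2) * (mu0\<^sup>2 * rho3 * vs - 1) + gamma\<^sup>2 * mu0\<^sup>2 * vs \<noteq> 0"
    using chs pos by simp
  have "(k0 - mu0\<^sup>2 * rho1) * (mu0\<^sup>2 * rho3 * tau - 1) + gamma\<^sup>2 * mu0\<^sup>2 * tau
      = k / rho1 * ((tau * rho3 - rho1 / k) * (k0 - k) + gamma\<^sup>2 * tau)"
    unfolding mu02 using pos by (simp add: field_simps power2_eq_square)
  then have nr2: "(k0 - mu0\<^sup>2 * rho1) * (mu0\<^sup>2 * rho3 * tau - 1) + gamma\<^sup>2 * mu0\<^sup>2 * tau \<noteq> 0"
    using cht pos by simp
  obtain A y0 t0 p0 r y1 t1 p1 where X: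
    "A + mu0 * y0 = 0" "b * y0 - k - gamma * t0 + mu0 * rho2 * A = 0" "p0 + gamma * A - mu0 * rho3 * t0 = 0" "t0 = mu0 * vs * p0"
    "r = mu0 * y1" "b * y1 - gamma * t1 - mu0 * rho2 * r = 0" "p1 + gamma * r + mu0 * rho3 * t1 = 0" "p0 / varpi + t1 + mu0 * vs * p1 = 0"
    using resonance_free_response[OF mu0 pos(10) nr1] by metis
  obtain A' y0' t0' p0' r' y1' t1' p1' where Y:
    "A' + mu0 * y0' = 0" "k0 * y0' - 2 * l * k - gamma * t0' + mu0 * rho1 * A' = 0" "p0' + gamma * A' - mu0 * rho3 * t0' = 0" "t0' = mu0 * tau * p0'"
    "r' = mu0 * y1'" "k0 * y1' - gamma * t1' - mu0 * rho1 * r' = 0" "p1' + gamma * r' + mu0 * rho3 * t1' = 0" "p0' / varpi + t1' + mu0 * tau * p1' = 0"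
    using resonance_free_response[OF mu0 pos(11) nr2] by metis
  \<comment> \<open>Leading part of \<open>k0 * N - gamma * xi\<close>, the combination through
    which the axial subsystem acts back on the equation of \<open>Ph\<close>.\<close>
  define R0 where "R0 = k0 * y0' - gamma * t0'"
  \<comment> \<open>Second-order correction of the squared frequency: the value that cancels the
    terms of order one in the imaginary part of residual component 0.\<close>
  define c0 where "c0 = l\<^sup>2 * k + l * R0 - mu0 * rho1 * (A + l * A')"
  \<comment> \<open>Beyond this threshold the correction is at most \<open>k / 2\<close>, so the
    corrected speed \<open>me\<close> stays comparable to \<open>mu0\<close>.\<close>
  define K0 where "K0 = 1 + sqrt (2 * \<bar>c0\<bar> / k)"
  define me where "me kp = sqrt ((k - (1 / kp)\<^sup>2 * c0) / rho1)" for kp :: real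
  \<comment> \<open>Chosen such that the real part of the residual in the equation of
    \<open>Ph\<close> vanishes exactly.\<close>
  define F where "F kp = (k - (1 / kp)\<^sup>2 * (l * R0)) / (me kp * rho1)" for kp :: real
  define d2 where "d2 kp = kp\<^sup>2 * (me kp - mu0)" for kp :: real
  \<comment> \<open>Components alternate between real and imaginary leading parts, as in an undamped
    oscillation; the damping first shows in the corrections of order \<open>1 / kp\<close>. The
    entry \<open>A' - l * F kp\<close> is such that \<open>V = W + l * (Ph / kp)\<close> has leading
    part \<open>\<i> * A'\<close>.\<close>
  define u where "u kp i = [complex_of_real kp, Complex 0 (kp * F kp), Complex y0 (y1 / kp), Complex (r / kp) A,
    Complex y0' (y1' / kp), Complex (r' / kp) (A' - l * F kp), Complex t0 (t1 / kp), Complex (p1 / kp) p0,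
    Complex t0' (t1' / kp), Complex (p1' / kp) p0'] ! i" for kp :: real and i :: nat
  have u: "u kp 0 = complex_of_real kp" "u kp 1 = Complex 0 (kp * F kp)" "u kp 2 = Complex y0 (y1 / kp)"
    "u kp 3 = Complex (r / kp) A" "u kp 4 = Complex y0' (y1' / kp)" "u kp 5 = Complex (r' / kp) (A' - l * F kp)"
    "u kp 6 = Complex t0 (t1 / kp)" "u kp 7 = Complex (p1 / kp) p0" "u kp 8 = Complex t0' (t1' / kp)"
    "u kp 9 = Complex (p1' / kp) p0'" for kp by (simp_all add: u_def)
  define g where "g kp i = opA kp (u kp) i - \<i> * complex_of_real (kp * me kp) * u kp i" for kp :: real and i :: nat
  have K1: "1 \<le> K0" unfolding K0_def using pos by simp
  have base: "1 \<le> kp" "(1 / kp)\<^sup>2 * \<bar>c0\<bar> \<le> k / 2" if kp: "K0 \<le> kp" for kp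
  proof -
    show kp1: "1 \<le> kp" using kp K1 by simp
    have "sqrt (2 * \<bar>c0\<bar> / k) \<le> kp" using kp by (simp add: K0_def)
    then have "2 * \<bar>c0\<bar> / k \<le> kp\<^sup>2" using kp1 by (simp add: real_sqrt_le_iff' sqrt_le_D)
    then show "(1 / kp)\<^sup>2 * \<bar>c0\<bar> \<le> k / 2" using kp1 pos by (simp add: field_simps power2_eq_square)
  qed
  have me: "(me kp)\<^sup>2 * rho1 = k - (1 / kp)\<^sup>2 * c0" "mu0 / 2 \<le> me kp" "me kp \<le> 2 * mu0" if kp: "K0 \<le> kp" for kp
  proof -
    have "\<bar>(1 / kp)\<^sup>2 * c0\<bar> \<le> k / 2" using base(2)[OF kp] by (simp add: abs_mult)
    then have n: "k / 2 \<le> k - (1 / kp)\<^sup>2 * c0" "k - (1 / kp)\<^sup>2 * c0 \<le> 2 * k" using pos by linarith+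
    then have p: "0 \<le> (k - (1 / kp)\<^sup>2 * c0) / rho1" using pos by simp
    then have m2: "(me kp)\<^sup>2 = (k - (1 / kp)\<^sup>2 * c0) / rho1" unfolding me_def by simp
    have m0: "0 \<le> me kp" unfolding me_def using p by simp
    show "(me kp)\<^sup>2 * rho1 = k - (1 / kp)\<^sup>2 * c0" unfolding m2 using pos by simp
    have "(mu0 / 2)\<^sup>2 = k / rho1 / 4" by (simp add: power_divide mu02)
    also have "\<dots> \<le> k / 2 / rho1" using pos by (simp add: field_simps)
    also have "\<dots> \<le> (me kp)\<^sup>2" unfolding m2 using n(1) pos by (intro divide_right_mono) auto
    finally show "mu0 / 2 \<le> me kp" using m0 by (rule power2_le_imp_le)
    have "(me kp)\<^sup>2 \<le> 2 * k / rho1" unfolding m2 using n(2) pos by (intro divide_right_mono) auto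
    also have "\<dots> \<le> 4 * (k / rho1)" using pos by (simp add: field_simps)
    also have "\<dots> = (2 * mu0)\<^sup>2" by (simp add: power_mult_distrib mu02)
    finally show "me kp \<le> 2 * mu0" by (rule power2_le_imp_le) (use mu0 in simp)
  qed
  have b_e: "bounded_above K0 (\<lambda>kp. 1 / kp)"
    unfolding bounded_above_def
  proof (rule exI[of _ 1], intro conjI allI impI)
    fix kp assume "K0 \<le> kp"
    then show "\<bar>1 / kp\<bar> \<le> 1" using base(1)[of kp] by simp
  qed simp
  have b_im: "bounded_above K0 (\<lambda>kp. 1 / me kp)"
    unfolding bounded_above_def
  proof (rule exI[of _ "2 / mu0"], intro conjI allI impI)
    fix kp assume "K0 \<le> kp"
    then show "\<bar>1 / me kp\<bar> \<le> 2 / mu0" using me(2)[of kp] mu0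
      by (simp add: abs_divide divide_simps mult.commute)
  qed (use mu0 in simp)
  have b_d: "bounded_above K0 d2"
    unfolding bounded_above_def
  proof (rule exI[of _ "\<bar>c0\<bar> / (rho1 * mu0)"], intro conjI allI impI)
    fix kp assume kp: "K0 \<le> kp"
    have kp1: "1 \<le> kp" by (rule base(1)[OF kp])
    have "(me kp - mu0) * (me kp + mu0) * rho1 = (me kp)\<^sup>2 * rho1 - mu0\<^sup>2 * rho1"
      by (simp add: algebra_simps power2_eq_square)
    also have "\<dots> = - ((1 / kp)\<^sup>2 * c0)" unfolding me(1)[OF kp] mu02 using pos by simp
    finally have "(me kp - mu0) * ((me kp + mu0) * rho1) = - ((1 / kp)\<^sup>2 * c0)" by (simp add: mult.assoc)
    then have "kp\<^sup>2 * ((me kp - mu0) * ((me kp + mu0) * rho1)) = - c0"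
      using kp1 by (simp add: power_divide)
    then have "d2 kp * ((me kp + mu0) * rho1) = - c0" by (simp add: d2_def mult.assoc)
    then have "\<bar>d2 kp\<bar> * \<bar>(me kp + mu0) * rho1\<bar> = \<bar>c0\<bar>" by (metis abs_minus_cancel abs_mult)
    moreover have "\<bar>d2 kp\<bar> * (rho1 * mu0) \<le> \<bar>d2 kp\<bar> * \<bar>(me kp + mu0) * rho1\<bar>"
    proof (intro mult_left_mono)
      have "rho1 * mu0 \<le> (me kp + mu0) * rho1" using me(2)[OF kp] mu0 pos by (simp add: algebra_simps)
      then show "rho1 * mu0 \<le> \<bar>(me kp + mu0) * rho1\<bar>" by linarith
    qed simp
    ultimately show "\<bar>d2 kp\<bar> \<le> \<bar>c0\<bar> / (rho1 * mu0)" using pos mu0 by (simp add: pos_le_divide_eq)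
  qed (use pos mu0 in simp)
  \<comment> \<open>The leading-order and first-order relations remove every term that grows with
    \<open>kp\<close>. The remainder is built from constants and the three bounded functions
    \<open>1 / kp\<close>, \<open>1 / me kp\<close> and \<open>d2 kp\<close>.\<close>
  have res: "kp * Re (g kp 0) = r + l * r'" "kp * Re (g kp 1) = 0" "kp * Re (g kp 2) = 1 / kp * (d2 kp * y1)"
    "kp * Re (g kp 3) = d2 kp * A" "kp * Re (g kp 4) = 1 / kp * (d2 kp * y1')" "kp * Re (g kp 5) = d2 kp * A' + l\<^sup>2 * R0 / rho1"
    "kp * Re (g kp 6) = 1 / kp * (d2 kp * t1)" "kp * Re (g kp 7) = d2 kp * p0 + (- p1 / (varpi * vs))"
    "kp * Re (g kp 8) = 1 / kp * (d2 kp * t1')" "kp * Re (g kp 9) = d2 kp * p0' + (- p1' / (varpi * tau))"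
    "kp * Im (g kp 0) = 1 / kp * (d2 kp * (1 / me kp) * (A + l * A') + 1 / me kp * (l ^ 3 * R0 / rho1))"
    "kp * Im (g kp 1) = l * (k0 * y1' - gamma * t1') / rho1" "kp * Im (g kp 2) = d2 kp * (- y0)"
    "kp * Im (g kp 3) = 1 / kp * (d2 kp * (- r))" "kp * Im (g kp 4) = d2 kp * (- y0')" "kp * Im (g kp 5) = 1 / kp * (d2 kp * (- r'))"
    "kp * Im (g kp 6) = d2 kp * (- t0)" "kp * Im (g kp 7) = 1 / kp * (d2 kp * (- p1))"
    "kp * Im (g kp 8) = d2 kp * (- t0')" "kp * Im (g kp 9) = 1 / kp * (d2 kp * (- p1'))" if kp: "K0 \<le> kp" for kp
  proof -
    have kp0: "0 < kp" using base(1)[OF kp] by simp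
    have me0: "0 < me kp" using me(2)[OF kp] mu0 by linarith
    have FF: "F kp * me kp * rho1 = k - (1 / kp)\<^sup>2 * (l * R0)" using me0 pos by (simp add: F_def)
    have X': "A = - (mu0 * y0)" "b * y0 - k - gamma * t0 = - (mu0 * rho2 * A)" "p0 + gamma * A = mu0 * rho3 * t0"
      "b * y1 - gamma * t1 = mu0 * rho2 * r" "p1 + gamma * r = - (mu0 * rho3 * t1)" "p0 / varpi + t1 = - (mu0 * vs * p1)"
      using X by linarith+
    have Y': "A' = - (mu0 * y0')" "k0 * y0' - 2 * l * k - gamma * t0' = - (mu0 * rho1 * A')" "p0' + gamma * A' = mu0 * rho3 * t0'"
      "k0 * y1' - gamma * t1' = mu0 * rho1 * r'" "p1' + gamma * r' = - (mu0 * rho3 * t1')" "p0' / varpi + t1' = - (mu0 * tau * p1')"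
      using Y by linarith+
    show "kp * Re (g kp 0) = r + l * r'" using kp0 by (simp add: g_def opA_simps u field_simps del: One_nat_def)
    have eq1: "Re (g kp 1) = (- k * kp * kp + l * R0 + kp * kp * (F kp * me kp * rho1)) / rho1"
      using pos by (simp add: g_def opA_simps u R0_def field_simps del: One_nat_def)
    show "kp * Re (g kp 1) = 0"
      unfolding eq1 FF using kp0 by (simp add: field_simps power2_eq_square)
    have eq2: "Re (g kp 2) = - r + me kp * y1"
      using pos kp0 by (simp add: g_def opA_simps u field_simps del: One_nat_def)
    show "kp * Re (g kp 2) = 1 / kp * (d2 kp * y1)"
      unfolding eq2 X(5) using pos kp0 by (simp add: d2_def field_simps power2_eq_square)
    have eq3: "Re (g kp 3) = kp * ((b * y0 - k - gamma * t0) / rho2 + me kp * A)"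
      using pos kp0 by (simp add: g_def opA_simps u field_simps del: One_nat_def)
    show "kp * Re (g kp 3) = d2 kp * A"
      unfolding eq3 X'(2) using pos kp0 by (simp add: d2_def field_simps power2_eq_square)
    have eq4: "Re (g kp 4) = - r' + me kp * y1'"
      using pos kp0 by (simp add: g_def opA_simps u field_simps del: One_nat_def)
    show "kp * Re (g kp 4) = 1 / kp * (d2 kp * y1')"
      unfolding eq4 Y(5) using pos kp0 by (simp add: d2_def field_simps power2_eq_square)
    have eq5: "Re (g kp 5) = (kp * (k0 * y0' - 2 * l * k - gamma * t0') + kp * (l * k) + kp * me kp * A' * rho1 - kp * l * (F kp * me kp * rho1)) / rho1"
      using pos kp0 by (simp add: g_def opA_simps u field_simps del: One_nat_def)
    show "kp * Re (g kp 5) = d2 kp * A' + l\<^sup>2 * R0 / rho1"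
      unfolding eq5 Y'(2) FF using pos kp0 by (simp add: d2_def field_simps power2_eq_square)
    have eq6: "Re (g kp 6) = (p1 + gamma * r) / rho3 + me kp * t1"
      using pos kp0 by (simp add: g_def opA_simps u field_simps del: One_nat_def)
    show "kp * Re (g kp 6) = 1 / kp * (d2 kp * t1)"
      unfolding eq6 X'(5) using pos kp0 by (simp add: d2_def field_simps power2_eq_square)
    have eq7: "Re (g kp 7) = - p1 / kp / varpi / vs - kp * t0 / vs + kp * me kp * p0"
      using pos kp0 by (simp add: g_def opA_simps u field_simps del: One_nat_def)
    show "kp * Re (g kp 7) = d2 kp * p0 + (- p1 / (varpi * vs))"
      unfolding eq7 X(4) using pos kp0 by (simp add: d2_def field_simps power2_eq_square)
    have eq8: "Re (g kp 8) = (p1' + gamma * r') / rho3 + me kp * t1'"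
      using pos kp0 by (simp add: g_def opA_simps u field_simps del: One_nat_def)
    show "kp * Re (g kp 8) = 1 / kp * (d2 kp * t1')"
      unfolding eq8 Y'(5) using pos kp0 by (simp add: d2_def field_simps power2_eq_square)
    have eq9: "Re (g kp 9) = - p1' / kp / varpi / tau - kp * t0' / tau + kp * me kp * p0'"
      using pos kp0 by (simp add: g_def opA_simps u field_simps del: One_nat_def)
    show "kp * Re (g kp 9) = d2 kp * p0' + (- p1' / (varpi * tau))"
      unfolding eq9 Y(4) using pos kp0 by (simp add: d2_def field_simps power2_eq_square)
    have "Im (g kp 0) * (me kp * rho1) = kp\<^sup>2 * (F kp * me kp * rho1) + (A + l * A') * me kp * rho1
        - l\<^sup>2 * (F kp * me kp * rho1) - kp\<^sup>2 * ((me kp)\<^sup>2 * rho1)"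
      by (simp add: g_def opA_simps u algebra_simps power2_eq_square del: One_nat_def)
    also have "\<dots> = (me kp - mu0) * rho1 * (A + l * A') + (1 / kp)\<^sup>2 * (l ^ 3 * R0)"
      unfolding FF me(1)[OF kp] using kp0 by (simp add: c0_def field_simps power2_eq_square power3_eq_cube)
    finally have "Im (g kp 0) = ((me kp - mu0) * rho1 * (A + l * A') + (1 / kp)\<^sup>2 * (l ^ 3 * R0)) / (me kp * rho1)"
      using me0 pos by (simp add: eq_divide_eq)
    also have "kp * \<dots> = 1 / kp * (d2 kp * (1 / me kp) * (A + l * A') + 1 / me kp * (l ^ 3 * R0 / rho1))"
      using me0 pos kp0 by (simp add: d2_def field_simps power2_eq_square)
    finally show "kp * Im (g kp 0) = 1 / kp * (d2 kp * (1 / me kp) * (A + l * A') + 1 / me kp * (l ^ 3 * R0 / rho1))" .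
    show "kp * Im (g kp 1) = l * (k0 * y1' - gamma * t1') / rho1"
      using pos kp0 by (simp add: g_def opA_simps u field_simps del: One_nat_def)
    have eq10: "Im (g kp 2) = - kp * A - kp * me kp * y0"
      by (simp add: g_def opA_simps u del: One_nat_def)
    show "kp * Im (g kp 2) = d2 kp * (- y0)"
      unfolding eq10 X'(1) by (simp add: d2_def field_simps power2_eq_square)
    have eq11: "Im (g kp 3) = (b * y1 - gamma * t1) / rho2 - me kp * r"
      using pos kp0 by (simp add: g_def opA_simps u field_simps del: One_nat_def)
    show "kp * Im (g kp 3) = 1 / kp * (d2 kp * (- r))"
      unfolding eq11 X'(4) using pos kp0 by (simp add: d2_def field_simps power2_eq_square)
    have eq12: "Im (g kp 4) = - kp * A' - kp * me kp * y0'"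
      by (simp add: g_def opA_simps u algebra_simps del: One_nat_def)
    show "kp * Im (g kp 4) = d2 kp * (- y0')"
      unfolding eq12 Y'(1) by (simp add: d2_def field_simps power2_eq_square)
    have eq13: "Im (g kp 5) = (k0 * y1' - gamma * t1') / rho1 - me kp * r'"
      using pos kp0 by (simp add: g_def opA_simps u field_simps del: One_nat_def)
    show "kp * Im (g kp 5) = 1 / kp * (d2 kp * (- r'))"
      unfolding eq13 Y'(4) using pos kp0 by (simp add: d2_def field_simps power2_eq_square)
    have eq14: "Im (g kp 6) = kp * (p0 + gamma * A) / rho3 - kp * me kp * t0"
      using pos kp0 by (simp add: g_def opA_simps u field_simps del: One_nat_def)
    show "kp * Im (g kp 6) = d2 kp * (- t0)"
      unfolding eq14 X'(3) using pos kp0 by (simp add: d2_def field_simps power2_eq_square)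
    have eq15: "Im (g kp 7) = - (p0 / varpi + t1) / vs - me kp * p1"
      using pos kp0 by (simp add: g_def opA_simps u field_simps del: One_nat_def)
    show "kp * Im (g kp 7) = 1 / kp * (d2 kp * (- p1))"
      unfolding eq15 X'(6) using pos kp0 by (simp add: d2_def field_simps power2_eq_square)
    have eq16: "Im (g kp 8) = kp * (p0' + gamma * A') / rho3 - kp * me kp * t0'"
      using pos kp0 by (simp add: g_def opA_simps u field_simps del: One_nat_def)
    show "kp * Im (g kp 8) = d2 kp * (- t0')"
      unfolding eq16 Y'(3) using pos kp0 by (simp add: d2_def field_simps power2_eq_square)
    have eq17: "Im (g kp 9) = - (p0' / varpi + t1') / tau - me kp * p1'"
      using pos kp0 by (simp add: g_def opA_simps u field_simps del: One_nat_def)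
    show "kp * Im (g kp 9) = 1 / kp * (d2 kp * (- p1'))"
      unfolding eq17 Y'(6) using pos kp0 by (simp add: d2_def field_simps power2_eq_square)
  qed
  have cong: "bounded_above K0 f" if "bounded_above K0 h" "\<And>kp. K0 \<le> kp \<Longrightarrow> f kp = h kp" for f h
    using that unfolding bounded_above_def by auto
  note bds = bounded_above_intros b_e b_im b_d
  have bR0: "bounded_above K0 (\<lambda>kp. kp * Re (g kp 0))" by (rule cong[OF _ res(1)]) (rule bds)+
  have bR1: "bounded_above K0 (\<lambda>kp. kp * Re (g kp 1))" by (rule cong[OF _ res(2)]) (rule bds)+
  have bR2: "bounded_above K0 (\<lambda>kp. kp * Re (g kp 2))" by (rule cong[OF _ res(3)]) (rule bds)+
  have bR3: "bounded_above K0 (\<lambda>kp. kp * Re (g kp 3))" by (rule cong[OF _ res(4)]) (rule bds)+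
  have bR4: "bounded_above K0 (\<lambda>kp. kp * Re (g kp 4))" by (rule cong[OF _ res(5)]) (rule bds)+
  have bR5: "bounded_above K0 (\<lambda>kp. kp * Re (g kp 5))" by (rule cong[OF _ res(6)]) (rule bds)+
  have bR6: "bounded_above K0 (\<lambda>kp. kp * Re (g kp 6))" by (rule cong[OF _ res(7)]) (rule bds)+
  have bR7: "bounded_above K0 (\<lambda>kp. kp * Re (g kp 7))" by (rule cong[OF _ res(8)]) (rule bds)+
  have bR8: "bounded_above K0 (\<lambda>kp. kp * Re (g kp 8))" by (rule cong[OF _ res(9)]) (rule bds)+
  have bR9: "bounded_above K0 (\<lambda>kp. kp * Re (g kp 9))" by (rule cong[OF _ res(10)]) (rule bds)+
  have bR: "bounded_above K0 (\<lambda>kp. kp * Re (g kp i))" if "i < 10" for i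
    using that
  proof (cases rule: less_10_cases)
    case 1
    show ?thesis unfolding 1 by (rule bR0)
  next
    case 2
    show ?thesis unfolding 2 by (rule bR1)
  next
    case 3
    show ?thesis unfolding 3 by (rule bR2)
  next
    case 4
    show ?thesis unfolding 4 by (rule bR3)
  next
    case 5
    show ?thesis unfolding 5 by (rule bR4)
  next
    case 6
    show ?thesis unfolding 6 by (rule bR5)
  next
    case 7
    show ?thesis unfolding 7 by (rule bR6)
  next
    case 8
    show ?thesis unfolding 8 by (rule bR7)
  next
    case 9
    show ?thesis unfolding 9 by (rule bR8)
  next
    case 10
    show ?thesis unfolding 10 by (rule bR9)
  qed
  have bI0: "bounded_above K0 (\<lambda>kp. kp * Im (g kp 0))" by (rule cong[OF _ res(11)]) (rule bds)+
  have bI1: "bounded_above K0 (\<lambda>kp. kp * Im (g kp 1))" by (rule cong[OF _ res(12)]) (rule bds)+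
  have bI2: "bounded_above K0 (\<lambda>kp. kp * Im (g kp 2))" by (rule cong[OF _ res(13)]) (rule bds)+
  have bI3: "bounded_above K0 (\<lambda>kp. kp * Im (g kp 3))" by (rule cong[OF _ res(14)]) (rule bds)+
  have bI4: "bounded_above K0 (\<lambda>kp. kp * Im (g kp 4))" by (rule cong[OF _ res(15)]) (rule bds)+
  have bI5: "bounded_above K0 (\<lambda>kp. kp * Im (g kp 5))" by (rule cong[OF _ res(16)]) (rule bds)+
  have bI6: "bounded_above K0 (\<lambda>kp. kp * Im (g kp 6))" by (rule cong[OF _ res(17)]) (rule bds)+
  have bI7: "bounded_above K0 (\<lambda>kp. kp * Im (g kp 7))" by (rule cong[OF _ res(18)]) (rule bds)+
  have bI8: "bounded_above K0 (\<lambda>kp. kp * Im (g kp 8))" by (rule cong[OF _ res(19)]) (rule bds)+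
  have bI9: "bounded_above K0 (\<lambda>kp. kp * Im (g kp 9))" by (rule cong[OF _ res(20)]) (rule bds)+
  have bI: "bounded_above K0 (\<lambda>kp. kp * Im (g kp i))" if "i < 10" for i
    using that
  proof (cases rule: less_10_cases)
    case 1
    show ?thesis unfolding 1 by (rule bI0)
  next
    case 2
    show ?thesis unfolding 2 by (rule bI1)
  next
    case 3
    show ?thesis unfolding 3 by (rule bI2)
  next
    case 4
    show ?thesis unfolding 4 by (rule bI3)
  next
    case 5
    show ?thesis unfolding 5 by (rule bI4)
  next
    case 6
    show ?thesis unfolding 6 by (rule bI5)
  next
    case 7
    show ?thesis unfolding 7 by (rule bI6)
  next
    case 8
    show ?thesis unfolding 8 by (rule bI7)
  next
    case 9
    show ?thesis unfolding 9 by (rule bI8)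
  next
    case 10
    show ?thesis unfolding 10 by (rule bI9)
  qed
  obtain BR where BR: "\<And>i kp. i < 10 \<Longrightarrow> K0 \<le> kp \<Longrightarrow> \<bar>kp * Re (g kp i)\<bar> \<le> BR i"
    using bR unfolding bounded_above_def by metis
  obtain BI where BI: "\<And>i kp. i < 10 \<Longrightarrow> K0 \<le> kp \<Longrightarrow> \<bar>kp * Im (g kp i)\<bar> \<le> BI i"
    using bI unfolding bounded_above_def by metis
  define G where "G = (\<Sum>i<10. wt i * ((BR i)\<^sup>2 + (BI i)\<^sup>2))"
  have G: "kp\<^sup>2 * EC (g kp) \<le> G" if kp: "K0 \<le> kp" for kp
  proof -
    have "kp\<^sup>2 * EC (g kp) = (\<Sum>i<10. wt i * ((kp * Re (g kp i))\<^sup>2 + (kp * Im (g kp i))\<^sup>2))"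
      unfolding EC_def cmod_power2 sum_distrib_left by (intro sum.cong) (auto simp: power_mult_distrib algebra_simps)
    also have "\<dots> \<le> G" unfolding G_def
      using sq_le[OF BR[OF _ kp]] sq_le[OF BI[OF _ kp]]
      by (intro sum_mono mult_left_mono add_mono) (auto simp: wt_pos less_imp_le)
    finally show ?thesis .
  qed
  have G0: "0 \<le> G" unfolding G_def by (intro sum_nonneg mult_nonneg_nonneg) (auto simp: wt_pos less_imp_le)
  have ECu: "k * kp\<^sup>2 \<le> EC (u kp)" for kp
  proof -
    have "wt 0 * (cmod (u kp 0))\<^sup>2 \<le> EC (u kp)"
      unfolding EC_def by (rule member_le_sum) (auto simp: wt_pos less_imp_le)
    then show ?thesis by (simp add: u wt_simps norm_of_real power2_abs)
  qed
  \<comment> \<open>One constant for both claims: the residual needs \<open>G / k\<close>, and the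
    bound on \<open>opA\<close> needs \<open>8 * mu0\<^sup>2 + 2 * G / k\<close>. The summand 1
    makes it positive.\<close>
  define C where "C = 3 * (G / k) + 8 * mu0\<^sup>2 + 1"
  have Gk: "0 \<le> G / k" using G0 pos by simp
  show ?thesis
  proof (rule that[of C K0])
    show "0 < C" unfolding C_def using Gk zero_le_power2[of mu0] by linarith
    show "0 < K0" using K1 by simp
    fix kp assume kp: "K0 \<le> kp"
    have kp1: "1 \<le> kp" by (rule base(1)[OF kp])
    define lam where "lam = kp * me kp"
    have Eu: "0 < EC (u kp)"
    proof -
      have "0 < k * kp\<^sup>2" using pos kp1 by simp
      then show ?thesis using ECu[of kp] by linarith
    qed
    have g1: "EC (g kp) \<le> G / k / kp ^ 4 * EC (u kp)"
    proof -
      have "EC (g kp) \<le> G / kp\<^sup>2" using G[OF kp] kp1 by (simp add: pos_le_divide_eq mult.commute)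
      also have "\<dots> = G / k / kp ^ 4 * (k * kp\<^sup>2)" using pos kp1 by (simp add: field_simps power2_eq_square power4_eq_xxxx)
      also have "\<dots> \<le> G / k / kp ^ 4 * EC (u kp)" using G0 pos kp1 ECu by (intro mult_left_mono) auto
      finally show ?thesis .
    qed
    have GC: "G / k \<le> C" unfolding C_def using Gk zero_le_power2[of mu0] by linarith
    have "EC (g kp) \<le> C / kp ^ 4 * EC (u kp)"
    proof -
      have "G / k / kp ^ 4 * EC (u kp) \<le> C / kp ^ 4 * EC (u kp)"
        using GC kp1 Eu by (intro mult_right_mono divide_right_mono) auto
      then show ?thesis using g1 by linarith
    qed
    moreover have "EC (opA kp (u kp)) \<le> C * kp\<^sup>2 * EC (u kp)"
    proof -
      have "EC (opA kp (u kp)) \<le> 2 * EC (\<lambda>i. (\<i> * complex_of_real lam) * u kp i)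
          + 2 * EC (\<lambda>i. opA kp (u kp) i - (\<i> * complex_of_real lam) * u kp i)" by (rule EC_le_2)
      also have "EC (\<lambda>i. (\<i> * complex_of_real lam) * u kp i) = lam\<^sup>2 * EC (u kp)"
        unfolding EC_scale by (simp add: norm_mult)
      also have "(\<lambda>i. opA kp (u kp) i - (\<i> * complex_of_real lam) * u kp i) = g kp"
        by (simp add: g_def lam_def fun_eq_iff)
      also have "lam\<^sup>2 * EC (u kp) \<le> (4 * mu0\<^sup>2 * kp\<^sup>2) * EC (u kp)"
      proof (intro mult_right_mono)
        have "(me kp)\<^sup>2 \<le> (2 * mu0)\<^sup>2" using me(2,3)[OF kp] mu0 by (intro power_mono) auto
        then show "lam\<^sup>2 \<le> 4 * mu0\<^sup>2 * kp\<^sup>2" unfolding lam_def power_mult_distrib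
          by (simp add: mult.commute mult_left_mono)
      qed (use Eu in simp)
      also have "EC (g kp) \<le> (G / k * kp\<^sup>2) * EC (u kp)"
      proof -
        have "1 / kp ^ 4 \<le> 1" "1 \<le> kp\<^sup>2" using kp1 by simp_all
        then have "1 / kp ^ 4 \<le> kp\<^sup>2" by linarith
        then have "G / k * (1 / kp ^ 4) \<le> G / k * kp\<^sup>2" using G0 pos by (intro mult_left_mono) auto
        then have "G / k / kp ^ 4 * EC (u kp) \<le> (G / k * kp\<^sup>2) * EC (u kp)" using Eu by (intro mult_right_mono) auto
        then show ?thesis using g1 by linarith
      qed
      finally have "EC (opA kp (u kp)) \<le> (8 * mu0\<^sup>2 + 2 * G / k) * (kp\<^sup>2 * EC (u kp))" by (simp add: algebra_simps)
      also have "\<dots> \<le> C * (kp\<^sup>2 * EC (u kp))"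
      proof (intro mult_right_mono)
        show "8 * mu0\<^sup>2 + 2 * G / k \<le> C" unfolding C_def using Gk by simp
      qed (use Eu in simp)
      finally show ?thesis by (simp add: mult.assoc)
    qed
    ultimately show "\<exists>lam u. 0 < EC u \<and> EC (\<lambda>i. opA kp u i - \<i> * complex_of_real lam * u i) \<le> C / kp ^ 4 * EC u \<and>
      EC (opA kp u) \<le> C * kp\<^sup>2 * EC u"
      using Eu unfolding g_def[abs_def] by blast
  qed
qed

text \<open>Up to a time of order \<open>kp\<^sup>2\<close> the tracking error is at most a quarter
  of the initial energy. The inequality \<open>EC_le_2\<close> then leaves at least a quarter of
  that energy in the trajectory.\<close>

lemma slow_modes:
  assumes chs: "(vs * rho3 - rho1 / k) * (b - k * rho2 / rho1) + gamma\<^sup>2 * vs \<noteq> 0"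
    and cht: "(tau * rho3 - rho1 / k) * (k0 - k) + gamma\<^sup>2 * tau \<noteq> 0"
  obtains C K0 \<delta> where "0 < C" "0 < K0" "0 < \<delta>" "\<And>kp. K0 \<le> kp \<Longrightarrow> \<exists>u0. 0 < EC u0 \<and>
      EC (opA kp u0) \<le> C * kp\<^sup>2 * EC u0 \<and>
      (\<forall>u. traj kp u \<and> u 0 = u0 \<longrightarrow> EC u0 \<le> 4 * EC (u (\<delta> * kp\<^sup>2)))"
proof -
  obtain C K0 where C: "0 < C" "0 < K0" and q: "\<And>kp. K0 \<le> kp \<Longrightarrow> \<exists>lam u. 0 < EC u \<and>
      EC (\<lambda>i. opA kp u i - \<i> * complex_of_real lam * u i) \<le> C / kp ^ 4 * EC u \<and>
      EC (opA kp u) \<le> C * kp\<^sup>2 * EC u"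
    using quasimode_exists[OF chs cht] by blast
  \<comment> \<open>Solves \<open>2 * exp 1 * \<delta>\<^sup>2 * C = 1 / 4\<close>, the condition
    for a tracking error of one quarter at time \<open>\<delta> * kp\<^sup>2\<close>.\<close>
  define \<delta> where "\<delta> = sqrt (1 / (8 * exp 1 * C))"
  have d: "0 < \<delta>" "\<delta>\<^sup>2 = 1 / (8 * exp 1 * C)" using C by (simp_all add: \<delta>_def)
  have "\<exists>u0. 0 < EC u0 \<and> EC (opA kp u0) \<le> C * kp\<^sup>2 * EC u0 \<and>
      (\<forall>u. traj kp u \<and> u 0 = u0 \<longrightarrow> EC u0 \<le> 4 * EC (u (\<delta> * kp\<^sup>2)))" if kp: "K0 \<le> kp" for kp
  proof -
    obtain lam u0 where u0: "0 < EC u0"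
      "EC (\<lambda>i. opA kp u0 i - \<i> * complex_of_real lam * u0 i) \<le> C / kp ^ 4 * EC u0"
      "EC (opA kp u0) \<le> C * kp\<^sup>2 * EC u0" using q[OF kp] by blast
    have kp0: "0 < kp" using kp C by simp
    have "EC u0 \<le> 4 * EC (u (\<delta> * kp\<^sup>2))" if tr: "traj kp u" and i: "u 0 = u0" for u
    proof -
      define T where "T = \<delta> * kp\<^sup>2"
      have T: "0 < T" using d kp0 by (simp add: T_def)
      define z where "z = exp (\<i> * complex_of_real (lam * T))"
      have z: "cmod z = 1" by (simp add: z_def norm_exp_eq_Re)
      have "EC (\<lambda>i. u T i - z * u0 i) \<le> 2 * exp 1 * T\<^sup>2 * (C / kp ^ 4 * EC u0)"
        using quasimode_tracking[OF tr T, of lam] mult_left_mono[OF u0(2), of "2 * exp 1 * T\<^sup>2"]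
        unfolding i z_def by simp
      also have "\<dots> = EC u0 / 4"
        using kp0 C unfolding T_def power_mult_distrib d(2) by (simp add: field_simps flip: power_mult)
      finally have w: "EC (\<lambda>i. u T i - z * u0 i) \<le> EC u0 / 4" .
      have "EC u0 = EC (\<lambda>i. z * u0 i)" unfolding EC_scale z by simp
      also have "\<dots> \<le> 2 * EC (u T) + 2 * EC (\<lambda>i. z * u0 i - u T i)" by (rule EC_le_2)
      also have "EC (\<lambda>i. z * u0 i - u T i) = EC (\<lambda>i. u T i - z * u0 i)"
        unfolding EC_def by (simp add: norm_minus_commute)
      finally show ?thesis using w unfolding T_def by linarith
    qed
    then show ?thesis using u0 by blast
  qed
  then show ?thesis using that[OF C d(1)] by blast
qed

end

section \<open>Energy variables and their coefficients\<close>

lemma mean0_add: "L2 ell f \<Longrightarrow> L2 ell g \<Longrightarrow> mean0 ell f \<Longrightarrow> mean0 ell g \<Longrightarrow> mean0 ell (\<lambda>x. f x + g x)"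
  by (simp add: mean0_def L2_integrable)

lemma mean0_cmult: "mean0 ell f \<Longrightarrow> mean0 ell (\<lambda>x. a * f x)"
  by (simp add: mean0_def)

lemma mean0_diff: "L2 ell f \<Longrightarrow> L2 ell g \<Longrightarrow> mean0 ell f \<Longrightarrow> mean0 ell g \<Longrightarrow> mean0 ell (\<lambda>x. f x - g x)"
  by (simp add: mean0_def L2_integrable)

lemma mean0_dx: "0 < ell \<Longrightarrow> H10 ell f \<Longrightarrow> mean0 ell (dx ell f)"
  unfolding mean0_def by (rule H10_integral_dx)

lemma H1_diff:
  assumes "0 < ell" "H1 ell f" "H1 ell g"
  shows "H1 ell (\<lambda>x. f x - g x)"
  using H1_add(1)[OF assms(1,2) H1_cmult(1)[OF assms(1,3), of "-1"]] by simp

lemma H1_continuous_rep: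
  assumes ell: "0 < ell" and f: "H1 ell f"
  obtains h where "continuous_on {0..ell} h" "AE x in lebesgue_on {0..ell}. f x = h x"
proof -
  obtain c where "AE x in lebesgue_on {0..ell}. f x = c + J (dx ell f) x"
    using H1_AC[OF ell f] by blast
  moreover have "continuous_on {0..ell} (\<lambda>x. c + J (dx ell f) x)"
    by (intro continuous_intros J_continuous_L2 L2_dx f)
  ultimately show ?thesis using that by blast
qed

locale bmc_system =
  fixes P :: bmc_params
  assumes ell: "0 < p_ell P"
    and params_pos: "0 < p_rho1 P" "0 < p_rho2 P" "0 < p_rho3 P" "0 < p_k P" "0 < p_k0 P" "0 < p_b P"
      "0 < p_varpi P" "0 < p_l P" "0 < p_gamma P" "0 < p_varsigma P" "0 < p_tau P"
    and nonresonance: "\<And>n::nat. 0 < n \<Longrightarrow> p_l P * p_ell P \<noteq> real n * pi"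
begin

sublocale bmc_coeffs "p_rho1 P" "p_rho2 P" "p_rho3 P" "p_k P" "p_k0 P" "p_b P" "p_varpi P" "p_l P" "p_gamma P"
    "p_varsigma P" "p_tau P"
  using params_pos by unfold_locales

abbreviation "L \<equiv> p_ell P"
abbreviation "M \<equiv> lebesgue_on {0..L}"

definition ecomp :: "bmc_state \<Rightarrow> nat \<Rightarrow> real \<Rightarrow> complex" where
  "ecomp v i = [shearS P v, s_Phi v, dx L (s_psi v), s_Psi v, axialN P v, s_W v,
     s_theta v, s_p v, s_xi v, s_q v] ! i"

lemma ecomp_simps:
  "ecomp v 0 = shearS P v" "ecomp v 1 = s_Phi v" "ecomp v 2 = dx L (s_psi v)" "ecomp v 3 = s_Psi v"
  "ecomp v 4 = axialN P v" "ecomp v 5 = s_W v" "ecomp v 6 = s_theta v" "ecomp v 7 = s_p v"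
  "ecomp v 8 = s_xi v" "ecomp v 9 = s_q v"
  by (simp_all add: ecomp_def)

definition basis :: "nat \<Rightarrow> nat \<Rightarrow> real \<Rightarrow> real" where
  "basis i = (if i \<in> {0, 3, 5, 7, 9} then cosf L else sinf L)"

lemma basis_simps:
  "basis 0 = cosf L" "basis 1 = sinf L" "basis 2 = sinf L" "basis 3 = cosf L" "basis 4 = sinf L"
  "basis 5 = cosf L" "basis 6 = sinf L" "basis 7 = cosf L" "basis 8 = sinf L" "basis 9 = cosf L"
  by (simp_all add: basis_def)

lemma basis_continuous: "continuous_on A (basis i n)"
  by (simp add: basis_def cosf_continuous sinf_continuous)

lemma basis_orthogonal: "orthogonal_system L (basis i)"
  using orthogonal_cosf[OF ell] orthogonal_sinf[OF ell] by (simp add: basis_def)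

definition coef :: "nat \<Rightarrow> bmc_state \<Rightarrow> nat \<Rightarrow> complex" where
  "coef n v i = fcoef L (basis i n) (ecomp v i)"

lemma VspaceD:
  assumes "Vspace P v"
  shows "H10 L (s_phi v)" "L2 L (s_Phi v)" "H1 L (s_psi v)" "mean0 L (s_psi v)" "L2 L (s_Psi v)"
    "mean0 L (s_Psi v)" "H1 L (s_w v)" "mean0 L (s_w v)" "L2 L (s_W v)" "mean0 L (s_W v)"
    "L2 L (s_theta v)" "L2 L (s_p v)" "mean0 L (s_p v)" "L2 L (s_xi v)" "L2 L (s_q v)" "mean0 L (s_q v)"
  using assms by (simp_all add: Vspace_def Let_def)

lemma Vspace_H1:
  assumes "Vspace P v"
  shows "H1 L (s_phi v)" "L2 L (s_phi v)" "L2 L (s_psi v)" "L2 L (s_w v)"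
  using VspaceD[OF assms] by (simp_all add: H10_H1 H1_L2)

lemma VspaceI:
  assumes "H10 L (s_phi v)" "L2 L (s_Phi v)" "H1 L (s_psi v)" "mean0 L (s_psi v)" "L2 L (s_Psi v)"
    "mean0 L (s_Psi v)" "H1 L (s_w v)" "mean0 L (s_w v)" "L2 L (s_W v)" "mean0 L (s_W v)"
    "L2 L (s_theta v)" "L2 L (s_p v)" "mean0 L (s_p v)" "L2 L (s_xi v)" "L2 L (s_q v)" "mean0 L (s_q v)"
  shows "Vspace P v"
  using assms by (simp add: Vspace_def Let_def)

lemma BdomD:
  assumes "Bdom P v"
  shows "Vspace P v" "H1 L (dx L (s_phi v))" "H10 L (s_Phi v)" "H10 L (dx L (s_psi v))" "H10 L (dx L (s_w v))"
    "H1 L (s_Psi v)" "H1 L (s_W v)" "H10 L (s_theta v)" "H10 L (s_xi v)" "H1 L (s_p v)" "H1 L (s_q v)"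
  using assms by (simp_all add: Bdom_def H2_def Let_def)

lemma Vspace_add:
  assumes "Vspace P u" "Vspace P v" shows "Vspace P (st_add u v)"
  by (rule VspaceI; simp add: st_add_def)
    (intro H10_add H1_add(1) L2_add mean0_add ell Vspace_H1[OF assms(1)] Vspace_H1[OF assms(2)]
      VspaceD[OF assms(1)] VspaceD[OF assms(2)])+

lemma Vspace_scale:
  assumes "Vspace P v" shows "Vspace P (st_scale a v)"
  by (rule VspaceI; simp add: st_scale_def)
    (intro H10_cmult H1_cmult(1) L2_cmult mean0_cmult ell Vspace_H1[OF assms(1)] VspaceD[OF assms(1)])+

lemma Vspace_diff: "Vspace P u \<Longrightarrow> Vspace P v \<Longrightarrow> Vspace P (st_diff u v)"
  unfolding st_diff_def by (intro Vspace_add Vspace_scale)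

lemma L2_ecomp:
  assumes v: "Vspace P v" and i: "i < 10" shows "L2 L (ecomp v i)"
proof -
  have "L2 L (shearS P v)" "L2 L (axialN P v)"
    unfolding shearS_def axialN_def
    by (intro L2_intros L2_dx Vspace_H1[OF v] VspaceD[OF v])+
  with VspaceD[OF v] show ?thesis
    by - (rule less_10_cases[OF i]; simp add: ecomp_simps L2_dx del: One_nat_def)
qed

lemma mean0_ecomp:
  assumes v: "Vspace P v" and i: "i \<in> {0, 3, 5, 7, 9}" shows "mean0 L (ecomp v i)"
proof -
  have "mean0 L (shearS P v)"
    unfolding shearS_def
    by (intro mean0_add mean0_cmult L2_intros mean0_dx ell L2_dx Vspace_H1[OF v] VspaceD[OF v])
  with VspaceD[OF v] i show ?thesis
    by (auto simp: ecomp_simps)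
qed

lemma ecomp_add:
  assumes u: "Vspace P u" and v: "Vspace P v" and i: "i < 10"
  shows "AE x in M. ecomp (st_add u v) i x = ecomp u i x + ecomp v i x"
proof -
  have "AE x in M. dx L (s_phi (st_add u v)) x = dx L (s_phi u) x + dx L (s_phi v) x"
    "AE x in M. dx L (s_psi (st_add u v)) x = dx L (s_psi u) x + dx L (s_psi v) x"
    "AE x in M. dx L (s_w (st_add u v)) x = dx L (s_w u) x + dx L (s_w v) x"
    unfolding st_add_def bmc_state.select_convs
    by (intro H1_add(2) ell Vspace_H1[OF u] Vspace_H1[OF v] VspaceD[OF u] VspaceD[OF v])+
  then show ?thesis
  proof eventually_elim
    case (elim x)
    then show ?case
      by - (rule less_10_cases[OF i]; simp add: ecomp_simps shearS_def axialN_def st_add_def algebra_simps del: One_nat_def)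
  qed
qed

lemma ecomp_scale:
  assumes v: "Vspace P v" and i: "i < 10"
  shows "AE x in M. ecomp (st_scale a v) i x = a * ecomp v i x"
proof -
  have "AE x in M. dx L (s_phi (st_scale a v)) x = a * dx L (s_phi v) x"
    "AE x in M. dx L (s_psi (st_scale a v)) x = a * dx L (s_psi v) x"
    "AE x in M. dx L (s_w (st_scale a v)) x = a * dx L (s_w v) x"
    unfolding st_scale_def bmc_state.select_convs
    by (intro H1_cmult(2) ell Vspace_H1[OF v] VspaceD[OF v])+
  then show ?thesis
  proof eventually_elim
    case (elim x)
    then show ?case
      by - (rule less_10_cases[OF i]; simp add: ecomp_simps shearS_def axialN_def st_scale_def algebra_simps del: One_nat_def)
  qed
qed

lemma coef_add:
  assumes "Vspace P u" "Vspace P v" "i < 10"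
  shows "coef n (st_add u v) i = coef n u i + coef n v i"
proof -
  have "coef n (st_add u v) i = fcoef L (basis i n) (\<lambda>x. ecomp u i x + ecomp v i x)"
    unfolding coef_def by (intro fcoef_cong_AE L2_ecomp Vspace_add L2_add ecomp_add basis_continuous assms)
  also have "\<dots> = coef n u i + coef n v i"
    unfolding coef_def by (intro fcoef_add L2_ecomp basis_continuous assms)
  finally show ?thesis .
qed

lemma coef_scale:
  assumes "Vspace P v" "i < 10"
  shows "coef n (st_scale a v) i = a * coef n v i"
proof -
  have "coef n (st_scale a v) i = fcoef L (basis i n) (\<lambda>x. a * ecomp v i x)"
    unfolding coef_def by (intro fcoef_cong_AE L2_ecomp Vspace_scale L2_cmult ecomp_scale basis_continuous assms)
  also have "\<dots> = a * coef n v i"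
    unfolding coef_def by (rule fcoef_cmult)
  finally show ?thesis .
qed

lemma coef_diff:
  assumes "Vspace P u" "Vspace P v" "i < 10"
  shows "coef n (st_diff u v) i = coef n u i - coef n v i"
  unfolding st_diff_def using assms by (simp add: coef_add coef_scale Vspace_scale)

section \<open>The seminorm on states and the size of coefficients\<close>

lemma Vnorm_nonneg: "0 \<le> Vnorm P v"
  unfolding Vnorm_def Let_def using params_pos by simp

lemma Vnorm_sq: "(Vnorm P v)\<^sup>2 = (\<Sum>i<10. wt i * (L2norm L (ecomp v i))\<^sup>2)"
proof -
  have "0 \<le> (\<Sum>i<10. wt i * (L2norm L (ecomp v i))\<^sup>2)"
    by (intro sum_nonneg mult_nonneg_nonneg) (auto simp: less_imp_le wt_pos)
  then show ?thesis
    unfolding Vnorm_def Let_def sum_lessThan_10 wt_simps ecomp_simps by simp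
qed

text \<open>In the form of a Euclidean norm of ten weighted L2 norms the triangle inequality reduces
  to Minkowski's inequality in ten dimensions.\<close>

lemma Vnorm_L2_set: "Vnorm P v = L2_set (\<lambda>i. sqrt (wt i) * L2norm L (ecomp v i)) {..<10}"
proof -
  have "L2_set (\<lambda>i. sqrt (wt i) * L2norm L (ecomp v i)) {..<10} = sqrt ((Vnorm P v)\<^sup>2)"
    unfolding L2_set_def Vnorm_sq
    by (intro arg_cong[where f = sqrt] sum.cong) (auto simp: power_mult_distrib less_imp_le wt_pos)
  then show ?thesis using Vnorm_nonneg by simp
qed

lemma Vnorm_scale:
  assumes "Vspace P v" shows "Vnorm P (st_scale a v) = cmod a * Vnorm P v"
proof -
  have "L2norm L (ecomp (st_scale a v) i) = cmod a * L2norm L (ecomp v i)" if i: "i < 10" for i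
  proof -
    have "L2norm L (ecomp (st_scale a v) i) = L2norm L (\<lambda>x. a * ecomp v i x)"
      by (intro L2norm_cong_AE L2_ecomp Vspace_scale L2_cmult ecomp_scale assms i)
    then show ?thesis by (simp add: L2norm_cmult)
  qed
  then have "(Vnorm P (st_scale a v))\<^sup>2 = (cmod a * Vnorm P v)\<^sup>2"
    unfolding power_mult_distrib Vnorm_sq sum_distrib_left
    by (intro sum.cong) (auto simp: power_mult_distrib)
  then show ?thesis
    using Vnorm_nonneg by (simp add: power2_eq_iff_nonneg)
qed

lemma Vnorm_triangle:
  assumes "Vspace P u" "Vspace P v" shows "Vnorm P (st_add u v) \<le> Vnorm P u + Vnorm P v"
proof -
  have "L2norm L (ecomp (st_add u v) i) \<le> L2norm L (ecomp u i) + L2norm L (ecomp v i)" if i: "i < 10" for i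
  proof -
    have "L2norm L (ecomp (st_add u v) i) = L2norm L (\<lambda>x. ecomp u i x + ecomp v i x)"
      by (intro L2norm_cong_AE L2_ecomp Vspace_add L2_add ecomp_add assms i)
    also have "\<dots> \<le> L2norm L (ecomp u i) + L2norm L (ecomp v i)"
      by (intro L2norm_triangle L2_ecomp assms i)
    finally show ?thesis .
  qed
  then have "Vnorm P (st_add u v)
      \<le> L2_set (\<lambda>i. sqrt (wt i) * L2norm L (ecomp u i) + sqrt (wt i) * L2norm L (ecomp v i)) {..<10}"
    unfolding Vnorm_L2_set
    by (intro L2_set_mono) (auto simp: L2norm_nonneg less_imp_le wt_pos simp flip: distrib_left intro!: mult_left_mono)
  also have "\<dots> \<le> Vnorm P u + Vnorm P v"
    unfolding Vnorm_L2_set by (rule L2_set_triangle_ineq)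
  finally show ?thesis .
qed

text \<open>States are functions rather than classes, so this is a pseudometric and
  \<open>Veq\<close> means distance zero. Symmetry and the triangle inequality need membership in
  \<open>Vspace\<close>, where \<open>dx\<close> is linear up to null sets.\<close>

definition vdist :: "bmc_state \<Rightarrow> bmc_state \<Rightarrow> real" where "vdist u v = Vnorm P (st_diff u v)"

lemma vdist_nonneg: "0 \<le> vdist u v" unfolding vdist_def by (rule Vnorm_nonneg)

lemma vdist_commute: assumes "Vspace P u" "Vspace P v" shows "vdist u v = vdist v u"
proof -
  have "st_diff u v = st_scale (-1) (st_diff v u)"
    by (simp add: st_diff_def st_add_def st_scale_def)
  then show ?thesis
    unfolding vdist_def using Vnorm_scale[OF Vspace_diff[OF assms(2,1)], of "-1"] by simp
qed

lemma vdist_triangle: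
  assumes "Vspace P u" "Vspace P v" "Vspace P w"
  shows "vdist u w \<le> vdist u v + vdist v w"
proof -
  have "st_diff u w = st_add (st_diff u v) (st_diff v w)"
    by (simp add: st_diff_def st_add_def st_scale_def)
  then show ?thesis
    unfolding vdist_def using Vnorm_triangle[OF Vspace_diff[OF assms(1,2)] Vspace_diff[OF assms(2,3)]] by simp
qed

lemma Vnorm_le_vdist:
  assumes "Vspace P u" "Vspace P v" shows "Vnorm P u \<le> Vnorm P v + vdist u v"
proof -
  have "u = st_add v (st_diff u v)"
    by (simp add: st_diff_def st_add_def st_scale_def)
  then show ?thesis
    unfolding vdist_def using Vnorm_triangle[OF assms(2) Vspace_diff[OF assms]] by simp
qed

lemma Veq_vdist: "Veq P u v \<longleftrightarrow> vdist u v = 0"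
  by (simp add: Veq_def vdist_def)

lemma Vnorm_Veq: "Vspace P u \<Longrightarrow> Vspace P v \<Longrightarrow> vdist u v = 0 \<Longrightarrow> Vnorm P u = Vnorm P v"
  using Vnorm_le_vdist[of u v] Vnorm_le_vdist[of v u] vdist_commute[of u v] by simp

lemma coef_Bessel:
  assumes "Vspace P v"
  shows "L / 2 * (\<Sum>n<N. EC (coef n v)) \<le> (Vnorm P v)\<^sup>2"
proof -
  have "L / 2 * (\<Sum>n<N. EC (coef n v))
      = (\<Sum>i<10. wt i * (L / 2 * (\<Sum>n<N. (cmod (fcoef L (basis i n) (ecomp v i)))\<^sup>2)))"
    unfolding EC_def coef_def by (subst sum.swap) (simp add: sum_distrib_left mult_ac)
  also have "\<dots> \<le> (Vnorm P v)\<^sup>2"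
    unfolding Vnorm_sq
    by (intro sum_mono mult_left_mono orthogonal_system.Bessel[OF basis_orthogonal] L2_ecomp assms)
      (auto simp: less_imp_le wt_pos)
  finally show ?thesis .
qed

lemma EC_coef_le:
  assumes "Vspace P v" shows "L / 2 * EC (coef n v) \<le> (Vnorm P v)\<^sup>2"
proof -
  have "L / 2 * EC (coef n v) \<le> L / 2 * (\<Sum>m<Suc n. EC (coef m v))"
    using ell by (intro mult_left_mono member_le_sum) (auto simp: EC_nonneg)
  then show ?thesis using coef_Bessel[OF assms, of "Suc n"] by linarith
qed

text \<open>Coefficients are bounded functionals, uniformly in the mode. This carries limits in the
  state space over to coefficients and makes coefficients independent of the representative.\<close>

lemma cmod_coef_le:
  assumes "i < 10"
  obtains C where "0 < C" "\<And>n v. Vspace P v \<Longrightarrow> cmod (coef n v i) \<le> C * Vnorm P v"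
proof
  let ?C = "sqrt (2 / (L * wt i))"
  have w: "0 < wt i" using wt_pos[OF assms] .
  show "0 < ?C" using ell w by simp
  fix n v assume v: "Vspace P v"
  have "wt i * (cmod (coef n v i))\<^sup>2 \<le> EC (coef n v)"
    unfolding EC_def by (rule member_le_sum) (use assms in \<open>auto simp: less_imp_le wt_pos\<close>)
  then have "L / 2 * (wt i * (cmod (coef n v i))\<^sup>2) \<le> (Vnorm P v)\<^sup>2"
    using EC_coef_le[OF v, of n] mult_left_mono[of "wt i * (cmod (coef n v i))\<^sup>2" "EC (coef n v)" "L / 2"] ell
    by linarith
  then have "(cmod (coef n v i))\<^sup>2 \<le> (?C * Vnorm P v)\<^sup>2"
    unfolding power_mult_distrib using ell w by (simp add: field_simps)
  then show "cmod (coef n v i) \<le> ?C * Vnorm P v"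
    by (rule power2_le_imp_le) (use ell w Vnorm_nonneg in simp)
qed

lemma coef_cong:
  assumes "Vspace P u" "Vspace P v" "vdist u v = 0" "i < 10"
  shows "coef n u i = coef n v i"
proof -
  obtain C where "\<And>n v. Vspace P v \<Longrightarrow> cmod (coef n v i) \<le> C * Vnorm P v"
    using cmod_coef_le[OF assms(4)] by blast
  from this[OF Vspace_diff[OF assms(1,2)], of n] have "cmod (coef n u i - coef n v i) \<le> 0"
    unfolding coef_diff[OF assms(1,2,4)] assms(3)[unfolded vdist_def] by simp
  then show ?thesis by simp
qed

lemma ecomp_H1:
  assumes v: "Bdom P v" and i: "i < 10" shows "H1 L (ecomp v i)"
proof -
  note D = BdomD[OF v] VspaceD[OF BdomD(1)[OF v]] Vspace_H1[OF BdomD(1)[OF v]]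
  have "H1 L (shearS P v)" "H1 L (axialN P v)"
    unfolding shearS_def axialN_def by (intro H1_add(1) H1_diff H1_cmult(1) ell D H10_H1)+
  with D show ?thesis
    by - (rule less_10_cases[OF i]; simp add: ecomp_simps H10_H1 del: One_nat_def)
qed

text \<open>On the domain every energy variable lies in H1 and so has a continuous representative,
  and the five variables expanded in cosines have zero mean.\<close>

lemma Parseval_Bdom:
  assumes v: "Bdom P v"
  shows "(\<lambda>n. L / 2 * EC (coef n v)) sums (Vnorm P v)\<^sup>2"
proof -
  have "(\<lambda>n. L / 2 * (cmod (coef n v i))\<^sup>2) sums (L2norm L (ecomp v i))\<^sup>2" if i: "i < 10" for i
  proof -
    obtain h where h: "continuous_on {0..L} h" "AE x in M. ecomp v i x = h x"
      using H1_continuous_rep[OF ell ecomp_H1[OF v i]] .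
    note L = L2_ecomp[OF BdomD(1)[OF v] i]
    show ?thesis
      unfolding coef_def basis_def
      using Parseval_sin[OF ell L h] Parseval_cos[OF ell L h mean0_ecomp[OF BdomD(1)[OF v]]] by auto
  qed
  then have "(\<lambda>n. \<Sum>i<10. wt i * (L / 2 * (cmod (coef n v i))\<^sup>2)) sums (Vnorm P v)\<^sup>2"
    unfolding Vnorm_sq by (intro sums_sum sums_mult) auto
  then show ?thesis
    by (simp add: EC_def sum_distrib_left mult_ac)
qed

section \<open>The operator on coefficients\<close>

lemma Bop_sel:
  "s_phi (Bop P v) = s_Phi v" "s_psi (Bop P v) = s_Psi v" "s_w (Bop P v) = s_W v"
  "s_Phi (Bop P v) = (\<lambda>x. complex_of_real (p_k P / p_rho1 P) * dx L (shearS P v) x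
     + complex_of_real (p_l P * p_k0 P / p_rho1 P) * axialN P v x
     - complex_of_real (p_l P * p_gamma P / p_rho1 P) * s_xi v x)"
  "s_Psi (Bop P v) = (\<lambda>x. complex_of_real (p_b P / p_rho2 P) * dx L (dx L (s_psi v)) x
     - complex_of_real (p_k P / p_rho2 P) * shearS P v x
     - complex_of_real (p_gamma P / p_rho2 P) * dx L (s_theta v) x)"
  "s_W (Bop P v) = (\<lambda>x. complex_of_real (p_k0 P / p_rho1 P) * dx L (axialN P v) x
     - complex_of_real (p_l P * p_k P / p_rho1 P) * shearS P v x
     - complex_of_real (p_gamma P / p_rho1 P) * dx L (s_xi v) x)"
  "s_theta (Bop P v) = (\<lambda>x. - complex_of_real (1 / p_rho3 P) * dx L (s_p v) x
     - complex_of_real (p_gamma P / p_rho3 P) * dx L (s_Psi v) x)"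
  "s_p (Bop P v) = (\<lambda>x. - complex_of_real (1 / (p_varsigma P * p_varpi P)) * s_p v x
     - complex_of_real (1 / p_varsigma P) * dx L (s_theta v) x)"
  "s_xi (Bop P v) = (\<lambda>x. - complex_of_real (1 / p_rho3 P) * dx L (s_q v) x
     - complex_of_real (p_gamma P / p_rho3 P) * (dx L (s_W v) x - complex_of_real (p_l P) * s_Phi v x))"
  "s_q (Bop P v) = (\<lambda>x. - complex_of_real (1 / (p_tau P * p_varpi P)) * s_q v x
     - complex_of_real (1 / p_tau P) * dx L (s_xi v) x)"
  by (simp_all only: Bop_def Let_def bmc_state.select_convs)

lemma axialN_H10:
  assumes "Bdom P v" shows "H10 L (axialN P v)"
  unfolding axialN_def
  by (intro H10_diff H10_cmult ell BdomD(5)[OF assms] VspaceD(1) BdomD(1)[OF assms])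

lemma Bdom_H1:
  assumes v: "Bdom P v"
  shows "H1 L (shearS P v)" "H10 L (axialN P v)" "H1 L (axialN P v)" "H1 L (s_Phi v)" "H1 L (dx L (s_psi v))"
    "H1 L (s_theta v)" "H1 L (s_xi v)"
  using ecomp_H1[OF v, of 0] ecomp_H1[OF v, of 4] axialN_H10[OF v] BdomD[OF v]
  by (simp_all add: ecomp_simps H10_H1)

lemma Bdom_L2:
  assumes v: "Bdom P v"
  shows "L2 L (shearS P v)" "L2 L (axialN P v)"
    "L2 L (dx L (shearS P v))" "L2 L (dx L (axialN P v))" "L2 L (dx L (s_Phi v))"
    "L2 L (dx L (dx L (s_psi v)))" "L2 L (dx L (s_theta v))" "L2 L (dx L (s_xi v))" "L2 L (dx L (s_Psi v))"
    "L2 L (dx L (s_W v))" "L2 L (dx L (s_p v))" "L2 L (dx L (s_q v))"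
  using Bdom_H1[OF v] BdomD[OF v] by (simp_all add: L2_dx H1_L2)

text \<open>The zero-mean constraints on the image come from the boundary conditions of the domain:
  each derivative occurring in a constrained component is that of a function in H10.\<close>

lemma Vspace_Bop:
  assumes v: "Bdom P v" shows "Vspace P (Bop P v)"
proof -
  note V = VspaceD[OF BdomD(1)[OF v]]
  have m: "mean0 L (shearS P v)" using mean0_ecomp[OF BdomD(1)[OF v], of 0] by (simp add: ecomp_simps)
  show ?thesis
    by (rule VspaceI; unfold Bop_sel)
      (intro L2_diff L2_add L2_cmult mean0_diff mean0_cmult m mean0_dx ell Bdom_L2[OF v] V
        BdomD(3-9)[OF v] Bdom_H1(2)[OF v])+
qed

text \<open>The choice of bases matches the boundary conditions: the five variables expanded in
  sines lie in H10, as the cosine coefficients of their derivatives require, while the variables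
  expanded in cosines are differentiated against sines only.\<close>

lemma coef_Bop:
  assumes v: "Bdom P v" and i: "i < 10"
  shows "coef n (Bop P v) i = opA (kap L n) (coef n v) i"
proof -
  note V = VspaceD[OF BdomD(1)[OF v]]
  note co = fcoef_add[OF _ _ cosf_continuous] fcoef_add[OF _ _ sinf_continuous]
    fcoef_diff[OF _ _ cosf_continuous] fcoef_diff[OF _ _ sinf_continuous] fcoef_cmult
    L2_cmult L2_add L2_diff Bdom_L2[OF v] V(2,5,9,11,12,14,15)
    fcoef_sin_dx[OF ell Bdom_H1(1)[OF v]] fcoef_sin_dx[OF ell BdomD(6)[OF v]] fcoef_sin_dx[OF ell BdomD(7)[OF v]]
    fcoef_sin_dx[OF ell BdomD(10)[OF v]] fcoef_sin_dx[OF ell BdomD(11)[OF v]]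
    fcoef_cos_dx[OF ell BdomD(3)[OF v]] fcoef_cos_dx[OF ell BdomD(4)[OF v]] fcoef_cos_dx[OF ell BdomD(8)[OF v]]
    fcoef_cos_dx[OF ell BdomD(9)[OF v]] fcoef_cos_dx[OF ell Bdom_H1(2)[OF v]]
  have nz: "complex_of_real (p_rho1 P) \<noteq> 0" "complex_of_real (p_rho2 P) \<noteq> 0" "complex_of_real (p_rho3 P) \<noteq> 0"
    "complex_of_real (p_varpi P) \<noteq> 0" "complex_of_real (p_varsigma P) \<noteq> 0" "complex_of_real (p_tau P) \<noteq> 0"
    using params_pos by simp_all
  have "coef n (Bop P v) 0 = opA (kap L n) (coef n v) 0"
    unfolding coef_def ecomp_simps basis_simps opA_simps shearS_def[of P "Bop P v"] Bop_sel by (simp only: co; simp)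
  moreover have "coef n (Bop P v) 1 = opA (kap L n) (coef n v) 1"
    unfolding coef_def ecomp_simps basis_simps opA_simps Bop_sel
    by (simp only: co, use nz in \<open>simp add: divide_simps; simp add: algebra_simps\<close>)
  moreover have "coef n (Bop P v) 2 = opA (kap L n) (coef n v) 2"
    unfolding coef_def ecomp_simps basis_simps opA_simps Bop_sel by (simp only: co; simp)
  moreover have "coef n (Bop P v) 3 = opA (kap L n) (coef n v) 3"
    unfolding coef_def ecomp_simps basis_simps opA_simps Bop_sel
    by (simp only: co, use nz in \<open>simp add: divide_simps; simp add: algebra_simps\<close>)
  moreover have "coef n (Bop P v) 4 = opA (kap L n) (coef n v) 4"
    unfolding coef_def ecomp_simps basis_simps opA_simps axialN_def[of P "Bop P v"] Bop_sel by (simp only: co; simp)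
  moreover have "coef n (Bop P v) 5 = opA (kap L n) (coef n v) 5"
    unfolding coef_def ecomp_simps basis_simps opA_simps Bop_sel
    by (simp only: co, use nz in \<open>simp add: divide_simps; simp add: algebra_simps\<close>)
  moreover have "coef n (Bop P v) 6 = opA (kap L n) (coef n v) 6"
    unfolding coef_def ecomp_simps basis_simps opA_simps Bop_sel
    by (simp only: co, use nz in \<open>simp add: divide_simps; simp add: algebra_simps\<close>)
  moreover have "coef n (Bop P v) 7 = opA (kap L n) (coef n v) 7"
    unfolding coef_def ecomp_simps basis_simps opA_simps Bop_sel
    by (simp only: co, use nz in \<open>simp add: divide_simps; simp add: algebra_simps\<close>)
  moreover have "coef n (Bop P v) 8 = opA (kap L n) (coef n v) 8"
    unfolding coef_def ecomp_simps basis_simps opA_simps Bop_sel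
    by (simp only: co, use nz in \<open>simp add: divide_simps; simp add: algebra_simps\<close>)
  moreover have "coef n (Bop P v) 9 = opA (kap L n) (coef n v) 9"
    unfolding coef_def ecomp_simps basis_simps opA_simps Bop_sel
    by (simp only: co, use nz in \<open>simp add: divide_simps; simp add: algebra_simps\<close>)
  ultimately show ?thesis
    by - (rule less_10_cases[OF i]; simp only:)
qed

end

section \<open>Orbits of the semigroup\<close>

text \<open>A nested interval argument: right continuity provides, inside any interval, a smaller
  one on which the oscillation is below a prescribed bound. A point common to the interiors of a
  shrinking sequence of such intervals is a point of two-sided continuity.\<close>

lemma right_continuous_imp_continuity_point:
  fixes d :: "real \<Rightarrow> real \<Rightarrow> real"
  assumes nonneg: "\<And>x y. 0 \<le> d x y"
    and sym: "\<And>x y. 0 \<le> x \<Longrightarrow> 0 \<le> y \<Longrightarrow> d x y = d y x"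
    and tri: "\<And>x y z. 0 \<le> x \<Longrightarrow> 0 \<le> y \<Longrightarrow> 0 \<le> z \<Longrightarrow> d x z \<le> d x y + d y z"
    and right: "\<And>t. 0 \<le> t \<Longrightarrow> ((\<lambda>h. d (t + h) t) \<longlongrightarrow> 0) (at_right 0)"
    and b: "0 < b"
  obtains t where "0 < t" "t < b" "((\<lambda>r. d t (t - r)) \<longlongrightarrow> 0) (at_right 0)"
proof -
  define Q where "Q n c \<longleftrightarrow> 0 < fst c \<and> fst c < snd c \<and> snd c < b \<and>
      (\<forall>x\<in>{fst c..snd c}. \<forall>y\<in>{fst c..snd c}. d x y \<le> 1 / Suc n)" for n :: nat and c :: "real \<times> real"
  have step: "\<exists>c'. Q n c' \<and> a < fst c' \<and> snd c' < b'" if "0 \<le> a" "a < b'" "b' \<le> b" for a b' n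
  proof -
    define s where "s = (a + b') / 2"
    have s: "a < s" "s < b'" using that by (auto simp: s_def)
    have "eventually (\<lambda>h. d (s + h) s < 1 / Suc n / 2) (at_right 0)"
      by (rule order_tendstoD(2)[OF right]) (use that s in auto)
    then obtain \<eta> where \<eta>: "0 < \<eta>" "\<And>h. 0 < h \<Longrightarrow> h < \<eta> \<Longrightarrow> d (s + h) s < 1 / Suc n / 2"
      unfolding eventually_at_right_field by auto
    \<comment> \<open>Right continuity at \<open>s\<close> controls the points just to the right of
      \<open>s\<close>. The middle third keeps a distance from \<open>s\<close> and from
      \<open>b'\<close>, so the new interval lies strictly inside the old one and the common point
      is interior to all of them.\<close>
    define m where "m = min \<eta> (b' - s)"
    have m: "0 < m" "m \<le> \<eta>" "m \<le> b' - s" using \<eta> s by (auto simp: m_def)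
    have near: "d x s \<le> 1 / Suc n / 2" if "x \<in> {s + m / 3..s + 2 * m / 3}" for x
      using \<eta>(2)[of "x - s"] that m by auto
    have "d x y \<le> 1 / Suc n"
      if x: "x \<in> {s + m / 3..s + 2 * m / 3}" and y: "y \<in> {s + m / 3..s + 2 * m / 3}" for x y
    proof -
      have p: "0 \<le> x" "0 \<le> y" "0 \<le> s" using x y m s \<open>0 \<le> a\<close> by auto
      show ?thesis using tri[OF p(1,3,2)] near[OF x] near[OF y] sym[OF p(3,2)] by linarith
    qed
    then have "Q n (s + m / 3, s + 2 * m / 3)"
      unfolding Q_def fst_conv snd_conv using m s that by (intro conjI ballI) auto
    then show ?thesis using m s by (intro exI[of _ "(s + m / 3, s + 2 * m / 3)"]) auto
  qed
  have "\<exists>f. \<forall>n. Q n (f n) \<and> fst (f n) < fst (f (Suc n)) \<and> snd (f (Suc n)) < snd (f n)"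
  proof (rule dependent_nat_choice)
    show "\<exists>c. Q 0 c" using step[of 0 b 0] b by auto
    fix c :: "real \<times> real" and n assume "Q n c"
    then show "\<exists>c'. Q (Suc n) c' \<and> fst c < fst c' \<and> snd c' < snd c"
      using step[of "fst c" "snd c" "Suc n"] unfolding Q_def by auto
  qed
  then obtain f where f: "\<And>n. Q n (f n)" "\<And>n. fst (f n) < fst (f (Suc n)) \<and> snd (f (Suc n)) < snd (f n)"
    by blast
  have inc: "incseq (\<lambda>n. fst (f n))" and dec: "decseq (\<lambda>n. snd (f n))"
    by (auto intro!: incseq_SucI decseq_SucI less_imp_le simp: f(2))
  have lt: "fst (f n) < snd (f m)" for n m
  proof -
    have "fst (f n) \<le> fst (f (max n m))" by (rule incseqD[OF inc]) simp
    also have "\<dots> < snd (f (max n m))" using f(1)[of "max n m"] by (simp add: Q_def)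
    also have "\<dots> \<le> snd (f m)" by (rule decseqD[OF dec]) simp
    finally show ?thesis .
  qed
  define t where "t = (SUP n. fst (f n))"
  have bdd: "bdd_above (range (\<lambda>n. fst (f n)))"
    by (rule bdd_aboveI[of _ "snd (f 0)"]) (auto intro: less_imp_le lt)
  have t: "fst (f n) < t" "t < snd (f n)" for n
  proof -
    have "fst (f (Suc n)) \<le> t" unfolding t_def by (rule cSUP_upper[OF _ bdd]) simp
    then show "fst (f n) < t" using f(2)[of n] by simp
    have "t \<le> snd (f (Suc n))" unfolding t_def by (rule cSUP_least) (auto intro: less_imp_le lt)
    then show "t < snd (f n)" using f(2)[of n] by simp
  qed
  have "((\<lambda>r. d t (t - r)) \<longlongrightarrow> 0) (at_right 0)"
  proof (rule order_tendstoI)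
    fix e :: real assume "e < 0"
    then show "eventually (\<lambda>r. e < d t (t - r)) (at_right 0)"
      by (auto intro!: always_eventually intro: less_le_trans nonneg)
  next
    fix e :: real assume "0 < e"
    then obtain n where n: "1 / Suc n < e" using nat_approx_posE by blast
    have "d t (t - r) < e" if "0 < r" "r < t - fst (f n)" for r
    proof -
      have "d t (t - r) \<le> 1 / Suc n"
        using f(1)[of n] t[of n] that unfolding Q_def by auto
      then show ?thesis using n by simp
    qed
    then show "eventually (\<lambda>r. d t (t - r) < e) (at_right 0)"
      unfolding eventually_at_right_field using t[of n] by (intro exI[of _ "t - fst (f n)"]) auto
  qed
  moreover have "0 < t" "t < b" using t[of 0] f(1)[of 0] by (auto simp: Q_def)
  ultimately show ?thesis by (rule that[rotated 2])
qed

locale bmc_semigroup = bmc_system +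
  fixes T :: "real \<Rightarrow> bmc_state \<Rightarrow> bmc_state"
  assumes gen: "generates_C0_semigroup P T"
begin

lemmas gen_unfolded = gen[unfolded generates_C0_semigroup_def Veq_vdist]

lemma T_V: "0 \<le> t \<Longrightarrow> Vspace P v \<Longrightarrow> Vspace P (T t v)"
  using gen_unfolded[THEN conjunct1] by blast

lemma T_linear: "0 \<le> t \<Longrightarrow> Vspace P u \<Longrightarrow> Vspace P v \<Longrightarrow>
    vdist (T t (st_add (st_scale a u) (st_scale c v))) (st_add (st_scale a (T t u)) (st_scale c (T t v))) = 0"
  using gen_unfolded[THEN conjunct2, THEN conjunct1] by blast

lemma T_0: "Vspace P v \<Longrightarrow> vdist (T 0 v) v = 0"
  using gen_unfolded[THEN conjunct2, THEN conjunct2, THEN conjunct2, THEN conjunct1] by blast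

lemma T_add: "0 \<le> s \<Longrightarrow> 0 \<le> t \<Longrightarrow> Vspace P v \<Longrightarrow> vdist (T (s + t) v) (T s (T t v)) = 0"
  using gen_unfolded[THEN conjunct2, THEN conjunct2, THEN conjunct2, THEN conjunct2, THEN conjunct1] by blast

lemma T_right: "Vspace P v \<Longrightarrow> ((\<lambda>t. vdist (T t v) v) \<longlongrightarrow> 0) (at_right 0)"
  unfolding vdist_def
  using gen_unfolded[THEN conjunct2, THEN conjunct2, THEN conjunct2, THEN conjunct2, THEN conjunct2, THEN conjunct1] by blast

definition quot :: "real \<Rightarrow> bmc_state \<Rightarrow> bmc_state" where
  "quot h v = st_scale (complex_of_real (1 / h)) (st_diff (T h v) v)"

lemma Bdom_iff: "Vspace P v \<Longrightarrow> Bdom P v \<longleftrightarrow> (\<exists>y. Vspace P y \<and> ((\<lambda>h. vdist (quot h v) y) \<longlongrightarrow> 0) (at_right 0))"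
  using gen unfolding generates_C0_semigroup_def vdist_def quot_def by blast

lemma quot_tendsto: "Bdom P v \<Longrightarrow> ((\<lambda>h. vdist (quot h v) (Bop P v)) \<longlongrightarrow> 0) (at_right 0)"
  using gen unfolding generates_C0_semigroup_def vdist_def quot_def by blast

lemma quot_V: "0 \<le> h \<Longrightarrow> Vspace P v \<Longrightarrow> Vspace P (quot h v)"
  unfolding quot_def by (intro Vspace_scale Vspace_diff T_V)

lemma T_bounded:
  assumes t: "0 \<le> t"
  obtains C where "0 \<le> C" "\<And>u v. Vspace P u \<Longrightarrow> Vspace P v \<Longrightarrow> vdist (T t u) (T t v) \<le> C * vdist u v"
proof -
  obtain C where C: "\<And>v. Vspace P v \<Longrightarrow> Vnorm P (T t v) \<le> C * Vnorm P v"
    using gen_unfolded[THEN conjunct2, THEN conjunct2, THEN conjunct1] t by blast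
  have "vdist (T t u) (T t v) \<le> max 0 C * vdist u v" if u: "Vspace P u" and v: "Vspace P v" for u v
  proof -
    have 1: "st_diff u v = st_add (st_scale 1 u) (st_scale (-1) v)"
      "st_diff (T t u) (T t v) = st_add (st_scale 1 (T t u)) (st_scale (-1) (T t v))"
      by (simp_all add: st_diff_def st_add_def st_scale_def)
    have "vdist (T t (st_diff u v)) (st_diff (T t u) (T t v)) = 0"
      unfolding 1 by (rule T_linear[OF t u v])
    then have "Vnorm P (T t (st_diff u v)) = Vnorm P (st_diff (T t u) (T t v))"
      by (intro Vnorm_Veq T_V Vspace_diff t u v)
    then have "vdist (T t u) (T t v) \<le> C * vdist u v"
      using C[OF Vspace_diff[OF u v]] by (simp add: vdist_def)
    also have "\<dots> \<le> max 0 C * vdist u v"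
      by (intro mult_right_mono vdist_nonneg) simp
    finally show ?thesis .
  qed
  then show ?thesis using that[of "max 0 C"] by simp
qed

lemma vdist_0_trans:
  assumes "Vspace P u" "Vspace P v" "Vspace P w" "vdist u v = 0" "vdist v w = 0" shows "vdist u w = 0"
  using vdist_triangle[OF assms(1-3)] vdist_nonneg[of u w] assms(4,5) by simp

lemma T_commute:
  assumes s: "0 \<le> s" and t: "0 \<le> t" and v: "Vspace P v" shows "vdist (T s (T t v)) (T t (T s v)) = 0"
proof -
  have V: "Vspace P (T s (T t v))" "Vspace P (T t (T s v))" "Vspace P (T (s + t) v)"
    using s t v by (auto intro!: T_V)
  show ?thesis
    using vdist_0_trans[OF V(1,3,2)] T_add[OF s t v] T_add[OF t s v] vdist_commute[OF V(1,3)]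
    by (simp add: add.commute)
qed

lemma T_quot:
  assumes t: "0 \<le> t" and h: "0 \<le> h" and v: "Vspace P v"
  shows "vdist (quot h (T t v)) (T t (quot h v)) = 0"
proof -
  let ?c = "complex_of_real (1 / h)"
  define X Y where "X = st_add (st_scale ?c (T t (T h v))) (st_scale (- ?c) (T t v))" and "Y = quot h (T t v)"
  have V: "Vspace P X" "Vspace P Y" "Vspace P (T t (quot h v))"
    unfolding X_def Y_def by (intro Vspace_add Vspace_scale T_V quot_V t h v)+
  have "quot h v = st_add (st_scale ?c (T h v)) (st_scale (- ?c) v)"
    by (simp add: quot_def st_diff_def st_add_def st_scale_def algebra_simps)
  then have 1: "vdist (T t (quot h v)) X = 0"
    unfolding X_def by (simp only: T_linear[OF t T_V[OF h v] v])
  have "st_diff Y X = st_scale ?c (st_diff (T h (T t v)) (T t (T h v)))"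
    by (simp add: X_def Y_def quot_def st_diff_def st_add_def st_scale_def algebra_simps)
  then have "vdist Y X = cmod ?c * vdist (T h (T t v)) (T t (T h v))"
    unfolding vdist_def by (simp only: Vnorm_scale Vspace_diff T_V t h v)
  then have "vdist Y X = 0" using T_commute[OF h t v] by simp
  then have "vdist Y (T t (quot h v)) = 0"
    by (rule vdist_0_trans[OF V(2,1,3)]) (use 1 vdist_commute[OF V(3,1)] in simp)
  then show ?thesis by (simp add: Y_def)
qed

text \<open>The domain is characterised by convergence of the difference quotients, and
  \<open>T t\<close> is bounded and commutes with them up to null elements. Hence the quotients at
  \<open>T t v\<close> converge to \<open>T t (Bop P v)\<close>.\<close>

lemma Bdom_T:
  assumes v: "Bdom P v" and t: "0 \<le> t" shows "Bdom P (T t v)"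
proof -
  note V = BdomD(1)[OF v] and BV = Vspace_Bop[OF v]
  obtain C where C: "0 \<le> C" "\<And>u v. Vspace P u \<Longrightarrow> Vspace P v \<Longrightarrow> vdist (T t u) (T t v) \<le> C * vdist u v"
    using T_bounded[OF t] by blast
  have "((\<lambda>h. vdist (quot h (T t v)) (T t (Bop P v))) \<longlongrightarrow> 0) (at_right 0)"
  proof (rule tendsto_sandwich[OF _ _ tendsto_const])
    show "((\<lambda>h. C * vdist (quot h v) (Bop P v)) \<longlongrightarrow> 0) (at_right 0)"
      using tendsto_mult_left[OF quot_tendsto[OF v], of C] by simp
    show "eventually (\<lambda>h. vdist (quot h (T t v)) (T t (Bop P v)) \<le> C * vdist (quot h v) (Bop P v)) (at_right 0)"
    proof (rule eventually_at_rightI[of 0 1])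
      fix h :: real assume "h \<in> {0<..<1}"
      then have h: "0 \<le> h" by simp
      have "vdist (quot h (T t v)) (T t (Bop P v))
          \<le> vdist (quot h (T t v)) (T t (quot h v)) + vdist (T t (quot h v)) (T t (Bop P v))"
        by (intro vdist_triangle quot_V T_V V BV t h)
      then show "vdist (quot h (T t v)) (T t (Bop P v)) \<le> C * vdist (quot h v) (Bop P v)"
        using T_quot[OF t h V] C(2)[OF quot_V[OF h V] BV] by simp
    qed simp
  qed (simp add: vdist_nonneg)
  then show ?thesis
    using Bdom_iff[OF T_V[OF t V]] T_V[OF t BV] by blast
qed

text \<open>A bounded functional applied to the difference quotient at \<open>T t v\<close>, which
  again lies in the domain. The semigroup law identifies increments of the orbit from time
  \<open>t\<close> with those of the orbit started at \<open>T t v\<close>.\<close>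

lemma coef_has_right_derivative:
  assumes v: "Bdom P v" and t: "0 \<le> t" and i: "i < 10"
  shows "((\<lambda>t. coef n (T t v) i) has_vector_derivative opA (kap L n) (coef n (T t v)) i) (at t within {t..})"
proof -
  define w where "w = T t v"
  have w: "Bdom P w" unfolding w_def by (rule Bdom_T[OF v t])
  note V = BdomD(1)[OF v] and W = BdomD(1)[OF w] and BW = Vspace_Bop[OF w]
  obtain C where C: "0 < C" "\<And>n v. Vspace P v \<Longrightarrow> cmod (coef n v i) \<le> C * Vnorm P v"
    using cmod_coef_le[OF i] by blast
  have "((\<lambda>h. norm (coef n (T (h + t) v) i - coef n w i - (h + t - t) *\<^sub>R opA (kap L n) (coef n w) i) / norm (h + t - t))
      \<longlongrightarrow> 0) (at_right 0)"
  proof (rule tendsto_sandwich[OF _ _ tendsto_const])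
    show "((\<lambda>h. C * vdist (quot h w) (Bop P w)) \<longlongrightarrow> 0) (at_right 0)"
      using tendsto_mult_left[OF quot_tendsto[OF w], of C] by simp
    show "eventually (\<lambda>h. norm (coef n (T (h + t) v) i - coef n w i - (h + t - t) *\<^sub>R opA (kap L n) (coef n w) i)
        / norm (h + t - t) \<le> C * vdist (quot h w) (Bop P w)) (at_right 0)"
    proof (rule eventually_at_rightI[of 0 1])
      fix h :: real assume "h \<in> {0<..<1}"
      then have h: "0 < h" "0 \<le> h" by simp_all
      have e: "coef n (T (h + t) v) i = coef n (T h w) i"
        unfolding w_def by (intro coef_cong T_V T_add V i h t add_nonneg_nonneg)
      have "coef n (st_diff (quot h w) (Bop P w)) i
          = complex_of_real (1 / h) * (coef n (T h w) i - coef n w i) - opA (kap L n) (coef n w) i"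
        unfolding coef_diff[OF quot_V[OF h(2) W] BW i] coef_Bop[OF w i]
        unfolding quot_def coef_scale[OF Vspace_diff[OF T_V[OF h(2) W] W] i] coef_diff[OF T_V[OF h(2) W] W i] ..
      also have "\<dots> = (coef n (T h w) i - coef n w i - h *\<^sub>R opA (kap L n) (coef n w) i) / complex_of_real h"
        using h by (simp add: scaleR_conv_of_real field_simps)
      finally have "norm (coef n (T h w) i - coef n w i - h *\<^sub>R opA (kap L n) (coef n w) i) / h
          = cmod (coef n (st_diff (quot h w) (Bop P w)) i)"
        using h by (simp add: norm_divide)
      also have "\<dots> \<le> C * vdist (quot h w) (Bop P w)"
        unfolding vdist_def by (intro C Vspace_diff quot_V W BW h)
      finally show "norm (coef n (T (h + t) v) i - coef n w i - (h + t - t) *\<^sub>R opA (kap L n) (coef n w) i)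
        / norm (h + t - t) \<le> C * vdist (quot h w) (Bop P w)"
        unfolding e using h by simp
    qed simp
  qed simp
  then show ?thesis
    unfolding has_vector_derivative_def has_derivative_iff_norm at_within_Ici_at_right w_def
      filterlim_at_right_to_0[where a = t]
    by (simp add: bounded_linear_scaleR_left)
qed

text \<open>The operator bound of the semigroup is given for each time separately, not uniformly on
  intervals, so it cannot be applied to \<open>T (t - r)\<close> with varying \<open>r\<close>. Left
  continuity at one earlier time \<open>t0\<close> is transported by the single operator
  \<open>T (t - t0)\<close> instead.\<close>

lemma T_left_continuous:
  assumes v: "Vspace P v" and t: "0 < t"
  shows "((\<lambda>r. vdist (T t v) (T (t - r) v)) \<longlongrightarrow> 0) (at_right 0)"
proof -
  have "((\<lambda>h. vdist (T (s + h) v) (T s v)) \<longlongrightarrow> 0) (at_right 0)" if s: "0 \<le> s" for s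
  proof -
    obtain C where C: "0 \<le> C" "\<And>u v. Vspace P u \<Longrightarrow> Vspace P v \<Longrightarrow> vdist (T s u) (T s v) \<le> C * vdist u v"
      using T_bounded[OF s] by blast
    show ?thesis
    proof (rule tendsto_sandwich[OF _ _ tendsto_const])
      show "((\<lambda>h. C * vdist (T h v) v) \<longlongrightarrow> 0) (at_right 0)"
        using tendsto_mult_left[OF T_right[OF v], of C] by simp
      show "eventually (\<lambda>h. vdist (T (s + h) v) (T s v) \<le> C * vdist (T h v) v) (at_right 0)"
      proof (rule eventually_at_rightI[of 0 1])
        fix h :: real assume "h \<in> {0<..<1}"
        then have h: "0 \<le> h" by simp
        have "vdist (T (s + h) v) (T s v) \<le> vdist (T (s + h) v) (T s (T h v)) + vdist (T s (T h v)) (T s v)"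
          by (intro vdist_triangle T_V v s h add_nonneg_nonneg)
        then show "vdist (T (s + h) v) (T s v) \<le> C * vdist (T h v) v"
          using T_add[OF s h v] C(2)[OF T_V[OF h v] v] by simp
      qed simp
    qed (simp add: vdist_nonneg)
  qed
  then obtain t0 where t0: "0 < t0" "t0 < t" "((\<lambda>r. vdist (T t0 v) (T (t0 - r) v)) \<longlongrightarrow> 0) (at_right 0)"
    by (rule right_continuous_imp_continuity_point[where d = "\<lambda>x y. vdist (T x v) (T y v)", rotated 3])
      (auto intro!: vdist_nonneg vdist_commute vdist_triangle T_V v t)
  define s where "s = t - t0"
  have s: "0 \<le> s" using t0 by (simp add: s_def)
  obtain C where C: "0 \<le> C" "\<And>u v. Vspace P u \<Longrightarrow> Vspace P v \<Longrightarrow> vdist (T s u) (T s v) \<le> C * vdist u v"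
    using T_bounded[OF s] by blast
  show ?thesis
  proof (rule tendsto_sandwich[OF _ _ tendsto_const])
    show "((\<lambda>r. C * vdist (T t0 v) (T (t0 - r) v)) \<longlongrightarrow> 0) (at_right 0)"
      using tendsto_mult_left[OF t0(3), of C] by simp
    show "eventually (\<lambda>r. vdist (T t v) (T (t - r) v) \<le> C * vdist (T t0 v) (T (t0 - r) v)) (at_right 0)"
    proof (rule eventually_at_rightI[of 0 t0])
      fix r assume r: "r \<in> {0<..<t0}"
      have V: "Vspace P (T t v)" "Vspace P (T s (T t0 v))" "Vspace P (T s (T (t0 - r) v))" "Vspace P (T (t - r) v)"
        using s t0 r t by (auto intro!: T_V v)
      have 1: "vdist (T t v) (T s (T t0 v)) = 0"
        using T_add[OF s _ v, of t0] t0 by (simp add: s_def)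
      have e: "s + (t0 - r) = t - r" by (simp add: s_def)
      have "vdist (T (t - r) v) (T s (T (t0 - r) v)) = 0"
        using T_add[OF s _ v, of "t0 - r", unfolded e] r by simp
      then have 2: "vdist (T s (T (t0 - r) v)) (T (t - r) v) = 0"
        using vdist_commute[OF V(3,4)] by simp
      have "vdist (T t v) (T (t - r) v) \<le> vdist (T s (T t0 v)) (T s (T (t0 - r) v))"
        using vdist_triangle[OF V(1,2,4)] vdist_triangle[OF V(2,3,4)] 1 2 by simp
      also have "\<dots> \<le> C * vdist (T t0 v) (T (t0 - r) v)"
        using t0 r by (intro C T_V v) auto
      finally show "vdist (T t v) (T (t - r) v) \<le> C * vdist (T t0 v) (T (t0 - r) v)" .
    qed (use t0 in simp)
  qed (simp add: vdist_nonneg)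
qed

lemma traj_coef:
  assumes v: "Bdom P v"
  shows "traj (kap L n) (\<lambda>t. coef n (T t v))"
  unfolding traj_def
proof (intro allI impI conjI)
  fix i :: nat assume i: "i < 10"
  note V = BdomD(1)[OF v]
  let ?u = "\<lambda>t. coef n (T t v) i"
  show d: "(?u has_vector_derivative opA (kap L n) (coef n (T t v)) i) (at t within {t..})" if "0 \<le> t" for t
    by (rule coef_has_right_derivative[OF v that i])
  have r: "continuous (at t within {t..}) ?u" if "0 \<le> t" for t
    by (rule has_vector_derivative_continuous[OF d[OF that]])
  show "continuous_on {0..} ?u"
    unfolding continuous_on_eq_continuous_within
  proof
    fix t :: real assume "t \<in> {0..}"
    then consider "t = 0" | "0 < t" by force
    then show "continuous (at t within {0..}) ?u"
    proof cases
      case 1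
      then show ?thesis using r[of 0] by simp
    next
      case 2
      obtain C where C: "0 < C" "\<And>n v. Vspace P v \<Longrightarrow> cmod (coef n v i) \<le> C * Vnorm P v"
        using cmod_coef_le[OF i] by blast
      have "((\<lambda>r. ?u (t - r) - ?u t) \<longlongrightarrow> 0) (at_right 0)"
      proof (rule Lim_null_comparison)
        show "((\<lambda>r. C * vdist (T t v) (T (t - r) v)) \<longlongrightarrow> 0) (at_right 0)"
          using tendsto_mult_left[OF T_left_continuous[OF V 2], of C] by simp
        show "eventually (\<lambda>r. cmod (?u (t - r) - ?u t) \<le> C * vdist (T t v) (T (t - r) v)) (at_right 0)"
        proof (rule eventually_at_rightI[of 0 t])
          fix r assume "r \<in> {0<..<t}"
          then have V2: "Vspace P (T t v)" "Vspace P (T (t - r) v)" by (auto intro!: T_V V)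
          have "cmod (?u (t - r) - ?u t) = cmod (coef n (st_diff (T t v) (T (t - r) v)) i)"
            unfolding coef_diff[OF V2 i] by (rule norm_minus_commute)
          also have "\<dots> \<le> C * vdist (T t v) (T (t - r) v)"
            unfolding vdist_def by (intro C Vspace_diff V2)
          finally show "cmod (?u (t - r) - ?u t) \<le> C * vdist (T t v) (T (t - r) v)" .
        qed (rule 2)
      qed
      then have "((\<lambda>r. ?u (t - r)) \<longlongrightarrow> ?u t) (at_right 0)"
        by (rule Lim_null[THEN iffD2])
      then have left: "(?u \<longlongrightarrow> ?u t) (at_left t)"
        unfolding at_left_minus[of t] filterlim_filtermap filterlim_at_right_to_0[where a = "- t"] by simp
      have "continuous (at_right t) ?u"
        using r[of t] 2 by (simp add: at_within_Ici_at_right)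
      then have "continuous (at t) ?u"
        unfolding continuous_at_split using left by (auto simp: continuous_within)
      then show ?thesis by (rule continuous_at_imp_continuous_at_within)
    qed
  qed
qed

end

section \<open>Inversion of \<open>B\<close>\<close>

text \<open>Variation of constants for \<open>E' = a E + F\<close>, in integrated form because
  \<open>F\<close> is merely square integrable.\<close>

lemma linear_ode_integral_form:
  fixes F :: "real \<Rightarrow> complex" and a c :: complex
  assumes F: "L2 ell F"
  defines "E \<equiv> \<lambda>x. exp (a * complex_of_real x) * (c + J (\<lambda>s. exp (- a * complex_of_real s) * F s) x)"
  shows "continuous_on {0..ell} E" "\<And>x. x \<in> {0..ell} \<Longrightarrow> E x = c + J (\<lambda>s. a * E s + F s) x"
proof -
  let ?e = "\<lambda>x. exp (a * complex_of_real x)"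
  define G where "G = (\<lambda>s. exp (- a * complex_of_real s) * F s)"
  have G: "L2 ell G"
    unfolding G_def by (intro L2_mult_continuous F continuous_intros)
  have E: "E = (\<lambda>x. ?e x * (c + J G x))" by (simp add: E_def G_def)
  have JG: "continuous_on {0..ell} (J G)" by (rule J_continuous_L2[OF G])
  show cE: "continuous_on {0..ell} E"
    unfolding E by (intro continuous_intros JG)
  have d: "(?e has_vector_derivative a * ?e x) (at x)" for x
    by (rule has_vector_derivative_real_field[where f = "\<lambda>z. exp (a * z)"]) (auto intro!: derivative_eq_intros)
  fix x assume x: "x \<in> {0..ell}"
  have sub: "integrable (lebesgue_on {0..x}) H" if "L2 ell H" for H
    using integrable_sub_ivl[OF L2_integrable[OF that]] x by simp
  have "J (\<lambda>s. (a * ?e s) * J G s) x = ?e x * J G x - J (\<lambda>s. ?e s * G s) x"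
    by (rule J_by_parts) (use x sub[OF G] d in \<open>auto intro!: continuous_intros\<close>)
  moreover have "(\<lambda>s. ?e s * G s) = F"
    by (simp add: G_def fun_eq_iff flip: mult.assoc exp_add)
  ultimately have 1: "J (\<lambda>s. (a * ?e s) * J G s) x = ?e x * J G x - J F x" by simp
  have "J (\<lambda>s. a * ?e s) x = ?e x - ?e 0"
    unfolding J_def
    by (rule integral_FTC_ivl) (use x in \<open>auto intro!: continuous_intros has_vector_derivative_at_within[OF d]\<close>)
  then have 2: "J (\<lambda>s. a * ?e s) x = ?e x - 1" by simp
  have c1: "continuous_on {0..x} (\<lambda>s. (a * ?e s) * J G s)"
    using x by (intro continuous_intros continuous_on_subset[OF JG]) auto
  have c2: "continuous_on {0..x} (\<lambda>s. c * (a * ?e s))" by (intro continuous_intros)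
  have "J (\<lambda>s. a * E s + F s) x = J (\<lambda>s. (c * (a * ?e s) + (a * ?e s) * J G s) + F s) x"
    unfolding E by (simp add: algebra_simps)
  also have "\<dots> = c * (?e x - 1) + (?e x * J G x - J F x) + J F x"
    using J_add[of x "\<lambda>s. c * (a * ?e s) + (a * ?e s) * J G s" F x] J_add[of x "\<lambda>s. c * (a * ?e s)" "\<lambda>s. (a * ?e s) * J G s" x]
      L2_integrable[OF L2_continuous[OF c1]] L2_integrable[OF L2_continuous[OF c2]] sub[OF F]
      J_mult[of c "\<lambda>s. a * ?e s" x] 1 2
    by simp
  finally show "E x = c + J (\<lambda>s. a * E s + F s) x"
    unfolding E by (simp add: algebra_simps)
qed

text \<open>The system \<open>u' = g - l z\<close>, \<open>z' = l u + h\<close> with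
  \<open>z\<close> zero at both ends. The combinations \<open>u + \<i> z\<close> and
  \<open>u - \<i> z\<close> decouple it into two scalar equations, and the common initial value
  \<open>c\<close> makes \<open>z\<close> vanish at 0.\<close>

lemma rotation_ode_solvable:
  fixes g h :: "real \<Rightarrow> complex" and l :: real
  assumes ell: "0 < ell" and g: "L2 ell g" and h: "L2 ell h" and s: "sin (l * ell) \<noteq> 0"
  obtains u z c where "continuous_on {0..ell} u" "continuous_on {0..ell} z"
    "\<And>x. x \<in> {0..ell} \<Longrightarrow> u x = c + J (\<lambda>s. g s - complex_of_real l * z s) x"
    "\<And>x. x \<in> {0..ell} \<Longrightarrow> z x = J (\<lambda>s. complex_of_real l * u s + h s) x"
    "z ell = 0"
proof -
  define a where "a = \<i> * complex_of_real l"
  define F where "F = (\<lambda>s. g s + \<i> * h s)"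
  define H where "H = (\<lambda>s. g s - \<i> * h s)"
  have L: "L2 ell F" "L2 ell H" unfolding F_def H_def by (intro L2_intros g h)+
  define Ep where "Ep c = (\<lambda>x. exp (a * complex_of_real x) * (c + J (\<lambda>s. exp (- a * complex_of_real s) * F s) x))" for c
  define Em where "Em c = (\<lambda>x. exp ((- a) * complex_of_real x) * (c + J (\<lambda>s. exp (- (- a) * complex_of_real s) * H s) x))" for c
  have Ep: "continuous_on {0..ell} (Ep c)" "x \<in> {0..ell} \<Longrightarrow> Ep c x = c + J (\<lambda>s. a * Ep c s + F s) x" for c x
    unfolding Ep_def using linear_ode_integral_form[OF L(1), where a = a and c = c] by blast+
  have Em: "continuous_on {0..ell} (Em c)" "x \<in> {0..ell} \<Longrightarrow> Em c x = c + J (\<lambda>s. (- a) * Em c s + H s) x" for c x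
    unfolding Em_def using linear_ode_integral_form[OF L(2), where a = "- a" and c = c] by blast+
  \<comment> \<open>The derivative of \<open>2 \<i> z ell\<close> with respect to the shooting
    parameter \<open>c\<close>. It equals \<open>2 \<i> sin (l * ell)\<close>, so the end condition
    can be met.\<close>
  define D where "D = exp (a * complex_of_real ell) - exp (- a * complex_of_real ell)"
  have "D = 2 * \<i> * complex_of_real (sin (l * ell))"
    unfolding D_def a_def by (simp add: sin_of_real[symmetric] sin_exp_eq mult_ac)
  then have D: "D \<noteq> 0" using s by simp
  define c where "c = - (Ep 0 ell - Em 0 ell) / D"
  have "Ep c ell - Em c ell = c * D + (Ep 0 ell - Em 0 ell)"
    unfolding Ep_def Em_def D_def by (simp add: algebra_simps)
  then have 0: "Ep c ell - Em c ell = 0" unfolding c_def using D by simp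
  define u where "u x = (Ep c x + Em c x) / 2" for x
  define z where "z x = (Ep c x - Em c x) / (2 * \<i>)" for x
  have cu: "continuous_on {0..ell} u" "continuous_on {0..ell} z"
    unfolding u_def[abs_def] z_def[abs_def] by (intro continuous_intros Ep Em; simp)+
  have int: "integrable (lebesgue_on {0..ell}) (\<lambda>s. a * Ep c s + F s)"
    "integrable (lebesgue_on {0..ell}) (\<lambda>s. (- a) * Em c s + H s)"
    by (rule L2_integrable[OF L2_add[OF L2_cmult[OF L2_continuous[OF Ep(1)]] L(1)]]
      L2_integrable[OF L2_add[OF L2_cmult[OF L2_continuous[OF Em(1)]] L(2)]])+
  have ux: "u x = c + J (\<lambda>s. g s - complex_of_real l * z s) x" if x: "x \<in> {0..ell}" for x
  proof -
    have "u x = c + (1/2) * (J (\<lambda>s. a * Ep c s + F s) x + J (\<lambda>s. (- a) * Em c s + H s) x)"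
      unfolding u_def Ep(2)[OF x] Em(2)[OF x] by (simp add: field_simps)
    also have "\<dots> = c + J (\<lambda>s. (1/2) * ((a * Ep c s + F s) + ((- a) * Em c s + H s))) x"
      using x by (simp only: J_mult J_add[OF int] atLeastAtMost_iff)
    also have "(\<lambda>s. (1/2) * ((a * Ep c s + F s) + ((- a) * Em c s + H s))) = (\<lambda>s. g s - complex_of_real l * z s)"
      by (simp add: fun_eq_iff F_def H_def z_def a_def field_simps)
    finally show ?thesis .
  qed
  have zx: "z x = J (\<lambda>s. complex_of_real l * u s + h s) x" if x: "x \<in> {0..ell}" for x
  proof -
    have "z x = (1 / (2 * \<i>)) * (J (\<lambda>s. a * Ep c s + F s) x - J (\<lambda>s. (- a) * Em c s + H s) x)"
      unfolding z_def Ep(2)[OF x] Em(2)[OF x] by (simp add: field_simps)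
    also have "\<dots> = J (\<lambda>s. (1 / (2 * \<i>)) * ((a * Ep c s + F s) - ((- a) * Em c s + H s))) x"
      using x by (simp only: J_mult J_diff[OF int] atLeastAtMost_iff)
    also have "(\<lambda>s. (1 / (2 * \<i>)) * ((a * Ep c s + F s) - ((- a) * Em c s + H s))) = (\<lambda>s. complex_of_real l * u s + h s)"
      by (simp add: fun_eq_iff F_def H_def u_def a_def field_simps)
    finally show ?thesis .
  qed
  show ?thesis by (rule that[OF cu ux zx]) (simp_all add: z_def 0)
qed

lemma H10_primitive:
  assumes ell: "0 < ell" and g: "L2 ell g" and m: "mean0 ell g"
  shows "H10 ell (J g)" "AE x in lebesgue_on {0..ell}. dx ell (J g) x = g x"
proof -
  have "J g ell = 0" using m by (simp add: J_def mean0_def)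
  then show "H10 ell (J g)" by (intro H10I[OF ell L2_J[OF g] g]) auto
  show "AE x in lebesgue_on {0..ell}. dx ell (J g) x = g x"
    by (rule H1I_AE(2)[OF ell L2_J[OF g] g, of 0]) simp
qed

lemma mean0_primitive:
  assumes ell: "0 < ell" and g: "L2 ell g"
  obtains p where "H1 ell p" "mean0 ell p" "AE x in lebesgue_on {0..ell}. dx ell p x = g x"
proof -
  define m where "m = (\<integral>x. J g x \<partial>lebesgue_on {0..ell}) / complex_of_real ell"
  let ?p = "\<lambda>x. J g x - m"
  have c: "L2 ell (\<lambda>x. m)" by (rule L2_continuous) simp
  have p: "L2 ell ?p" by (intro L2_diff L2_J g c)
  have "mean0 ell ?p"
    unfolding mean0_def using L2_integrable[OF L2_J[OF g]] L2_integrable[OF c] ell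
    by (simp add: m_def measure_restrict_space scaleR_conv_of_real)
  moreover have "H1 ell ?p" "AE x in lebesgue_on {0..ell}. dx ell ?p x = g x"
    by (rule H1I_AE[OF ell p g, of "- m"]; simp)+
  ultimately show ?thesis using that by blast
qed

lemma H10_cong:
  assumes ell: "0 < ell" and f: "H10 ell f" and L: "L2 ell f'" and e: "AE x in lebesgue_on {0..ell}. f x = f' x"
  shows "H10 ell f'"
proof (rule H10I[OF ell L L2_dx[OF H10_H1[OF f]] _ H10D(2)[OF ell f]])
  show "AE x in lebesgue_on {0..ell}. f' x = J (dx ell f) x"
    using e H10D(1)[OF ell f] by eventually_elim simp
qed

lemma AE_continuous_on_ivl:
  "(\<And>x. x \<in> {0..b} \<Longrightarrow> Q x) \<Longrightarrow> AE x in lebesgue_on {0..b::real}. Q x"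
  by (rule AE_I2) simp

section \<open>Solution of the stationary problem\<close>

context bmc_system
begin

lemma nonresonant_sin: "sin (p_l P * L) \<noteq> 0"
proof
  assume "sin (p_l P * L) = 0"
  then obtain i :: int where i: "p_l P * L = of_int i * pi" by (auto simp: sin_zero_iff_int2)
  have "0 < p_l P * L" using ell params_pos by simp
  then have "0 < i" unfolding i by (simp add: zero_less_mult_iff)
  then have "p_l P * L = real (nat i) * pi" "0 < nat i" using i by simp_all
  then show False using nonresonance by blast
qed

text \<open>The three components that the norm differentiates are required to be literally equal, so
  that \<open>dx\<close> chooses the same derivative for both states; the others may differ on null
  sets.\<close>

lemma vdist_eq_0I:
  assumes u: "Vspace P u" and v: "Vspace P v"
    and e: "s_phi u = s_phi v" "s_psi u = s_psi v" "s_w u = s_w v"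
    and "AE x in M. s_Phi u x = s_Phi v x" "AE x in M. s_Psi u x = s_Psi v x" "AE x in M. s_W u x = s_W v x"
      "AE x in M. s_theta u x = s_theta v x" "AE x in M. s_p u x = s_p v x"
      "AE x in M. s_xi u x = s_xi v x" "AE x in M. s_q u x = s_q v x"
  shows "vdist u v = 0"
proof -
  have e0: "shearS P u = shearS P v" "axialN P u = axialN P v" "dx L (s_psi u) = dx L (s_psi v)"
    unfolding shearS_def axialN_def e by simp_all
  have eq: "AE x in M. ecomp u i x = ecomp v i x" if i: "i < 10" for i
    using assms(6-12) by - (rule less_10_cases[OF i]; simp add: ecomp_simps e0 del: One_nat_def)
  have "L2norm L (ecomp (st_diff u v) i) = 0" if i: "i < 10" for i
  proof -
    have "AE x in M. ecomp (st_add u (st_scale (-1) v)) i x = 0"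
      using ecomp_add[OF u Vspace_scale[OF v, of "-1"] i] ecomp_scale[OF v i, of "-1"] eq[OF i]
      by eventually_elim simp
    then show ?thesis
      using L2norm_eq_0_iff[OF L2_ecomp[OF Vspace_diff[OF u v] i]] by (simp add: st_diff_def)
  qed
  then have "(Vnorm P (st_diff u v))\<^sup>2 = 0"
    unfolding Vnorm_sq by (intro sum.neutral) simp
  then show ?thesis by (simp add: vdist_def)
qed

text \<open>The equations are triangular. Velocities are read off from \<open>f\<close>, integration
  gives \<open>p, q\<close> and from these \<open>\<theta>, \<xi>\<close>. A rotation system then
  yields the shear and axial forces, two integrations yield \<open>\<psi>\<close>, and a second
  rotation system yields \<open>w\<close> and \<open>\<phi>\<close>.\<close>

lemma Bop_surj:
  assumes f: "Vspace P f"
  obtains u where "Bdom P u" "vdist (Bop P u) f = 0"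
proof -
  note F = VspaceD[OF f] Vspace_H1[OF f]
  let ?c = complex_of_real
  let ?l = "?c (p_l P)" and ?g = "?c (p_gamma P)" and ?k = "?c (p_k P)" and ?kn = "?c (p_k0 P)" and ?b = "?c (p_b P)"
    and ?r1 = "?c (p_rho1 P)" and ?r2 = "?c (p_rho2 P)" and ?r3 = "?c (p_rho3 P)"
    and ?vs = "?c (p_varsigma P)" and ?ta = "?c (p_tau P)" and ?v = "?c (p_varpi P)"
  have nz: "?l \<noteq> 0" "?k \<noteq> 0" "?kn \<noteq> 0" "?b \<noteq> 0" "?r1 \<noteq> 0" "?r2 \<noteq> 0" "?r3 \<noteq> 0" "?vs \<noteq> 0" "?ta \<noteq> 0" "?v \<noteq> 0"
    using params_pos by simp_all
  have Fd: "L2 L (dx L (s_psi f))" "L2 L (dx L (s_w f))" by (intro L2_dx F)+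
  have "L2 L (\<lambda>x. - ?g * dx L (s_psi f) x - ?r3 * s_theta f x)" by (intro L2_diff L2_cmult Fd F)
  then obtain p where p: "H1 L p" "mean0 L p" "AE x in M. dx L p x = - ?g * dx L (s_psi f) x - ?r3 * s_theta f x"
    by (rule mean0_primitive[OF ell])
  have "L2 L (\<lambda>x. ?g * ?l * s_phi f x - ?g * dx L (s_w f) x - ?r3 * s_xi f x)" by (intro L2_diff L2_cmult Fd F)
  then obtain q where q: "H1 L q" "mean0 L q"
      "AE x in M. dx L q x = ?g * ?l * s_phi f x - ?g * dx L (s_w f) x - ?r3 * s_xi f x"
    by (rule mean0_primitive[OF ell])
  note pq = H1_L2[OF p(1)] H1_L2[OF q(1)]
  have "L2 L (\<lambda>x. - ?vs * s_p f x - (1 / ?v) * p x)" "mean0 L (\<lambda>x. - ?vs * s_p f x - (1 / ?v) * p x)"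
    by (intro L2_diff mean0_diff L2_cmult mean0_cmult F pq p)+
  note th = H10_primitive[OF ell this]
  define \<theta> where "\<theta> = J (\<lambda>x. - ?vs * s_p f x - (1 / ?v) * p x)"
  note th = th[folded \<theta>_def]
  have "L2 L (\<lambda>x. - ?ta * s_q f x - (1 / ?v) * q x)" "mean0 L (\<lambda>x. - ?ta * s_q f x - (1 / ?v) * q x)"
    by (intro L2_diff mean0_diff L2_cmult mean0_cmult F pq q)+
  note xi = H10_primitive[OF ell this]
  define \<xi> where "\<xi> = J (\<lambda>x. - ?ta * s_q f x - (1 / ?v) * q x)"
  note xi = xi[folded \<xi>_def]
  note tx = H10_H1[OF th(1)] H10_H1[OF xi(1)]
  note tx2 = H1_L2[OF tx(1)] H1_L2[OF tx(2)] L2_dx[OF tx(1)] L2_dx[OF tx(2)]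
  \<comment> \<open>With \<open>u1 = k S\<close> and \<open>z1 = k0 N\<close> the second and sixth
    equations of \<open>B u = f\<close> form the rotation system; \<open>N\<close> has to vanish at
    both ends.\<close>
  define g1 where "g1 = (\<lambda>x. ?r1 * s_Phi f x + ?l * ?g * \<xi> x)"
  define h1 where "h1 = (\<lambda>x. ?r1 * s_W f x + ?g * dx L \<xi> x)"
  have gh: "L2 L g1" "L2 L h1" "mean0 L h1"
    unfolding g1_def h1_def by (intro L2_add mean0_add L2_cmult mean0_cmult mean0_dx ell F tx2 xi(1))+
  obtain u1 z1 c1 where u1: "continuous_on {0..L} u1" "continuous_on {0..L} z1"
    "\<And>x. x \<in> {0..L} \<Longrightarrow> u1 x = c1 + J (\<lambda>s. g1 s - ?l * z1 s) x"
    "\<And>x. x \<in> {0..L} \<Longrightarrow> z1 x = J (\<lambda>s. ?l * u1 s + h1 s) x" "z1 L = 0"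
    using rotation_ode_solvable[OF ell gh(1,2) nonresonant_sin] by blast
  note Lu = L2_continuous[OF u1(1)] L2_continuous[OF u1(2)]
  have L1: "L2 L (\<lambda>s. g1 s - ?l * z1 s)" "L2 L (\<lambda>s. ?l * u1 s + h1 s)" by (intro L2_diff L2_add L2_cmult gh Lu)+
  \<comment> \<open>Since \<open>h1\<close> has zero mean, the end condition on \<open>z1\<close>
    forces zero mean of \<open>u1\<close>, hence of \<open>S\<close>; the next integration needs
    it.\<close>
  have "J (\<lambda>s. ?l * u1 s + h1 s) L = 0" using u1(4)[of L] u1(5) ell by simp
  moreover have "J (\<lambda>s. ?l * u1 s + h1 s) L = ?l * (\<integral>x. u1 x \<partial>M)"
    using gh(3) L2_integrable[OF L2_cmult[OF Lu(1), of ?l]] L2_integrable[OF gh(2)] by (simp add: J_def mean0_def)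
  ultimately have mu: "mean0 L u1" using nz by (simp add: mean0_def)
  have HS: "H1 L u1" "AE x in M. dx L u1 x = g1 x - ?l * z1 x"
    by (rule H1I_AE[OF ell Lu(1) L1(1), of c1]; rule AE_continuous_on_ivl; rule u1(3); assumption)+
  have HN: "H10 L z1" "AE x in M. dx L z1 x = ?l * u1 x + h1 x"
  proof -
    have e: "AE x in M. z1 x = J (\<lambda>s. ?l * u1 s + h1 s) x" by (rule AE_continuous_on_ivl) (rule u1(4))
    show "H10 L z1" by (rule H10I[OF ell Lu(2) L1(2) e]) (use u1(4)[of L] u1(5) ell in simp)
    show "AE x in M. dx L z1 x = ?l * u1 x + h1 x"
      by (rule H1I_AE(2)[OF ell Lu(2) L1(2), of 0]) (use e in simp)
  qed
  define S where "S = (\<lambda>x. (1 / ?k) * u1 x)"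
  define N where "N = (\<lambda>x. (1 / ?kn) * z1 x)"
  have S: "H1 L S" "L2 L S" "mean0 L S"
    unfolding S_def by (intro H1_cmult(1) L2_cmult mean0_cmult ell HS(1) Lu mu)+
  have dS: "AE x in M. dx L S x = (1 / ?k) * (g1 x - ?l * z1 x)"
    unfolding S_def using H1_cmult(2)[OF ell HS(1), of "1 / ?k"] HS(2) by eventually_elim (simp only:)
  have N: "H10 L N" "L2 L N"
    unfolding N_def by (intro H10_cmult L2_cmult ell HN(1) Lu)+
  have dN: "AE x in M. dx L N x = (1 / ?kn) * (?l * u1 x + h1 x)"
    unfolding N_def using H1_cmult(2)[OF ell H10_H1[OF HN(1)], of "1 / ?kn"] HN(2) by eventually_elim (simp only:)
  \<comment> \<open>The second derivative of \<open>\<psi>\<close>. Its zero mean lets the primitive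
    \<open>J y\<close> vanish at both ends, as required of the first derivative.\<close>
  define y where "y = (\<lambda>x. (1 / ?b) * (?k * S x + ?r2 * s_Psi f x + ?g * dx L \<theta> x))"
  have y: "L2 L y" "mean0 L y"
    unfolding y_def by (intro L2_add mean0_add L2_cmult mean0_cmult mean0_dx ell F tx2 th(1) S)+
  note Y = H10_primitive[OF ell y]
  note LY = H1_L2[OF H10_H1[OF Y(1)]]
  obtain \<psi> where psi: "H1 L \<psi>" "mean0 L \<psi>" "AE x in M. dx L \<psi> x = J y x"
    using mean0_primitive[OF ell LY] by blast
  have dpsi: "H10 L (dx L \<psi>)" "AE x in M. dx L (dx L \<psi>) x = y x"
  proof -
    show "H10 L (dx L \<psi>)"
      by (rule H10_cong[OF ell Y(1) L2_dx[OF psi(1)]]) (use psi(3) in eventually_elim, simp)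
    show "AE x in M. dx L (dx L \<psi>) x = y x"
      by (rule H1I_AE(2)[OF ell L2_dx[OF psi(1)] y(1), of 0]) (use psi(3) in simp)
  qed
  have hL: "L2 L (\<lambda>x. \<psi> x - S x)" "mean0 L (\<lambda>x. \<psi> x - S x)" by (intro L2_diff mean0_diff H1_L2 psi S)+
  \<comment> \<open>The same system with \<open>z = - \<phi>\<close> recovers the displacements from
    \<open>S\<close>, \<open>N\<close> and \<open>\<psi>\<close>; zero mean of \<open>w\<close>
    again follows from the end condition.\<close>
  obtain w z c2 where w: "continuous_on {0..L} w" "continuous_on {0..L} z"
    "\<And>x. x \<in> {0..L} \<Longrightarrow> w x = c2 + J (\<lambda>s. N s - ?l * z s) x"
    "\<And>x. x \<in> {0..L} \<Longrightarrow> z x = J (\<lambda>s. ?l * w s + (\<psi> s - S s)) x" "z L = 0"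
    using rotation_ode_solvable[OF ell N(2) hL(1) nonresonant_sin] by blast
  note Lw = L2_continuous[OF w(1)] L2_continuous[OF w(2)]
  have L2': "L2 L (\<lambda>s. N s - ?l * z s)" "L2 L (\<lambda>s. ?l * w s + (\<psi> s - S s))" by (intro L2_diff[of L N] L2_add L2_cmult N hL Lw)+
  have "J (\<lambda>s. ?l * w s + (\<psi> s - S s)) L = 0" using w(4)[of L] w(5) ell by simp
  moreover have "J (\<lambda>s. ?l * w s + (\<psi> s - S s)) L = ?l * (\<integral>x. w x \<partial>M)"
    using hL(2) L2_integrable[OF L2_cmult[OF Lw(1), of ?l]] L2_integrable[OF hL(1)]
    unfolding J_def mean0_def by (subst Bochner_Integration.integral_add) simp_all
  ultimately have mw: "mean0 L w" using nz by (simp add: mean0_def)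
  have W: "H1 L w" "AE x in M. dx L w x = N x - ?l * z x"
    by (rule H1I_AE[OF ell Lw(1) L2'(1), of c2]; rule AE_continuous_on_ivl; rule w(3); assumption)+
  define \<phi> where "\<phi> = (\<lambda>x. (-1) * z x)"
  have Hz: "H10 L z" "AE x in M. dx L z x = ?l * w x + (\<psi> x - S x)"
  proof -
    have e: "AE x in M. z x = J (\<lambda>s. ?l * w s + (\<psi> s - S s)) x" by (rule AE_continuous_on_ivl) (rule w(4))
    show "H10 L z" by (rule H10I[OF ell Lw(2) L2'(2) e]) (use w(4)[of L] w(5) ell in simp)
    show "AE x in M. dx L z x = ?l * w x + (\<psi> x - S x)"
      by (rule H1I_AE(2)[OF ell Lw(2) L2'(2), of 0]) (use e in simp)
  qed
  have phi: "H10 L \<phi>" "AE x in M. dx L \<phi> x = S x - \<psi> x - ?l * w x"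
  proof -
    show "H10 L \<phi>" unfolding \<phi>_def by (rule H10_cmult[OF ell Hz(1)])
    show "AE x in M. dx L \<phi> x = S x - \<psi> x - ?l * w x"
      using H1_cmult(2)[OF ell H10_H1[OF Hz(1)], of "-1", folded \<phi>_def] Hz(2) by eventually_elim simp
  qed
  note Lp = H1_L2[OF H10_H1[OF phi(1)]]
  have Hdw: "H10 L (dx L w)"
  proof (rule H10_cong[OF ell H10_diff[OF ell N(1) H10_cmult[OF ell Hz(1), of ?l]] L2_dx[OF W(1)]])
    show "AE x in M. N x - ?l * z x = dx L w x" using W(2) by eventually_elim simp
  qed
  have Hdp: "H1 L (dx L \<phi>)"
  proof (rule H1_cong(1)[OF ell _ L2_dx[OF H10_H1[OF phi(1)]]])
    show "H1 L (\<lambda>x. S x - \<psi> x - ?l * w x)" by (intro H1_diff H1_cmult(1) ell S psi W)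
    show "AE x in M. S x - \<psi> x - ?l * w x = dx L \<phi> x" using phi(2) by eventually_elim simp
  qed
  define u where "u = \<lparr> s_phi = \<phi>, s_Phi = s_phi f, s_psi = \<psi>, s_Psi = s_psi f, s_w = w, s_W = s_w f,
    s_theta = \<theta>, s_p = p, s_xi = \<xi>, s_q = q \<rparr>"
  have u: "s_phi u = \<phi>" "s_Phi u = s_phi f" "s_psi u = \<psi>" "s_Psi u = s_psi f" "s_w u = w" "s_W u = s_w f"
    "s_theta u = \<theta>" "s_p u = p" "s_xi u = \<xi>" "s_q u = q"
    by (simp_all add: u_def)
  have V: "Vspace P u"
    by (rule VspaceI; unfold u) (fact F psi phi mw W p q pq tx2)+
  have B: "Bdom P u"
    unfolding Bdom_def H2_def Let_def u
    by (intro conjI) (fact V F psi phi H10_H1[OF phi(1)] Hdp dpsi Hdw p q th xi)+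
  have Sh: "AE x in M. S x = shearS P u x"
    using phi(2) unfolding shearS_def u by eventually_elim simp
  have dSh: "AE x in M. dx L (shearS P u) x = dx L S x"
    by (rule H1_cong(2)[OF ell S(1) Bdom_L2(1)[OF B] Sh])
  have Ax: "AE x in M. N x = axialN P u x"
    using W(2) unfolding axialN_def u \<phi>_def by eventually_elim simp
  have dAx: "AE x in M. dx L (axialN P u) x = dx L N x"
    by (rule H1_cong(2)[OF ell H10_H1[OF N(1)] Bdom_L2(2)[OF B] Ax])
  have "vdist (Bop P u) f = 0"
  proof (rule vdist_eq_0I[OF Vspace_Bop[OF B] f], unfold Bop_sel u)
    show "AE x in M. ?c (p_k P / p_rho1 P) * dx L (shearS P u) x + ?c (p_l P * p_k0 P / p_rho1 P) * axialN P u x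
        - ?c (p_l P * p_gamma P / p_rho1 P) * \<xi> x = s_Phi f x"
      using dSh dS Ax
    proof eventually_elim
      case (elim x)
      show ?case unfolding elim(1,2) elim(3)[symmetric] using nz by (simp add: g1_def N_def field_simps)
    qed
    show "AE x in M. ?c (p_b P / p_rho2 P) * dx L (dx L \<psi>) x - ?c (p_k P / p_rho2 P) * shearS P u x
        - ?c (p_gamma P / p_rho2 P) * dx L \<theta> x = s_Psi f x"
      using dpsi(2) Sh
    proof eventually_elim
      case (elim x)
      show ?case unfolding elim(1) elim(2)[symmetric] using nz by (simp add: y_def field_simps)
    qed
    show "AE x in M. ?c (p_k0 P / p_rho1 P) * dx L (axialN P u) x - ?c (p_l P * p_k P / p_rho1 P) * shearS P u x
        - ?c (p_gamma P / p_rho1 P) * dx L \<xi> x = s_W f x"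
      using dAx dN Sh
    proof eventually_elim
      case (elim x)
      show ?case unfolding elim(1,2) elim(3)[symmetric] using nz by (simp add: h1_def S_def field_simps)
    qed
    show "AE x in M. - ?c (1 / p_rho3 P) * dx L p x - ?c (p_gamma P / p_rho3 P) * dx L (s_psi f) x = s_theta f x"
      using p(3)
    proof eventually_elim
      case (elim x)
      show ?case unfolding elim using nz by (simp add: field_simps)
    qed
    show "AE x in M. - ?c (1 / (p_varsigma P * p_varpi P)) * p x - ?c (1 / p_varsigma P) * dx L \<theta> x = s_p f x"
      using th(2)
    proof eventually_elim
      case (elim x)
      show ?case unfolding elim using nz by (simp add: field_simps)
    qed
    show "AE x in M. - ?c (1 / p_rho3 P) * dx L q x
        - ?c (p_gamma P / p_rho3 P) * (dx L (s_w f) x - ?l * s_phi f x) = s_xi f x"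
      using q(3)
    proof eventually_elim
      case (elim x)
      show ?case unfolding elim using nz by (simp add: field_simps)
    qed
    show "AE x in M. - ?c (1 / (p_tau P * p_varpi P)) * q x - ?c (1 / p_tau P) * dx L \<xi> x = s_q f x"
      using xi(2)
    proof eventually_elim
      case (elim x)
      show ?case unfolding elim using nz by (simp add: field_simps)
    qed
  qed simp_all
  then show ?thesis using that B by blast
qed

lemma Binv:
  assumes "Vspace P f" shows "Bdom P (Binv P f)" "vdist (Bop P (Binv P f)) f = 0"
proof -
  have "\<exists>u. Bdom P u \<and> Veq P (Bop P u) f"
    unfolding Veq_vdist using Bop_surj[OF assms] by blast
  then have "Bdom P (Binv P f) \<and> Veq P (Bop P (Binv P f)) f"
    unfolding Binv_def by (rule someI_ex)
  then show "Bdom P (Binv P f)" "vdist (Bop P (Binv P f)) f = 0"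
    by (simp_all add: Veq_vdist)
qed

end

section \<open>Decay rates\<close>

lemma kap_at_top:
  assumes "0 < ell" shows "filterlim (kap ell) at_top sequentially"
  unfolding kap_def[abs_def]
  by (rule filterlim_at_top_mult_tendsto_pos[OF tendsto_const])
    (use assms in simp, rule filterlim_compose[OF filterlim_real_sequentially filterlim_Suc])

lemma H1_smooth:
  assumes ell: "0 < ell" and d: "\<And>x. (e has_vector_derivative e' x) (at x)" and c: "continuous_on {0..ell} e'"
  shows "H1 ell e" "AE x in lebesgue_on {0..ell}. dx ell e x = e' x"
proof -
  have ce: "continuous_on {0..ell} e"
    using d by (meson continuous_at_imp_continuous_on has_vector_derivative_continuous)
  have J: "e x = e 0 + J e' x" if x: "x \<in> {0..ell}" for x
  proof -
    have "J e' x = e x - e 0"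
      unfolding J_def
      by (rule integral_FTC_ivl)
        (use x in \<open>auto intro: continuous_on_subset[OF c] has_vector_derivative_at_within[OF d]\<close>)
    then show ?thesis by simp
  qed
  show "H1 ell e" "AE x in lebesgue_on {0..ell}. dx ell e x = e' x"
    by (rule H1I_AE[OF ell L2_continuous[OF ce] L2_continuous[OF c], of "e 0"];
        rule AE_continuous_on_ivl; rule J; assumption)+
qed

lemma sin_mode:
  assumes ell: "0 < ell"
  shows "H10 ell (\<lambda>x. c * complex_of_real (sinf ell n x))"
    "AE x in lebesgue_on {0..ell}. dx ell (\<lambda>x. c * complex_of_real (sinf ell n x)) x
      = c * complex_of_real (kap ell n) * complex_of_real (cosf ell n x)"
proof -
  let ?f = "\<lambda>x. c * complex_of_real (sinf ell n x)"
  have d: "(?f has_vector_derivative c * complex_of_real (kap ell n) * complex_of_real (cosf ell n x)) (at x)" for x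
    using has_vector_derivative_mult_right[OF sinf_deriv[of ell n x], of c] by (simp add: mult.assoc)
  have k: "continuous_on {0..ell} (\<lambda>x. c * complex_of_real (kap ell n) * complex_of_real (cosf ell n x))"
    by (intro continuous_intros)
  note H = H1_smooth[OF ell d k]
  show "H10 ell ?f"
    unfolding H10_def
    by (intro conjI H(1) exI[of _ ?f]) (auto intro!: continuous_intros simp: sinf_boundary[OF ell])
  show "AE x in lebesgue_on {0..ell}. dx ell ?f x
      = c * complex_of_real (kap ell n) * complex_of_real (cosf ell n x)" by (rule H(2))
qed

lemma cos_mode:
  assumes ell: "0 < ell"
  shows "H1 ell (\<lambda>x. c * complex_of_real (cosf ell n x))" "mean0 ell (\<lambda>x. c * complex_of_real (cosf ell n x))"
    "AE x in lebesgue_on {0..ell}. dx ell (\<lambda>x. c * complex_of_real (cosf ell n x)) x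
      = - c * complex_of_real (kap ell n) * complex_of_real (sinf ell n x)"
proof -
  let ?f = "\<lambda>x. c * complex_of_real (cosf ell n x)"
  have d: "(?f has_vector_derivative - c * complex_of_real (kap ell n) * complex_of_real (sinf ell n x)) (at x)" for x
    using has_vector_derivative_mult_right[OF cosf_deriv[of ell n x], of c] by (simp add: mult.assoc)
  have k: "continuous_on {0..ell} (\<lambda>x. - c * complex_of_real (kap ell n) * complex_of_real (sinf ell n x))"
    by (intro continuous_intros)
  note H = H1_smooth[OF ell d k]
  show "H1 ell ?f" "AE x in lebesgue_on {0..ell}. dx ell ?f x
      = - c * complex_of_real (kap ell n) * complex_of_real (sinf ell n x)" by (fact H)+
  have "(\<integral>x. complex_of_real (kap ell n * cosf ell n x) \<partial>lebesgue_on {0..ell})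
      = complex_of_real (sinf ell n ell) - complex_of_real (sinf ell n 0)"
    by (rule integral_FTC_ivl)
      (use ell in \<open>auto intro!: continuous_intros has_vector_derivative_at_within sinf_deriv simp del: of_real_mult\<close>)
  then have "(\<integral>x. complex_of_real (cosf ell n x) \<partial>lebesgue_on {0..ell}) = 0"
    using kap_pos[OF ell, of n] by (simp add: sinf_boundary[OF ell])
  then show "mean0 ell ?f" by (simp add: mean0_def)
qed

context bmc_coeffs
begin

lemma opA_scale: "i < 10 \<Longrightarrow> opA kp (\<lambda>i. z * u i) i = z * opA kp u i"
  by (erule less_10_cases; simp add: opA_simps algebra_simps add_divide_distrib diff_divide_distrib del: One_nat_def)

lemma opA_cong: "(\<And>i. i < 10 \<Longrightarrow> u i = v i) \<Longrightarrow> opA kp u = opA kp v"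
  by (simp add: opA_def fun_eq_iff)

end

section \<open>Nonresonance of the wave numbers and single-mode states\<close>

context bmc_system
begin

text \<open>No wave number equals \<open>l\<close>, so every term is positive. The terms tend to 1,
  and the infimum reduces to a minimum over finitely many modes.\<close>

lemma wave_numbers_nonresonant:
  obtains del where "0 < del" "\<And>n. del \<le> \<bar>1 - (p_l P)\<^sup>2 * (1 / kap L n)\<^sup>2\<bar>"
proof -
  define a where "a n = \<bar>1 - (p_l P)\<^sup>2 * (1 / kap L n)\<^sup>2\<bar>" for n
  have pos: "0 < a n" for n
  proof -
    have k: "0 < kap L n" by (rule kap_pos[OF ell])
    have "p_l P \<noteq> kap L n"
    proof
      assume "p_l P = kap L n"
      then have "p_l P * L = real (Suc n) * pi" using ell by (simp add: kap_def)
      then show False using nonresonance[of "Suc n"] by blast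
    qed
    then have "(p_l P)\<^sup>2 \<noteq> (kap L n)\<^sup>2"
      using k params_pos by (simp add: power2_eq_iff_nonneg)
    then show ?thesis unfolding a_def using k by (simp add: field_simps)
  qed
  have "((\<lambda>n. 1 / kap L n) \<longlongrightarrow> 0) sequentially"
    by (intro tendsto_divide_0[OF tendsto_const] filterlim_at_top_imp_at_infinity kap_at_top ell)
  then have "(a \<longlongrightarrow> \<bar>1 - (p_l P)\<^sup>2 * 0\<^sup>2\<bar>) sequentially"
    unfolding a_def[abs_def] by (intro tendsto_intros)
  then have "eventually (\<lambda>n. 1 / 2 < a n) sequentially"
    by (rule order_tendstoD) simp
  then obtain N where N: "\<And>n. N \<le> n \<Longrightarrow> 1 / 2 < a n" by (auto simp: eventually_sequentially)
  define del where "del = Min (insert (1 / 2) (a ` {..<N}))"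
  have fin: "finite (insert (1 / 2) (a ` {..<N}))" by simp
  have "0 < del"
    unfolding del_def using pos by (subst Min_gr_iff) auto
  moreover have "del \<le> a n" for n
  proof (cases "n < N")
    case True
    then show ?thesis unfolding del_def by (intro Min_le[OF fin]) simp
  next
    case False
    have "del \<le> 1 / 2" unfolding del_def by (intro Min_le[OF fin]) simp
    with N[of n] False show ?thesis by simp
  qed
  ultimately show ?thesis using that unfolding a_def by blast
qed

lemma kap_ge: "pi / L \<le> kap L n"
  unfolding kap_def using mult_right_mono[of 1 "real (Suc n)" "pi / L"] ell by simp

lemma coef_Binv:
  assumes f: "Vspace P f" and i: "i < 10"
  shows "opA (kap L n) (coef n (Binv P f)) i = coef n f i"
  using coef_Bop[OF Binv(1)[OF f] i] coef_cong[OF Vspace_Bop[OF Binv(1)[OF f]] f Binv(2)[OF f] i] by metis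

text \<open>The vector \<open>a\<close> prescribes the coefficients of the energy variables, while a
  state stores displacements. The amplitudes of \<open>\<phi>, \<psi>, w\<close> solve
  \<open>\<phi> \<kappa> + \<psi> + l w = a 0\<close>, \<open>- \<psi> \<kappa> = a 2\<close> and
  \<open>- w \<kappa> - l \<phi> = a 4\<close>; nonresonance makes the denominator nonzero.\<close>

definition mode :: "nat \<Rightarrow> (nat \<Rightarrow> complex) \<Rightarrow> bmc_state" where
  "mode n a = (let \<kappa> = complex_of_real (kap L n); l = complex_of_real (p_l P);
     \<phi> = (a 0 + a 2 / \<kappa> + l * a 4 / \<kappa>) / (\<kappa> - l\<^sup>2 / \<kappa>);
     sn = (\<lambda>c x. c * complex_of_real (sinf L n x)); cs = (\<lambda>c x. c * complex_of_real (cosf L n x)) in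
     \<lparr> s_phi = sn \<phi>, s_Phi = sn (a 1), s_psi = cs (- a 2 / \<kappa>), s_Psi = cs (a 3),
       s_w = cs (- (a 4 + l * \<phi>) / \<kappa>), s_W = cs (a 5), s_theta = sn (a 6), s_p = cs (a 7),
       s_xi = sn (a 8), s_q = cs (a 9) \<rparr>)"

lemma mode_V: "Vspace P (mode n a)"
  by (rule VspaceI; simp only: mode_def Let_def bmc_state.select_convs)
    (intro sin_mode(1)[OF ell] cos_mode[OF ell] H1_L2[OF cos_mode(1)[OF ell]] H1_L2[OF H10_H1[OF sin_mode(1)[OF ell]]])+

lemma ecomp_mode:
  assumes i: "i < 10"
  shows "AE x in M. ecomp (mode n a) i x = a i * complex_of_real (basis i n x)"
proof -
  define \<kappa> l where "\<kappa> = complex_of_real (kap L n)" and "l = complex_of_real (p_l P)"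
  define \<phi> where "\<phi> = (a 0 + a 2 / \<kappa> + l * a 4 / \<kappa>) / (\<kappa> - l\<^sup>2 / \<kappa>)"
  define \<psi> w where "\<psi> = - a 2 / \<kappa>" and "w = - (a 4 + l * \<phi>) / \<kappa>"
  let ?sn = "\<lambda>c x. c * complex_of_real (sinf L n x)" and ?cs = "\<lambda>c x. c * complex_of_real (cosf L n x)"
  have k: "\<kappa> \<noteq> 0" using kap_pos[OF ell, of n] by (simp add: \<kappa>_def)
  obtain del where "0 < del" "\<And>n. del \<le> \<bar>1 - (p_l P)\<^sup>2 * (1 / kap L n)\<^sup>2\<bar>" using wave_numbers_nonresonant by blast
  from this(1) this(2)[of n] have "1 - (p_l P)\<^sup>2 * (1 / kap L n)\<^sup>2 \<noteq> 0" by auto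
  then have "complex_of_real (1 - (p_l P)\<^sup>2 * (1 / kap L n)\<^sup>2) \<noteq> 0" by (simp only: of_real_eq_0_iff not_False_eq_True)
  then have "1 - l\<^sup>2 * (1 / \<kappa>)\<^sup>2 \<noteq> 0" by (simp add: \<kappa>_def l_def)
  then have k2: "\<kappa> - l\<^sup>2 / \<kappa> \<noteq> 0" using k by (auto simp: field_simps power2_eq_square)
  have m: "mode n a = \<lparr> s_phi = ?sn \<phi>, s_Phi = ?sn (a 1), s_psi = ?cs \<psi>, s_Psi = ?cs (a 3),
       s_w = ?cs w, s_W = ?cs (a 5), s_theta = ?sn (a 6), s_p = ?cs (a 7),
       s_xi = ?sn (a 8), s_q = ?cs (a 9) \<rparr>"
    unfolding mode_def Let_def \<psi>_def w_def \<phi>_def \<kappa>_def l_def ..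
  have "\<phi> * (\<kappa> - l\<^sup>2 / \<kappa>) = a 0 + a 2 / \<kappa> + l * a 4 / \<kappa>"
    unfolding \<phi>_def using k2 by simp
  moreover have "\<phi> * \<kappa> + \<psi> + l * w = \<phi> * (\<kappa> - l\<^sup>2 / \<kappa>) - a 2 / \<kappa> - l * a 4 / \<kappa>"
    unfolding \<psi>_def w_def by (simp add: power2_eq_square algebra_simps add_divide_distrib diff_divide_distrib)
  ultimately have e0: "\<phi> * \<kappa> + \<psi> + l * w = a 0" by simp
  have "\<psi> * \<kappa> = - a 2" "w * \<kappa> = - (a 4 + l * \<phi>)"
    unfolding \<psi>_def w_def using k by simp_all
  then have e2: "- \<psi> * \<kappa> = a 2" and e4: "- w * \<kappa> - l * \<phi> = a 4" by simp_all
  note D = sin_mode(2)[OF ell, of \<phi> n, folded \<kappa>_def] cos_mode(3)[OF ell, of \<psi> n, folded \<kappa>_def]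
    cos_mode(3)[OF ell, of w n, folded \<kappa>_def]
  show ?thesis using D
  proof eventually_elim
    case (elim x)
    have "ecomp (mode n a) 0 x = (\<phi> * \<kappa> + \<psi> + l * w) * complex_of_real (cosf L n x)"
      unfolding ecomp_simps shearS_def m bmc_state.select_convs elim(1) l_def by (simp add: algebra_simps)
    then have 0: "ecomp (mode n a) 0 x = a 0 * complex_of_real (basis 0 n x)" unfolding e0 basis_simps .
    have "ecomp (mode n a) 2 x = (- \<psi> * \<kappa>) * complex_of_real (sinf L n x)"
      unfolding ecomp_simps m bmc_state.select_convs elim(2) ..
    then have 2: "ecomp (mode n a) 2 x = a 2 * complex_of_real (basis 2 n x)" unfolding e2 basis_simps .
    have "ecomp (mode n a) 4 x = (- w * \<kappa> - l * \<phi>) * complex_of_real (sinf L n x)"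
      unfolding ecomp_simps axialN_def m bmc_state.select_convs elim(3) l_def by (simp add: algebra_simps)
    then have 4: "ecomp (mode n a) 4 x = a 4 * complex_of_real (basis 4 n x)" unfolding e4 basis_simps .
    show ?case
      using 0 2 4
      by - (rule less_10_cases[OF i]; simp add: ecomp_simps(2,4,6-) basis_simps m del: One_nat_def)
  qed
qed

lemma coef_mode:
  assumes i: "i < 10" shows "coef n (mode n a) i = a i"
proof -
  have L2b: "L2 L (\<lambda>x. a i * complex_of_real (basis i n x))"
    by (intro L2_cmult L2_continuous continuous_on_of_real basis_continuous)
  have "coef n (mode n a) i = fcoef L (basis i n) (\<lambda>x. a i * complex_of_real (basis i n x))"
    unfolding coef_def by (intro fcoef_cong_AE L2_ecomp mode_V L2b ecomp_mode basis_continuous i)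
  also have "\<dots> = a i * (complex_of_real (2 / L) * complex_of_real (\<integral>x. basis i n x * basis i n x \<partial>M))"
    unfolding fcoef_cmult unfolding fcoef_def by (simp flip: of_real_mult)
  also have "\<dots> = a i"
    unfolding orthogonal_system.orth[OF basis_orthogonal] using ell by simp
  finally show ?thesis .
qed

lemma Vnorm_mode: "(Vnorm P (mode n a))\<^sup>2 = L / 2 * EC a"
proof -
  have "(L2norm L (ecomp (mode n a) i))\<^sup>2 = (cmod (a i))\<^sup>2 * (L / 2)" if i: "i < 10" for i
  proof -
    have L2b: "L2 L (\<lambda>x. complex_of_real (basis i n x))"
      by (intro L2_continuous continuous_on_of_real basis_continuous)
    have "L2norm L (ecomp (mode n a) i) = cmod (a i) * L2norm L (\<lambda>x. complex_of_real (basis i n x))"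
      using L2norm_cong_AE[OF L2_ecomp[OF mode_V i] L2_cmult[OF L2b] ecomp_mode[OF i]] by (simp add: L2norm_cmult)
    moreover have "(L2norm L (\<lambda>x. complex_of_real (basis i n x)))\<^sup>2 = L / 2"
      using orthogonal_system.orth[OF basis_orthogonal, of i n n]
      unfolding L2norm_sq by (simp add: power2_eq_square)
    ultimately show ?thesis by (simp add: power_mult_distrib)
  qed
  then show ?thesis
    unfolding Vnorm_sq EC_def sum_distrib_left by (intro sum.cong) auto
qed

end

section \<open>Upper and lower bounds for the decay rate\<close>

context bmc_semigroup
begin

lemma coef_T_0: "Vspace P v \<Longrightarrow> i < 10 \<Longrightarrow> coef n (T 0 v) i = coef n v i"
  by (intro coef_cong T_V T_0) auto

lemma decay_upper_bound:
  obtains K where "0 < K" "\<And>f t. Vspace P f \<Longrightarrow> 0 < t \<Longrightarrow> Vnorm P (T t (Binv P f)) \<le> K / sqrt t * Vnorm P f"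
proof -
  have k1: "0 < pi / L" using ell by simp
  obtain del where del: "0 < del" "\<And>n. del \<le> \<bar>1 - (p_l P)\<^sup>2 * (1 / kap L n)\<^sup>2\<bar>" using wave_numbers_nonresonant by blast
  obtain C1 where C1: "0 < C1" "\<And>kp u t. pi / L \<le> kp \<Longrightarrow> del \<le> \<bar>1 - (p_l P)\<^sup>2 * (1 / kp)\<^sup>2\<bar> \<Longrightarrow>
      traj kp u \<Longrightarrow> 0 < t \<Longrightarrow> EC (u t) \<le> C1 * kp\<^sup>2 / t * EC (u 0)"
    using traj_decay[OF k1 del(1)] by blast
  obtain C2 where C2: "0 < C2" "\<And>kp u. pi / L \<le> kp \<Longrightarrow> del \<le> \<bar>1 - (p_l P)\<^sup>2 * (1 / kp)\<^sup>2\<bar> \<Longrightarrow>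
      kp\<^sup>2 * EC u \<le> C2 * EC (opA kp u)"
    using inverse_bound[OF k1 del(1)] by blast
  have "Vnorm P (T t (Binv P f)) \<le> sqrt (C1 * C2) / sqrt t * Vnorm P f" if f: "Vspace P f" and t: "0 < t" for f t
  proof -
    define v where "v = Binv P f"
    have v: "Bdom P v" unfolding v_def by (rule Binv(1)[OF f])
    have mode_bound: "EC (coef n (T t v)) \<le> C1 * C2 / t * EC (coef n f)" for n
    proof -
      let ?k = "kap L n"
      have "EC (coef n (T t v)) \<le> C1 * ?k\<^sup>2 / t * EC (coef n (T 0 v))"
        by (rule C1(2)[OF kap_ge del(2) traj_coef[OF v] t])
      also have "EC (coef n (T 0 v)) = EC (coef n v)"
        by (intro EC_cong coef_T_0 BdomD(1)[OF v])
      also have "C1 * ?k\<^sup>2 / t * EC (coef n v) = C1 / t * (?k\<^sup>2 * EC (coef n v))" by simp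
      also have "\<dots> \<le> C1 / t * (C2 * EC (opA ?k (coef n v)))"
        by (intro mult_left_mono C2(2)[OF kap_ge del(2)]) (use C1 t in simp)
      also have "EC (opA ?k (coef n v)) = EC (coef n f)"
        unfolding v_def by (intro EC_cong coef_Binv f)
      finally show ?thesis by simp
    qed
    have "(\<Sum>n<N. L / 2 * EC (coef n (T t v))) \<le> C1 * C2 / t * (Vnorm P f)\<^sup>2" for N
    proof -
      have "(\<Sum>n<N. L / 2 * EC (coef n (T t v))) \<le> (\<Sum>n<N. L / 2 * (C1 * C2 / t * EC (coef n f)))"
        by (intro sum_mono mult_left_mono mode_bound) (use ell in simp)
      also have "\<dots> = C1 * C2 / t * (L / 2 * (\<Sum>n<N. EC (coef n f)))"
        by (simp add: sum_distrib_left mult_ac)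
      also have "\<dots> \<le> C1 * C2 / t * (Vnorm P f)\<^sup>2"
        by (intro mult_left_mono coef_Bessel[OF f]) (use C1 C2 t in simp)
      finally show ?thesis .
    qed
    \<comment> \<open>Parseval's identity is available on the left because the orbit stays in the
      domain. For \<open>f\<close>, an arbitrary state, Bessel's inequality is enough.\<close>
    then have "(Vnorm P (T t v))\<^sup>2 \<le> C1 * C2 / t * (Vnorm P f)\<^sup>2"
      using Parseval_Bdom[OF Bdom_T[OF v, of t]] t unfolding sums_def
      by (intro LIMSEQ_le_const2) auto
    also have "\<dots> = (sqrt (C1 * C2) / sqrt t * Vnorm P f)\<^sup>2"
      using C1 C2 t by (simp add: power_mult_distrib power_divide)
    finally show ?thesis
      unfolding v_def[symmetric] by (rule power2_le_imp_le) (use C1 C2 t Vnorm_nonneg in simp)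
  qed
  then show ?thesis using that[of "sqrt (C1 * C2)"] C1 C2 by simp
qed

lemma traj_scale:
  assumes "traj kp u" and w: "\<And>t i. i < 10 \<Longrightarrow> w t i = z * u t i"
  shows "traj kp w"
  unfolding traj_def
proof (intro allI impI conjI)
  fix i :: nat assume i: "i < 10"
  have e: "(\<lambda>t. w t i) = (\<lambda>t. z * u t i)" using w[OF i] by simp
  show "continuous_on {0..} (\<lambda>t. w t i)"
    unfolding e using assms(1) i by (intro continuous_intros) (auto simp: traj_def)
  fix t :: real assume t: "0 \<le> t"
  have "opA kp (w t) i = z * opA kp (u t) i"
    using opA_cong[of "w t" "\<lambda>i. z * u t i"] w opA_scale[OF i] by metis
  then show "((\<lambda>t. w t i) has_vector_derivative opA kp (w t) i) (at t within {t..})"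
    unfolding e using assms(1) i t by (auto simp: traj_def intro!: has_vector_derivative_mult_right)
qed

text \<open>The datum is the single-mode state whose coefficients are the image of a slow mode under
  the modal matrix. Its preimage under \<open>B\<close> carries the slow mode itself, which keeps a
  fixed part of its energy until time \<open>\<delta> * (kap L n)\<^sup>2\<close>.\<close>

lemma decay_lower_bound:
  assumes chs: "chi_varsigma P \<noteq> 0" and cht: "chi_tau P \<noteq> 0"
  obtains c K0 \<delta> where "0 < c" "0 < \<delta>" "\<forall>n. K0 \<le> kap L n \<longrightarrow>
    (\<exists>f. Vspace P f \<and> Vnorm P f \<le> 1 \<and> c \<le> sqrt (\<delta> * (kap L n)\<^sup>2) * Vnorm P (T (\<delta> * (kap L n)\<^sup>2) (Binv P f)))"
proof -
  obtain C K0 \<delta> where C: "0 < C" "0 < K0" "0 < \<delta>" and slow: "\<And>kp. K0 \<le> kp \<Longrightarrow> \<exists>u0. 0 < EC u0 \<and>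
      EC (opA kp u0) \<le> C * kp\<^sup>2 * EC u0 \<and>
      (\<forall>u. traj kp u \<and> u 0 = u0 \<longrightarrow> EC u0 \<le> 4 * EC (u (\<delta> * kp\<^sup>2)))"
    using slow_modes[OF chs[unfolded chi_varsigma_def] cht[unfolded chi_tau_def]] by blast
  have k1: "0 < pi / L" using ell by simp
  obtain del where del: "0 < del" "\<And>n. del \<le> \<bar>1 - (p_l P)\<^sup>2 * (1 / kap L n)\<^sup>2\<bar>" using wave_numbers_nonresonant by blast
  obtain C2 where C2: "0 < C2" "\<And>kp u. pi / L \<le> kp \<Longrightarrow> del \<le> \<bar>1 - (p_l P)\<^sup>2 * (1 / kp)\<^sup>2\<bar> \<Longrightarrow>
      kp\<^sup>2 * EC u \<le> C2 * EC (opA kp u)"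
    using inverse_bound[OF k1 del(1)] by blast
  \<comment> \<open>At time \<open>\<delta> * ?k\<^sup>2\<close> the squared norm is at least
    \<open>1 / (4 * C * ?k\<^sup>2)\<close>; multiplying by the time cancels the wave
    number.\<close>
  define c where "c = sqrt (\<delta> / (4 * C))"
  have "\<exists>f. Vspace P f \<and> Vnorm P f \<le> 1 \<and> c \<le> sqrt (\<delta> * (kap L n)\<^sup>2) * Vnorm P (T (\<delta> * (kap L n)\<^sup>2) (Binv P f))"
    if n: "K0 \<le> kap L n" for n
  proof -
    let ?k = "kap L n"
    have k: "0 < ?k" by (rule kap_pos[OF ell])
    obtain u0 where u0: "0 < EC u0" "EC (opA ?k u0) \<le> C * ?k\<^sup>2 * EC u0"
      "\<And>u. traj ?k u \<Longrightarrow> u 0 = u0 \<Longrightarrow> EC u0 \<le> 4 * EC (u (\<delta> * ?k\<^sup>2))"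
      using slow[OF n] by blast
    define A where "A = EC (opA ?k u0)"
    have "0 < ?k\<^sup>2 * EC u0" using k u0 by simp
    also have "\<dots> \<le> C2 * A" unfolding A_def by (rule C2(2)[OF kap_ge del(2)])
    finally have A: "0 < A" using C2 by (simp add: zero_less_mult_iff)
    \<comment> \<open>Normalises the datum to norm one.\<close>
    define s where "s = 1 / sqrt (L / 2 * A)"
    have s: "0 < s" "s\<^sup>2 = 1 / (L / 2 * A)" using A ell by (simp_all add: s_def power_divide)
    define f where "f = mode n (\<lambda>i. complex_of_real s * opA ?k u0 i)"
    have f: "Vspace P f" unfolding f_def by (rule mode_V)
    have "(Vnorm P f)\<^sup>2 = L / 2 * (s\<^sup>2 * A)"
      unfolding f_def Vnorm_mode EC_scale A_def by simp
    also have "\<dots> = 1" unfolding s(2) using A ell by simp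
    finally have f1: "Vnorm P f \<le> 1" by (simp add: power2_eq_1_iff) (use Vnorm_nonneg in force)
    define v where "v = Binv P f"
    have v: "Bdom P v" unfolding v_def by (rule Binv(1)[OF f])
    \<comment> \<open>The modal matrix is injective by \<open>inverse_bound\<close>: the difference
      of the two vectors is mapped to zero, so it has no energy.\<close>
    have cv: "coef n v i = complex_of_real s * u0 i" if i: "i < 10" for i
    proof -
      let ?w = "\<lambda>i. coef n v i - 1 * (complex_of_real s * u0 i)"
      have "opA ?k ?w i = 0" if "i < 10" for i
        unfolding opA_linear[OF that] opA_scale[OF that] v_def coef_Binv[OF f that]
        unfolding f_def coef_mode[OF that] by simp
      then have "EC (opA ?k ?w) = 0" unfolding EC_def by (intro sum.neutral) simp
      moreover have "?k\<^sup>2 * EC ?w \<le> C2 * EC (opA ?k ?w)" by (rule C2(2)[OF kap_ge del(2)])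
      ultimately have "?k\<^sup>2 * EC ?w \<le> 0" by simp
      then have "EC ?w \<le> 0" using k by (simp add: mult_le_0_iff)
      moreover have "wt i * (cmod (?w i))\<^sup>2 \<le> EC ?w"
        unfolding EC_def by (rule member_le_sum) (use i in \<open>auto simp: less_imp_le wt_pos\<close>)
      ultimately have "wt i * (cmod (?w i))\<^sup>2 \<le> 0" by simp
      then show ?thesis using wt_pos[OF i] by (simp add: mult_le_0_iff)
    qed
    \<comment> \<open>\<open>slow_modes\<close> asks for \<open>u 0 = u0\<close> as functions on all
      indices, so the meaningless entries from index 10 on are filled with those of
      \<open>u0\<close>.\<close>
    define u where "u t i = (if i < 10 then complex_of_real (1 / s) * coef n (T t v) i else u0 i)" for t i
    define t where "t = \<delta> * ?k\<^sup>2"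
    have t: "0 < t" using C k by (simp add: t_def)
    have "traj ?k u"
      by (rule traj_scale[OF traj_coef[OF v], where z = "complex_of_real (1 / s)"]) (simp add: u_def)
    moreover have "u 0 = u0"
      using s cv coef_T_0[OF BdomD(1)[OF v]] by (auto simp: u_def fun_eq_iff)
    ultimately have "EC u0 \<le> 4 * EC (u t)" unfolding t_def by (rule u0(3))
    also have "EC (u t) = EC (\<lambda>i. complex_of_real (1 / s) * coef n (T t v) i)"
      by (rule EC_cong) (simp add: u_def)
    also have "\<dots> = EC (coef n (T t v)) / s\<^sup>2"
      unfolding EC_scale using s by (simp add: norm_divide power_divide)
    finally have "s\<^sup>2 * EC u0 \<le> 4 * EC (coef n (T t v))" using s(1) by (simp add: field_simps)
    moreover have "L / 2 * EC (coef n (T t v)) \<le> (Vnorm P (T t v))\<^sup>2"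
      using t by (intro EC_coef_le T_V BdomD(1)[OF v]) simp
    ultimately have "L / 2 * (s\<^sup>2 * EC u0) \<le> 4 * (Vnorm P (T t v))\<^sup>2"
      using ell mult_left_mono[of "s\<^sup>2 * EC u0" "4 * EC (coef n (T t v))" "L / 2"] by linarith
    then have "EC u0 / A \<le> 4 * (Vnorm P (T t v))\<^sup>2"
      unfolding s(2) using ell A by simp
    moreover have "1 / (C * ?k\<^sup>2) \<le> EC u0 / A"
      using u0(2) A C k unfolding A_def[symmetric] by (simp add: field_simps)
    ultimately have "1 / (C * ?k\<^sup>2) \<le> 4 * (Vnorm P (T t v))\<^sup>2" by linarith
    then have "t * (1 / (C * ?k\<^sup>2)) \<le> t * (4 * (Vnorm P (T t v))\<^sup>2)"
      using t by (intro mult_left_mono) auto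
    moreover have "t * (1 / (C * ?k\<^sup>2)) = \<delta> / C" using k by (simp add: t_def)
    ultimately have "\<delta> / (4 * C) \<le> (sqrt t * Vnorm P (T t v))\<^sup>2"
      using t by (simp add: power_mult_distrib)
    then have "c \<le> sqrt t * Vnorm P (T t v)"
      unfolding c_def using t Vnorm_nonneg by (intro real_le_lsqrt) auto
    then show ?thesis
      using f f1 unfolding t_def v_def by blast
  qed
  moreover have "0 < c" using C by (simp add: c_def)
  ultimately show ?thesis using that C by blast
qed

end

theorem theorem5p1:
  fixes P :: bmc_params and T :: "real \<Rightarrow> bmc_state \<Rightarrow> bmc_state"
  assumes "p_ell P > 0" "p_rho1 P > 0" "p_rho2 P > 0" "p_rho3 P > 0" "p_k P > 0"
    "p_k0 P > 0" "p_b P > 0" "p_varpi P > 0" "p_l P > 0" "p_gamma P > 0"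
    "p_varsigma P > 0" "p_tau P > 0"
    and "\<forall>n::nat. n > 0 \<longrightarrow> p_l P * p_ell P \<noteq> real n * pi"
    and "generates_C0_semigroup P T"
  shows "(\<exists>K>0. \<forall>t>0. TBinv_norm P T t \<le> ereal (K / sqrt t))
       \<and> (chi_varsigma P * chi_tau P \<noteq> 0 \<longrightarrow>
            Limsup at_top (\<lambda>t::real. ereal (sqrt t) * TBinv_norm P T t) > 0)"
proof -
  interpret bmc_semigroup P T
    by unfold_locales (fact assms | use assms(13) in blast)+
  show ?thesis
  proof (intro conjI impI)
    obtain K where K: "0 < K" "\<And>f t. Vspace P f \<Longrightarrow> 0 < t \<Longrightarrow> Vnorm P (T t (Binv P f)) \<le> K / sqrt t * Vnorm P f"
      using decay_upper_bound by blast
    show "\<exists>K>0. \<forall>t>0. TBinv_norm P T t \<le> ereal (K / sqrt t)"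
    proof (intro exI[of _ K] conjI allI impI K(1))
      fix t :: real assume t: "0 < t"
      show "TBinv_norm P T t \<le> ereal (K / sqrt t)"
        unfolding TBinv_norm_def
      proof (rule SUP_least)
        fix f assume "f \<in> {f. Vspace P f \<and> Vnorm P f \<le> 1}"
        then have f: "Vspace P f" "Vnorm P f \<le> 1" by simp_all
        have "Vnorm P (T t (Binv P f)) \<le> K / sqrt t * Vnorm P f" by (rule K(2)[OF f(1) t])
        also have "\<dots> \<le> K / sqrt t"
          using mult_left_mono[OF f(2), of "K / sqrt t"] K(1) t by simp
        finally show "ereal (Vnorm P (T t (Binv P f))) \<le> ereal (K / sqrt t)" by simp
      qed
    qed
  next
    assume "chi_varsigma P * chi_tau P \<noteq> 0"
    then have nz: "chi_varsigma P \<noteq> 0" "chi_tau P \<noteq> 0" by simp_all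
    obtain c K0 \<delta> where c: "0 < c" "0 < \<delta>" "\<forall>n. K0 \<le> kap L n \<longrightarrow>
      (\<exists>f. Vspace P f \<and> Vnorm P f \<le> 1 \<and> c \<le> sqrt (\<delta> * (kap L n)\<^sup>2) * Vnorm P (T (\<delta> * (kap L n)\<^sup>2) (Binv P f)))"
      using decay_lower_bound[OF nz] .
    let ?X = "\<lambda>t::real. ereal (sqrt t) * TBinv_norm P T t"
    have lower: "ereal c \<le> ?X (\<delta> * (kap L n)\<^sup>2)" if n: "K0 \<le> kap L n" for n
    proof -
      let ?t = "\<delta> * (kap L n)\<^sup>2"
      obtain f where f: "Vspace P f" "Vnorm P f \<le> 1" "c \<le> sqrt ?t * Vnorm P (T ?t (Binv P f))"
        using c(3) n by blast
      have "ereal c \<le> ereal (sqrt ?t) * ereal (Vnorm P (T ?t (Binv P f)))" using f(3) by simp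
      also have "\<dots> \<le> ?X ?t"
        unfolding TBinv_norm_def
        by (intro ereal_mult_left_mono SUP_upper) (use f c in auto)
      finally show ?thesis .
    qed
    \<comment> \<open>The lower bound holds along the times
      \<open>\<delta> * (kap L n)\<^sup>2\<close>, which are unbounded, so the function cannot
      eventually stay below \<open>c\<close>.\<close>
    have "\<not> Limsup at_top ?X < ereal c"
    proof
      assume "Limsup at_top ?X < ereal c"
      then have "eventually (\<lambda>t. ?X t < ereal c) at_top" by (rule Limsup_lessD)
      then obtain t0 where t0: "\<And>t. t0 \<le> t \<Longrightarrow> ?X t < ereal c" by (auto simp: eventually_at_top_linorder)
      \<comment> \<open>The bound 1 guarantees that the wave number does not exceed its square, so
        the square passes \<open>t0 / \<delta>\<close> as well.\<close>
      have "eventually (\<lambda>n. max (max K0 1) (t0 / \<delta>) \<le> kap L n) sequentially"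
        using kap_at_top[OF ell] unfolding filterlim_at_top by blast
      then obtain n where n: "max (max K0 1) (t0 / \<delta>) \<le> kap L n"
        by (auto simp: eventually_sequentially)
      then have n: "K0 \<le> kap L n" "1 \<le> kap L n" "t0 / \<delta> \<le> kap L n" by simp_all
      have "t0 / \<delta> \<le> (kap L n)\<^sup>2"
        using n(3) self_le_power[OF n(2), of 2] by simp
      then have "t0 \<le> \<delta> * (kap L n)\<^sup>2" using c(2) by (simp add: field_simps)
      then show False using t0 lower[OF n(1)] by (metis not_le)
    qed
    then show "0 < Limsup at_top ?X"
      using c(1) by (metis ereal_less(2) less_le_trans not_le)
  qed
qed

end
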